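(* Let $Q$ be a positive integer and let $\alpha=v/w$ be a rational number in $(0,1]$ in lowest terms with $w<Q^{1/2}$. Put $E(\alpha)=\ell(\alpha)+(\log w)^2$. Then \[ \frac{1}{\sharp \mathscr{F}(Q)} \sum_{x\in\mathscr{F}_{\alpha}(Q)} \ell(x) = \frac{\alpha(\log Q)^2}{2\zeta(2)} + \frac{\alpha\log Q}{\zeta(2)}\left(2\gamma - 2\frac{\zeta'(2)}{\zeta(2)} + F(\alpha) - \frac32\right) + O(E(\alpha)). \] Moreover, if $\alpha<1$, then \[ \frac{1}{\sharp \mathscr{F}(Q)} \sum_{x\in\mathscr{F}^{\mathrm c}_{\alpha}(Q)} \ell(x) = \frac{1}{\sharp \mathscr{F}(Q)} \sum_{x\in\mathscr{F}_{\alpha}(Q)} \ell(x) - \left(1-\frac{1}{w^2}\right)\log Q + O(E(1-\alpha)). \] The implied constants are absolute.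
   Context: $\mathscr{F}(Q)=\{a/b\in\mathbb{Q}\cap[0,1]: 1\le b\le Q\}$ (each rational counted once); for $\alpha\in(0,1]$, $\mathscr{F}_\alpha(Q)=\mathscr{F}(Q)\cap[0,\alpha)$ and $\mathscr{F}^{\mathrm c}_\alpha(Q)=\mathscr{F}(Q)\cap(1-\alpha,1]$. Every rational $x\in(0,1)$ has a unique minus (by-excess) continued fraction expansion $x = 1-\cfrac{1}{b_1-\cfrac{1}{b_2-\cdots-\cfrac{1}{b_n}}}$ with integers $b_i\ge 2$, as produced by the by-excess Euclidean algorithm; $\ell(x)=n$ is the number of its partial quotients. By convention $\ell(1)=1$ and $\ell(0)=0$. $\gamma$ is the Euler–Mascheroni constant, $\zeta$ the Riemann zeta function, and $\zeta(s,x)=\sum_{n\ge0}(n+x)^{-s}$ ($\Re s>1$, $x\in(0,1]$) the Hurwitz zeta function. For a rational $\alpha=v/w\in(0,1]$ in lowest terms, $F(\alpha)=\frac{1}{\alpha w^2}\sum_{r=1}^{w-1}(1-\{\alpha r\})\,\zeta(2,r/w)$, where $\{\cdot\}$ denotes the fractional part (so $F(1)=0$). *)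

theory Defs
  imports "HOL-Analysis.Analysis"
begin

definition farey :: "nat \<Rightarrow> rat set" where
  "farey Q = {of_nat a / of_nat b | a b. 1 \<le> b \<and> b \<le> Q} \<inter> {0..1}"

definition farey_low :: "rat \<Rightarrow> nat \<Rightarrow> rat set" where
  "farey_low \<alpha> Q = farey Q \<inter> {0..<\<alpha>}"

definition farey_high :: "rat \<Rightarrow> nat \<Rightarrow> rat set" where
  "farey_high \<alpha> Q = farey Q \<inter> {1 - \<alpha><..1}"

definition denom :: "rat \<Rightarrow> nat" where
  "denom \<alpha> = nat (snd (quotient_of \<alpha>))"

text \<open>\<open>minus_cf [b\<^sub>1, \<dots>, b\<^sub>n]\<close> is \<open>1 / (b\<^sub>1 - 1 / (b\<^sub>2 - \<dots> - 1 / b\<^sub>n))\<close>.\<close>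

fun minus_cf :: "int list \<Rightarrow> rat" where
  "minus_cf [] = 0"
| "minus_cf (b # bs) = 1 / (of_int b - minus_cf bs)"

definition is_minus_expansion :: "rat \<Rightarrow> int list \<Rightarrow> bool" where
  "is_minus_expansion x bs \<longleftrightarrow> (\<forall>b\<in>set bs. 2 \<le> b) \<and> x = 1 - minus_cf bs"

text \<open>
  The number of partial quotients. The values at \<open>0\<close> and \<open>1\<close> are conventions; on \<open>(0,1)\<close> the
  expansion exists and is unique, see \<open>minus_expansion_ex1\<close> below.
\<close>

definition minus_cf_length :: "rat \<Rightarrow> nat" where
  "minus_cf_length x =
     (if x = 0 then 0 else if x = 1 then 1 else length (THE bs. is_minus_expansion x bs))"

lemma minus_cf_bounds:
  assumes "\<forall>b\<in>set bs. 2 \<le> b"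
  shows "0 \<le> minus_cf bs \<and> minus_cf bs < 1 \<and> (bs \<noteq> [] \<longrightarrow> 0 < minus_cf bs)"
  using assms
proof (induction bs)
  case (Cons b bs)
  from Cons have "minus_cf bs < 1" "(2::rat) \<le> of_int b"
    by auto
  hence "1 < of_int b - minus_cf bs"
    by linarith
  thus ?case by simp
qed simp

lemma minus_cf_inject:
  assumes "\<forall>b\<in>set bs. 2 \<le> b" "\<forall>b\<in>set cs. 2 \<le> b" "minus_cf bs = minus_cf cs"
  shows "bs = cs"
  using assms
proof (induction bs arbitrary: cs)
  case Nil
  thus ?case using minus_cf_bounds[of cs] by force
next
  case (Cons b bs)
  have "cs \<noteq> []"
    using Cons.prems minus_cf_bounds[of "b # bs"] by force
  then obtain c cs' where cs: "cs = c # cs'"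
    by (cases cs) auto
  have eq: "of_int b - minus_cf bs = of_int c - minus_cf cs'"
    using Cons.prems(3) by (simp add: cs inverse_eq_divide[symmetric])
  have "0 \<le> minus_cf bs" "minus_cf bs < 1" "0 \<le> minus_cf cs'" "minus_cf cs' < 1"
    using Cons.prems minus_cf_bounds[of bs] minus_cf_bounds[of cs'] by (auto simp: cs)
  hence "of_int b < (of_int (c + 1) :: rat)" "of_int c < (of_int (b + 1) :: rat)"
    using eq by auto
  hence "b = c"
    unfolding of_int_less_iff by linarith
  moreover from this eq have "bs = cs'"
    using Cons.prems by (intro Cons.IH) (auto simp: cs)
  ultimately show ?case by (simp add: cs)
qed

lemma minus_cf_exists:
  assumes "p < q"
  shows "\<exists>bs. (\<forall>b\<in>set bs. 2 \<le> b) \<and> minus_cf bs = of_nat p / of_nat q"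
  using assms
proof (induction p arbitrary: q rule: less_induct)
  case (less p)
  show ?case
  proof (cases "p = 0")
    case True
    thus ?thesis by (intro exI[of _ "[]"]) auto
  next
    case False
    define b where "b = (q + p - 1) div p"
    define r where "r = b * p - q"
    have m: "b * p + (q + p - 1) mod p = q + p - 1" "(q + p - 1) mod p < p"
      using False by (auto simp: b_def)
    hence bq: "b * p \<ge> q" and "b * p < q + p"
      using False by linarith+
    hence "r < p"
      by (simp add: r_def)
    have "b \<ge> 2"
    proof (rule ccontr)
      assume "\<not> b \<ge> 2"
      hence "b * p \<le> 1 * p" by (intro mult_le_mono) auto
      thus False using bq less.prems by linarith
    qed
    obtain bs where bs: "\<forall>b\<in>set bs. 2 \<le> b" "minus_cf bs = of_nat r / of_nat p"
      using less.IH[OF \<open>r < p\<close> \<open>r < p\<close>] by blast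
    have "(of_nat r :: rat) = of_nat b * of_nat p - of_nat q"
      using bq by (simp add: r_def of_nat_diff)
    hence "of_nat b - minus_cf bs = (of_nat q / of_nat p :: rat)"
      using False by (simp add: bs divide_simps)
    thus ?thesis using bs \<open>b \<ge> 2\<close>
      by (intro exI[of _ "int b # bs"]) auto
  qed
qed

lemma minus_expansion_ex1:
  assumes "0 < x" "x < 1"
  shows "\<exists>!bs. is_minus_expansion x bs"
proof -
  obtain p q where pq: "1 - x = of_int p / of_int q" "q > 0"
    using quotient_of_div[of "1 - x"] quotient_of_denom_pos[of "1 - x"]
    by (cases "quotient_of (1 - x)") auto
  have "(0::rat) < of_int p / of_int q" "of_int p / of_int q < (1::rat)"
    using assms pq by linarith+
  hence "0 < p" "p < q"
    using pq(2) by (auto simp: zero_less_divide_iff)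
  then obtain bs where bs: "\<forall>b\<in>set bs. 2 \<le> b" "minus_cf bs = 1 - x"
    using minus_cf_exists[of "nat p" "nat q"] pq by auto
  show ?thesis
  proof (rule ex1I[of _ bs])
    show "is_minus_expansion x bs"
      using bs by (simp add: is_minus_expansion_def)
  next
    fix cs assume "is_minus_expansion x cs"
    thus "cs = bs"
      using bs by (intro minus_cf_inject) (auto simp: is_minus_expansion_def)
  qed
qed

text \<open>
  The series below is meaningful for real or complex \<open>s\<close> with real part greater than \<open>1\<close>
  (\<open>'a\<close> is \<open>real\<close> or \<open>complex\<close>) and \<open>0 < x \<le> 1\<close>.
\<close>

definition hurwitz_zeta :: "'a :: {real_normed_field, ln} \<Rightarrow> real \<Rightarrow> 'a" where
  "hurwitz_zeta s x = (\<Sum>n. (of_nat n + of_real x) powr (- s))"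

definition zeta :: "'a :: {real_normed_field, ln} \<Rightarrow> 'a" where
  "zeta s = (\<Sum>n. of_nat (Suc n) powr (- s))"

definition F_coeff :: "rat \<Rightarrow> real" where
  "F_coeff \<alpha> = 1 / (of_rat \<alpha> * (real (denom \<alpha>))\<^sup>2) *
     (\<Sum>r\<in>{1..<denom \<alpha>}. (1 - of_rat (frac (\<alpha> * of_nat r))) *
        hurwitz_zeta 2 (real r / real (denom \<alpha>)))"

definition err :: "rat \<Rightarrow> real" where
  "err \<alpha> = real (minus_cf_length \<alpha>) + (ln (real (denom \<alpha>)))\<^sup>2"

definition avg_low :: "rat \<Rightarrow> nat \<Rightarrow> real" where
  "avg_low \<alpha> Q = 1 / real (card (farey Q)) * (\<Sum>x\<in>farey_low \<alpha> Q. real (minus_cf_length x))"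

definition avg_high :: "rat \<Rightarrow> nat \<Rightarrow> real" where
  "avg_high \<alpha> Q = 1 / real (card (farey Q)) * (\<Sum>x\<in>farey_high \<alpha> Q. real (minus_cf_length x))"

end

theory Submission
  imports Defs "HOL-Number_Theory.Number_Theory" "HOL-Computational_Algebra.Squarefree" "HOL-Real_Asymp.Real_Asymp"
begin

text \<open>
  Undoing the by-excess Euclidean algorithm one step at a time shows that \<open>\<ell>(x)\<close> is the number of
  intervals \<open>(f/e, c/d)\<close> containing \<open>x\<close> with \<open>c e - d f = 1\<close> and \<open>1 \<le> e \<le> d\<close>. A point of such an interval
  is \<open>x = (t c + s f) / (t d + s e)\<close> for a unique coprime pair \<open>t, s \<ge> 1\<close>, so the sum of \<open>\<ell>\<close> over
  \<open>x < \<alpha>\<close> counts quintuples \<open>(d, e, f, t, s)\<close> with \<open>t d + s e \<le> Q\<close>. Replacing the condition \<open>x < \<alpha>\<close> by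
  \<open>f/e < \<alpha>\<close> changes the count only through intervals containing \<open>\<alpha>\<close>; these have \<open>d < w\<close> and there is at
  most one for each \<open>d\<close>, so the normalized error is \<open>O(1 + log w)\<close>.

  As \<open>f d \<equiv> -1\<close> modulo \<open>e\<close>, the bound \<open>O(gcd(h, e) e\<^bsup>3/4 + \<epsilon>\<^esup>)\<close> for Kloosterman sums, obtained from
  their fourth moment, makes \<open>f\<close> equidistributed independently of \<open>d\<close>. The number of \<open>f < \<alpha> e\<close> prime to
  \<open>e\<close> is \<open>\<alpha> \<phi>(e)\<close> plus a divisor sum of the defects \<open>\<lceil>\<alpha> m\<rceil> - \<alpha> m\<close>, whose series
  \<open>\<Sum> (\<lceil>\<alpha> m\<rceil> - \<alpha> m) / m\<^sup>2\<close> equals \<open>\<alpha> F(\<alpha>)\<close>. For \<open>\<alpha> = 1\<close>, Moebius inversion reduces the count to the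
  convolution \<open>\<Sum> \<tau>(m) \<tau>(n)\<close> over \<open>m + n \<le> Q\<close>, evaluated by the Dirichlet hyperbola method.

  The second formula follows from the first at \<open>1\<close>, \<open>\<alpha>\<close> and \<open>1 - \<alpha>\<close>, because the defects of \<open>\<alpha>\<close> and
  \<open>1 - \<alpha>\<close> at \<open>m\<close> add up to \<open>1\<close> if \<open>w\<close> does not divide \<open>m\<close>, and to \<open>0\<close> otherwise.
\<close>

section \<open>The Moebius function and the number of divisors\<close>

text \<open>The target error is \<open>O(Q^2)\<close> before division by the number of Farey
  fractions, uniformly in \<alpha> and without a factor \<open>log Q\<close>. This shapes three
  choices. The weights of all intervals with a given \<open>f/e\<close>, collected over a residue
  class of \<open>d\<close> modulo \<open>e\<close>, form a decreasing function of
  \<open>d mod e\<close>; its values contain a \<open>log Q\<close>, but its variation is at most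
  \<open>Q^2 / e^2\<close>. Equidistribution is charged to the variation only, so an error factor
  \<open>e powr (3/4 + \<epsilon>)\<close> leaves a convergent sum over \<open>e\<close>, as any
  power saving would. The number of lattice points in a triangle is given an error that is the
  geometric mean of two simple ones, because the sharper of these loses a logarithm in the Moebius
  variable. In the main term, \<alpha> occurs only through the number of
  \<open>f < \<alpha> e\<close> prime to \<open>e\<close>: the part
  \<open>\<alpha> \<phi>(e)\<close> yields \<alpha> times the total at \<alpha> = 1, which is
  evaluated as a whole, while for the defects the leading term of the contribution of each
  \<open>e\<close> is precise enough.\<close>

definition moebius :: "nat \<Rightarrow> real" where
  "moebius n = (if squarefree n then (-1) ^ card (prime_factors n) else 0)"

lemma abs_moebius_le: "\<bar>moebius n\<bar> \<le> 1"
  by (simp add: moebius_def power_abs)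

lemma moebius_1 [simp]: "moebius (Suc 0) = 1"
  by (simp add: moebius_def)

lemma moebius_times_prime:
  assumes "prime p" "\<not> p dvd d" "squarefree d"
  shows "moebius (p * d) = - moebius d"
proof -
  have cop: "coprime p d" using assms by (simp add: prime_imp_coprime)
  have "d \<noteq> 0" using assms by (intro notI) auto
  have "squarefree (p * d)"
    using assms cop by (simp add: squarefree_mult_coprime squarefree_prime)
  have "prime_factors (p * d) = insert p (prime_factors d)"
    using prime_factors_product[of p d] prime_factorization_prime[OF assms(1)] prime_gt_0_nat[OF assms(1)] \<open>d \<noteq> 0\<close>
    by simp
  moreover have "p \<notin> prime_factors d" using assms by auto
  ultimately show ?thesis
    using \<open>squarefree (p * d)\<close> assms by (simp add: moebius_def)
qed

text \<open>A prime \<open>p\<close> dividing \<open>n\<close> pairs the squarefree divisors prime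
  to \<open>p\<close> with their products by \<open>p\<close>, and \<open>moebius\<close> changes
  sign along each pair.\<close>

lemma sum_moebius_divisors:
  assumes "n > 0"
  shows "(\<Sum>d | d dvd n. moebius d) = (if n = 1 then 1 else 0)"
proof (cases "n = 1")
  case True
  have "{d. d dvd (1::nat)} = {1}" by auto
  with True show ?thesis by simp
next
  case False
  then obtain p where p: "prime p" "p dvd n"
    using prime_factor_nat by blast
  define S where "S = {d. d dvd n \<and> squarefree d \<and> \<not> p dvd d}"
  have fin: "finite {d. d dvd n}" using assms by simp
  have finS: "finite S" unfolding S_def by (rule finite_subset[OF _ fin]) auto
  have p0: "p > 0" using p by (simp add: prime_gt_0_nat)
  have eq: "{d. d dvd n \<and> squarefree d} = S \<union> (\<lambda>d. p * d) ` S" (is "?L = ?R")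
  proof (intro equalityI subsetI)
    fix d assume d: "d \<in> ?L"
    show "d \<in> ?R"
    proof (cases "p dvd d")
      case True
      then obtain e where e: "d = p * e" by blast
      have "\<not> p dvd e"
      proof
        assume "p dvd e"
        then have "p\<^sup>2 dvd d" by (simp add: e power2_eq_square)
        with d have "is_unit p" by (auto simp: squarefree_def)
        with p show False by auto
      qed
      moreover have "squarefree e" using d squarefree_multD(2) e by blast
      moreover have "e dvd n" using d e by (auto dest: dvd_mult_right)
      ultimately show ?thesis by (auto simp: S_def e)
    qed (use d in \<open>auto simp: S_def\<close>)
  next
    fix d assume d: "d \<in> ?R"
    show "d \<in> ?L"
    proof (cases "d \<in> S")
      case False
      with d obtain e where e: "d = p * e" "e \<in> S" by auto
      have cop: "coprime p e" using e p by (simp add: S_def prime_imp_coprime)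
      have "p * e dvd n" using cop e p by (intro divides_mult) (auto simp: S_def)
      then show ?thesis using e cop p
        by (auto simp: S_def squarefree_mult_coprime squarefree_prime)
    qed (auto simp: S_def)
  qed
  have "(\<Sum>d | d dvd n. moebius d) = (\<Sum>d | d dvd n \<and> squarefree d. moebius d)"
    by (rule sum.mono_neutral_right[OF fin]) (auto simp: moebius_def)
  also have "\<dots> = (\<Sum>d\<in>S. moebius d) + (\<Sum>d\<in>(\<lambda>d. p * d) ` S. moebius d)"
    unfolding eq by (rule sum.union_disjoint) (use finS in \<open>auto simp: S_def\<close>)
  also have "(\<Sum>d\<in>(\<lambda>d. p * d) ` S. moebius d) = (\<Sum>d\<in>S. moebius (p * d))"
    by (subst sum.reindex) (use p0 in \<open>auto simp: inj_on_def\<close>)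
  also have "\<dots> = (\<Sum>d\<in>S. - moebius d)"
    by (rule sum.cong) (use p in \<open>auto simp: S_def moebius_times_prime\<close>)
  finally show ?thesis using False by (simp add: sum_negf)
qed

text \<open>The range \<open>{1..K}\<close> depends on neither number, so that the sum over
  \<open>k\<close> can be interchanged with sums over families of pairs.\<close>

lemma coprime_indicator_sum_moebius:
  fixes a b K :: nat
  assumes "0 < a" "a \<le> K"
  shows "(if coprime a b then 1 else 0 :: real) =
    (\<Sum>k\<in>{1..K}. if k dvd a \<and> k dvd b then moebius k else 0)"
proof -
  have g: "gcd a b > 0" using assms by simp
  have "(\<Sum>k\<in>{1..K}. if k dvd a \<and> k dvd b then moebius k else 0) =
     (\<Sum>k\<in>{k\<in>{1..K}. k dvd a \<and> k dvd b}. moebius k)"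
    by (rule sum.inter_filter[symmetric]) auto
  also have "{k\<in>{1..K}. k dvd a \<and> k dvd b} = {d. d dvd gcd a b}"
  proof (intro equalityI subsetI)
    fix d assume "d \<in> {d. d dvd gcd a b}"
    then have "d dvd a" "d dvd b" by auto
    moreover from this have "d \<le> a" "d > 0" using assms by (simp_all add: dvd_imp_le dvd_pos_nat)
    ultimately show "d \<in> {k\<in>{1..K}. k dvd a \<and> k dvd b}" using assms by auto
  qed auto
  also have "(\<Sum>k | k dvd gcd a b. moebius k) = (if gcd a b = 1 then 1 else 0)"
    by (rule sum_moebius_divisors[OF g])
  also have "\<dots> = (if coprime a b then 1 else 0)"
    by (simp only: coprime_iff_gcd_eq_1)
  finally show ?thesis ..
qed

section \<open>The divisor bound\<close>

definition tau :: "nat \<Rightarrow> nat" where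
  "tau n = card {d. d dvd n}"

lemma tau_pos: "n > 0 \<Longrightarrow> tau n > 0"
  unfolding tau_def by (subst card_gt_0_iff) auto

lemma tau_mult_le:
  assumes "m > 0" "n > 0"
  shows "tau (m * n) \<le> tau m * tau n"
proof -
  have "{d. d dvd m * n} \<subseteq> (\<lambda>(x,y). x * y) ` ({d. d dvd m} \<times> {d. d dvd n})"
  proof
    fix d assume "d \<in> {d. d dvd m * n}"
    then obtain x y where "d = x * y" "x dvd m" "y dvd n"
      using division_decomp[of d m n] by auto
    then show "d \<in> (\<lambda>(x,y). x * y) ` ({d. d dvd m} \<times> {d. d dvd n})" by auto
  qed
  then have "tau (m * n) \<le> card ({d. d dvd m} \<times> {d. d dvd n})"
    unfolding tau_def using assms by (intro surj_card_le) auto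
  then show ?thesis by (simp add: card_cartesian_product tau_def)
qed

text \<open>Each term of the divisor sum of \<open>totient\<close>, which equals \<open>n\<close>,
  is at most \<open>totient n\<close>. It serves to bound \<open>1 / totient e\<close> by
  \<open>tau e / e\<close>.\<close>

lemma le_tau_mult_totient: "n \<le> tau n * totient n"
proof (cases "n = 0")
  case False
  have "n = (\<Sum>d | d dvd n. totient d)" by (simp add: totient_divisor_sum)
  also have "\<dots> \<le> (\<Sum>d | d dvd n. totient n)"
    by (rule sum_mono) (use False in \<open>auto intro!: totient_dvd_mono\<close>)
  finally show ?thesis by (simp add: tau_def)
qed simp

lemma sum_divisors_reindex:
  fixes F :: "nat \<Rightarrow> nat \<Rightarrow> 'a :: comm_monoid_add"
  shows "(\<Sum>e\<in>{1..N}. \<Sum>d | d dvd e. F d (e div d)) =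
     (\<Sum>(d,m)\<in>{(d,m). 1 \<le> d \<and> 1 \<le> m \<and> d * m \<le> N}. F d m)"
proof -
  have fin: "finite {d. d dvd e}" if "e \<in> {1..N}" for e :: nat using that by auto
  have "(\<Sum>e\<in>{1..N}. \<Sum>d | d dvd e. F d (e div d)) =
      (\<Sum>(e,d)\<in>(SIGMA e:{1..N}. {d. d dvd e}). F d (e div d))"
    by (subst sum.Sigma) (use fin in auto)
  also have "\<dots> = (\<Sum>(d,m)\<in>{(d,m). 1 \<le> d \<and> 1 \<le> m \<and> d * m \<le> N}. F d m)"
    by (rule sum.reindex_bij_witness[of _ "\<lambda>(d,m). (d*m, d)" "\<lambda>(e,d). (d, e div d)"])
       (auto simp: Suc_le_eq dest: dvd_imp_le intro!: Nat.gr0I)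
  finally show ?thesis .
qed

text \<open>One factor \<open>tau e\<close> is opened as a sum over \<open>d dvd e\<close>;
  submultiplicativity of the other \<open>j\<close> factors splits the double sum into a product, so
  that the bound for \<open>Suc j\<close> is the square of the bound for \<open>j\<close>.\<close>

lemma tau_power_sum_bounded:
  "\<exists>C::real. 0 < C \<and> (\<forall>N. (\<Sum>e\<in>{1..N}. real (tau e) ^ j / real e ^ 2) \<le> C)"
proof (induction j)
  case 0
  have sm: "summable (\<lambda>n. 1 / real (Suc n) ^ 2)"
    using inverse_power_summable[of 2] by (subst summable_Suc_iff) (simp add: inverse_eq_divide)
  have "(\<Sum>e\<in>{1..N}. 1 / real e ^ 2) \<le> (\<Sum>n. 1 / real (Suc n) ^ 2)" for N
  proof -
    have "(\<Sum>e\<in>{1..N}. 1 / real e ^ 2) = (\<Sum>n<N. 1 / real (Suc n) ^ 2)"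
      by (rule sum.reindex_bij_witness[of _ Suc "\<lambda>n. n - 1"]) auto
    also have "\<dots> \<le> (\<Sum>n. 1 / real (Suc n) ^ 2)" by (rule sum_le_suminf[OF sm]) auto
    finally show ?thesis .
  qed
  moreover have "(\<Sum>n. 1 / real (Suc n) ^ 2) > 0" by (rule suminf_pos[OF sm]) auto
  ultimately show ?case by (intro exI[of _ "\<Sum>n. 1 / real (Suc n) ^ 2"]) auto
next
  case (Suc j)
  then obtain C where C: "C > 0" "\<And>N. (\<Sum>e\<in>{1..N}. real (tau e) ^ j / real e ^ 2) \<le> C" by blast
  have "(\<Sum>e\<in>{1..N}. real (tau e) ^ Suc j / real e ^ 2) \<le> C * C" for N
  proof -
    have "(\<Sum>e\<in>{1..N}. real (tau e) ^ Suc j / real e ^ 2) =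
       (\<Sum>e\<in>{1..N}. \<Sum>d | d dvd e. real (tau (d * (e div d))) ^ j / real (d * (e div d)) ^ 2)"
      by (intro sum.cong refl) (simp add: tau_def)
    also have "\<dots> = (\<Sum>(d,m)\<in>{(d,m). 1 \<le> d \<and> 1 \<le> m \<and> d * m \<le> N}. real (tau (d * m)) ^ j / real (d * m) ^ 2)"
      by (rule sum_divisors_reindex)
    also have "\<dots> \<le> (\<Sum>(d,m)\<in>{(d,m). 1 \<le> d \<and> 1 \<le> m \<and> d * m \<le> N}.
        (real (tau d) ^ j / real d ^ 2) * (real (tau m) ^ j / real m ^ 2))"
    proof (rule sum_mono, clarify)
      fix d m assume dm: "(1::nat) \<le> d" "1 \<le> m" "d * m \<le> N"
      have "real (tau (d * m)) ^ j \<le> (real (tau d) * real (tau m)) ^ j"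
        using tau_mult_le[of d m] dm
        by (intro power_mono) (simp_all flip: of_nat_mult del: of_nat_mult)
      then show "real (tau (d * m)) ^ j / real (d * m) ^ 2 \<le> (real (tau d) ^ j / real d ^ 2) * (real (tau m) ^ j / real m ^ 2)"
        by (simp add: power_mult_distrib divide_right_mono)
    qed
    also have "\<dots> \<le> (\<Sum>(d,m)\<in>{1..N}\<times>{1..N}. (real (tau d) ^ j / real d ^ 2) * (real (tau m) ^ j / real m ^ 2))"
    proof (rule sum_mono2)
      show "{(d, m). 1 \<le> d \<and> 1 \<le> m \<and> d * m \<le> N} \<subseteq> {1..N} \<times> {1..N}"
      proof clarify
        fix d m assume dm: "(1::nat) \<le> d" "1 \<le> m" "d * m \<le> N"
        have "d * 1 \<le> d * m" "1 * m \<le> d * m" using dm by (intro mult_le_mono; simp)+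
        then have "d \<le> N" "m \<le> N" using dm by linarith+
        then show "d \<in> {1..N} \<and> m \<in> {1..N}" using dm by auto
      qed
    qed (auto)
    also have "\<dots> = (\<Sum>d\<in>{1..N}. real (tau d) ^ j / real d ^ 2) * (\<Sum>d\<in>{1..N}. real (tau d) ^ j / real d ^ 2)"
      by (simp add: sum_product sum.cartesian_product)
    also have "\<dots> \<le> C * C" using C by (intro mult_mono) (auto intro!: sum_nonneg)
    finally show ?thesis .
  qed
  then show ?case using C(1) by (intro exI[of _ "C * C"]) auto
qed

text \<open>A single term of the bounded sum gives \<open>tau n ^ j \<le> C * n\<^sup>2\<close>, and
  a \<open>j\<close>-th root with \<open>2 / j < \<delta>\<close> suffices. This avoids prime
  factorizations.\<close>

lemma tau_le_powr:
  assumes "\<delta> > 0"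
  shows "\<exists>C>0. \<forall>n>0. real (tau n) \<le> C * real n powr \<delta>"
proof -
  obtain j :: nat where j: "2 / \<delta> < real j" using reals_Archimedean2 by blast
  have j0: "real j > 0" using j assms by (smt (verit) divide_pos_pos)
  obtain C where C: "C > 0" "\<And>N. (\<Sum>e\<in>{1..N}. real (tau e) ^ j / real e ^ 2) \<le> C"
    using tau_power_sum_bounded by blast
  have "real (tau n) \<le> (C powr (1/j)) * real n powr \<delta>" if "n > 0" for n
  proof -
    have "real (tau n) ^ j / real n ^ 2 \<le> (\<Sum>e\<in>{1..n}. real (tau e) ^ j / real e ^ 2)"
      by (rule member_le_sum[of n "{1..n}" "\<lambda>e. real (tau e) ^ j / real e ^ 2"]) (use that in auto)
    with C(2)[of n] have "real (tau n) ^ j / real n ^ 2 \<le> C" by linarith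
    then have "real (tau n) ^ j \<le> C * real n ^ 2" using that by (simp add: divide_le_eq)
    then have "(real (tau n) ^ j) powr (1/j) \<le> (C * real n ^ 2) powr (1/j)"
      by (intro powr_mono2) auto
    also have "(real (tau n) ^ j) powr (1/j) = real (tau n)"
      using j0 tau_pos[OF that] by (simp add: powr_powr flip: powr_realpow)
    also have "(C * real n ^ 2) powr (1/j) = C powr (1/j) * real n powr (2/j)"
      using C that by (simp add: powr_mult powr_powr flip: powr_numeral)
    also have "\<dots> \<le> C powr (1/j) * real n powr \<delta>"
      using that j j0 assms by (intro mult_left_mono powr_mono) (auto simp: field_simps)
    finally show ?thesis .
  qed
  moreover have "C powr (1/j) > 0" using C by simp
  ultimately show ?thesis by blast
qed

section \<open>Kloosterman sums\<close>

definition add_char :: "nat \<Rightarrow> int \<Rightarrow> complex" where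
  "add_char e x = cis (2 * pi * real_of_int x / real e)"

lemma add_char_add: "add_char e (x + y) = add_char e x * add_char e y"
  by (simp add: add_char_def cis_mult add_divide_distrib distrib_left)

lemma add_char_0 [simp]: "add_char e 0 = 1"
  by (simp add: add_char_def)

lemma cnj_add_char: "cnj (add_char e x) = add_char e (- x)"
  by (simp add: add_char_def cis_cnj)

lemma norm_add_char [simp]: "norm (add_char e x) = 1"
  by (simp add: add_char_def)

lemma add_char_mult_nat: "add_char e (int h * x) = add_char e x ^ h"
proof -
  have "2 * pi * real_of_int (int h * x) / real e = real h * (2 * pi * real_of_int x / real e)" by simp
  then show ?thesis by (simp only: add_char_def Complex.DeMoivre)
qed

lemma add_char_eq_1_iff:
  assumes "e > 0"
  shows "add_char e x = 1 \<longleftrightarrow> int e dvd x"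
proof -
  have "add_char e x = 1 \<longleftrightarrow> (\<exists>n::int. 2 * pi * real_of_int x / real e = of_int (2 * n) * pi)"
    unfolding add_char_def cis_conv_exp by (subst exp_eq_1) auto
  also have "\<dots> \<longleftrightarrow> (\<exists>n::int. real_of_int x = real_of_int (int e * n))"
    using assms by (intro ex_cong1) (auto simp: field_simps)
  also have "\<dots> \<longleftrightarrow> int e dvd x"
    unfolding of_int_eq_iff by (auto simp: dvd_def)
  finally show ?thesis .
qed

lemma add_char_cong:
  assumes "e > 0" "int e dvd x - y"
  shows "add_char e x = add_char e y"
  using add_char_add[of e y "x - y"] add_char_eq_1_iff[of e "x - y"] assms by simp

lemma sum_add_char:
  assumes "e > 0"
  shows "(\<Sum>h<e. add_char e (int h * x)) = (if int e dvd x then of_nat e else 0)"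
proof (cases "int e dvd x")
  case True
  then have "add_char e x = 1" using assms by (simp add: add_char_eq_1_iff)
  then show ?thesis using True by (simp add: add_char_mult_nat)
next
  case False
  then have ne: "add_char e x \<noteq> 1" using assms by (simp add: add_char_eq_1_iff)
  have "add_char e (int e * x) = 1" using assms by (simp add: add_char_eq_1_iff)
  then have "add_char e x ^ e = 1" by (simp add: add_char_mult_nat)
  then show ?thesis using False ne by (simp add: add_char_mult_nat geometric_sum)
qed

text \<open>Orthogonality in both frequencies turns the mean square into a count of coinciding
  values. When \<open>I\<close> consists of pairs of inverse pairs, the inner sum is the square of a
  Kloosterman sum and the count gives its fourth moment.\<close>

lemma parseval_add_char:
  fixes F U :: "'i \<Rightarrow> int"
  assumes "e > 0" "finite I"
  shows "(\<Sum>h<e. \<Sum>k<e. norm (\<Sum>i\<in>I. add_char e (int h * F i + int k * U i)) ^ 2) =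
    real e ^ 2 * real (card {(i,j)\<in>I \<times> I. int e dvd F i - F j \<and> int e dvd U i - U j})"
proof -
  have "complex_of_real (\<Sum>h<e. \<Sum>k<e. norm (\<Sum>i\<in>I. add_char e (int h * F i + int k * U i)) ^ 2) =
     (\<Sum>h<e. \<Sum>k<e. (\<Sum>(i,j)\<in>I \<times> I. add_char e (int h * (F i - F j)) * add_char e (int k * (U i - U j))))"
    unfolding of_real_sum
  proof (intro sum.cong refl)
    fix h k :: nat
    have "complex_of_real (norm (\<Sum>i\<in>I. add_char e (int h * F i + int k * U i)) ^ 2) =
       (\<Sum>i\<in>I. add_char e (int h * F i + int k * U i)) * (\<Sum>j\<in>I. cnj (add_char e (int h * F j + int k * U j)))"
      by (simp only: complex_norm_square cnj_sum)
    also have "\<dots> = (\<Sum>(i,j)\<in>I \<times> I. add_char e (int h * F i + int k * U i) * add_char e (- (int h * F j + int k * U j)))"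
      by (simp add: sum_product sum.cartesian_product cnj_add_char)
    also have "\<dots> = (\<Sum>(i,j)\<in>I \<times> I. add_char e (int h * (F i - F j)) * add_char e (int k * (U i - U j)))"
      by (intro sum.cong refl) (auto simp: algebra_simps simp flip: add_char_add)
    finally show "complex_of_real (norm (\<Sum>i\<in>I. add_char e (int h * F i + int k * U i)) ^ 2) = \<dots>" .
  qed
  also have "\<dots> = (\<Sum>(i,j)\<in>I \<times> I. (\<Sum>h<e. add_char e (int h * (F i - F j))) * (\<Sum>k<e. add_char e (int k * (U i - U j))))"
    by (subst sum.swap, subst (2) sum.swap)
       (simp add: sum_product case_prod_unfold sum.swap[of _ _ "I \<times> I"])
  also have "\<dots> = (\<Sum>(i,j)\<in>I \<times> I. if int e dvd F i - F j \<and> int e dvd U i - U j then of_nat e ^ 2 else 0)"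
    by (intro sum.cong refl) (auto simp: sum_add_char assms power2_eq_square)
  also have "\<dots> = (\<Sum>p\<in>{p\<in>I \<times> I. case p of (i,j) \<Rightarrow> int e dvd F i - F j \<and> int e dvd U i - U j}. of_nat e ^ 2)"
    unfolding sum.inter_filter[OF finite_cartesian_product[OF assms(2,2)]]
    by (simp add: case_prod_unfold)
  also have "{p\<in>I \<times> I. case p of (i,j) \<Rightarrow> int e dvd F i - F j \<and> int e dvd U i - U j} =
      {(i,j)\<in>I \<times> I. int e dvd F i - F j \<and> int e dvd U i - U j}" by auto
  also have "(\<Sum>p\<in>\<dots>. of_nat e ^ 2) =
      complex_of_real (real e ^ 2 * real (card {(i,j)\<in>I \<times> I. int e dvd F i - F j \<and> int e dvd U i - U j}))"
    by simp
  finally show ?thesis by (simp only: of_real_eq_iff)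
qed

text \<open>The graph of \<open>f \<mapsto> -1/f\<close> modulo \<open>e\<close>. The sign is
  dictated by \<open>c e = f d + 1\<close>, which for \<open>f < e\<close> makes
  \<open>(f, d mod e)\<close> such a pair. For \<open>e = 1\<close> the only pair is
  \<open>(0, 0)\<close>.\<close>

definition inv_pairs :: "nat \<Rightarrow> (nat \<times> nat) set" where
  "inv_pairs e = {(f,u). f < e \<and> u < e \<and> e dvd f * u + 1}"

lemma finite_inv_pairs [simp]: "finite (inv_pairs e)"
  by (rule finite_subset[of _ "{..<e} \<times> {..<e}"]) (auto simp: inv_pairs_def)

lemma inv_pairs_sym: "(f,u) \<in> inv_pairs e \<longleftrightarrow> (u,f) \<in> inv_pairs e"
  by (auto simp: inv_pairs_def mult.commute)

lemma inv_pairs_dvd: "(f,u) \<in> inv_pairs e \<Longrightarrow> int e dvd int f * int u + 1"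
proof -
  assume "(f,u) \<in> inv_pairs e"
  then have "int e dvd int (f * u + 1)" unfolding of_nat_dvd_iff by (simp add: inv_pairs_def)
  then show ?thesis by (simp add: add.commute)
qed

lemma inv_pairs_coprime:
  assumes "(f,u) \<in> inv_pairs e"
  shows "coprime f e"
proof (rule coprimeI)
  fix d assume "d dvd f" "d dvd e"
  then have "d dvd f * u + 1" "d dvd f * u" using assms by (auto simp: inv_pairs_def elim: dvd_trans)
  then show "is_unit d" using dvd_diff_nat[of d "f * u + 1" "f * u"] by simp
qed

lemma inv_pairs_unique:
  assumes "(f,u) \<in> inv_pairs e" "(f,u') \<in> inv_pairs e"
  shows "u = u'"
proof -
  have "int e dvd (int f * int u + 1) - (int f * int u' + 1)"
    using assms by (intro dvd_diff inv_pairs_dvd)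
  then have "int e dvd int f * (int u - int u')" by (simp add: algebra_simps)
  moreover have "coprime (int e) (int f)" using inv_pairs_coprime[OF assms(1)] by (simp add: coprime_commute)
  ultimately have "int e dvd int u - int u'" by (simp add: coprime_dvd_mult_right_iff)
  moreover have "\<bar>int u - int u'\<bar> < int e" using assms by (auto simp: inv_pairs_def)
  ultimately show ?thesis using dvd_imp_le_int[of "int u - int u'" "int e"] by force
qed

lemma inv_pairs_exists:
  assumes "coprime f e" "f < e"
  shows "\<exists>u. (f,u) \<in> inv_pairs e"
proof -
  have "coprime (int f) (int e)" using assms by simp
  then obtain x y where xy: "x * int f + y * int e = 1"
    using bezout_int[of "int f" "int e"] by auto
  define u where "u = nat ((- x) mod int e)"
  have e: "e > 0" using assms by simp
  have u: "int u = (- x) mod int e" using e by (simp add: u_def)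
  have "int e dvd int f * int u + 1"
  proof -
    have "[int f * int u + 1 = int f * (- x) + 1] (mod int e)"
      unfolding u by (intro cong_add cong_mult cong_refl) (simp add: cong_def)
    also have "int f * (- x) + 1 = y * int e" using xy by (simp add: algebra_simps)
    finally show ?thesis by (simp add: cong_def dvd_eq_mod_eq_0)
  qed
  then have "e dvd f * u + 1"
    by (metis of_nat_1 of_nat_add of_nat_dvd_iff of_nat_mult)
  moreover have "u < e" using u e by (metis of_nat_0_less_iff of_nat_less_iff pos_mod_bound)
  ultimately show ?thesis using assms by (auto simp: inv_pairs_def)
qed

lemma sum_inv_pairs_snd:
  fixes \<phi> :: "nat \<Rightarrow> 'a :: comm_monoid_add"
  shows "(\<Sum>(f,u)\<in>inv_pairs e. \<phi> u) = (\<Sum>u | u < e \<and> coprime u e. \<phi> u)"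
proof -
  have "(\<Sum>(f,u)\<in>inv_pairs e. \<phi> u) = (\<Sum>p\<in>inv_pairs e. \<phi> (snd p))" by (simp add: case_prod_unfold)
  also have "\<dots> = sum \<phi> (snd ` inv_pairs e)"
  proof (subst sum.reindex)
    show "inj_on snd (inv_pairs e)"
    proof (rule inj_onI, clarsimp)
      fix f f' u assume "(f,u) \<in> inv_pairs e" "(f',u) \<in> inv_pairs e"
      then have "(u,f) \<in> inv_pairs e" "(u,f') \<in> inv_pairs e" by (simp_all add: inv_pairs_sym)
      then show "f = f'" by (rule inv_pairs_unique)
    qed
  qed simp
  also have "snd ` inv_pairs e = {u. u < e \<and> coprime u e}"
  proof (intro equalityI subsetI)
    fix u assume "u \<in> {u. u < e \<and> coprime u e}"
    then obtain f where "(u,f) \<in> inv_pairs e" using inv_pairs_exists[of u e] by auto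
    then show "u \<in> snd ` inv_pairs e" using inv_pairs_sym by force
  next
    fix u assume "u \<in> snd ` inv_pairs e"
    then obtain f where f: "(f,u) \<in> inv_pairs e" by auto
    then have "(u,f) \<in> inv_pairs e" by (simp add: inv_pairs_sym)
    then show "u \<in> {u. u < e \<and> coprime u e}"
      using inv_pairs_coprime by (auto simp: inv_pairs_def)
  qed
  finally show ?thesis .
qed

lemma sum_inv_pairs_fst:
  fixes \<phi> :: "nat \<Rightarrow> 'a :: comm_monoid_add"
  shows "(\<Sum>(f,u)\<in>inv_pairs e. \<phi> f) = (\<Sum>u | u < e \<and> coprime u e. \<phi> u)"
proof -
  have "(\<Sum>(f,u)\<in>inv_pairs e. \<phi> f) = (\<Sum>(f,u)\<in>inv_pairs e. \<phi> u)"
    by (rule sum.reindex_bij_witness[of _ prod.swap prod.swap]) (auto simp: inv_pairs_sym)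
  then show ?thesis by (simp add: sum_inv_pairs_snd)
qed

text \<open>The residues in \<open>{..<e}\<close> prime to \<open>e\<close> are the totatives except
  for \<open>e = 1\<close>, where \<open>0\<close> takes the place of \<open>1\<close>.\<close>

lemma card_coprime_less:
  assumes "e > 0"
  shows "card {u. u < e \<and> coprime u e} = totient e"
proof (cases "e = 1")
  case True
  then have "{u. u < e \<and> coprime u e} = {0}" by auto
  then show ?thesis using True by simp
next
  case False
  have "{u. u < e \<and> coprime u e} = totatives e"
    using assms False by (auto simp: in_totatives_iff le_less intro!: Nat.gr0I)
  then show ?thesis by (simp add: totient_def)
qed

lemma card_inv_pairs:
  assumes "e > 0"
  shows "card (inv_pairs e) = totient e"
  using sum_inv_pairs_snd[of "\<lambda>_. 1::nat" e] card_coprime_less[OF assms] by simp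

text \<open>Since \<open>inv_pairs\<close> solves \<open>f u \<equiv> -1\<close> rather than \<open>f u \<equiv> 1\<close>, this is the usual sum \<open>S(h, -k; e)\<close>.\<close>

definition kloosterman :: "nat \<Rightarrow> int \<Rightarrow> int \<Rightarrow> complex" where
  "kloosterman e h k = (\<Sum>(f,u)\<in>inv_pairs e. add_char e (h * int f + k * int u))"

lemma kloosterman_cong:
  assumes "e > 0" "int e dvd h - h'" "int e dvd k - k'"
  shows "kloosterman e h k = kloosterman e h' k'"
  unfolding kloosterman_def
proof (intro sum.cong refl, clarify)
  fix f u
  have "int e dvd (h - h') * int f + (k - k') * int u" using assms by (intro dvd_add dvd_mult2)
  then show "add_char e (h * int f + k * int u) = add_char e (h' * int f + k' * int u)"
    using assms(1) by (intro add_char_cong) (auto simp: algebra_simps)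
qed

text \<open>The substitution of \<open>a f\<close> for \<open>f\<close> and \<open>- b u\<close> for
  \<open>u\<close> permutes \<open>inv_pairs e\<close>: since \<open>a b\<close> is
  \<open>-1\<close> modulo \<open>e\<close>, the product \<open>f u\<close> does not change.\<close>

lemma kloosterman_twist:
  assumes "(a,b) \<in> inv_pairs e"
  shows "kloosterman e (int a * h) (- int b * k) = kloosterman e h k"
proof -
  have e: "e > 0" using assms by (auto simp: inv_pairs_def)
  have ab: "int e dvd int a * int b + 1" using inv_pairs_dvd[OF assms] .
  define g where "g = (\<lambda>(f,u). (nat (int a * int f mod int e), nat (- int b * int u mod int e)))"
  have nm: "int (nat (x mod int e)) = x mod int e" for x using e by simp
  have lt: "nat (x mod int e) < e" for x using e by (simp add: nat_less_iff)
  have in_R: "g p \<in> inv_pairs e" if "p \<in> inv_pairs e" for p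
  proof -
    obtain f u where p: "p = (f,u)" by (cases p)
    have fu: "int e dvd int f * int u + 1" using that inv_pairs_dvd by (simp add: p)
    define f' u' where "f' = nat (int a * int f mod int e)" and "u' = nat (- int b * int u mod int e)"
    have "[int f' * int u' + 1 = (int a * int f) * (- int b * int u) + 1] (mod int e)"
      unfolding f'_def u'_def nm by (intro cong_add cong_mult cong_refl) (simp_all add: cong_def)
    also have "(int a * int f) * (- int b * int u) + 1 =
       (int f * int u + 1) - (int a * int b + 1) * (int f * int u)" by (simp add: algebra_simps)
    also have "[\<dots> = 0] (mod int e)" using fu ab by (simp add: cong_0_iff)
    finally have "int e dvd int f' * int u' + 1" by (simp add: cong_0_iff)
    then have "e dvd f' * u' + 1" by (metis of_nat_1 of_nat_add of_nat_dvd_iff of_nat_mult)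
    then show ?thesis using lt by (simp add: g_def p inv_pairs_def f'_def u'_def)
  qed
  have inj: "inj_on g (inv_pairs e)"
  proof (rule inj_onI, clarify)
    fix f u f2 u2
    assume R: "(f,u) \<in> inv_pairs e" "(f2,u2) \<in> inv_pairs e" and eq: "g (f,u) = g (f2,u2)"
    have "int a * int f mod int e = int a * int f2 mod int e"
      using eq e by (auto simp: g_def eq_nat_nat_iff)
    then have "int e dvd int a * int f - int a * int f2" by (simp add: mod_eq_dvd_iff)
    then have "int e dvd int a * (int f - int f2)" by (simp add: algebra_simps)
    moreover have "coprime (int e) (int a)" using inv_pairs_coprime[OF assms] by (simp add: coprime_commute)
    ultimately have "int e dvd int f - int f2" by (simp add: coprime_dvd_mult_right_iff)
    moreover have "\<bar>int f - int f2\<bar> < int e" using R by (auto simp: inv_pairs_def)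
    ultimately have "f = f2" using dvd_imp_le_int[of "int f - int f2" "int e"] by force
    with R inv_pairs_unique show "f = f2 \<and> u = u2" by blast
  qed
  have surj: "g ` inv_pairs e = inv_pairs e"
    by (rule card_subset_eq) (use in_R card_image[OF inj] in auto)
  have "kloosterman e h k = (\<Sum>p\<in>g ` inv_pairs e. add_char e (h * int (fst p) + k * int (snd p)))"
    by (simp add: surj kloosterman_def case_prod_unfold)
  also have "\<dots> = (\<Sum>p\<in>inv_pairs e. add_char e (h * int (fst (g p)) + k * int (snd (g p))))"
    by (subst sum.reindex[OF inj]) simp
  also have "\<dots> = (\<Sum>(f,u)\<in>inv_pairs e. add_char e ((int a * h) * int f + (- int b * k) * int u))"
  proof (intro sum.cong refl, clarify)
    fix f u
    have "[h * (int a * int f mod int e) + k * (- int b * int u mod int e) =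
        h * (int a * int f) + k * (- int b * int u)] (mod int e)"
      by (intro cong_add cong_mult cong_refl) (simp_all add: cong_def)
    then have "int e dvd h * (int a * int f mod int e) + k * (- int b * int u mod int e) -
        ((int a * h) * int f + (- int b * k) * int u)"
      by (simp add: cong_iff_dvd_diff algebra_simps)
    then show "add_char e (h * int (fst (g (f,u))) + k * int (snd (g (f,u)))) =
        add_char e ((int a * h) * int f + (- int b * k) * int u)"
      unfolding g_def prod.case fst_conv snd_conv nm by (intro add_char_cong e)
  qed
  finally show ?thesis by (simp add: kloosterman_def)
qed

section \<open>Congruence counts and the fourth moment\<close>

text \<open>The quotient \<open>(2 x - c) / m\<close> determines \<open>x\<close> and lies among
  \<open>2 * g\<close> consecutive integers. This treats even and odd \<open>m\<close>
  alike.\<close>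

lemma card_two_mult_cong_le:
  assumes "m > 0"
  shows "card {x. x < m * g \<and> int m dvd 2 * int x - c} \<le> 2 * g"
proof -
  define L where "L = - (c div int m)"
  let ?X = "{x. x < m * g \<and> int m dvd 2 * int x - c}"
  let ?y = "\<lambda>x. (2 * int x - c) div int m"
  have cm: "c = (c div int m) * int m + c mod int m" "0 \<le> c mod int m" "c mod int m < int m"
    using assms by simp_all
  have "inj_on ?y ?X"
  proof (rule inj_onI)
    fix x x' assume "x \<in> ?X" "x' \<in> ?X" "?y x = ?y x'"
    then have "2 * int x - c = 2 * int x' - c" by (metis (mono_tags, lifting) dvd_div_mult_self mem_Collect_eq)
    then show "x = x'" by simp
  qed
  moreover have "?y ` ?X \<subseteq> {L..<L + 2 * int g}"
  proof clarify
    fix x assume x: "x < m * g" "int m dvd 2 * int x - c"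
    define y where "y = ?y x"
    have y: "y * int m = 2 * int x - c" using x by (simp add: y_def)
    have "(L - 1) * int m < y * int m"
    proof -
      have "(L - 1) * int m = - ((c div int m) * int m) - int m" by (simp add: L_def algebra_simps)
      then show ?thesis using cm y by linarith
    qed
    then have "L \<le> y" using assms mult_less_cancel_right_pos[of "int m"] by simp
    have "int x < int m * int g" using x by (simp flip: of_nat_mult)
    then have "y * int m < (L + 2 * int g) * int m"
    proof -
      have "(L + 2 * int g) * int m = - ((c div int m) * int m) + 2 * (int m * int g)"
        by (simp add: L_def algebra_simps)
      then show ?thesis using cm y \<open>int x < int m * int g\<close> by linarith
    qed
    then have "y < L + 2 * int g" using assms mult_less_cancel_right_pos[of "int m"] by simp
    with \<open>L \<le> y\<close> show "?y x \<in> {L..<L + 2 * int g}" by (simp add: y_def)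
  qed
  ultimately have "card ?X \<le> card {L..<L + 2 * int g}" by (intro card_inj_on_le) auto
  then show ?thesis by simp
qed

text \<open>With \<open>g\<close> the gcd and \<open>m = e / g\<close>, two solutions differ by a
  multiple of \<open>m\<close>, so a solution is determined by its quotient by \<open>m\<close>,
  which takes \<open>g\<close> values at most.\<close>

lemma card_linear_cong_le:
  assumes "e > 0"
  shows "card {a. a < e \<and> int e dvd int a * h - h'} \<le> nat (gcd h (int e))"
proof -
  define g where "g = gcd h (int e)"
  have g: "g > 0" using assms by (simp add: g_def)
  obtain m where m: "int e = g * m" by (metis dvd_def g_def gcd_dvd2)
  have mpos: "m > 0" using m assms g by (metis of_nat_0_less_iff zero_less_mult_pos)
  obtain h1 where h1: "h = g * h1" by (metis dvd_def g_def gcd_dvd1)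
  have cop: "coprime m h1"
  proof -
    have "gcd (g * h1) (g * m) = g * gcd h1 m" using g gcd_mult_distrib_int[of g h1 m] by simp
    then have "g = g * gcd h1 m" unfolding h1[symmetric] m[symmetric] g_def[symmetric] .
    then have "gcd h1 m = 1" using g by simp
    then have "coprime h1 m" by (simp only: coprime_iff_gcd_eq_1)
    then show ?thesis by (simp only: coprime_commute)
  qed
  let ?X = "{a. a < e \<and> int e dvd int a * h - h'}"
  have "inj_on (\<lambda>a. int a div m) ?X"
  proof (rule inj_onI)
    fix a a' assume a: "a \<in> ?X" "a' \<in> ?X" "int a div m = int a' div m"
    have "int e dvd (int a * h - h') - (int a' * h - h')" using a by (metis (mono_tags, lifting) dvd_diff mem_Collect_eq)
    then have "g * m dvd g * (h1 * (int a - int a'))" by (simp add: m h1 algebra_simps)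
    then have "m dvd int a - int a'" using g cop by (simp add: coprime_dvd_mult_right_iff)
    then have "int a mod m = int a' mod m" by (simp add: mod_eq_dvd_iff)
    with a(3) have "int a = int a'" by (metis div_mult_mod_eq)
    then show "a = a'" by simp
  qed
  moreover have "(\<lambda>a. int a div m) ` ?X \<subseteq> {0..<g}"
  proof clarify
    fix a assume "a < e"
    then have "int a < g * m" using m by (metis of_nat_less_iff)
    then have "int a div m < g" using mpos by (smt (verit) mult_right_mono div_mult_mod_eq pos_mod_sign)
    then show "int a div m \<in> {0..<g}" using mpos by (simp add: pos_imp_zdiv_nonneg_iff)
  qed
  ultimately have "card ?X \<le> card {0..<g}" by (intro card_inj_on_le) auto
  then show ?thesis by (simp add: g_def)
qed

lemma card_multiples_less:
  assumes "d dvd e" "e > 0"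
  shows "card {A. A < e \<and> d dvd A} = e div d"
proof -
  obtain m where m: "e = d * m" using assms by blast
  have d: "d > 0" using assms m by simp
  have "{A. A < e \<and> d dvd A} = (\<lambda>j. d * j) ` {..<m}" using d by (auto simp: m)
  then have "card {A. A < e \<and> d dvd A} = card {..<m}"
    using d by (simp add: card_image inj_on_def)
  then show ?thesis using d by (simp add: m)
qed

text \<open>The gcd is bounded by the sum of all common divisors. After interchanging the sums each
  divisor \<open>d\<close> of \<open>e\<close> contributes \<open>d * (e div d) = e\<close>.\<close>

lemma sum_gcd_le:
  assumes "e > 0"
  shows "(\<Sum>A<e. gcd A e) \<le> e * tau e"
proof -
  have "(\<Sum>A<e. gcd A e) \<le> (\<Sum>A<e. \<Sum>d | d dvd e. if d dvd A then d else 0)"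
  proof (rule sum_mono)
    fix A
    show "gcd A e \<le> (\<Sum>d | d dvd e. if d dvd A then d else 0)"
      using member_le_sum[of "gcd A e" "{d. d dvd e}" "\<lambda>d. if d dvd A then d else 0"] assms by simp
  qed
  also have "\<dots> = (\<Sum>d | d dvd e. \<Sum>A<e. if d dvd A then d else 0)" by (rule sum.swap)
  also have "\<dots> = (\<Sum>d | d dvd e. d * card {A. A < e \<and> d dvd A})"
  proof (intro sum.cong refl)
    fix d
    have "(\<Sum>A<e. if d dvd A then d else 0) = (\<Sum>A\<in>{A\<in>{..<e}. d dvd A}. d)"
      by (rule sum.inter_filter[symmetric]) simp
    then show "(\<Sum>A<e. if d dvd A then d else 0) = d * card {A. A < e \<and> d dvd A}" by simp
  qed
  also have "\<dots> = (\<Sum>d | d dvd e. e)"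
    by (intro sum.cong refl) (simp add: card_multiples_less assms)
  finally show ?thesis by (simp add: tau_def mult.commute)
qed

text \<open>By \<open>parseval_add_char\<close> the moment counts solutions of
  \<open>f1 + f2 = f3 + f4\<close> and \<open>u1 + u2 = u3 + u4\<close> modulo \<open>e\<close>.
  Clearing the inverses in the latter and eliminating \<open>f4\<close> leaves a product of three
  linear forms that must vanish modulo \<open>e\<close>. For given differences \<open>A\<close> and
  \<open>B\<close> the remaining variable satisfies a congruence with at most
  \<open>2 * gcd (A * B) e\<close> solutions.\<close>

lemma kloosterman_fourth_moment:
  assumes e: "e > 0"
  shows "(\<Sum>h<e. \<Sum>k<e. norm (kloosterman e (int h) (int k)) ^ 4) \<le> 2 * real e ^ 4 * real (tau e) ^ 2"
proof -
  define R where "R = inv_pairs e"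
  define F U :: "(nat \<times> nat) \<times> (nat \<times> nat) \<Rightarrow> int"
    where "F = (\<lambda>((f1,u1),(f2,u2)). int f1 + int f2)" and "U = (\<lambda>((f1,u1),(f2,u2)). int u1 + int u2)"
  define T where "T = {(i,j)\<in>(R \<times> R) \<times> (R \<times> R). int e dvd F i - F j \<and> int e dvd U i - U j}"
  \<comment> \<open>\<open>A\<close> and \<open>B\<close> stand for \<open>f3 - f1\<close> and
    \<open>f3 - f2\<close>, and \<open>x\<close> for \<open>f3\<close>; the last factor is then
    \<open>f1 + f2\<close> modulo \<open>e\<close>.\<close>
  define V where "V = {(A,B,x). A < e \<and> B < e \<and> x < e \<and> int e dvd int A * int B * (2 * int x - (int A + int B))}"
  have finR: "finite R" by (simp add: R_def)
  have sq: "norm (kloosterman e h k) ^ 4 = norm (\<Sum>i\<in>R \<times> R. add_char e (h * F i + k * U i)) ^ 2" for h k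
  proof -
    have "kloosterman e h k * kloosterman e h k = (\<Sum>p\<in>R. \<Sum>q\<in>R. add_char e (h * int (fst p) + k * int (snd p)) * add_char e (h * int (fst q) + k * int (snd q)))"
      by (simp add: kloosterman_def sum_product case_prod_unfold R_def)
    also have "\<dots> = (\<Sum>(p,q)\<in>R \<times> R. add_char e (h * int (fst p) + k * int (snd p)) * add_char e (h * int (fst q) + k * int (snd q)))"
      by (rule sum.cartesian_product)
    also have "\<dots> = (\<Sum>i\<in>R \<times> R. add_char e (h * F i + k * U i))"
      by (intro sum.cong refl) (auto simp: F_def U_def algebra_simps simp flip: add_char_add)
    finally have "norm (kloosterman e h k * kloosterman e h k) = norm (\<Sum>i\<in>R \<times> R. add_char e (h * F i + k * U i))" by simp
    then have "(norm (kloosterman e h k) * norm (kloosterman e h k)) ^ 2 = norm (\<Sum>i\<in>R \<times> R. add_char e (h * F i + k * U i)) ^ 2"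
      by (simp only: norm_mult)
    then show ?thesis by (simp add: power2_eq_square power4_eq_xxxx mult_ac)
  qed
  have eq: "(\<Sum>h<e. \<Sum>k<e. norm (kloosterman e (int h) (int k)) ^ 4) = real e ^ 2 * real (card T)"
    unfolding sq T_def using finR e by (subst parseval_add_char) simp_all
  define md where "md = (\<lambda>x::int. nat (x mod int e))"
  have md: "int (md x) = x mod int e" "md x < e" for x
    using e by (simp_all add: md_def nat_less_iff)
  define g where "g = (\<lambda>(((f1::nat,u1::nat),(f2::nat,u2::nat)),((f3::nat,u3::nat),(f4::nat,u4::nat))).
     (md (int f3 - int f1), md (int f3 - int f2), f3))"
  have small: "x = y" if "int e dvd int x - int y" "x < e" "y < e" for x y
  proof -
    have "\<bar>int x - int y\<bar> < int e" using that by auto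
    then show ?thesis using that(1) dvd_imp_le_int[of "int x - int y" "int e"] by force
  qed
  have md_eqD: "int e dvd a - b" if "md a = md b" for a b
    using md(1)[of a] md(1)[of b] that by (metis mod_eq_dvd_iff)
  have "inj_on g T"
  proof (rule inj_onI)
    fix s t assume st: "s \<in> T" "t \<in> T" "g s = g t"
    obtain f1 u1 f2 u2 f3 u3 f4 u4 where s: "s = (((f1,u1),(f2,u2)),((f3,u3),(f4,u4)))" by (metis surj_pair)
    obtain f1' u1' f2' u2' f3' u3' f4' u4' where t: "t = (((f1',u1'),(f2',u2')),((f3',u3'),(f4',u4')))" by (metis surj_pair)
    have R: "(f1,u1) \<in> R" "(f2,u2) \<in> R" "(f3,u3) \<in> R" "(f4,u4) \<in> R"
       "(f1',u1') \<in> R" "(f2',u2') \<in> R" "(f3',u3') \<in> R" "(f4',u4') \<in> R"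
      using st(1,2) by (auto simp: T_def s t)
    have lt: "f1 < e" "f2 < e" "f3 < e" "f4 < e" "f1' < e" "f2' < e" "f3' < e" "f4' < e"
      using R by (auto simp: R_def inv_pairs_def)
    have d: "int e dvd int f1 + int f2 - (int f3 + int f4)" "int e dvd int f1' + int f2' - (int f3' + int f4')"
      using st(1,2) by (auto simp: T_def s t F_def)
    have 3: "f3 = f3'" using st(3) by (simp add: g_def s t)
    have "int e dvd (int f3 - int f1) - (int f3' - int f1')" "int e dvd (int f3 - int f2) - (int f3' - int f2')"
    proof -
      have "md (int f3 - int f1) = md (int f3' - int f1')" "md (int f3 - int f2) = md (int f3' - int f2')"
        using st(3) unfolding g_def s t prod.case prod.inject by blast+
      from md_eqD[OF this(1)] md_eqD[OF this(2)]
      show "int e dvd (int f3 - int f1) - (int f3' - int f1')" "int e dvd (int f3 - int f2) - (int f3' - int f2')" .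
    qed
    then have "int e dvd - (int f1 - int f1')" "int e dvd - (int f2 - int f2')" using 3 by (simp_all add: algebra_simps)
    then have 12: "f1 = f1'" "f2 = f2'" using lt by (auto intro!: small simp: dvd_minus_iff simp del: minus_diff_eq)
    have "int e dvd (int f1' + int f2' - (int f3' + int f4')) - (int f1 + int f2 - (int f3 + int f4))"
      by (rule dvd_diff[OF d(2,1)])
    then have "int e dvd int f4 - int f4'" using 3 12 by simp
    then have 4: "f4 = f4'" using lt by (intro small)
    have "u1 = u1'" "u2 = u2'" "u3 = u3'" "u4 = u4'"
      using R 12 3 4 unfolding R_def by (metis inv_pairs_unique)+
    then show "s = t" using 12 3 4 by (simp add: s t)
  qed
  moreover have "g ` T \<subseteq> V"
  proof (rule image_subsetI)
    fix s assume sT: "s \<in> T"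
    obtain f1 u1 f2 u2 f3 u3 f4 u4 where s: "s = (((f1,u1),(f2,u2)),((f3,u3),(f4,u4)))" by (metis surj_pair)
    have R: "(f1,u1) \<in> R" "(f2,u2) \<in> R" "(f3,u3) \<in> R" "(f4,u4) \<in> R" using sT by (auto simp: T_def s)
    have inv: "[int f1 * int u1 = -1] (mod int e)" "[int f2 * int u2 = -1] (mod int e)"
       "[int f3 * int u3 = -1] (mod int e)" "[int f4 * int u4 = -1] (mod int e)"
      using R inv_pairs_dvd by (auto simp: R_def cong_iff_dvd_diff)
    have F: "[int f1 + int f2 = int f3 + int f4] (mod int e)" and U: "[int u1 + int u2 = int u3 + int u4] (mod int e)"
      using sT by (auto simp: T_def s F_def U_def cong_iff_dvd_diff)
    define a b c x1 x2 x3 x4 where v: "a = int f1" "b = int f2" "c = int f3" "x1 = int u1" "x2 = int u2" "x3 = int u3" "x4 = int u4"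
    \<comment> \<open>Taking \<open>a + b - c\<close> in place of \<open>f4\<close>, to which it is
      congruent, makes the factorization below an identity between integers.\<close>
    define d where "d = a + b - c"
    have f4: "[int f4 = d] (mod int e)"
      using cong_diff[OF cong_sym[OF F] cong_refl[of c]] by (simp add: d_def v)
    have dx: "[d * x4 = -1] (mod int e)"
      using cong_trans[OF cong_mult[OF cong_sym[OF f4] cong_refl] inv(4)] by (simp add: v)
    note inv' = inv(1-3)[folded v]
    have "[(a + b) * c * d = - (a * b * c * d * (x1 + x2))] (mod int e)"
    proof -
      have "[- (a * b * c * d * (x1 + x2)) = - (b * c * d * (a * x1) + a * c * d * (b * x2))] (mod int e)"
        by (simp add: algebra_simps)
      also have "[- (b * c * d * (a * x1) + a * c * d * (b * x2)) = - (b * c * d * (-1) + a * c * d * (-1))] (mod int e)"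
        by (intro cong_minus_minus_iff[THEN iffD2] cong_add cong_mult cong_refl inv')
      finally show ?thesis by (simp add: algebra_simps cong_sym_eq)
    qed
    also have "[- (a * b * c * d * (x1 + x2)) = - (a * b * c * d * (x3 + x4))] (mod int e)"
      using U by (intro cong_minus_minus_iff[THEN iffD2] cong_mult cong_refl) (simp add: v)
    also have "[- (a * b * c * d * (x3 + x4)) = (c + d) * a * b] (mod int e)"
    proof -
      have "[- (a * b * c * d * (x3 + x4)) = - (a * b * d * (c * x3) + a * b * c * (d * x4))] (mod int e)"
        by (simp add: algebra_simps)
      also have "[- (a * b * d * (c * x3) + a * b * c * (d * x4)) = - (a * b * d * (-1) + a * b * c * (-1))] (mod int e)"
        by (intro cong_minus_minus_iff[THEN iffD2] cong_add cong_mult cong_refl inv' dx)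
      finally show ?thesis by (simp add: algebra_simps)
    qed
    finally have "int e dvd (a + b) * c * d - (c + d) * a * b" by (simp add: cong_iff_dvd_diff)
    \<comment> \<open>As \<open>c + d = a + b\<close>, the left side is
      \<open>(a + b) * (c * d - a * b)\<close>, and
      \<open>c * d - a * b = - ((c - a) * (c - b))\<close>.\<close>
    also have "(a + b) * c * d - (c + d) * a * b = - ((c - a) * (c - b) * (2 * c - ((c - a) + (c - b))))"
      by (simp add: d_def algebra_simps)
    finally have main: "int e dvd (c - a) * (c - b) * (2 * c - ((c - a) + (c - b)))" by simp
    have "[int (md (c - a)) * int (md (c - b)) * (2 * c - (int (md (c - a)) + int (md (c - b)))) =
        (c - a) * (c - b) * (2 * c - ((c - a) + (c - b)))] (mod int e)"
      unfolding md by (intro cong_mult cong_diff cong_add cong_refl) (simp_all add: cong_def)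
    with main have "int e dvd int (md (c - a)) * int (md (c - b)) * (2 * c - (int (md (c - a)) + int (md (c - b))))"
      by (simp only: cong_dvd_iff)
    moreover have "f3 < e" using R by (auto simp: R_def inv_pairs_def)
    ultimately show "g s \<in> V" by (simp add: g_def s V_def md v)
  qed
  moreover have "finite V" by (rule finite_subset[of _ "{..<e} \<times> {..<e} \<times> {..<e}"]) (auto simp: V_def)
  ultimately have "card T \<le> card V" by (rule card_inj_on_le)
  also have "V = (SIGMA A:{..<e}. SIGMA B:{..<e}. {x. x < e \<and> int e dvd int A * int B * (2 * int x - (int A + int B))})"
    by (auto simp: V_def)
  also have "card \<dots> = (\<Sum>A<e. \<Sum>B<e. card {x. x < e \<and> int e dvd int A * int B * (2 * int x - (int A + int B))})"
    by (simp add: card_SigmaI)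
  also have "\<dots> \<le> (\<Sum>A<e. \<Sum>B<e. 2 * (gcd A e * gcd B e))"
  proof (intro sum_mono)
    fix A B :: nat
    define h where "h = gcd (A * B) e"
    obtain m where m: "e = m * h" by (metis dvd_def gcd_dvd2 h_def mult.commute)
    have h0: "h > 0" using e by (simp add: h_def)
    have m0: "m > 0" using e m by (cases m) auto
    obtain q where q: "A * B = q * h" by (metis dvd_def gcd_dvd1 h_def mult.commute)
    have cop: "coprime m q"
    proof -
      have "gcd (h * q) (h * m) = h * gcd q m" by (simp add: gcd_mult_distrib_nat)
      then have "h = h * gcd q m" unfolding mult.commute[of h] q[symmetric] m[symmetric] by (simp flip: h_def add: mult.commute)
      then have "gcd q m = 1" using h0 by simp
      then have "coprime q m" by (simp only: coprime_iff_gcd_eq_1)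
      then show ?thesis by (simp only: coprime_commute)
    qed
    have "int m dvd 2 * int x - (int A + int B)" if "int e dvd int A * int B * (2 * int x - (int A + int B))" for x
    proof -
      have "int (m * h) dvd int (q * h) * (2 * int x - (int A + int B))" using that unfolding m[symmetric] q[symmetric] by simp
      then have "int m * int h dvd (int q * (2 * int x - (int A + int B))) * int h" by (simp add: mult_ac)
      then have "int m dvd int q * (2 * int x - (int A + int B))" using h0 by simp
      moreover have "coprime (int m) (int q)" using cop by simp
      ultimately show ?thesis by (simp only: coprime_dvd_mult_right_iff)
    qed
    then have "card {x. x < e \<and> int e dvd int A * int B * (2 * int x - (int A + int B))} \<le>
       card {x. x < m * h \<and> int m dvd 2 * int x - (int A + int B)}"
      by (intro card_mono) (auto simp flip: m)
    also have "\<dots> \<le> 2 * h" by (rule card_two_mult_cong_le[OF m0])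
    \<comment> \<open>A divisor of \<open>A * B\<close> splits as \<open>y * z\<close> with
      \<open>y dvd A\<close> and \<open>z dvd B\<close>, and here both divide
      \<open>e\<close>.\<close>
    also have "h \<le> gcd A e * gcd B e"
    proof -
      have "h dvd gcd A e * gcd B e"
      proof -
        obtain y z where yz: "h = y * z" "y dvd A" "z dvd B"
          using division_decomp[of h A B] by (auto simp: h_def)
        have "h dvd e" by (simp add: h_def)
        then have "y dvd e" "z dvd e" using yz(1) by (auto dest: dvd_mult_left dvd_mult_right)
        then show ?thesis unfolding yz(1) using yz by (intro mult_dvd_mono) auto
      qed
      then show ?thesis using e by (intro dvd_imp_le) auto
    qed
    finally show "card {x. x < e \<and> int e dvd int A * int B * (2 * int x - (int A + int B))} \<le> 2 * (gcd A e * gcd B e)"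
      by simp
  qed
  also have "\<dots> = 2 * ((\<Sum>A<e. gcd A e) * (\<Sum>B<e. gcd B e))"
    by (subst sum_product) (simp only: sum_distrib_left)
  also have "\<dots> \<le> 2 * ((e * tau e) * (e * tau e))"
    using sum_gcd_le[OF e] by (intro mult_le_mono order_refl)
  finally have "real (card T) \<le> real (2 * ((e * tau e) * (e * tau e)))" by (simp only: of_nat_le_iff)
  then have "real e ^ 2 * real (card T) \<le> real e ^ 2 * real (2 * ((e * tau e) * (e * tau e)))"
    by (rule mult_left_mono) simp
  then show ?thesis unfolding eq by (simp add: power2_eq_square power4_eq_xxxx mult_ac)
qed

text \<open>By \<open>kloosterman_twist\<close>, the value at \<open>(h, k)\<close> recurs at \<open>(a h, - b k)\<close> for all \<open>\<phi>(e)\<close> pairs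
  \<open>(a, b)\<close>, and each term of the fourth moment is hit at most \<open>gcd h e\<close> times.\<close>

lemma kloosterman_bound:
  assumes e: "e > 0"
  shows "norm (kloosterman e (int h) (int k)) \<le> 2 * real (gcd h e) * real (tau e) * real e powr (3/4)"
proof -
  define R where "R = inv_pairs e"
  define md where "md = (\<lambda>x::int. nat (x mod int e))"
  have md: "int (md x) = x mod int e" "md x < e" for x
    using e by (simp_all add: md_def nat_less_iff)
  define G where "G = (\<lambda>h'. \<Sum>k'<e. norm (kloosterman e (int h') (int k')) ^ 4)"
  have G0: "G x \<ge> 0" for x unfolding G_def by (intro sum_nonneg) simp
  have "real (totient e) * norm (kloosterman e (int h) (int k)) ^ 4 = (\<Sum>(a,b)\<in>R. norm (kloosterman e (int h) (int k)) ^ 4)"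
    by (simp add: R_def card_inv_pairs e)
  also have "\<dots> \<le> (\<Sum>(a,b)\<in>R. G (md (int a * int h)))"
  proof (rule sum_mono, clarify)
    fix a b assume ab: "(a,b) \<in> R"
    have "kloosterman e (int h) (int k) = kloosterman e (int a * int h) (- int b * int k)"
      using kloosterman_twist ab by (simp add: R_def)
    also have "\<dots> = kloosterman e (int (md (int a * int h))) (int (md (- int b * int k)))"
      unfolding md by (intro kloosterman_cong e) (simp_all add: mod_eq_dvd_iff [symmetric])
    finally have "norm (kloosterman e (int h) (int k)) ^ 4 = norm (kloosterman e (int (md (int a * int h))) (int (md (- int b * int k)))) ^ 4"
      by simp
    also have "\<dots> \<le> G (md (int a * int h))"
      unfolding G_def by (rule member_le_sum) (use md in auto)
    finally show "norm (kloosterman e (int h) (int k)) ^ 4 \<le> G (md (int a * int h))" .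
  qed
  also have "\<dots> = (\<Sum>a | a < e \<and> coprime a e. G (md (int a * int h)))"
    unfolding R_def by (rule sum_inv_pairs_fst)
  also have "\<dots> \<le> (\<Sum>a<e. G (md (int a * int h)))"
    by (rule sum_mono2) (auto simp: G0)
  also have "\<dots> = (\<Sum>h'<e. \<Sum>a | a \<in> {..<e} \<and> md (int a * int h) = h'. G (md (int a * int h)))"
    by (rule sum.group[symmetric]) (use md in auto)
  also have "\<dots> = (\<Sum>h'<e. real (card {a. a \<in> {..<e} \<and> md (int a * int h) = h'}) * G h')"
    by (intro sum.cong refl) simp
  also have "\<dots> \<le> (\<Sum>h'<e. real (gcd h e) * G h')"
  proof (intro sum_mono mult_right_mono G0)
    fix h' assume "h' \<in> {..<e}"
    have "{a. a \<in> {..<e} \<and> md (int a * int h) = h'} \<subseteq> {a. a < e \<and> int e dvd int a * int h - int h'}"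
    proof clarify
      fix a show "int e dvd int a * int h - int (md (int a * int h))"
        unfolding md by (simp add: mod_eq_dvd_iff[symmetric])
    qed
    then have "card {a. a \<in> {..<e} \<and> md (int a * int h) = h'} \<le> card {a. a < e \<and> int e dvd int a * int h - int h'}"
      by (intro card_mono) auto
    also have "\<dots> \<le> nat (gcd (int h) (int e))" by (rule card_linear_cong_le[OF e])
    finally show "real (card {a. a \<in> {..<e} \<and> md (int a * int h) = h'}) \<le> real (gcd h e)" by simp
  qed
  also have "\<dots> = real (gcd h e) * (\<Sum>h'<e. \<Sum>k'<e. norm (kloosterman e (int h') (int k')) ^ 4)"
    by (simp add: G_def sum_distrib_left)
  also have "\<dots> \<le> real (gcd h e) * (2 * real e ^ 4 * real (tau e) ^ 2)"
    by (intro mult_left_mono kloosterman_fourth_moment e) simp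
  finally have 1: "real (totient e) * norm (kloosterman e (int h) (int k)) ^ 4 \<le> real (gcd h e) * (2 * real e ^ 4 * real (tau e) ^ 2)" .
  define N where "N = norm (kloosterman e (int h) (int k)) ^ 4"
  define g where "g = real (gcd h e)"
  have g1: "g \<ge> 1" using e by (simp add: g_def Suc_leI)
  have N0: "N \<ge> 0" by (simp add: N_def)
  have t1: "real (tau e) \<ge> 1" using tau_pos[OF e] by simp
  \<comment> \<open>Replacing \<open>totient e\<close> by \<open>e / tau e\<close> takes one power
    of \<open>e\<close> off the fourth moment; the fourth root of the remaining \<open>e ^ 3\<close>
    is the source of the exponent \<open>3/4\<close>.\<close>
  have "real e * N \<le> (real (tau e) * real (totient e)) * N"
    using le_tau_mult_totient[of e] N0 by (intro mult_right_mono) (simp_all flip: of_nat_mult)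
  also have "\<dots> = real (tau e) * (real (totient e) * N)" by simp
  also have "\<dots> \<le> real (tau e) * (g * (2 * real e ^ 4 * real (tau e) ^ 2))"
    using 1 by (intro mult_left_mono) (simp_all add: N_def g_def)
  also have "\<dots> = real e * (2 * g * real (tau e) ^ 3 * real e ^ 3)"
    by (simp add: eval_nat_numeral)
  finally have "N \<le> 2 * g * real (tau e) ^ 3 * real e ^ 3" using e by simp
  \<comment> \<open>Constant, gcd and divisor function are rounded up to fourth powers so that the
    root can be taken.\<close>
  also have "\<dots> \<le> 16 * g ^ 4 * real (tau e) ^ 4 * real e ^ 3"
    using g1 t1 e by (intro mult_mono power_increasing) (auto simp: self_le_power intro!: mult_mono)
  also have "\<dots> = (2 * g * real (tau e) * real e powr (3/4)) ^ 4"
    using e by (simp add: power_mult_distrib powr_power powr_numeral)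
  finally show ?thesis unfolding N_def g_def
    by (rule power_le_imp_le_base[where n = 3, simplified]) simp
qed

section \<open>Equidistribution of inverses\<close>

text \<open>The norm is \<open>2 * sin (pi * h' / e)\<close>, where \<open>h'\<close> is the
  distance of \<open>h\<close> from the nearest multiple of \<open>e\<close>. The bound has the sum
  of \<open>1 / h\<close> and \<open>1 / (e - h)\<close> instead of \<open>1 / h'\<close>, since
  these can be summed over \<open>h\<close> separately.\<close>

lemma norm_one_minus_add_char_ge:
  assumes "0 < h" "h < e"
  shows "1 / norm (1 - add_char e (- int h)) \<le> real e * (1 / real h + 1 / real (e - h))"
proof -
  define h' where "h' = min h (e - h)"
  have h': "h' > 0" "2 * h' \<le> e" using assms by (auto simp: h'_def)
  define x where "x = pi * real h' / real e"
  have e: "e > 0" using assms by simp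
  have x0: "x > 0" using h' e by (simp add: x_def)
  have x2: "x \<le> 2"
  proof -
    have "x = (pi / 2) * (real (2 * h') / real e)" by (simp add: x_def)
    also have "\<dots> \<le> 2 * 1"
      using h'(2) pi_less_4 e by (intro mult_mono) (simp_all add: divide_le_eq)
    finally show ?thesis by simp
  qed
  \<comment> \<open>Taylor expansion gives \<open>sin x \<ge> x - x ^ 3 / 6\<close>, and
    \<open>x \<le> 2\<close> gives \<open>x ^ 3 \<le> 4 * x\<close>.\<close>
  have "x / 3 \<le> sin x"
  proof -
    have "\<bar>sin x - (\<Sum>m<3. sin_coeff m * x ^ m)\<bar> \<le> inverse (fact 3) * \<bar>x\<bar> ^ 3"
      by (rule Maclaurin_sin_bound)
    then have "\<bar>sin x - x\<bar> \<le> x ^ 3 / 6"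
      using x0 by (simp add: sin_coeff_def eval_nat_numeral)
    moreover have "x ^ 3 \<le> 4 * x"
    proof -
      have "x * x \<le> 2 * 2" using x0 x2 by (intro mult_mono) auto
      then have "x * (x * x) \<le> x * 4" using x0 by (intro mult_left_mono) auto
      then show ?thesis by (simp add: eval_nat_numeral)
    qed
    ultimately show ?thesis by linarith
  qed
  have nrm: "norm (1 - add_char e (- int h)) = 2 * sin x"
  proof -
    have eq: "norm (1 - cis t) = 2 * \<bar>sin (t / 2)\<bar>" for t
    proof -
      have "norm (1 - cis t) ^ 2 = (1 - cos t) ^ 2 + sin t ^ 2"
        by (simp add: cmod_power2)
      also have "\<dots> = 2 - 2 * cos t" using sin_cos_squared_add[of t] by (simp add: power2_eq_square algebra_simps)
      also have "cos t = 1 - 2 * sin (t / 2) ^ 2" using cos_double_sin[of "t/2"] by simp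
      finally have "norm (1 - cis t) ^ 2 = (2 * \<bar>sin (t / 2)\<bar>) ^ 2" by (simp add: power_mult_distrib)
      then show ?thesis by (rule power2_eq_imp_eq) auto
    qed
    have sp: "sin x \<ge> 0" using \<open>x / 3 \<le> sin x\<close> x0 by linarith
    have "\<bar>sin (pi * real h / real e)\<bar> = sin x"
    proof (cases "h' = h")
      case True then show ?thesis using sp by (simp add: x_def)
    next
      case False
      then have "real h' = real e - real h" using assms by (auto simp: h'_def of_nat_diff)
      then have "x = pi - pi * real h / real e"
        using e by (simp add: x_def right_diff_distrib diff_divide_distrib)
      then show ?thesis using sp by simp
    qed
    moreover have "norm (1 - add_char e (- int h)) = 2 * \<bar>sin (pi * real h / real e)\<bar>"
      unfolding add_char_def eq by simp
    ultimately show ?thesis by simp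
  qed
  have "1 / norm (1 - add_char e (- int h)) \<le> real e / real h'"
  proof -
    have "real h' / real e \<le> 2 * (x / 3)"
      using pi_ge_two h' e by (simp add: x_def field_simps)
  also have "\<dots> \<le> norm (1 - add_char e (- int h))" unfolding nrm using \<open>x / 3 \<le> sin x\<close> by simp
    finally have le: "real h' / real e \<le> norm (1 - add_char e (- int h))" .
    have "0 < real h' / real e" using h' e by simp
    then have "1 / norm (1 - add_char e (- int h)) \<le> 1 / (real h' / real e)"
      using le by (intro divide_left_mono mult_pos_pos) linarith+
    then show ?thesis by simp
  qed
  also have "\<dots> \<le> real e * (1 / real h + 1 / real (e - h))"
  proof (cases "h' = h")
    case False
    then have "h' = e - h" by (auto simp: h'_def)
    then show ?thesis by (simp add: distrib_left)
  qed (simp add: distrib_left)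
  finally show ?thesis .
qed

text \<open>The Fourier coefficients, without normalization, of the indicator function of
  \<open>{..<n}\<close> on the residues modulo \<open>e\<close>. The coefficient at \<open>0\<close>
  is \<open>n\<close>.\<close>

definition initial_dft :: "nat \<Rightarrow> nat \<Rightarrow> nat \<Rightarrow> complex" where
  "initial_dft e n h = (\<Sum>j<n. add_char e (- (int h * int j)))"

lemma norm_initial_dft_le:
  assumes "0 < h" "h < e"
  shows "norm (initial_dft e n h) \<le> 2 * real e * (1 / real h + 1 / real (e - h))"
proof -
  define z where "z = add_char e (- int h)"
  have "\<not> int e dvd - int h" using assms by (simp add: nat_dvd_not_less)
  then have z1: "z \<noteq> 1" using assms by (simp add: z_def add_char_eq_1_iff)
  have "initial_dft e n h = (\<Sum>j<n. z ^ j)"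
    unfolding initial_dft_def z_def by (intro sum.cong refl) (simp flip: add_char_mult_nat add: mult.commute)
  also have "\<dots> = (z ^ n - 1) / (z - 1)" by (rule geometric_sum[OF z1])
  finally have "norm (initial_dft e n h) = norm (z ^ n - 1) / norm (1 - z)" by (simp add: norm_divide norm_minus_commute)
  also have "\<dots> \<le> 2 * (1 / norm (1 - z))"
  proof -
    have "norm (z ^ n - 1) \<le> norm (z ^ n) + norm (1::complex)" by (rule norm_triangle_ineq4)
    also have "\<dots> = 2" by (simp add: norm_power z_def)
    finally show ?thesis by (simp add: divide_right_mono)
  qed
  also have "\<dots> \<le> 2 * (real e * (1 / real h + 1 / real (e - h)))"
    unfolding z_def by (intro mult_left_mono norm_one_minus_add_char_ge assms) simp
  finally show ?thesis by simp
qed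

lemma initial_dft_inversion:
  assumes "n \<le> e" "f < e"
  shows "(\<Sum>h<e. initial_dft e n h * add_char e (int h * int f)) = (if f < n then of_nat e else 0)"
proof -
  have e: "e > 0" using assms by simp
  have "(\<Sum>h<e. initial_dft e n h * add_char e (int h * int f)) = (\<Sum>h<e. \<Sum>j<n. add_char e (int h * (int f - int j)))"
    unfolding initial_dft_def sum_distrib_right
    by (intro sum.cong refl) (simp flip: add_char_add add: algebra_simps)
  also have "\<dots> = (\<Sum>j<n. \<Sum>h<e. add_char e (int h * (int f - int j)))" by (rule sum.swap)
  also have "\<dots> = (\<Sum>j<n. if j = f then of_nat e else 0)"
  proof (intro sum.cong refl)
    fix j assume "j \<in> {..<n}"
    then have "j < e" using assms by simp
    then have "int e dvd int f - int j \<longleftrightarrow> j = f"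
      using assms(2) by (simp flip: mod_eq_dvd_iff) auto
    then show "(\<Sum>h<e. add_char e (int h * (int f - int j))) = (if j = f then of_nat e else 0)"
      by (simp add: sum_add_char e)
  qed
  also have "\<dots> = (if f < n then of_nat e else 0)" by simp
  finally show ?thesis .
qed

lemma sum_reflect_harm: "(\<Sum>h\<in>{1..<e}. f (e - h)) = (\<Sum>h\<in>{1..<e}. f (h::nat) :: real)"
  by (rule sum.reindex_bij_witness[of _ "\<lambda>h. e - h" "\<lambda>h. e - h"]) auto

lemma sum_inverse_eq_harm: "(\<Sum>h\<in>{1..n}. 1 / real h) = harm n"
  by (simp add: harm_def inverse_eq_divide)

text \<open>The coefficient at \<open>0\<close> contributes \<open>m \<le> e * harm e\<close>, the
  others at most \<open>4 * e * harm e\<close> by the symmetry between \<open>k\<close> and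
  \<open>e - k\<close>.\<close>

lemma sum_norm_initial_dft_le:
  assumes "e > 0" "m \<le> e"
  shows "(\<Sum>k<e. norm (initial_dft e m k)) \<le> 5 * real e * harm e"
proof -
  have "{..<e} = insert 0 {1..<e}" using assms by auto
  then have "(\<Sum>k<e. norm (initial_dft e m k)) = norm (initial_dft e m 0) + (\<Sum>k\<in>{1..<e}. norm (initial_dft e m k))"
    by simp
  also have "norm (initial_dft e m 0) = real m" by (simp add: initial_dft_def)
  also have "(\<Sum>k\<in>{1..<e}. norm (initial_dft e m k)) \<le> (\<Sum>k\<in>{1..<e}. 2 * real e * (1 / real k + 1 / real (e - k)))"
    by (intro sum_mono norm_initial_dft_le) auto
  also have "\<dots> = 4 * real e * (\<Sum>k\<in>{1..<e}. 1 / real k)"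
    using sum_reflect_harm[of "\<lambda>k. 1 / real k" e] by (simp flip: sum_distrib_left add: sum.distrib)
  also have "(\<Sum>k\<in>{1..<e}. 1 / real k) \<le> (\<Sum>k\<in>{1..e}. 1 / real k)"
    by (rule sum_mono2) auto
  also have "\<dots> = harm e" by (rule sum_inverse_eq_harm)
  finally have "(\<Sum>k<e. norm (initial_dft e m k)) \<le> real m + 4 * real e * harm e"
    by (simp add: mult_left_mono)
  moreover have "real m \<le> real e * harm e"
  proof -
    have "(1::real) \<le> harm e" using harm_mono[of 1 e, where 'a = real] assms by (simp add: harm_expand)
    then have "real e * 1 \<le> real e * harm e" by (intro mult_left_mono) auto
    then show ?thesis using assms by linarith
  qed
  ultimately show ?thesis by simp
qed

text \<open>The gcd is bounded by the sum of the common divisors \<open>d\<close>. Writing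
  \<open>h = d * j\<close>, each \<open>d\<close> leaves a harmonic sum over
  \<open>j\<close>.\<close>

lemma sum_gcd_div_le:
  assumes "e > 0"
  shows "(\<Sum>h\<in>{1..<e}. real (gcd h e) / real h) \<le> real (tau e) * harm e"
proof -
  have "(\<Sum>h\<in>{1..<e}. real (gcd h e) / real h) \<le> (\<Sum>h\<in>{1..<e}. \<Sum>d | d dvd e. if d dvd h then real d / real h else 0)"
  proof (rule sum_mono)
    fix h :: nat
    show "real (gcd h e) / real h \<le> (\<Sum>d | d dvd e. if d dvd h then real d / real h else 0)"
      using member_le_sum[of "gcd h e" "{d. d dvd e}" "\<lambda>d. if d dvd h then real d / real h else 0"] assms by simp
  qed
  also have "\<dots> = (\<Sum>d | d dvd e. \<Sum>h\<in>{1..<e}. if d dvd h then real d / real h else 0)" by (rule sum.swap)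
  also have "\<dots> \<le> (\<Sum>d | d dvd e. harm e)"
  proof (intro sum_mono)
    fix d assume "d \<in> {d. d dvd e}"
    then have d: "d > 0" using assms by (auto intro: Nat.gr0I)
    have "(\<Sum>h\<in>{1..<e}. if d dvd h then real d / real h else 0) = (\<Sum>h\<in>{h\<in>{1..<e}. d dvd h}. real d / real h)"
      by (rule sum.inter_filter[symmetric]) simp
    also have "\<dots> = (\<Sum>j\<in>{j. 1 \<le> j \<and> d * j < e}. 1 / real j)"
      by (rule sum.reindex_bij_witness[of _ "\<lambda>j. d * j" "\<lambda>h. h div d"]) (use d in \<open>auto simp: Suc_le_eq\<close>)
    also have "\<dots> \<le> (\<Sum>j\<in>{1..e}. 1 / real j)"
    proof (rule sum_mono2)
      show "{j. 1 \<le> j \<and> d * j < e} \<subseteq> {1..e}"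
      proof clarify
        fix j assume "1 \<le> j" "d * j < e"
        moreover have "1 * j \<le> d * j" using d by (intro mult_le_mono) auto
        ultimately have "j \<le> e" by linarith
        then show "j \<in> {1..e}" using \<open>1 \<le> j\<close> by simp
      qed
    qed auto
    also have "\<dots> = harm e" by (rule sum_inverse_eq_harm)
    finally show "(\<Sum>h\<in>{1..<e}. if d dvd h then real d / real h else 0) \<le> harm e" .
  qed
  finally show ?thesis by (simp add: tau_def)
qed

text \<open>Both indicators are expanded into characters. The frequencies with \<open>h = 0\<close>
  reproduce \<open>n / e\<close> times the count over \<open>u\<close> exactly, so this count need
  not be evaluated; all others carry a Kloosterman sum with \<open>h \<noteq> 0\<close>. The
  \<open>40\<close> is the product of \<open>2\<close> from the coefficients in \<open>h\<close>,
  \<open>2\<close> from \<open>kloosterman_bound\<close>, \<open>2\<close> from the symmetry in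
  \<open>h\<close> and \<open>5\<close> from the coefficients in \<open>k\<close>.\<close>

lemma inv_pairs_box_count:
  assumes e: "e > 0" and n: "n \<le> e" and m: "m \<le> e"
  shows "\<bar>(\<Sum>(f,u)\<in>inv_pairs e. if f < n \<and> u < m then 1 else 0) -
      real n / real e * (\<Sum>(f,u)\<in>inv_pairs e. if u < m then 1 else 0)\<bar>
     \<le> 40 * real (tau e) ^ 2 * harm e ^ 2 * real e powr (3/4)"
proof -
  define R where "R = inv_pairs e"
  define A where "A = initial_dft e"
  have fin: "finite R" by (simp add: R_def)
  have lt: "f < e \<and> u < e" if "(f,u) \<in> R" for f u using that by (auto simp: R_def inv_pairs_def)
  have um: "of_nat e * (\<Sum>(f,u)\<in>R. if u < m then 1 else 0) = (\<Sum>k<e. A m k * kloosterman e 0 (int k))"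
  proof -
    have "of_nat e * (\<Sum>(f,u)\<in>R. if u < m then 1 else 0 :: complex) = (\<Sum>(f,u)\<in>R. \<Sum>k<e. A m k * add_char e (int k * int u))"
      unfolding sum_distrib_left A_def
      by (intro sum.cong refl) (use lt m in \<open>auto simp: initial_dft_inversion\<close>)
    also have "\<dots> = (\<Sum>k<e. \<Sum>(f,u)\<in>R. A m k * add_char e (int k * int u))"
      unfolding case_prod_unfold by (rule sum.swap)
    finally show ?thesis by (simp add: kloosterman_def R_def sum_distrib_left case_prod_unfold)
  qed
  have box: "of_nat e * of_nat e * (\<Sum>(f,u)\<in>R. if f < n \<and> u < m then 1 else 0) = (\<Sum>h<e. \<Sum>k<e. A n h * A m k * kloosterman e (int h) (int k))"
  proof -
    have "of_nat e * of_nat e * (\<Sum>(f,u)\<in>R. if f < n \<and> u < m then 1 else 0 :: complex) =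
      (\<Sum>(f,u)\<in>R. (\<Sum>h<e. A n h * add_char e (int h * int f)) * (\<Sum>k<e. A m k * add_char e (int k * int u)))"
      unfolding sum_distrib_left[where A = R] A_def
      by (intro sum.cong refl) (use lt m n in \<open>auto simp: initial_dft_inversion\<close>)
    also have "\<dots> = (\<Sum>p\<in>R. \<Sum>h<e. \<Sum>k<e. A n h * A m k * add_char e (int h * int (fst p) + int k * int (snd p)))"
      by (intro sum.cong refl, unfold case_prod_unfold sum_product, intro sum.cong refl)
         (simp add: add_char_add mult_ac)
    also have "\<dots> = (\<Sum>h<e. \<Sum>p\<in>R. \<Sum>k<e. A n h * A m k * add_char e (int h * int (fst p) + int k * int (snd p)))"
      by (rule sum.swap)
    also have "\<dots> = (\<Sum>h<e. \<Sum>k<e. \<Sum>p\<in>R. A n h * A m k * add_char e (int h * int (fst p) + int k * int (snd p)))"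
      by (intro sum.cong refl sum.swap)
    finally show ?thesis by (simp add: kloosterman_def R_def sum_distrib_left case_prod_unfold)
  qed
  have split: "{..<e} = insert 0 {1..<e}" using e by auto
  define q where "q = (\<lambda>h. 1 / real h + 1 / real (e - h))"
  have "A n 0 = of_nat n" by (simp add: A_def initial_dft_def)
  then have "of_nat e * of_nat e * (\<Sum>(f,u)\<in>R. if f < n \<and> u < m then 1 else 0) -
     of_nat n * (of_nat e * (\<Sum>(f,u)\<in>R. if u < m then 1 else 0)) =
     (\<Sum>h\<in>{1..<e}. \<Sum>k<e. A n h * A m k * kloosterman e (int h) (int k))"
    unfolding box um by (subst split) (simp add: sum_distrib_left mult.assoc)
  then have "norm (of_nat e * of_nat e * (\<Sum>(f,u)\<in>R. if f < n \<and> u < m then 1 else 0) -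
     of_nat n * (of_nat e * (\<Sum>(f,u)\<in>R. if u < m then 1 else 0)) :: complex) \<le>
     (\<Sum>h\<in>{1..<e}. \<Sum>k<e. norm (A n h) * norm (A m k) * norm (kloosterman e (int h) (int k)))"
    by (auto simp flip: norm_mult intro!: order_trans[OF norm_sum] sum_mono norm_sum)
  also have "\<dots> \<le> (\<Sum>h\<in>{1..<e}. \<Sum>k<e. (2 * real e * q h) * norm (A m k) *
       (2 * real (gcd h e) * real (tau e) * real e powr (3/4)))"
    unfolding A_def q_def
    by (intro sum_mono mult_mono norm_initial_dft_le kloosterman_bound e) auto
  also have "\<dots> = 4 * real e * real (tau e) * real e powr (3/4) *
      (\<Sum>h\<in>{1..<e}. real (gcd h e) * q h) * (\<Sum>k<e. norm (A m k))"
    by (simp add: sum_distrib_left sum_distrib_right mult_ac)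
  also have "(\<Sum>h\<in>{1..<e}. real (gcd h e) * q h) =
     2 * (\<Sum>h\<in>{1..<e}. real (gcd h e) / real h)"
  proof -
    have "(\<Sum>h\<in>{1..<e}. real (gcd h e) / real (e - h)) = (\<Sum>h\<in>{1..<e}. real (gcd (e - h) e) / real (e - h))"
    proof (intro sum.cong refl)
      fix h assume "h \<in> {1..<e}"
      then have "gcd (e - h) e = gcd h e"
        using gcd_diff1_nat[of h e] gcd_diff1_nat[of "e - h" e] by (simp add: gcd.commute)
      then show "real (gcd h e) / real (e - h) = real (gcd (e - h) e) / real (e - h)" by simp
    qed
    also have "\<dots> = (\<Sum>h\<in>{1..<e}. real (gcd h e) / real h)" by (rule sum_reflect_harm)
    finally show ?thesis by (simp add: q_def distrib_left sum.distrib)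
  qed
  also have "4 * real e * real (tau e) * real e powr (3/4) * (2 * (\<Sum>h\<in>{1..<e}. real (gcd h e) / real h)) * (\<Sum>k<e. norm (A m k))
     \<le> 4 * real e * real (tau e) * real e powr (3/4) * (2 * (real (tau e) * harm e)) * (5 * real e * harm e)"
    unfolding A_def using e m
    by (intro mult_mono mult_nonneg_nonneg sum_gcd_div_le sum_norm_initial_dft_le sum_nonneg) (auto simp: harm_nonneg)
  finally have ineq: "norm (of_nat e * of_nat e * (\<Sum>(f,u)\<in>R. if f < n \<and> u < m then 1 else 0) -
     of_nat n * (of_nat e * (\<Sum>(f,u)\<in>R. if u < m then 1 else 0)) :: complex) \<le>
     40 * real (tau e) ^ 2 * harm e ^ 2 * real e powr (3/4) * (real e * real e)"
    by (simp add: power2_eq_square mult_ac)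
  define x y where "x = (\<Sum>(f,u)\<in>R. if f < n \<and> u < m then 1 else 0 :: real)" and "y = (\<Sum>(f,u)\<in>R. if u < m then 1 else 0 :: real)"
  have xy: "complex_of_real x = (\<Sum>(f,u)\<in>R. if f < n \<and> u < m then 1 else 0)" "complex_of_real y = (\<Sum>(f,u)\<in>R. if u < m then 1 else 0)"
    unfolding x_def y_def of_real_sum by (intro sum.cong refl; auto)+
  have "complex_of_real ((x - real n / real e * y) * (real e * real e)) = of_nat e * of_nat e * of_real x - of_nat n * (of_nat e * of_real y)"
    using e by (simp add: field_simps)
  then have "\<bar>(x - real n / real e * y) * (real e * real e)\<bar> \<le> 40 * real (tau e) ^ 2 * harm e ^ 2 * real e powr (3/4) * (real e * real e)"
    using ineq unfolding xy[symmetric] by (metis norm_of_real real_norm_def)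
  then have "\<bar>x - real n / real e * y\<bar> * (real e * real e) \<le> 40 * real (tau e) ^ 2 * harm e ^ 2 * real e powr (3/4) * (real e * real e)"
    by (simp only: abs_mult abs_of_nat)
  then show ?thesis using e unfolding x_def y_def R_def by simp
qed

text \<open>A layer-cake decomposition: \<phi>, continued by \<open>0\<close> from \<open>e\<close>
  on, is a combination of indicators of initial segments with weights \<open>w j \<ge> 0\<close> of
  total mass \<open>\<phi> 0\<close>, and the box counts are superposed accordingly.\<close>

lemma inv_pairs_antimono_sum:
  fixes \<phi> :: "nat \<Rightarrow> real"
  assumes e: "e > 0" and n: "n \<le> e"
    and anti: "\<And>u v. u \<le> v \<Longrightarrow> v < e \<Longrightarrow> \<phi> v \<le> \<phi> u" and nonneg: "\<And>u. u < e \<Longrightarrow> 0 \<le> \<phi> u"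
  shows "\<bar>(\<Sum>(f,u)\<in>inv_pairs e. if f < n then \<phi> u else 0) -
      real n / real e * (\<Sum>(f,u)\<in>inv_pairs e. \<phi> u)\<bar>
     \<le> \<phi> 0 * (40 * real (tau e) ^ 2 * harm e ^ 2 * real e powr (3/4))"
proof -
  define R where "R = inv_pairs e"
  define K where "K = 40 * real (tau e) ^ 2 * harm e ^ 2 * real e powr (3/4)"
  define \<psi> where "\<psi> = (\<lambda>u. if u < e then \<phi> u else 0)"
  define w where "w = (\<lambda>j. \<psi> j - \<psi> (Suc j))"
  have w0: "w j \<ge> 0" for j
    using anti[of j "Suc j"] nonneg[of j] by (auto simp: w_def \<psi>_def)
  have tel: "(\<Sum>j<k. w j) = \<psi> 0 - \<psi> k" for k
    unfolding w_def by (induction k) auto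
  have layer: "\<phi> u = (\<Sum>j<e. w j * (if u < Suc j then 1 else 0))" if "u < e" for u
  proof -
    have "(\<Sum>j<e. w j * (if u < Suc j then 1 else 0)) = (\<Sum>j\<in>{..<e}. if \<not> j < u then w j else 0)"
      by (intro sum.cong refl) auto
    also have "\<dots> = (\<Sum>j\<in>{..<e} - {..<u}. w j)"
      by (subst sum.inter_filter[symmetric]) (auto intro!: sum.cong)
    also have "\<dots> = (\<Sum>j<e. w j) - (\<Sum>j<u. w j)"
      using that by (subst sum_diff) auto
    also have "\<dots> = \<phi> u" using that e unfolding tel by (simp add: \<psi>_def)
    finally show ?thesis by simp
  qed
  have lt: "snd p < e" if "p \<in> R" for p using that by (auto simp: R_def inv_pairs_def)
  have "(\<Sum>(f,u)\<in>R. if f < n then \<phi> u else 0) = (\<Sum>p\<in>R. \<Sum>j<e. w j * (if fst p < n \<and> snd p < Suc j then 1 else 0))"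
    by (intro sum.cong refl) (auto simp: layer dest!: lt)
  also have "\<dots> = (\<Sum>j<e. w j * (\<Sum>(f,u)\<in>R. if f < n \<and> u < Suc j then 1 else 0))"
    by (subst sum.swap) (simp add: sum_distrib_left case_prod_unfold)
  finally have 1: "(\<Sum>(f,u)\<in>R. if f < n then \<phi> u else 0) = (\<Sum>j<e. w j * (\<Sum>(f,u)\<in>R. if f < n \<and> u < Suc j then 1 else 0))" .
  have "(\<Sum>(f,u)\<in>R. \<phi> u) = (\<Sum>p\<in>R. \<Sum>j<e. w j * (if snd p < Suc j then 1 else 0))"
    by (intro sum.cong refl) (auto simp: layer dest!: lt)
  also have "\<dots> = (\<Sum>j<e. w j * (\<Sum>(f,u)\<in>R. if u < Suc j then 1 else 0))"
    by (subst sum.swap) (simp add: sum_distrib_left case_prod_unfold)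
  finally have 2: "(\<Sum>(f,u)\<in>R. \<phi> u) = (\<Sum>j<e. w j * (\<Sum>(f,u)\<in>R. if u < Suc j then 1 else 0))" .
  have "(\<Sum>(f,u)\<in>R. if f < n then \<phi> u else 0) - real n / real e * (\<Sum>(f,u)\<in>R. \<phi> u) =
     (\<Sum>j<e. w j * ((\<Sum>(f,u)\<in>R. if f < n \<and> u < Suc j then 1 else 0) - real n / real e * (\<Sum>(f,u)\<in>R. if u < Suc j then 1 else 0)))"
    unfolding 1 2 by (simp add: sum_distrib_left right_diff_distrib sum_subtractf mult_ac)
  also have "\<bar>\<dots>\<bar> \<le> (\<Sum>j<e. w j * K)"
    unfolding K_def R_def
    by (intro order_trans[OF sum_abs] sum_mono, unfold abs_mult, intro mult_mono inv_pairs_box_count)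
       (use e n w0 in \<open>auto\<close>)
  also have "\<dots> = \<phi> 0 * K"
    using e by (simp add: tel \<psi>_def flip: sum_distrib_right)
  finally show ?thesis unfolding R_def K_def .
qed

text \<open>Subtracting the last value \<open>\<phi> (e - 1)\<close> makes the error proportional to
  the variation of \<phi> instead of its size; for the row weights below the size would cost a
  factor \<open>log Q\<close>. The constant part causes no error because the density
  \<open>n / e\<close> is replaced by the true proportion of residues \<open>f < n\<close> prime to
  \<open>e\<close>. That replacement is itself the case \<phi> = 1 and accounts for the second half
  of the \<open>80\<close>.\<close>

lemma inv_pairs_equidistributed:
  fixes \<phi> :: "nat \<Rightarrow> real"
  assumes e: "e > 0" and n: "n \<le> e"
    and anti: "\<And>u v. u \<le> v \<Longrightarrow> v < e \<Longrightarrow> \<phi> v \<le> \<phi> u"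
  shows "\<bar>(\<Sum>(f,u)\<in>inv_pairs e. if f < n then \<phi> u else 0) -
      real (card {f. f < n \<and> coprime f e}) / real (totient e) * (\<Sum>u | u < e \<and> coprime u e. \<phi> u)\<bar>
     \<le> (\<phi> 0 - \<phi> (e - 1)) * (80 * real (tau e) ^ 2 * harm e ^ 2 * real e powr (3/4))"
proof -
  define R where "R = inv_pairs e"
  define K where "K = 40 * real (tau e) ^ 2 * harm e ^ 2 * real e powr (3/4)"
  define c where "c = \<phi> (e - 1)"
  define \<psi> where "\<psi> = (\<lambda>u. \<phi> u - c)"
  define n0 where "n0 = real (card {f. f < n \<and> coprime f e})"
  define t where "t = real (totient e)"
  have t: "t > 0" using e by (simp add: t_def)
  have "(\<Sum>(f,u)\<in>R. if f < n then 1 else 0 :: real) = (\<Sum>f | f < e \<and> coprime f e. if f < n then 1 else 0)"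
    unfolding R_def by (rule sum_inv_pairs_fst)
  also have "\<dots> = n0"
    using n by (subst sum.inter_filter[symmetric]) (auto simp: n0_def intro!: arg_cong[where f = card])
  finally have n0: "(\<Sum>(f,u)\<in>R. if f < n then 1 else 0 :: real) = n0" .
  have cardR: "(\<Sum>(f,u)\<in>R. 1::real) = t" by (simp add: R_def t_def card_inv_pairs[OF e])
  have E1: "\<bar>n0 - real n / real e * t\<bar> \<le> K"
    using inv_pairs_antimono_sum[OF e n, of "\<lambda>_. 1"] n0 cardR by (simp add: R_def K_def)
  have psi: "0 \<le> \<psi> u" "\<psi> u \<le> \<psi> 0" if "u < e" for u
    using anti[of u "e - 1"] anti[of 0 u] that by (auto simp: \<psi>_def c_def)
  define S where "S = (\<Sum>(f,u)\<in>R. \<psi> u)"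
  have E2: "\<bar>(\<Sum>(f,u)\<in>R. if f < n then \<psi> u else 0) - real n / real e * S\<bar> \<le> \<psi> 0 * K"
    unfolding R_def K_def S_def
    by (rule inv_pairs_antimono_sum[OF e n]) (use anti psi in \<open>auto simp: \<psi>_def\<close>)
  have S: "0 \<le> S" "S \<le> t * \<psi> 0"
  proof -
    show "0 \<le> S" unfolding S_def by (intro sum_nonneg) (auto simp: R_def inv_pairs_def psi)
    have "S \<le> (\<Sum>(f,u)\<in>R. \<psi> 0)" unfolding S_def by (intro sum_mono) (auto simp: R_def inv_pairs_def psi)
    also have "\<dots> = t * \<psi> 0" using cardR by simp
    finally show "S \<le> t * \<psi> 0" .
  qed
  have "(\<Sum>(f,u)\<in>R. if f < n then \<phi> u else 0) = (\<Sum>(f,u)\<in>R. (if f < n then \<psi> u else 0) + c * (if f < n then 1 else 0))"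
    by (intro sum.cong refl) (auto simp: \<psi>_def)
  also have "\<dots> = (\<Sum>(f,u)\<in>R. if f < n then \<psi> u else 0) + c * n0"
    by (simp add: case_prod_unfold sum.distrib flip: sum_distrib_left n0)
  finally have 1: "(\<Sum>(f,u)\<in>R. if f < n then \<phi> u else 0) = (\<Sum>(f,u)\<in>R. if f < n then \<psi> u else 0) + c * n0" .
  have "(\<Sum>u | u < e \<and> coprime u e. \<phi> u) = (\<Sum>(f,u)\<in>R. \<phi> u)" by (simp add: R_def sum_inv_pairs_snd)
  also have "\<dots> = (\<Sum>(f,u)\<in>R. \<psi> u + c * 1)" by (intro sum.cong refl) (auto simp: \<psi>_def)
  also have "\<dots> = S + c * t" by (simp add: S_def case_prod_unfold sum.distrib flip: cardR)
  finally have 2: "(\<Sum>u | u < e \<and> coprime u e. \<phi> u) = S + c * t" .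
  have "(\<Sum>(f,u)\<in>R. if f < n then \<phi> u else 0) - n0 / t * (S + c * t) =
     ((\<Sum>(f,u)\<in>R. if f < n then \<psi> u else 0) - real n / real e * S) - (n0 - real n / real e * t) * (S / t)"
    unfolding 1 using t by (simp add: field_simps)
  also have "\<bar>\<dots>\<bar> \<le> \<psi> 0 * K + K * \<psi> 0"
  proof (rule order_trans[OF abs_triangle_ineq4], rule add_mono[OF E2])
    have "\<bar>(n0 - real n / real e * t) * (S / t)\<bar> = \<bar>n0 - real n / real e * t\<bar> * (S / t)"
      using S t by (simp add: abs_mult)
    also have "\<dots> \<le> K * \<psi> 0" using E1 S t by (intro mult_mono) (auto simp: field_simps)
    finally show "\<bar>(n0 - real n / real e * t) * (S / t)\<bar> \<le> K * \<psi> 0" .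
  qed
  finally show ?thesis unfolding 2 R_def n0_def t_def by (simp add: \<psi>_def c_def K_def algebra_simps)
qed

section \<open>Counting partial quotients\<close>

text \<open>The intervals \<open>(f/e, c/d)\<close> around \<open>a/q\<close>. The fraction
  \<open>a/q\<close> is not assumed reduced, so that the steps of the algorithm act directly on
  numerator and denominator.\<close>

definition brackets :: "int \<Rightarrow> int \<Rightarrow> (int \<times> int \<times> int \<times> int) set" where
  "brackets a q = {(c,d,e,f). 1 \<le> e \<and> e \<le> d \<and> 0 \<le> f \<and> c * e = f * d + 1 \<and> f * q < a * e \<and> a * d < c * q}"

text \<open>Base of the induction along expansions: the empty list has the value \<open>1\<close>,
  and none of the intervals contains \<open>1\<close>.\<close>

lemma brackets_one:
  assumes "q > 0"
  shows "brackets q q = {}"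
proof -
  have False if h: "1 \<le> e" "e \<le> d" "0 \<le> f" "c * e = f * d + 1" "f * q < q * e" "q * d < c * q" for c d e f
  proof -
    have "f < e" "d < c" using h(5,6) assms by (simp_all add: mult.commute)
    then have "(d + 1) * e \<le> c * e" using h by (intro mult_right_mono) auto
    moreover have "f * d \<le> (e - 1) * d" using \<open>f < e\<close> h by (intro mult_right_mono) auto
    ultimately show False using h by (simp add: algebra_simps)
  qed
  then show ?thesis by (auto simp: brackets_def)
qed

text \<open>The map \<open>z \<mapsto> z / (1 + z)\<close> sends the endpoints \<open>f/e\<close>
  and \<open>c/d\<close> to \<open>f/(e+f)\<close> and \<open>c/(c+d)\<close>, and only the interval
  \<open>(0, 1)\<close> does not arise in this way. The difficulty lies in recovering the order of
  the two old denominators; it is resolved by the new point being at most \<open>1/2\<close>, which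
  forces \<open>2 * f < E\<close>.\<close>

lemma brackets_add:
  assumes a: "0 < a" "a \<le> q"
  shows "brackets a (a + q) = insert (1,1,1,0) ((\<lambda>(c,d,e,f). (c,c+d,e+f,f)) ` brackets a q)"
proof (intro equalityI subsetI)
  fix x assume "x \<in> brackets a (a + q)"
  then obtain c D E f where x: "x = (c,D,E,f)" and h: "1 \<le> E" "E \<le> D" "0 \<le> f" "c * E = f * D + 1"
      "f * (a + q) < a * E" "a * D < c * (a + q)" by (auto simp: brackets_def)
  show "x \<in> insert (1,1,1,0) ((\<lambda>(c,d,e,f). (c,c+d,e+f,f)) ` brackets a q)"
  proof (cases "x = (1,1,1,0)")
    case False
    have "f * (2 * a) \<le> f * (a + q)" using h a by (intro mult_left_mono) auto
    then have "a * (2 * f) < a * E" using h(5) by (simp add: algebra_simps)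
    then have f: "2 * f < E" using a by simp
    have le: "E - f \<le> D - c"
    proof (cases "f = 0")
      case True
      then have "c * E = 1" using h by simp
      then have "c = 1 \<and> E = 1" using h(1) by (simp add: zmult_eq_1_iff)
      moreover have "D \<noteq> 1" using False calculation True by (simp add: x)
      ultimately show ?thesis using h True by simp
    next
      case f0: False
      show ?thesis
      proof (rule ccontr)
        assume "\<not> ?thesis"
        then have "D \<le> E + c - f - 1" by simp
        then have "D * E \<le> (E + c - f - 1) * E" using h by (intro mult_right_mono) auto
        then have "(D - E) * (E - f) \<le> 1 - E" using h(4) by (simp add: algebra_simps)
        moreover have "0 \<le> (D - E) * (E - f)" using h f by (intro mult_nonneg_nonneg) auto
        ultimately show False using f f0 h by linarith
      qed
    qed
    have "(c, D - c, E - f, f) \<in> brackets a q"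
      using h f le by (auto simp: brackets_def algebra_simps)
    then have "(c, c + (D - c), (E - f) + f, f) \<in> (\<lambda>(c,d,e,f). (c,c+d,e+f,f)) ` brackets a q"
      by (force simp: image_iff)
    then show ?thesis by (simp add: x)
  qed simp
next
  fix x assume x: "x \<in> insert (1,1,1,0) ((\<lambda>(c,d,e,f). (c,c+d,e+f,f)) ` brackets a q)"
  show "x \<in> brackets a (a + q)"
  proof (cases "x = (1,1,1,0)")
    case True then show ?thesis using a by (simp add: brackets_def)
  next
    case False
    with x obtain c d e f where x: "x = (c,c+d,e+f,f)" and h: "1 \<le> e" "e \<le> d" "0 \<le> f" "c * e = f * d + 1"
      "f * q < a * e" "a * d < c * q" by (auto simp: brackets_def)
    have "f * e \<le> f * d" using h by (intro mult_left_mono) auto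
    then have "f * e < c * e" using h by linarith
    then have "f < c" by (rule mult_right_less_imp_less) (use h in auto)
    then show ?thesis using h by (simp add: x brackets_def algebra_simps)
  qed
qed

text \<open>The maps \<open>z \<mapsto> z / (1 + z)\<close> of \<open>brackets_add\<close>, which prepends the partial quotient 2, and
  \<open>z \<mapsto> 1 / (2 - z)\<close>, which increases the first one by 1, generate all expansions.\<close>

lemma brackets_reflect:
  assumes a: "0 < a" "a < q"
  shows "brackets q (2 * q - a) =
    insert (1,1,1,0) ((\<lambda>(c,d,e,f). (d,2*d-c,2*e-f,e)) ` (brackets a q - {(1,1,1,0)}))"
proof (intro equalityI subsetI)
  fix x assume "x \<in> brackets q (2 * q - a)"
  then obtain C D E F where x: "x = (C,D,E,F)" and h: "1 \<le> E" "E \<le> D" "0 \<le> F" "C * E = F * D + 1"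
      "F * (2 * q - a) < q * E" "q * D < C * (2 * q - a)" by (auto simp: brackets_def)
  show "x \<in> insert (1,1,1,0) ((\<lambda>(c,d,e,f). (d,2*d-c,2*e-f,e)) ` (brackets a q - {(1,1,1,0)}))"
  proof (cases "x = (1,1,1,0)")
    case False
    have "0 < C * E" using h by (metis add_nonneg_pos mult_nonneg_nonneg order_trans zero_less_one zero_le_one)
    then have C: "C > 0" by (rule zero_less_mult_pos2) (use h in auto)
    have "C * (2 * q - a) < C * (2 * q)" using C a by simp
    then have "q * D < q * (2 * C)" using h(6) by (simp add: algebra_simps)
    then have D: "D < 2 * C" using a by simp
    \<comment> \<open>The preimage of \<open>F/E\<close> under
      \<open>z \<mapsto> 1 / (2 - z)\<close> is \<open>(2 F - E) / F\<close>; its numerator can be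
      negative only for the interval \<open>(0, 1)\<close>.\<close>
    have E: "E \<le> 2 * F"
    proof (rule ccontr)
      assume "\<not> E \<le> 2 * F"
      then have e1: "1 \<le> E - 2 * F" by simp
      have "F * D \<le> F * (2 * C - 1)" using D h by (intro mult_left_mono) auto
      then have "C * (E - 2 * F) \<le> 1 - F" using h(4) by (simp add: algebra_simps)
      moreover have "C * 1 \<le> C * (E - 2 * F)" using e1 C by (intro mult_left_mono) auto
      ultimately have "C = 1" "F = 0" using C h by linarith+
      with h D have "E = 1" "D = 1" by auto
      with \<open>C = 1\<close> \<open>F = 0\<close> False show False by (simp add: x)
    qed
    have F: "F \<ge> 1" using E h by simp
    have "C * E \<le> C * D" using h C by (intro mult_left_mono) auto
    then have "F * D < C * D" using h by linarith
    then have "F < C" by (rule mult_right_less_imp_less) (use h in auto)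
    have "(2 * C - D, C, F, 2 * F - E) \<in> brackets a q"
      using h E F \<open>F < C\<close> by (auto simp: brackets_def algebra_simps)
    moreover have "(2 * C - D, C, F, 2 * F - E) \<noteq> (1,1,1,0)" using \<open>F < C\<close> by auto
    ultimately have "(C, 2 * C - (2 * C - D), 2 * F - (2 * F - E), F) \<in>
        (\<lambda>(c,d,e,f). (d,2*d-c,2*e-f,e)) ` (brackets a q - {(1,1,1,0)})"
      by (intro image_eqI[of _ _ "(2 * C - D, C, F, 2 * F - E)"]) auto
    then show ?thesis by (simp add: x)
  qed simp
next
  fix x assume x: "x \<in> insert (1,1,1,0) ((\<lambda>(c,d,e,f). (d,2*d-c,2*e-f,e)) ` (brackets a q - {(1,1,1,0)}))"
  show "x \<in> brackets q (2 * q - a)"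
  proof (cases "x = (1,1,1,0)")
    case True then show ?thesis using a by (simp add: brackets_def)
  next
    case False
    with x obtain c d e f where x: "x = (d,2*d-c,2*e-f,e)" and h: "1 \<le> e" "e \<le> d" "0 \<le> f" "c * e = f * d + 1"
      "f * q < a * e" "a * d < c * q" and ne: "(c,d,e,f) \<noteq> (1,1,1,0)" by (auto simp: brackets_def)
    have "a * e < q * e" using a h by simp
    then have "f * q < q * e" using h by linarith
    then have "f * q < e * q" by (metis mult.commute)
    then have fe: "f < e" using a by simp
    have "e \<noteq> d"
    proof
      assume "e = d"
      then have "(c - f) * d = 1" using h by (simp add: algebra_simps)
      then have "d = 1" "c - f = 1" using h by (auto simp: zmult_eq_1_iff)
      then show False using ne fe h \<open>e = d\<close> by auto
    qed
    then have "e < d" using h by simp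
    have "2 * e - f \<le> 2 * d - c"
    proof (rule ccontr)
      assume "\<not> ?thesis"
      then have "2 * d - c \<le> 2 * e - f - 1" by simp
      then have "(2 * d - c) * e \<le> (2 * e - f - 1) * e" using h by (intro mult_right_mono) auto
      then have "(2 * e - f) * (d - e) \<le> 1 - e" using h(4) by (simp add: algebra_simps)
      moreover have "(2 * e - f) * 1 \<le> (2 * e - f) * (d - e)" using \<open>e < d\<close> fe h by (intro mult_left_mono) auto
      ultimately have "(2 * e - f) * 1 \<le> 1 - e" by (rule order_trans[rotated])
      then show False using fe h(1) by simp
    qed
    then show ?thesis using h fe by (simp add: x brackets_def algebra_simps)
  qed
qed

text \<open>With \<open>x' = 1 - minus_cf bs\<close> and \<open>n = b - 2\<close>, the value of
  \<open>b # bs\<close> is \<open>1 - 1 / (n + 1 + x')\<close>. For \<open>n = 0\<close> this is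
  \<open>x' / (1 + x')\<close>, and \<open>brackets_add\<close> adds one interval. Raising
  \<open>n\<close> by one applies \<open>z \<mapsto> 1 / (2 - z)\<close>, and
  \<open>brackets_reflect\<close> keeps the number of intervals: \<open>(0, 1)\<close> is removed
  before and inserted after the map.\<close>

lemma card_brackets_eq_length:
  assumes "\<forall>b\<in>set bs. 2 \<le> b" "q > 0" "of_int a / of_int q = 1 - minus_cf bs"
  shows "finite (brackets a q) \<and> card (brackets a q) = length bs"
  using assms
proof (induction bs arbitrary: a q)
  case Nil
  then have "a = q" by (simp add: field_simps)
  then show ?case using Nil by (simp add: brackets_one)
next
  case (Cons b bs)
  define x' where "x' = 1 - minus_cf bs"
  have x': "0 < x'" "x' \<le> 1" using minus_cf_bounds[of bs] Cons.prems by (auto simp: x'_def)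
  have key: "finite (brackets a q) \<and> card (brackets a q) = Suc (length bs)"
    if "q > 0" "of_int a / of_int q = 1 - 1 / (of_nat n + 1 + x')" for n :: nat and a q :: int
    using that
  proof (induction n arbitrary: a q)
    case 0
    have aq: "of_int a * (1 + x') = of_int q * x'" using 0 x' by (simp add: field_simps)
    have q0: "(of_int q :: rat) > 0" using 0 by simp
    have "of_int q * x' > 0" using q0 x' by simp
    then have "(of_int a :: rat) > 0" using aq x' by (metis add_pos_pos zero_less_mult_pos2 zero_less_one)
    then have a0: "a > 0" by simp
    have "of_int a + of_int a * x' = of_int q * x'" using aq by (simp add: algebra_simps)
    then have eq: "of_int a = (of_int (q - a) :: rat) * x'" by (simp add: algebra_simps)
    then have "(of_int (q - a) :: rat) > 0" using \<open>(of_int a :: rat) > 0\<close> x' by (metis zero_less_mult_pos2)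
    then have qa: "q - a > 0" by (simp only: of_int_0_less_iff)
    have "(of_int (q - a) :: rat) * x' \<le> of_int (q - a) * 1" using \<open>(of_int (q - a) :: rat) > 0\<close> x' by (intro mult_left_mono) auto
    then have "(of_int a :: rat) \<le> of_int (q - a)" unfolding eq[symmetric] mult_1_right .
    then have le: "a \<le> q - a" by (simp only: of_int_le_iff)
    have "of_int a / of_int (q - a) = 1 - minus_cf bs"
      unfolding x'_def[symmetric] using \<open>(of_int (q - a) :: rat) > 0\<close>
      by (metis eq nonzero_mult_div_cancel_left less_irrefl)
    then have IH: "finite (brackets a (q - a)) \<and> card (brackets a (q - a)) = length bs"
      using Cons.IH[of "q - a" a] Cons.prems qa by simp
    have eqb: "brackets a q = insert (1,1,1,0) ((\<lambda>(c,d,e,f). (c,c+d,e+f,f)) ` brackets a (q - a))"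
      using brackets_add[OF a0 le] by simp
    have "inj_on (\<lambda>(c,d,e,f). (c,c+d,e+f,f)) (brackets a (q - a))" by (auto simp: inj_on_def)
    moreover have "(1,1,1,0) \<notin> (\<lambda>(c,d,e,f). (c,c+d,e+f,f)) ` brackets a (q - a)" by (auto simp: brackets_def)
    ultimately show ?case using IH unfolding eqb by (simp add: card_image)
  next
    case (Suc n)
    define z where "z = 1 - 1 / (of_nat n + 1 + x')"
    have z: "0 < z" "z < 1" using x' by (simp_all add: z_def add_pos_nonneg)
    have q0: "(of_int q :: rat) > 0" using Suc by simp
    have "of_int a / of_int q = 1 / (2 - z)"
      unfolding Suc.prems z_def using x' by (simp add: field_simps add_pos_nonneg add_nonneg_eq_0_iff)
    then have aq: "of_int a * (2 - z) = of_int q" using z q0 by (simp add: field_simps)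
    then have "(of_int a :: rat) > 0" using q0 z by (metis diff_gt_0_iff_gt less_trans one_less_numeral_iff semiring_norm(76) zero_less_mult_pos2)
    then have a0: "a > 0" by simp
    have za: "of_int (2 * a - q) = of_int a * z" using aq by (simp add: algebra_simps)
    have zeq: "of_int (2 * a - q) / of_int a = z" unfolding za using \<open>(of_int a :: rat) > 0\<close> by simp
    have "(0::rat) < of_int (2 * a - q)" unfolding za using z \<open>(of_int a :: rat) > 0\<close> by simp
    then have p: "0 < 2 * a - q" by (simp only: of_int_0_less_iff)
    have "of_int a * z < of_int a * 1" using z \<open>(of_int a :: rat) > 0\<close> by (intro mult_strict_left_mono) auto
    then have "(of_int (2 * a - q) :: rat) < of_int a" unfolding za by simp
    then have lt: "2 * a - q < a" by (simp only: of_int_less_iff)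
    have IH: "finite (brackets (2 * a - q) a) \<and> card (brackets (2 * a - q) a) = Suc (length bs)"
      using Suc.IH[of a "2 * a - q"] a0 zeq by (simp add: z_def)
    let ?g = "\<lambda>(c,d,e,f). (d,2*d-c,2*e-f,e::int)"
    let ?B = "brackets (2 * a - q) a - {(1,1,1,0)}"
    have eqb: "brackets a q = insert (1,1,1,0) (?g ` ?B)"
      using brackets_reflect[OF p lt] by simp
    have "inj_on ?g ?B" by (auto simp: inj_on_def)
    moreover have "(1,1,1,0) \<notin> ?g ` ?B" by (auto simp: brackets_def)
    moreover have "(1,1,1,0) \<in> brackets (2 * a - q) a" using p lt by (simp add: brackets_def)
    ultimately show ?case using IH unfolding eqb by (simp add: card_image)
  qed
  have "b \<ge> 2" using Cons.prems by simp
  then have "of_nat (nat (b - 2)) + 1 + x' = of_int b - minus_cf bs"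
    by (simp add: x'_def)
  then show ?case using key[of q a "nat (b - 2)"] Cons.prems by simp
qed

text \<open>The convention at \<open>0\<close> agrees with the count, as no interval with
  \<open>f \<ge> 0\<close> contains \<open>0\<close>. At \<open>1\<close> it does not: the count is
  \<open>0\<close> by \<open>brackets_one\<close>, whence the strict bound.\<close>

lemma minus_cf_length_eq_card_brackets:
  assumes "0 \<le> x" "x < 1" "x = of_int a / of_int q" "q > 0"
  shows "finite (brackets a q)" "minus_cf_length x = card (brackets a q)"
proof -
  have "finite (brackets a q) \<and> minus_cf_length x = card (brackets a q)"
  proof (cases "x = 0")
    case True
    then have "a = 0" using assms by simp
    then have "brackets a q = {}" using assms by (auto simp: brackets_def mult_less_0_iff)
    then show ?thesis by (simp add: minus_cf_length_def True)
  next
    case False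
    then obtain bs where bs: "is_minus_expansion x bs" "\<And>cs. is_minus_expansion x cs \<Longrightarrow> cs = bs"
      using minus_expansion_ex1[of x] assms by (metis order_le_less)
    then have "(THE bs. is_minus_expansion x bs) = bs" by blast
    then have "minus_cf_length x = length bs" using False assms by (simp add: minus_cf_length_def)
    moreover have "finite (brackets a q) \<and> card (brackets a q) = length bs"
      by (rule card_brackets_eq_length) (use bs assms in \<open>auto simp: is_minus_expansion_def\<close>)
    ultimately show ?thesis by simp
  qed
  then show "finite (brackets a q)" "minus_cf_length x = card (brackets a q)" by auto
qed

text \<open>The numerator \<open>c\<close> is determined by the other entries and is dropped, which
  leaves the congruence between \<open>f\<close> and \<open>d\<close> modulo \<open>e\<close> as the
  condition on them.\<close>

definition brackets_nat :: "nat \<Rightarrow> nat \<Rightarrow> (nat \<times> nat \<times> nat) set" where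
  "brackets_nat a q = {(d,e,f). 1 \<le> e \<and> e \<le> d \<and> e dvd f * d + 1 \<and> f * q < a * e \<and> a * d < (f * d + 1) div e * q}"

lemma card_brackets_nat:
  "card (brackets_nat a q) = card (brackets (int a) (int q))" "finite (brackets (int a) (int q)) \<Longrightarrow> finite (brackets_nat a q)"
proof -
  have bij: "bij_betw (\<lambda>(d,e,f). (int ((f * d + 1) div e), int d, int e, int f)) (brackets_nat a q) (brackets (int a) (int q))"
  proof (rule bij_betwI'[rule_format])
    fix x y assume "x \<in> brackets_nat a q" "y \<in> brackets_nat a q"
    show "((\<lambda>(d,e,f). (int ((f * d + 1) div e), int d, int e, int f)) x = (\<lambda>(d,e,f). (int ((f * d + 1) div e), int d, int e, int f)) y) = (x = y)"
      by (auto simp: case_prod_unfold prod_eq_iff)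
  next
    fix x assume "x \<in> brackets_nat a q"
    then obtain d e f where x: "x = (d,e,f)" and h: "1 \<le> e" "e \<le> d" "e dvd f * d + 1" "f * q < a * e" "a * d < (f * d + 1) div e * q"
      by (auto simp: brackets_nat_def)
    have "(f * d + 1) div e * e = f * d + 1" using h by simp
    then have "int ((f * d + 1) div e) * int e = int f * int d + 1"
      by (metis of_nat_1 of_nat_add of_nat_mult)
    moreover have "int f * int q < int a * int e" "int a * int d < int ((f * d + 1) div e) * int q"
      using h by (simp_all only: of_nat_mult[symmetric] of_nat_less_iff)
    ultimately show "(\<lambda>(d,e,f). (int ((f * d + 1) div e), int d, int e, int f)) x \<in> brackets (int a) (int q)"
      using h unfolding x brackets_def by simp
  next
    fix y assume "y \<in> brackets (int a) (int q)"
    then obtain c d e f where y: "y = (c,d,e,f)" and h: "1 \<le> e" "e \<le> d" "0 \<le> f" "c * e = f * d + 1"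
      "f * int q < int a * e" "int a * d < c * int q" by (auto simp: brackets_def)
    have "0 < c * e" using h by (metis add_nonneg_pos mult_nonneg_nonneg order_trans zero_less_one zero_le_one)
    then have c: "c > 0" by (rule zero_less_mult_pos2) (use h in auto)
    obtain c' d' e' f' where n: "c = int c'" "d = int d'" "e = int e'" "f = int f'"
      using h c by (metis nonneg_int_cases order_less_imp_le order_trans zero_le_one)
    have ce: "c' * e' = f' * d' + 1"
    proof -
      have "int (c' * e') = int (f' * d' + 1)" using h(4) by (simp add: n)
      then show ?thesis by (simp only: of_nat_eq_iff)
    qed
    have e': "e' > 0" using h n by simp
    have c': "(f' * d' + 1) div e' = c'" unfolding ce[symmetric] using e' by simp
    have "f' * q < a * e'" "a * d' < c' * q" using h(5,6) unfolding n by (simp_all only: of_nat_mult[symmetric] of_nat_less_iff)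
    moreover have "e' dvd f' * d' + 1" unfolding ce[symmetric] by simp
    ultimately have "(d',e',f') \<in> brackets_nat a q" using h c' by (simp add: brackets_nat_def n)
    then show "\<exists>x\<in>brackets_nat a q. y = (\<lambda>(d,e,f). (int ((f * d + 1) div e), int d, int e, int f)) x"
      using c' by (intro bexI[of _ "(d',e',f')"]) (auto simp: y n)
  qed
  show "card (brackets_nat a q) = card (brackets (int a) (int q))" by (rule bij_betw_same_card[OF bij])
  show "finite (brackets (int a) (int q)) \<Longrightarrow> finite (brackets_nat a q)" using bij_betw_finite[OF bij] by simp
qed

section \<open>Reduced fractions and quintuples\<close>

lemma of_rat_denom:
  assumes "0 \<le> x"
  obtains a where "x = of_nat a / of_nat (denom x)" "coprime a (denom x)" "denom x > 0"
proof -
  obtain p q where pq: "quotient_of x = (p,q)" by (cases "quotient_of x")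
  have q: "q > 0" using quotient_of_denom_pos[OF pq] .
  have x: "x = of_int p / of_int q" using quotient_of_div[OF pq] .
  have "p \<ge> 0" using assms q unfolding x by (simp add: zero_le_divide_iff)
  have cop: "coprime p q" using quotient_of_coprime[OF pq] .
  have d: "denom x = nat q" by (simp add: denom_def pq)
  show ?thesis
  proof (rule that[of "nat p"])
    have "x = of_nat (nat p) / of_nat (nat q)" using q \<open>p \<ge> 0\<close> x by simp
    then show "x = of_nat (nat p) / of_nat (denom x)" unfolding d .
    show "coprime (nat p) (denom x)" using cop q \<open>p \<ge> 0\<close> unfolding d by (simp flip: coprime_int_iff)
    show "denom x > 0" using q by (simp add: d)
  qed
qed

lemma denom_eqI:
  assumes "q > 0" "coprime a q"
  shows "denom (of_nat a / of_nat q) = q"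
proof -
  have "of_nat a / of_nat q = Fract (int a) (int q)" by (simp add: Fract_of_int_quotient)
  then have "quotient_of (of_nat a / of_nat q) = (int a, int q)"
    using assms by (simp add: quotient_of_Fract normalize_stable)
  then show ?thesis by (simp add: denom_def)
qed

definition low_pairs :: "rat \<Rightarrow> nat \<Rightarrow> (nat \<times> nat) set" where
  "low_pairs \<alpha> Q = {(a,q). 1 \<le> q \<and> q \<le> Q \<and> coprime a q \<and> (of_nat a :: rat) < \<alpha> * of_nat q}"

lemma bij_betw_low_pairs:
  assumes "\<alpha> \<le> 1"
  shows "bij_betw (\<lambda>(a,q). of_nat a / of_nat q) (low_pairs \<alpha> Q) (farey_low \<alpha> Q)"
proof (rule bij_betwI')
  fix x y assume xy: "x \<in> low_pairs \<alpha> Q" "y \<in> low_pairs \<alpha> Q"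
  obtain a q b r where x: "x = (a,q)" and y: "y = (b,r)" by (metis surj_pair)
  have h: "q > 0" "coprime a q" "r > 0" "coprime b r" using xy by (auto simp: low_pairs_def x y)
  have "(a,q) = (b,r)" if eq: "(of_nat a / of_nat q :: rat) = of_nat b / of_nat r"
  proof -
    have "q = r" using denom_eqI[OF h(1,2)] denom_eqI[OF h(3,4)] eq by simp
    then show ?thesis using eq h by simp
  qed
  then show "((\<lambda>(a,q). of_nat a / of_nat q :: rat) x = (\<lambda>(a,q). of_nat a / of_nat q) y) = (x = y)"
    by (auto simp: x y)
next
  fix x assume "x \<in> low_pairs \<alpha> Q"
  then obtain a q where x: "x = (a,q)" and h: "1 \<le> q" "q \<le> Q" "(of_nat a :: rat) < \<alpha> * of_nat q"
    by (auto simp: low_pairs_def)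
  have lt: "(of_nat a / of_nat q :: rat) < \<alpha>" using h by (simp add: divide_less_eq)
  then have "(of_nat a / of_nat q :: rat) \<le> 1" using assms by linarith
  then have "of_nat a / of_nat q \<in> farey_low \<alpha> Q"
    using h lt unfolding farey_low_def farey_def by auto
  then show "(\<lambda>(a,q). of_nat a / of_nat q) x \<in> farey_low \<alpha> Q" by (simp add: x)
next
  fix y assume y: "y \<in> farey_low \<alpha> Q"
  then obtain b c where bc: "y = of_nat b / of_nat c" "1 \<le> c" "c \<le> Q" "0 \<le> y" "y < \<alpha>"
    by (auto simp: farey_low_def farey_def)
  obtain a where a: "y = of_nat a / of_nat (denom y)" "coprime a (denom y)" "denom y > 0"
    using of_rat_denom[OF \<open>0 \<le> y\<close>] .
  have "(of_nat a * of_nat c :: rat) = of_nat b * of_nat (denom y)"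
    using a(1,3) bc(1,2) by (simp add: frac_eq_eq)
  then have "a * c = b * denom y" by (simp only: of_nat_mult[symmetric] of_nat_eq_iff)
  then have "denom y dvd a * c" by simp
  then have "denom y dvd c" using a(2) by (simp add: coprime_dvd_mult_right_iff coprime_commute)
  then have "denom y \<le> Q" using bc dvd_imp_le[of "denom y" c] by simp
  moreover have "(of_nat a :: rat) < \<alpha> * of_nat (denom y)"
    using bc(5) a(1,3) by (metis of_nat_0_less_iff pos_divide_less_eq)
  ultimately have "(a, denom y) \<in> low_pairs \<alpha> Q" using a by (simp add: low_pairs_def)
  then show "\<exists>x\<in>low_pairs \<alpha> Q. y = (\<lambda>(a,q). of_nat a / of_nat q) x"
    using a(1) by (intro bexI[of _ "(a, denom y)"]) simp_all
qed

text \<open>An interval together with the coordinates \<open>(t, s)\<close> of a point inside it;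
  \<open>t * d + s * e\<close> is the denominator of that point. A bound on \<open>f\<close> comes
  only with \<alpha>.\<close>

definition cells :: "nat \<Rightarrow> (nat \<times> nat \<times> nat \<times> nat \<times> nat) set" where
  "cells Q = {(d,e,f,t,s). 1 \<le> e \<and> e \<le> d \<and> e dvd f * d + 1 \<and> 1 \<le> t \<and> 1 \<le> s \<and> coprime t s \<and> t * d + s * e \<le> Q}"

definition inner_cells :: "rat \<Rightarrow> nat \<Rightarrow> (nat \<times> nat \<times> nat \<times> nat \<times> nat) set" where
  "inner_cells \<alpha> Q = {(d,e,f,t,s)\<in>cells Q. of_nat (t * ((f * d + 1) div e) + s * f) < \<alpha> * of_nat (t * d + s * e)}"

text \<open>The condition on \<alpha> concerns the lower endpoint alone, so that it separates from
  \<open>d\<close>, \<open>t\<close> and \<open>s\<close>.\<close>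

definition outer_cells :: "rat \<Rightarrow> nat \<Rightarrow> (nat \<times> nat \<times> nat \<times> nat \<times> nat) set" where
  "outer_cells \<alpha> Q = {(d,e,f,t,s)\<in>cells Q. of_nat f < \<alpha> * of_nat e}"

text \<open>The substitution has determinant \<open>c e - f d = 1\<close> and is inverted by
  \<open>t = a e - f q\<close>, \<open>s = c q - a d\<close>, so both pairs have the same common
  divisors.\<close>

lemma coprime_unimodular:
  fixes t s a q c d e f :: int
  assumes "a = t * c + s * f" "q = t * d + s * e" "c * e = f * d + 1"
  shows "coprime a q \<longleftrightarrow> coprime t s"
proof -
  have "a * e - f * q = t * (c * e - f * d)" "c * q - a * d = s * (c * e - f * d)"
    by (simp_all add: assms(1,2) algebra_simps)
  then have t: "t = a * e - f * q" and s: "s = c * q - a * d" by (simp_all add: assms(3))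
  have "gcd a q dvd gcd t s" unfolding t s by (simp add: dvd_diff)
  moreover have "gcd t s dvd gcd a q" unfolding assms(1,2) by simp
  ultimately have "gcd a q = gcd t s" by (simp add: zdvd_antisym_nonneg)
  then show ?thesis by (simp only: coprime_iff_gcd_eq_1)
qed

text \<open>The new coordinates are those of the inverse substitution. The subtractions of natural
  numbers are genuine and their values positive because \<open>a/q\<close> lies strictly between
  \<open>f/e\<close> and \<open>c/d\<close>.\<close>

lemma bij_betw_inner_cells:
  "bij_betw (\<lambda>((a,q),(d,e,f)). (d, e, f, a * e - f * q, (f * d + 1) div e * q - a * d))
     (SIGMA p:low_pairs \<alpha> Q. brackets_nat (fst p) (snd p)) (inner_cells \<alpha> Q)"
proof (rule bij_betw_byWitness[where f' = "\<lambda>(d,e,f,t,s). ((t * ((f * d + 1) div e) + s * f, t * d + s * e), (d,e,f))"])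
  let ?A = "SIGMA p:low_pairs \<alpha> Q. brackets_nat (fst p) (snd p)"
  let ?g = "\<lambda>((a,q),(d,e,f)). (d, e, f, a * e - f * q, (f * d + 1) div e * q - a * d)"
  let ?h = "\<lambda>(d,e,f,t,s). ((t * ((f * d + 1) div e) + s * f, t * d + s * e), (d,e,f))"
  have 1: "?h (?g x) = x \<and> ?g x \<in> inner_cells \<alpha> Q" if "x \<in> ?A" for x
  proof -
    obtain a q d e f where x: "x = ((a,q),(d,e,f))" by (metis surj_pair)
    have h: "1 \<le> e" "e \<le> d" "e dvd f * d + 1" "f * q < a * e" "a * d < (f * d + 1) div e * q"
      and L: "1 \<le> q" "q \<le> Q" "coprime a q" "(of_nat a :: rat) < \<alpha> * of_nat q"
      using that by (auto simp: x brackets_nat_def low_pairs_def)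
    define c where "c = (f * d + 1) div e"
    have ce: "c * e = f * d + 1" using h by (simp add: c_def)
    define t s where "t = a * e - f * q" and "s = c * q - a * d"
    have ti: "int t = int a * int e - int f * int q" and si: "int s = int c * int q - int a * int d"
      using h by (simp_all add: t_def s_def of_nat_diff c_def)
    have cei: "int c * int e = int f * int d + 1" using ce by (metis of_nat_1 of_nat_add of_nat_mult)
    have "int (t * c + s * f) = int a * (int c * int e) - int a * (int f * int d)"
      by (simp add: ti si algebra_simps)
    also have "\<dots> = int a" unfolding cei by (simp add: algebra_simps)
    finally have a: "t * c + s * f = a" by (simp only: of_nat_eq_iff)
    have "int (t * d + s * e) = int q * (int c * int e) - int q * (int f * int d)"
      by (simp add: ti si algebra_simps)
    also have "\<dots> = int q" unfolding cei by (simp add: algebra_simps)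
    finally have q: "t * d + s * e = q" by (simp only: of_nat_eq_iff)
    have "coprime (int a) (int q) \<longleftrightarrow> coprime (int t) (int s)"
      by (rule coprime_unimodular[OF _ _ cei]) (simp_all flip: a q)
    then have cop: "coprime t s" using L by simp
    have ts: "1 \<le> t" "1 \<le> s" using h by (simp_all add: t_def s_def c_def Suc_le_eq)
    have gx: "?g x = (d,e,f,t,s)" by (simp add: x t_def s_def c_def)
    have hc: "Suc (f * d) div e = c" by (simp add: c_def)
    have lt: "(of_nat (t * c + s * f) :: rat) < \<alpha> * of_nat (t * d + s * e)"
      unfolding a q by (rule L)
    have tdQ: "t * d + s * e \<le> Q" unfolding q by (rule L)
    have "?h (?g x) = x" unfolding gx by (simp add: x a q hc)
    moreover have "?g x \<in> inner_cells \<alpha> Q"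
      unfolding gx inner_cells_def cells_def using h L ts cop lt tdQ by (simp add: hc)
    ultimately show ?thesis by simp
  qed
  have 2: "?g (?h x) = x \<and> ?h x \<in> ?A" if "x \<in> inner_cells \<alpha> Q" for x
  proof -
    obtain d e f t s where x: "x = (d,e,f,t,s)" by (metis surj_pair)
    define c where "c = (f * d + 1) div e"
    define a q where "a = t * c + s * f" and "q = t * d + s * e"
    have h: "1 \<le> e" "e \<le> d" "e dvd f * d + 1" "1 \<le> t" "1 \<le> s" "coprime t s" "q \<le> Q"
       "(of_nat a :: rat) < \<alpha> * of_nat q"
      using that by (auto simp: x inner_cells_def cells_def a_def q_def c_def)
    have ce: "c * e = f * d + 1" using h by (simp add: c_def)
    have cei: "int c * int e = int f * int d + 1" using ce by (metis of_nat_1 of_nat_add of_nat_mult)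
    have "a * e = t * (c * e) + s * f * e" by (simp add: a_def algebra_simps)
    also have "\<dots> = f * q + t" unfolding ce by (simp add: q_def algebra_simps)
    finally have ae: "a * e = f * q + t" .
    have "c * q = t * c * d + s * (c * e)" by (simp add: q_def algebra_simps)
    also have "\<dots> = a * d + s" unfolding ce by (simp add: a_def algebra_simps)
    finally have cq: "c * q = a * d + s" .
    have "coprime (int a) (int q) \<longleftrightarrow> coprime (int t) (int s)"
      by (rule coprime_unimodular[OF _ _ cei]) (simp_all add: a_def q_def)
    then have cop: "coprime a q" using h by simp
    have "0 < t * d" using h by simp
    then have q1: "1 \<le> q" unfolding q_def by linarith
    have hx: "?h x = ((a,q),(d,e,f))" by (simp add: x a_def q_def c_def)
    have hc: "Suc (f * d) div e = c" by (simp add: c_def)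
    have "?g (?h x) = x" unfolding hx by (simp add: x ae cq hc)
    moreover have "?h x \<in> ?A"
      unfolding hx using h cop q1 ae cq by (simp add: low_pairs_def brackets_nat_def hc)
    ultimately show ?thesis by simp
  qed
  show "\<forall>a\<in>?A. ?h (?g a) = a" using 1 by blast
  show "\<forall>a'\<in>inner_cells \<alpha> Q. ?g (?h a') = a'" using 2 by blast
  show "?g ` ?A \<subseteq> inner_cells \<alpha> Q" using 1 by blast
  show "?h ` inner_cells \<alpha> Q \<subseteq> ?A" using 2 by blast
qed

lemma sum_minus_cf_length_eq_card:
  assumes "\<alpha> \<le> 1"
  shows "(\<Sum>x\<in>farey_low \<alpha> Q. minus_cf_length x) = card (inner_cells \<alpha> Q)"
proof -
  have len: "finite (brackets_nat a q) \<and> minus_cf_length (of_nat a / of_nat q) = card (brackets_nat a q)"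
    if "(a,q) \<in> low_pairs \<alpha> Q" for a q
  proof -
    have h: "1 \<le> q" "(of_nat a :: rat) < \<alpha> * of_nat q" using that by (auto simp: low_pairs_def)
    have "\<alpha> * of_nat q \<le> 1 * of_nat q" using assms by (intro mult_right_mono) auto
    then have "(of_nat a :: rat) < of_nat q" using h by linarith
    then have "(of_nat a / of_nat q :: rat) < 1" by simp
    then have "finite (brackets (int a) (int q)) \<and>
        minus_cf_length (of_nat a / of_nat q) = card (brackets (int a) (int q))"
      using h(1) by (intro conjI minus_cf_length_eq_card_brackets) auto
    then show ?thesis by (simp only: card_brackets_nat)
  qed
  have fin: "finite (low_pairs \<alpha> Q)"
  proof (rule finite_subset[of _ "{..Q} \<times> {..Q}"])
    show "low_pairs \<alpha> Q \<subseteq> {..Q} \<times> {..Q}"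
    proof clarify
      fix a q assume "(a,q) \<in> low_pairs \<alpha> Q"
      then have h: "q \<le> Q" "(of_nat a :: rat) < \<alpha> * of_nat q" by (auto simp: low_pairs_def)
      have "\<alpha> * of_nat q \<le> 1 * of_nat q" using assms by (intro mult_right_mono) auto
      then have "(of_nat a :: rat) < of_nat q" using h by linarith
      then show "a \<in> {..Q} \<and> q \<in> {..Q}" using h by simp
    qed
  qed simp
  have "(\<Sum>x\<in>farey_low \<alpha> Q. minus_cf_length x) = (\<Sum>p\<in>low_pairs \<alpha> Q. minus_cf_length (case p of (a,q) \<Rightarrow> of_nat a / of_nat q))"
    by (rule sum.reindex_bij_betw[OF bij_betw_low_pairs[OF assms], symmetric])
  also have "\<dots> = (\<Sum>p\<in>low_pairs \<alpha> Q. card (brackets_nat (fst p) (snd p)))"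
    by (intro sum.cong refl) (auto simp: len)
  also have "\<dots> = card (SIGMA p:low_pairs \<alpha> Q. brackets_nat (fst p) (snd p))"
    by (rule card_SigmaI[symmetric]) (use fin len in auto)
  also have "\<dots> = card (inner_cells \<alpha> Q)" by (rule bij_betw_same_card[OF bij_betw_inner_cells])
  finally show ?thesis .
qed

section \<open>Passing from points to intervals\<close>

text \<open>The number of cells over one interval. It depends on \<open>d\<close> and
  \<open>e\<close> but not on \<open>f\<close>, which is what permits averaging over
  \<open>f\<close>.\<close>

definition coprime_cone :: "nat \<Rightarrow> nat \<Rightarrow> nat \<Rightarrow> nat" where
  "coprime_cone Q d e = card {(t,s). 1 \<le> t \<and> 1 \<le> s \<and> coprime t s \<and> t * d + s * e \<le> Q}"

lemma finite_cone:
  fixes d e Q :: nat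
  assumes "d \<ge> 1" "e \<ge> 1"
  shows "finite {(t,s). 1 \<le> t \<and> 1 \<le> s \<and> coprime t s \<and> t * d + s * e \<le> Q}"
proof (rule finite_subset[of _ "{..Q} \<times> {..Q}"])
  show "{(t,s). 1 \<le> t \<and> 1 \<le> s \<and> coprime t s \<and> t * d + s * e \<le> Q} \<subseteq> {..Q} \<times> {..Q}"
  proof clarify
    fix t s assume "t * d + s * e \<le> Q"
    moreover have "t * 1 \<le> t * d" by (rule mult_le_mono) (use assms in auto)
    moreover have "s * 1 \<le> s * e" by (rule mult_le_mono) (use assms in auto)
    ultimately have "t \<le> Q" "s \<le> Q" by linarith+
    then show "t \<in> {..Q} \<and> s \<in> {..Q}" by simp
  qed
qed simp

lemma coprime_cone_antimono:
  assumes "1 \<le> d" "1 \<le> e" "d \<le> d'"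
  shows "coprime_cone Q d' e \<le> coprime_cone Q d e"
  unfolding coprime_cone_def
proof (intro card_mono finite_cone assms, clarify)
  fix t s assume "t * d' + s * e \<le> Q"
  moreover have "t * d \<le> t * d'" using assms by simp
  ultimately show "t * d + s * e \<le> Q" by linarith
qed

lemma coprime_cone_le:
  assumes "1 \<le> d" "1 \<le> e"
  shows "real (coprime_cone Q d e) \<le> real Q ^ 2 / (real d * real e)"
proof -
  have "{(t,s). 1 \<le> t \<and> 1 \<le> s \<and> coprime t s \<and> t * d + s * e \<le> Q} \<subseteq> {1..Q div d} \<times> {1..Q div e}"
  proof clarify
    fix t s assume h: "1 \<le> t" "1 \<le> s" "t * d + s * e \<le> Q"
    then have "t \<le> Q div d" "s \<le> Q div e" using assms by (simp_all add: less_eq_div_iff_mult_less_eq)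
    then show "t \<in> {1..Q div d} \<and> s \<in> {1..Q div e}" using h by simp
  qed
  then have "coprime_cone Q d e \<le> card ({1..Q div d} \<times> {1..Q div e})"
    unfolding coprime_cone_def by (intro card_mono) auto
  then have "real (coprime_cone Q d e) \<le> real (Q div d) * real (Q div e)" by (simp flip: of_nat_mult)
  also have "\<dots> \<le> (real Q / real d) * (real Q / real e)"
    by (intro mult_mono of_nat_div_le_of_nat) auto
  finally show ?thesis by (simp add: power2_eq_square)
qed

lemma coprime_cone_eq_0: "Q < d \<Longrightarrow> coprime_cone Q d e = 0"
proof -
  assume "Q < d"
  have "\<not> t * d + s * e \<le> Q" if "1 \<le> t" for t s
  proof -
    have "1 * d \<le> t * d" using that by (intro mult_le_mono) auto
    then show ?thesis using \<open>Q < d\<close> by linarith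
  qed
  then have "{(t,s). 1 \<le> t \<and> 1 \<le> s \<and> coprime t s \<and> t * d + s * e \<le> Q} = {}" by blast
  then show ?thesis unfolding coprime_cone_def by (simp only: card.empty)
qed

text \<open>With \<alpha> = \<open>v/w\<close> strictly inside the interval,
  \<open>w = e (c w - v d) + d (v e - f w)\<close> with both brackets positive, hence
  \<open>d < w\<close>. Given \<open>d\<close>, the multiple \<open>c w\<close> of \<open>w\<close>
  lies in a range of length \<open>w\<close>, which fixes \<open>c\<close>; then \<open>e\<close> is
  fixed modulo \<open>d\<close> within \<open>{1..d}\<close>, and \<open>f\<close> follows. So a
  cell is determined by \<open>(d, t, s)\<close>, with at most \<open>Q / d\<close> values of
  \<open>t\<close> and \<open>Q\<close> of \<open>s\<close>.\<close>

lemma card_outer_minus_inner_le: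
  assumes "0 \<le> \<alpha>"
  shows "finite (outer_cells \<alpha> Q - inner_cells \<alpha> Q)"
    "real (card (outer_cells \<alpha> Q - inner_cells \<alpha> Q)) \<le> real Q ^ 2 * harm (denom \<alpha>)"
proof -
  obtain v where v: "\<alpha> = of_nat v / of_nat (denom \<alpha>)" "denom \<alpha> > 0"
    using of_rat_denom[OF assms] by metis
  define w where "w = denom \<alpha>"
  have w: "w > 0" "(of_nat w :: rat) > 0" using v by (auto simp: w_def)
  have less_iff: "(of_nat x :: rat) < \<alpha> * of_nat y \<longleftrightarrow> x * w < v * y" for x y
  proof -
    have "\<alpha> * of_nat y = of_nat v * of_nat y / of_nat w"
      using v(1) unfolding w_def by (metis times_divide_eq_left)
    then have "(of_nat x :: rat) < \<alpha> * of_nat y \<longleftrightarrow> (of_nat x :: rat) < of_nat v * of_nat y / of_nat w"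
      by (simp only:)
    also have "\<dots> \<longleftrightarrow> (of_nat x :: rat) * of_nat w < of_nat v * of_nat y"
      using w by (simp add: pos_less_divide_eq)
    also have "\<dots> \<longleftrightarrow> x * w < v * y" by (simp only: of_nat_mult[symmetric] of_nat_less_iff)
    finally show ?thesis .
  qed
  define D where "D = outer_cells \<alpha> Q - inner_cells \<alpha> Q"
  have facts: "1 \<le> e \<and> e \<le> d \<and> d < w \<and> 1 \<le> t \<and> 1 \<le> s \<and> t \<le> Q div d \<and> s \<le> Q \<and>
      c * e = f * d + 1 \<and> v * d < c * w \<and> c * w < v * d + w + 1"
    if "(d,e,f,t,s) \<in> D" "c = (f * d + 1) div e" for c d e f t s
  proof -
    have h: "1 \<le> e" "e \<le> d" "e dvd f * d + 1" "1 \<le> t" "1 \<le> s" "t * d + s * e \<le> Q"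
       "f * w < v * e" "\<not> (t * c + s * f) * w < v * (t * d + s * e)"
      using that unfolding D_def outer_cells_def inner_cells_def cells_def less_iff mem_Collect_eq
        prod.case Diff_iff by blast+
    have ce: "c * e = f * d + 1" using that h by simp
    have vd: "v * d < c * w"
    proof (rule ccontr)
      assume "\<not> ?thesis"
      then have "t * (c * w) \<le> t * (v * d)" by (intro mult_left_mono) auto
      moreover have "s * (f * w) < s * (v * e)" using h by simp
      moreover have "(t * c + s * f) * w = t * (c * w) + s * (f * w)"
        "v * (t * d + s * e) = t * (v * d) + s * (v * e)" by (simp_all add: algebra_simps)
      ultimately have "(t * c + s * f) * w < v * (t * d + s * e)" by linarith
      then show False using h by simp
    qed
    have "c * w * e = f * w * d + w" using arg_cong[OF ce, of "\<lambda>x. x * w"] by (simp add: algebra_simps)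
    have d: "d < w"
    proof -
      have "(f * w + 1) * d \<le> (v * e) * d" using h by (intro mult_le_mono) auto
      moreover have "(v * d + 1) * e \<le> (c * w) * e" using vd by (intro mult_le_mono) auto
      moreover have "(f * w + 1) * d = f * w * d + d" "(v * d + 1) * e = (v * e) * d + e"
        by (simp_all add: algebra_simps)
      ultimately show ?thesis using \<open>c * w * e = f * w * d + w\<close> h(1) by linarith
    qed
    \<comment> \<open>Together with \<open>vd\<close> this places \<open>c * w\<close> among the
      \<open>w\<close> integers after \<open>v * d\<close>, which contain only one multiple of
      \<open>w\<close>.\<close>
    have cw: "c * w < v * d + w + 1"
    proof (rule ccontr)
      assume "\<not> ?thesis"
      then have "(v * d + w + 1) * e \<le> c * w * e" by (intro mult_right_mono) auto
      moreover have "f * w * d \<le> v * e * d" using h by (intro mult_right_mono) auto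
      moreover have "w * 1 \<le> w * e" using h by (intro mult_le_mono) auto
      moreover have "(v * d + w + 1) * e = v * e * d + w * e + e" by (simp add: algebra_simps)
      ultimately show False using \<open>c * w * e = f * w * d + w\<close> h(1) by linarith
    qed
    have "t * d \<le> Q" using h by linarith
    then have "t \<le> Q div d" using h by (simp add: less_eq_div_iff_mult_less_eq)
    moreover have "s * 1 \<le> s * e" using h by (intro mult_le_mono) auto
    then have "s \<le> Q" using h by linarith
    ultimately show ?thesis using h ce vd cw d by simp
  qed
  let ?p = "\<lambda>(d,e,f,t,s). (d,t,s)"
  let ?T = "SIGMA d:{1..w}. {1..Q div d} \<times> {1..Q}"
  have inj: "inj_on ?p D"
  proof (rule inj_onI)
    fix x y assume xy: "x \<in> D" "y \<in> D" "?p x = ?p y"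
    obtain d e f t s where x: "x = (d,e,f,t,s)" by (metis surj_pair)
    obtain e' f' where y: "y = (d,e',f',t,s)" using xy(3) x by (cases y) auto
    define c c' where "c = (f * d + 1) div e" and "c' = (f' * d + 1) div e'"
    have h: "1 \<le> e" "e \<le> d" "c * e = f * d + 1" "v * d < c * w" "c * w < v * d + w + 1"
      using facts[of d e f t s c] xy(1) unfolding x c_def by simp_all
    have h': "1 \<le> e'" "e' \<le> d" "c' * e' = f' * d + 1" "v * d < c' * w" "c' * w < v * d + w + 1"
      using facts[of d e' f' t s c'] xy(2) unfolding y c'_def by simp_all
    have "c = c'"
    proof (rule ccontr)
      assume "c \<noteq> c'"
      then consider "c + 1 \<le> c'" | "c' + 1 \<le> c" by linarith
      then show False
      proof cases
        case 1
        then have "(c + 1) * w \<le> c' * w" by (intro mult_right_mono) auto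
        moreover have "(c + 1) * w = c * w + w" by simp
        ultimately show False using h h' by linarith
      next
        case 2
        then have "(c' + 1) * w \<le> c * w" by (intro mult_right_mono) auto
        moreover have "(c' + 1) * w = c' * w + w" by simp
        ultimately show False using h h' by linarith
      qed
    qed
    have ei: "int c * int e = int f * int d + 1" "int c * int e' = int f' * int d + 1"
      using h(3) h'(3) \<open>c = c'\<close> by (metis of_nat_1 of_nat_add of_nat_mult)+
    then have "int c * (int e - int e') = int d * (int f - int f')" by (simp add: algebra_simps)
    then have "int d dvd int c * (int e - int e')" by simp
    moreover have "coprime (int d) (int c)"
    proof (rule coprimeI)
      fix k assume "k dvd int d" "k dvd int c"
      then have "k dvd int c * int e - int f * int d" by (intro dvd_diff) auto
      then show "is_unit k" using ei by simp
    qed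
    ultimately have dv: "int d dvd int e - int e'" by (simp add: coprime_dvd_mult_right_iff)
    have "e = e'"
    proof (rule ccontr)
      assume "e \<noteq> e'"
      then have "int d \<le> \<bar>int e - int e'\<bar>" using dvd_imp_le_int[OF _ dv] by simp
      then show False using h h' by linarith
    qed
    then have "f * d = f' * d" using h h' \<open>c = c'\<close> by simp
    then have "f = f'" using h by simp
    then show "x = y" using \<open>e = e'\<close> by (simp add: x y)
  qed
  have sub: "?p ` D \<subseteq> ?T"
  proof clarsimp
    fix d e f t s assume "(d,e,f,t,s) \<in> D"
    from facts[OF this refl] show "Suc 0 \<le> d \<and> d \<le> w \<and> Suc 0 \<le> t \<and> t \<le> Q div d \<and> Suc 0 \<le> s \<and> s \<le> Q"
      by simp
  qed
  show "finite (outer_cells \<alpha> Q - inner_cells \<alpha> Q)"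
    using inj_on_finite[OF inj sub] by (simp add: D_def)
  have "card D \<le> card ?T" by (rule card_inj_on_le[OF inj sub]) simp
  also have "\<dots> = (\<Sum>d\<in>{1..w}. (Q div d) * Q)" by (simp add: card_SigmaI card_cartesian_product)
  finally have "real (card D) \<le> (\<Sum>d\<in>{1..w}. real (Q div d) * real Q)"
    by (simp flip: of_nat_mult of_nat_sum)
  also have "\<dots> \<le> (\<Sum>d\<in>{1..w}. real Q / real d * real Q)"
    by (intro sum_mono mult_right_mono of_nat_div_le_of_nat) auto
  also have "\<dots> = real Q ^ 2 * harm w"
    by (simp add: harm_def sum_distrib_left power2_eq_square field_simps)
  finally show "real (card (outer_cells \<alpha> Q - inner_cells \<alpha> Q)) \<le> real Q ^ 2 * harm (denom \<alpha>)"
    by (simp add: D_def w_def)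
qed

lemma inner_subset_outer_cells: "inner_cells \<alpha> Q \<subseteq> outer_cells \<alpha> Q"
proof (rule subsetI)
  fix x assume xi: "x \<in> inner_cells \<alpha> Q"
  obtain d e f t s where x: "x = (d,e,f,t,s)" by (metis surj_pair)
  define c where "c = (f * d + 1) div e"
  have h: "1 \<le> e" "e \<le> d" "e dvd f * d + 1" "1 \<le> t" "1 \<le> s"
     "(of_nat (t * c + s * f) :: rat) < \<alpha> * of_nat (t * d + s * e)"
    using xi by (auto simp: x inner_cells_def cells_def c_def)
  have ce: "c * e = f * d + 1" using h by (simp add: c_def)
  have "of_nat f < \<alpha> * of_nat e"
  proof (rule ccontr)
    assume "\<not> of_nat f < \<alpha> * of_nat e"
    then have fe: "\<alpha> * of_nat e \<le> of_nat f" by simp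
    have e0: "(of_nat e :: rat) > 0" using h by simp
    have "(\<alpha> * of_nat e) * of_nat (t * d + s * e) \<le> of_nat f * of_nat (t * d + s * e)"
      using fe by (intro mult_right_mono) auto
    also have "\<dots> \<le> (of_nat (f * (t * d + s * e) + t) :: rat)"
      unfolding of_nat_mult[symmetric] of_nat_le_iff by simp
    also have "f * (t * d + s * e) + t = (t * c + s * f) * e"
    proof -
      have "(t * c + s * f) * e = t * (c * e) + s * f * e" by (simp add: algebra_simps)
      also have "\<dots> = f * (t * d + s * e) + t" unfolding ce by (simp add: algebra_simps)
      finally show ?thesis ..
    qed
    also have "of_nat ((t * c + s * f) * e) < (\<alpha> * of_nat (t * d + s * e)) * of_nat e"
      unfolding of_nat_mult[of _ e] using h(6) e0 by (intro mult_strict_right_mono) auto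
    finally show False by (simp add: mult_ac)
  qed
  then show "x \<in> outer_cells \<alpha> Q" using xi by (auto simp: x outer_cells_def inner_cells_def)
qed

text \<open>The denominators \<open>d \<ge> e\<close> in the residue class \<open>u\<close> modulo
  \<open>e\<close> are \<open>u + j * e\<close> with \<open>j \<ge> 1\<close>, for
  \<open>u < e\<close>. Terms with a denominator above \<open>Q\<close> vanish by
  \<open>coprime_cone_eq_0\<close>.\<close>

definition row_weight :: "nat \<Rightarrow> nat \<Rightarrow> nat \<Rightarrow> nat" where
  "row_weight Q e u = (\<Sum>j\<in>{1..Q}. coprime_cone Q (u + j * e) e)"

text \<open>Whether \<open>e\<close> divides \<open>f * d + 1\<close> depends only on
  \<open>u = d mod e\<close>, so the condition becomes \<open>(f, u) \<in> inv_pairs e\<close> and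
  the rest is a weight depending on \<open>u\<close>. For integers, \<open>f < \<alpha> e\<close>
  means that \<open>f\<close> is below the ceiling.\<close>

lemma card_outer_cells:
  assumes "0 \<le> \<alpha>" "\<alpha> \<le> 1"
  shows "finite (outer_cells \<alpha> Q)"
    "card (outer_cells \<alpha> Q) = (\<Sum>e\<in>{1..Q}. \<Sum>(f,u)\<in>inv_pairs e. if f < nat \<lceil>\<alpha> * of_nat e\<rceil> then row_weight Q e u else 0)"
proof -
  let ?I = "\<lambda>e. {(f,u)\<in>inv_pairs e. f < nat \<lceil>\<alpha> * of_nat e\<rceil>}"
  let ?C = "\<lambda>d e. {(t,s). 1 \<le> t \<and> 1 \<le> s \<and> coprime t s \<and> t * d + s * e \<le> Q}"
  let ?S = "SIGMA e:{1..Q}. SIGMA (f,u):?I e. SIGMA j:{1..Q}. ?C (u + j * e) e"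
  have fl: "f < nat \<lceil>\<alpha> * of_nat e\<rceil> \<longleftrightarrow> (of_nat f :: rat) < \<alpha> * of_nat e" for f e
    by (simp add: zless_nat_eq_int_zless less_ceiling_iff)
  let ?g = "\<lambda>(e,(f,u),j,(t,s)). (u + j * e, e, f, t, s)"
  let ?h = "\<lambda>(d,e,f,t,s). (e, (f, d mod e), d div e, (t, s))"
  have bij: "bij_betw ?g ?S (outer_cells \<alpha> Q)"
  proof (rule bij_betw_byWitness[where f' = ?h])
    show "\<forall>a\<in>?S. ?h (?g a) = a" by (auto simp: inv_pairs_def)
    show "\<forall>a'\<in>outer_cells \<alpha> Q. ?g (?h a') = a'" by auto
    show "?g ` ?S \<subseteq> outer_cells \<alpha> Q"
    proof (rule image_subsetI)
      fix x assume "x \<in> ?S"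
      then obtain e f u j t s where x: "x = (e,(f,u),j,(t,s))" and h: "1 \<le> e" "e \<le> Q" "(f,u) \<in> inv_pairs e"
        "(of_nat f :: rat) < \<alpha> * of_nat e" "1 \<le> j" "1 \<le> t" "1 \<le> s" "coprime t s" "t * (u + j * e) + s * e \<le> Q"
        by (auto simp: fl)
      have "e dvd f * u + 1" using h by (simp add: inv_pairs_def)
      then have "e dvd (f * u + 1) + e * (f * j)" by (rule dvd_add) simp
      then have "e dvd f * (u + j * e) + 1" by (simp add: algebra_simps)
      moreover have "1 * e \<le> j * e" using h by (intro mult_right_mono) auto
      then have "e \<le> u + j * e" by linarith
      ultimately show "?g x \<in> outer_cells \<alpha> Q" using h by (simp add: x outer_cells_def cells_def)
    qed
    show "?h ` outer_cells \<alpha> Q \<subseteq> ?S"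
    proof (rule image_subsetI)
      fix x assume "x \<in> outer_cells \<alpha> Q"
      then obtain d e f t s where x: "x = (d,e,f,t,s)" and h: "1 \<le> e" "e \<le> d" "e dvd f * d + 1"
        "(of_nat f :: rat) < \<alpha> * of_nat e" "1 \<le> t" "1 \<le> s" "coprime t s" "t * d + s * e \<le> Q"
        by (auto simp: outer_cells_def cells_def)
      have "1 * d \<le> t * d" using h by (intro mult_right_mono) auto
      then have dQ: "d \<le> Q" using h by linarith
      have "\<alpha> * of_nat e \<le> 1 * of_nat e" using assms by (intro mult_right_mono) auto
      then have "(of_nat f :: rat) < of_nat e" using h by linarith
      then have fe: "f < e" by simp
      have "f * d + 1 = (f * (d mod e) + 1) + e * (f * (d div e))"
        by (metis (no_types, lifting) add.assoc add.commute add_mult_distrib2 mod_mult_div_eq mult.left_commute)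
      then have "e dvd f * (d mod e) + 1" using h(3) by (metis dvd_add_left_iff dvd_triv_left)
      then have "(f, d mod e) \<in> inv_pairs e" using fe h by (simp add: inv_pairs_def)
      moreover have "1 \<le> d div e" using h by (simp add: Suc_le_eq div_greater_zero_iff)
      moreover have "d div e \<le> Q" using dQ div_le_dividend[of d e] by linarith
      ultimately show "?h x \<in> ?S" using h dQ by (simp add: x fl)
    qed
  qed
  have finI: "finite (?I e)" for e by (rule finite_subset[OF _ finite_inv_pairs[of e]]) auto
  have finC: "finite (?C (u + j * e) e)" if "1 \<le> e" "1 \<le> j" for u j e
    by (rule finite_cone) (use that in \<open>auto simp: Suc_le_eq\<close>)
  have finS: "finite ?S"
    by (intro finite_SigmaI) (auto intro!: finI finC finC[simplified] finite_SigmaI)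
  then show "finite (outer_cells \<alpha> Q)" using bij_betw_finite[OF bij] by simp
  have "card (outer_cells \<alpha> Q) = card ?S" using bij_betw_same_card[OF bij] by simp
  also have "\<dots> = (\<Sum>e\<in>{1..Q}. card (SIGMA (f,u):?I e. SIGMA j:{1..Q}. ?C (u + j * e) e))"
    by (rule card_SigmaI) (auto intro!: finI finC finC[simplified] finite_SigmaI)
  also have "\<dots> = (\<Sum>e\<in>{1..Q}. \<Sum>(f,u)\<in>inv_pairs e. if f < nat \<lceil>\<alpha> * of_nat e\<rceil> then row_weight Q e u else 0)"
  proof (intro sum.cong refl)
    fix e assume e: "e \<in> {1..Q}"
    have "card (SIGMA (f,u):?I e. SIGMA j:{1..Q}. ?C (u + j * e) e) =
       (\<Sum>p\<in>?I e. card (SIGMA j:{1..Q}. ?C (snd p + j * e) e))"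
    proof (subst card_SigmaI)
      show "finite (?I e)" by (rule finI)
      show "\<forall>p\<in>?I e. finite (case p of (f,u) \<Rightarrow> SIGMA j:{1..Q}. ?C (u + j * e) e)"
        using e by (auto intro!: finC finC[simplified] finite_SigmaI)
    qed (simp add: case_prod_unfold)
    also have "\<dots> = (\<Sum>p\<in>?I e. row_weight Q e (snd p))"
    proof (intro sum.cong refl)
      fix p assume "p \<in> ?I e"
      have "card (SIGMA j:{1..Q}. ?C (snd p + j * e) e) = (\<Sum>j\<in>{1..Q}. card (?C (snd p + j * e) e))"
        by (rule card_SigmaI) (use e in \<open>auto intro!: finC finC[simplified]\<close>)
      then show "card (SIGMA j:{1..Q}. ?C (snd p + j * e) e) = row_weight Q e (snd p)"
        by (simp add: row_weight_def coprime_cone_def)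
    qed
    also have "?I e = {p\<in>inv_pairs e. fst p < nat \<lceil>\<alpha> * of_nat e\<rceil>}" by auto
    also have "(\<Sum>p\<in>\<dots>. row_weight Q e (snd p)) = (\<Sum>p\<in>inv_pairs e. if fst p < nat \<lceil>\<alpha> * of_nat e\<rceil> then row_weight Q e (snd p) else 0)"
      by (rule sum.inter_filter) simp
    finally show "card (SIGMA (f,u):?I e. SIGMA j:{1..Q}. ?C (u + j * e) e) =
       (\<Sum>(f,u)\<in>inv_pairs e. if f < nat \<lceil>\<alpha> * of_nat e\<rceil> then row_weight Q e u else 0)"
      by (simp add: case_prod_unfold)
  qed
  finally show "card (outer_cells \<alpha> Q) = (\<Sum>e\<in>{1..Q}. \<Sum>(f,u)\<in>inv_pairs e. if f < nat \<lceil>\<alpha> * of_nat e\<rceil> then row_weight Q e u else 0)" .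
qed

lemma sum_minus_cf_length_approx:
  assumes "0 \<le> \<alpha>" "\<alpha> \<le> 1"
  shows "\<bar>(\<Sum>x\<in>farey_low \<alpha> Q. real (minus_cf_length x)) -
     (\<Sum>e\<in>{1..Q}. \<Sum>(f,u)\<in>inv_pairs e. if f < nat \<lceil>\<alpha> * of_nat e\<rceil> then real (row_weight Q e u) else 0)\<bar>
     \<le> real Q ^ 2 * harm (denom \<alpha>)"
proof -
  let ?O = "outer_cells \<alpha> Q" and ?I = "inner_cells \<alpha> Q"
  have "(\<Sum>x\<in>farey_low \<alpha> Q. real (minus_cf_length x)) = real (card ?I)"
    using sum_minus_cf_length_eq_card[OF assms(2), of Q] by (simp flip: of_nat_sum)
  moreover have "(\<Sum>e\<in>{1..Q}. \<Sum>(f,u)\<in>inv_pairs e. if f < nat \<lceil>\<alpha> * of_nat e\<rceil> then real (row_weight Q e u) else 0) = real (card ?O)"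
    unfolding card_outer_cells(2)[OF assms] of_nat_sum by (intro sum.cong refl) auto
  moreover have "card ?O = card ?I + card (?O - ?I)"
    using card_outer_cells(1)[OF assms, of Q] inner_subset_outer_cells[of \<alpha> Q]
    by (metis card_Diff_subset card_mono finite_subset le_add_diff_inverse)
  ultimately show ?thesis using card_outer_minus_inner_le(2)[OF assms(1), of Q] by simp
qed

section \<open>Dirichlet series at 2\<close>

lemma sum_powr_bounded:
  assumes "s > 1"
  shows "\<exists>C>0. \<forall>N. (\<Sum>k\<in>{1..N}. real k powr (- s)) \<le> C"
proof -
  have sm: "summable (\<lambda>n. real n powr (- s))"
    using assms by (subst summable_real_powr_iff) auto
  have "(\<Sum>k\<in>{1..N}. real k powr (- s)) \<le> (\<Sum>n. real n powr (- s))" for N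
    by (rule sum_le_suminf[OF sm]) auto
  moreover have "0 \<le> (\<Sum>n. real n powr (- s))" by (rule suminf_nonneg[OF sm]) simp
  ultimately show ?thesis
    by (intro exI[of _ "(\<Sum>n. real n powr (- s)) + 1"]) (simp add: add_increasing2)
qed

lemma summable_Suc_powr: "s < -1 \<Longrightarrow> summable (\<lambda>n. real (Suc n) powr s)"
  using summable_real_powr_iff[of s] summable_Suc_iff[of "\<lambda>n. real n powr s"] by blast

lemma sum_divisors_eq:
  fixes F :: "nat \<Rightarrow> nat \<Rightarrow> 'a :: comm_monoid_add"
  shows "(\<Sum>e\<in>{1..N}. \<Sum>d | d dvd e. F d (e div d)) = (\<Sum>d\<in>{1..N}. \<Sum>m\<in>{1..N div d}. F d m)"
proof -
  have "{(d,m). 1 \<le> d \<and> 1 \<le> m \<and> d * m \<le> N} = (SIGMA d:{1..N}. {1..N div d})"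
  proof -
    have a: "d \<le> N" if "1 \<le> m" "d * m \<le> N" for d m
    proof -
      have "d * 1 \<le> d * m" using that by (intro mult_le_mono) auto
      then show ?thesis using that by linarith
    qed
    have b: "m \<le> N div d \<longleftrightarrow> d * m \<le> N" if "1 \<le> d" for m d
      using that by (simp add: less_eq_div_iff_mult_less_eq mult.commute[of d])
    show ?thesis
    proof (rule Set.set_eqI, rule prod.induct)
      fix d m
      show "(d, m) \<in> {(d,m). 1 \<le> d \<and> 1 \<le> m \<and> d * m \<le> N} \<longleftrightarrow> (d, m) \<in> (SIGMA d:{1..N}. {1..N div d})"
        using a[of m d] b[of d m] by (cases "1 \<le> d") auto
    qed
  qed
  then show ?thesis unfolding sum_divisors_reindex by (simp only:) (simp add: sum.Sigma)
qed

text \<open>The exponent splits as \<open>7/4 = 5/4 + 1/2\<close>: the half is spent on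
  \<open>1 / sqrt M\<close> and the rest still converges. The coefficients below decay like inverse
  squares up to logarithms, for which \<open>7/4\<close> leaves room.\<close>

lemma series_tail_bound:
  fixes g :: "nat \<Rightarrow> real"
  assumes "\<And>m. m \<ge> 1 \<Longrightarrow> \<bar>g m\<bar> \<le> c * real m powr (-7/4)"
  shows "summable (\<lambda>n. g (Suc n))"
    "M \<ge> 1 \<Longrightarrow> \<bar>(\<Sum>m\<in>{1..M}. g m) - (\<Sum>n. g (Suc n))\<bar> \<le>
       (c * (\<Sum>n. real (Suc n) powr (-5/4)) + 1) / sqrt (real M)"
proof -
  have sm: "summable (\<lambda>n. real (Suc n) powr (-7/4))" "summable (\<lambda>n. real (Suc n) powr (-5/4))"
    by (rule summable_Suc_powr; simp)+
  show g: "summable (\<lambda>n. g (Suc n))"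
    by (rule summable_comparison_test'[OF summable_mult[OF sm(1), of c], of 0])
      (use assms in \<open>auto simp del: of_nat_Suc\<close>)
  have c0: "c \<ge> 0" using assms[of 1] by simp
  define C where "C = c * (\<Sum>n. real (Suc n) powr (-5/4)) + 1"
  have S0: "(\<Sum>n. real (Suc n) powr (-5/4)) \<ge> 0" by (rule suminf_nonneg[OF sm(2)]) auto
  show "\<bar>(\<Sum>m\<in>{1..M}. g m) - (\<Sum>n. g (Suc n))\<bar> \<le>
       (c * (\<Sum>n. real (Suc n) powr (-5/4)) + 1) / sqrt (real M)" if M: "M \<ge> 1"
    unfolding C_def[symmetric]
  proof -
    have "(\<Sum>m\<in>{1..M}. g m) = (\<Sum>n<M. g (Suc n))"
      by (rule sum.reindex_bij_witness[of _ Suc "\<lambda>n. n - 1"]) auto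
    then have "(\<Sum>m\<in>{1..M}. g m) - (\<Sum>n. g (Suc n)) = - (\<Sum>n. g (Suc (n + M)))"
      using suminf_minus_initial_segment[OF g, of M] by simp
    also have "\<bar>\<dots>\<bar> \<le> (\<Sum>n. c * (real (Suc (n + M)) powr (-5/4) * (1 / sqrt (real M))))"
      unfolding abs_minus
    proof (rule norm_suminf_le[where 'a = real, unfolded real_norm_def])
      fix n
      have "real (Suc (n + M)) powr (-7/4) = real (Suc (n + M)) powr (-5/4) * real (Suc (n + M)) powr (-1/2)"
        by (simp flip: powr_add del: of_nat_Suc)
      also have "\<dots> \<le> real (Suc (n + M)) powr (-5/4) * (real M powr (-1/2))"
        using M by (intro mult_left_mono powr_mono2') auto
      also have "real M powr (-1/2) = 1 / sqrt (real M)"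
        using M by (simp add: powr_minus powr_half_sqrt inverse_eq_divide)
      finally have "c * real (Suc (n + M)) powr (-7/4) \<le> c * (real (Suc (n + M)) powr (-5/4) * (1 / sqrt (real M)))"
        using c0 by (intro mult_left_mono)
      moreover have "\<bar>g (Suc (n + M))\<bar> \<le> c * real (Suc (n + M)) powr (-7/4)" by (rule assms) simp
      ultimately show "\<bar>g (Suc (n + M))\<bar> \<le> c * (real (Suc (n + M)) powr (-5/4) * (1 / sqrt (real M)))" by linarith
    next
      show "summable (\<lambda>n. c * (real (Suc (n + M)) powr (-5/4) * (1 / sqrt (real M))))"
        using summable_ignore_initial_segment[OF sm(2), of M] by (intro summable_mult summable_mult2)
    qed
    also have "\<dots> = c * ((\<Sum>n. real (Suc (n + M)) powr (-5/4)) * (1 / sqrt (real M)))"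
      using summable_ignore_initial_segment[OF sm(2), of M]
      by (intro sums_unique[symmetric] sums_mult sums_mult2 summable_sums)
    also have "\<dots> = c * (\<Sum>n. real (Suc (n + M)) powr (-5/4)) * (1 / sqrt (real M))" by simp
    also have "(\<Sum>n. real (Suc (n + M)) powr (-5/4)) \<le> (\<Sum>n. real (Suc n) powr (-5/4))"
      using suminf_minus_initial_segment[OF sm(2), of M] sum_nonneg[of "{..<M}" "\<lambda>n. real (Suc n) powr (-5/4)"] by simp
    also have "c * (\<Sum>n. real (Suc n) powr (-5/4)) * (1 / sqrt (real M)) \<le> C * (1 / sqrt (real M))"
      by (intro mult_right_mono) (auto simp: C_def)
    finally show "\<bar>(\<Sum>m\<in>{1..M}. g m) - (\<Sum>n. g (Suc n))\<bar> \<le> C / sqrt (real M)"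
      using c0 by (simp add: mult_left_mono mult_right_mono divide_right_mono)
  qed
qed

text \<open>The constant depends on \<open>c\<close> only. This is the origin of uniformity in
  \<alpha> when the coefficients involve the defects of \<alpha>.\<close>

lemma series_tail_bound_uniform:
  assumes "c \<ge> 0"
  obtains C where "C > 0" "\<And>g M. (\<And>m. m \<ge> 1 \<Longrightarrow> \<bar>g m\<bar> \<le> c * real m powr (-7/4)) \<Longrightarrow> M \<ge> 1 \<Longrightarrow>
    \<bar>(\<Sum>m\<in>{1..M}. g m) - (\<Sum>n. g (Suc n))\<bar> \<le> C / sqrt (real M)"
proof -
  have "(\<Sum>n. real (Suc n) powr (-5/4)) \<ge> 0"
    by (rule suminf_nonneg[OF summable_Suc_powr]) auto
  then have "c * (\<Sum>n. real (Suc n) powr (-5/4)) + 1 > 0" using assms by (simp add: add_nonneg_pos)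
  then show ?thesis using series_tail_bound(2) by (rule that)
qed

text \<open>For fixed \<open>k\<close> the tail of the inner sum beyond \<open>N div k\<close> is of
  order \<open>sqrt (k / N)\<close>; against the decay of \<open>a k\<close> this leaves a
  convergent sum of \<open>k powr (-5/4)\<close>. Hence the partial sums of a Dirichlet convolution
  reach the product of the two series at the rate \<open>1 / sqrt N\<close>.\<close>

lemma hyperbola_product_bound:
  assumes c0: "c \<ge> 0"
  obtains C where "C > 0" "\<And>a g N. (\<And>k. k \<ge> 1 \<Longrightarrow> \<bar>a k\<bar> \<le> c * real k powr (-7/4)) \<Longrightarrow>
    (\<And>m. m \<ge> 1 \<Longrightarrow> \<bar>g m\<bar> \<le> c * real m powr (-7/4)) \<Longrightarrow> N \<ge> 1 \<Longrightarrow>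
    \<bar>(\<Sum>k\<in>{1..N}. \<Sum>m\<in>{1..N div k}. a k * g m) - (\<Sum>n. a (Suc n)) * (\<Sum>n. g (Suc n))\<bar> \<le> C / sqrt (real N)"
proof -
  obtain K where K: "K > 0" "\<And>g M. (\<And>m. m \<ge> 1 \<Longrightarrow> \<bar>g m\<bar> \<le> c * real m powr (-7/4)) \<Longrightarrow> M \<ge> 1 \<Longrightarrow>
    \<bar>(\<Sum>m\<in>{1..M}. g m) - (\<Sum>n. g (Suc n))\<bar> \<le> K / sqrt (real M)"
    using series_tail_bound_uniform[OF c0] by blast
  obtain C3 where C3: "C3 > 0" "\<And>N. (\<Sum>k\<in>{1..N}. real k powr (-5/4)) \<le> C3"
    using sum_powr_bounded[of "5/4"] by auto
  have main: "\<bar>(\<Sum>k\<in>{1..N}. \<Sum>m\<in>{1..N div k}. a k * g m) - (\<Sum>n. a (Suc n)) * (\<Sum>n. g (Suc n))\<bar> \<le>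
      (2 * c * K * C3 + K * (c + K) + 1) / sqrt (real N)"
    if a: "\<And>k. k \<ge> 1 \<Longrightarrow> \<bar>a k\<bar> \<le> c * real k powr (-7/4)"
      and g: "\<And>m. m \<ge> 1 \<Longrightarrow> \<bar>g m\<bar> \<le> c * real m powr (-7/4)" and N: "N \<ge> 1" for a g and N :: nat
  proof -
    define G A where "G = (\<Sum>n. g (Suc n))" and "A = (\<Sum>n. a (Suc n))"
    have C1: "K > 0" "\<And>M. M \<ge> 1 \<Longrightarrow> \<bar>(\<Sum>m\<in>{1..M}. g m) - G\<bar> \<le> K / sqrt (real M)"
      using K(1) K(2)[of g, OF g] unfolding G_def by auto
    have C2: "K > 0" "\<And>M. M \<ge> 1 \<Longrightarrow> \<bar>(\<Sum>m\<in>{1..M}. a m) - A\<bar> \<le> K / sqrt (real M)"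
      using K(1) K(2)[of a, OF a] unfolding A_def by auto
    have "\<bar>G\<bar> \<le> c + K" using C1(2)[of 1] g[of 1] by simp
    have "(\<Sum>k\<in>{1..N}. \<Sum>m\<in>{1..N div k}. a k * g m) - A * G =
       (\<Sum>k\<in>{1..N}. a k * ((\<Sum>m\<in>{1..N div k}. g m) - G)) + ((\<Sum>k\<in>{1..N}. a k) - A) * G"
      by (simp add: sum_distrib_left right_diff_distrib sum_subtractf sum_distrib_right algebra_simps)
    also have "\<bar>\<dots>\<bar> \<le> (\<Sum>k\<in>{1..N}. (2 * c * K / sqrt (real N)) * real k powr (-5/4)) + (K / sqrt (real N)) * \<bar>G\<bar>"
    proof (rule order_trans[OF abs_triangle_ineq], rule add_mono)
      show "\<bar>\<Sum>k\<in>{1..N}. a k * ((\<Sum>m\<in>{1..N div k}. g m) - G)\<bar> \<le> (\<Sum>k\<in>{1..N}. (2 * c * K / sqrt (real N)) * real k powr (-5/4))"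
      proof (rule order_trans[OF sum_abs], rule sum_mono)
        fix k assume k: "k \<in> {1..N}"
        define M where "M = N div k"
        have M1: "M \<ge> 1" using k by (simp add: M_def Suc_le_eq div_greater_zero_iff)
        have "N < k * M + k" using k mult_div_mod_eq[of k N] mod_less_divisor[of k N] unfolding M_def by (metis add_less_cancel_left atLeastAtMost_iff less_le_trans zero_less_one)
        also have "k * M + k \<le> k * M + k * M" using M1 by simp
        \<comment> \<open>The chain gives the factor \<open>2\<close>; it is raised to
          \<open>4\<close>, which has an integral square root.\<close>
        finally have "real N \<le> real (4 * (k * M))" by (intro of_nat_mono) simp
        then have "sqrt (real N) \<le> sqrt (real (4 * (k * M)))" by (rule real_sqrt_le_mono)
        also have "\<dots> = 2 * sqrt (real k) * sqrt (real M)" by (simp add: real_sqrt_mult)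
        finally have sq: "sqrt (real N) \<le> 2 * sqrt (real k) * sqrt (real M)" .
        have "\<bar>(\<Sum>m\<in>{1..M}. g m) - G\<bar> \<le> K / sqrt (real M)" by (rule C1(2)[OF M1])
        also have "\<dots> \<le> K * (2 * sqrt (real k) / sqrt (real N))"
          using sq N M1 C1 by (simp add: field_simps)
        finally have b: "\<bar>(\<Sum>m\<in>{1..M}. g m) - G\<bar> \<le> K * (2 * sqrt (real k) / sqrt (real N))" .
        have "\<bar>a k * ((\<Sum>m\<in>{1..M}. g m) - G)\<bar> \<le> (c * real k powr (-7/4)) * (K * (2 * sqrt (real k) / sqrt (real N)))"
          unfolding abs_mult using b a[of k] k c0 by (intro mult_mono) auto
        also have "\<dots> = (2 * c * K / sqrt (real N)) * (real k powr (-7/4) * real k powr (1/2))"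
          using k by (simp add: powr_half_sqrt)
        also have "real k powr (-7/4) * real k powr (1/2) = real k powr (-5/4)"
          by (simp flip: powr_add)
        finally show "\<bar>a k * ((\<Sum>m\<in>{1..N div k}. g m) - G)\<bar> \<le> (2 * c * K / sqrt (real N)) * real k powr (-5/4)"
          by (simp add: M_def)
      qed
      show "\<bar>((\<Sum>k\<in>{1..N}. a k) - A) * G\<bar> \<le> (K / sqrt (real N)) * \<bar>G\<bar>"
        unfolding abs_mult by (intro mult_right_mono C2 N) auto
    qed
    also have "(\<Sum>k\<in>{1..N}. (2 * c * K / sqrt (real N)) * real k powr (-5/4)) \<le> (2 * c * K / sqrt (real N)) * C3"
      unfolding sum_distrib_left[symmetric] using c0 C1 by (intro mult_left_mono C3) auto
    also have "(2 * c * K / sqrt (real N)) * C3 + (K / sqrt (real N)) * \<bar>G\<bar> \<le>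
        (2 * c * K / sqrt (real N)) * C3 + (K / sqrt (real N)) * (c + K)"
      using K \<open>\<bar>G\<bar> \<le> c + K\<close> by (intro add_left_mono mult_left_mono) auto
    also have "\<dots> \<le> (2 * c * K * C3 + K * (c + K) + 1) / sqrt (real N)"
      by (simp add: add_divide_distrib)
    finally show ?thesis unfolding A_def G_def by simp
  qed
  have "2 * c * K * C3 + K * (c + K) + 1 > 0" using c0 K C3 by (intro add_nonneg_pos add_nonneg_nonneg) auto
  then show ?thesis using main by (rule that)
qed

text \<open>Used for identities between series: the partial sums of a suitable convolution are known
  exactly and lie within \<open>C / sqrt N\<close> of the product of the limits.\<close>

lemma limit_const_eqI:
  fixes x y :: real
  assumes "\<And>N. N \<ge> 1 \<Longrightarrow> \<bar>x - y\<bar> \<le> C / sqrt (real N)"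
  shows "x = y"
proof -
  have "(\<lambda>N. C / sqrt (real N)) \<longlonglongrightarrow> 0"
    by real_asymp
  moreover have "\<forall>\<^sub>F N in sequentially. \<bar>x - y\<bar> \<le> C / sqrt (real N)"
    using eventually_ge_at_top[of "1::nat"] by eventually_elim (rule assms)
  ultimately have "\<bar>x - y\<bar> \<le> 0" by (intro tendsto_lowerbound) auto
  then show ?thesis by simp
qed

lemma ln_le_powr_quarter: "m \<ge> 1 \<Longrightarrow> ln (real m) \<le> 4 * real m powr (1/4)"
  using ln_powr_bound[of "real m" "1/4"] by simp

text \<open>The factor \<open>4\<close> matches \<open>ln_over_square_le_powr\<close>, so that the
  coefficients with and without a logarithm satisfy the same hypothesis of
  \<open>hyperbola_product_bound\<close>.\<close>

lemma inverse_square_le_powr: "m \<ge> 1 \<Longrightarrow> 1 / real m ^ 2 \<le> 4 * real m powr (-7/4)"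
proof -
  assume m: "m \<ge> 1"
  have "1 / real m ^ 2 = real m powr (-2)" using m by (simp add: powr_minus powr_numeral inverse_eq_divide)
  also have "\<dots> \<le> real m powr (-7/4)" using m by (intro powr_mono) auto
  also have "\<dots> \<le> 4 * \<dots>" by simp
  finally show ?thesis .
qed

lemma ln_over_square_le_powr: "m \<ge> 1 \<Longrightarrow> ln (real m) / real m ^ 2 \<le> 4 * real m powr (-7/4)"
proof -
  assume m: "m \<ge> 1"
  have "ln (real m) / real m ^ 2 \<le> 4 * real m powr (1/4) / real m ^ 2"
    using ln_le_powr_quarter[OF m] by (rule divide_right_mono) simp
  also have "\<dots> = 4 * (real m powr (1/4) * real m powr (-2))" using m by (simp add: powr_minus powr_numeral inverse_eq_divide)
  also have "real m powr (1/4) * real m powr (-2) = real m powr (-7/4)" by (simp flip: powr_add)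
  finally show ?thesis .
qed

lemma abs_le_inverse_square_imp_powr:
  "m \<ge> 1 \<Longrightarrow> \<bar>b\<bar> \<le> 1 \<Longrightarrow> \<bar>b / real m ^ 2\<bar> \<le> 4 * real m powr (-7/4)"
  using inverse_square_le_powr[of m] divide_right_mono[of "\<bar>b\<bar>" 1 "real m ^ 2"] by simp

lemma moebius_ln_le_powr: "m \<ge> 1 \<Longrightarrow> \<bar>moebius m * ln (real m) / real m ^ 2\<bar> \<le> 4 * real m powr (-7/4)"
proof -
  assume m: "m \<ge> 1"
  have "\<bar>moebius m\<bar> * (ln (real m) / real m ^ 2) \<le> 1 * (ln (real m) / real m ^ 2)"
    using m by (intro mult_right_mono abs_moebius_le) auto
  then show ?thesis using ln_over_square_le_powr[OF m] m by (simp add: abs_mult)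
qed

section \<open>Moebius series and the derivative of zeta at 2\<close>

lemma zeta_2: "zeta (2::real) = (\<Sum>n. 1 / real (Suc n) ^ 2)"
  unfolding zeta_def
  by (intro arg_cong[where f = suminf] ext) (simp add: powr_minus powr_numeral inverse_eq_divide del: of_nat_Suc)

lemma zeta_2_pos: "zeta (2::real) > 0"
proof -
  have "summable (\<lambda>n. 1 / real (Suc n) ^ 2)"
    by (rule series_tail_bound(1)[where g = "\<lambda>m. 1 / real m ^ 2" and c = 4]) (use inverse_square_le_powr in auto)
  then show ?thesis unfolding zeta_2 by (rule suminf_pos) auto
qed

text \<open>The convolution of \<open>moebius\<close> with \<open>1\<close> is supported at
  \<open>1\<close>, so its weighted partial sums are all equal to \<open>1\<close>.\<close>

lemma moebius_series: "(\<Sum>n. moebius (Suc n) / real (Suc n) ^ 2) = 1 / zeta 2"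
proof -
  define A where "A = (\<Sum>n. moebius (Suc n) / real (Suc n) ^ 2)"
  obtain C where C: "C > 0" "\<And>N. N \<ge> 1 \<Longrightarrow> \<bar>(\<Sum>k\<in>{1..N}. \<Sum>m\<in>{1..N div k}. (moebius k / real k ^ 2) * (1 / real m ^ 2)) - A * zeta 2\<bar> \<le> C / sqrt (real N)"
  proof (rule hyperbola_product_bound[of 4])
    fix C :: real
    assume "C > 0" and C: "\<And>a g N. (\<And>k. k \<ge> 1 \<Longrightarrow> \<bar>a k\<bar> \<le> 4 * real k powr (-7/4)) \<Longrightarrow>
      (\<And>m. m \<ge> 1 \<Longrightarrow> \<bar>g m\<bar> \<le> 4 * real m powr (-7/4)) \<Longrightarrow> N \<ge> 1 \<Longrightarrow>
      \<bar>(\<Sum>k\<in>{1..N}. \<Sum>m\<in>{1..N div k}. a k * g m) - (\<Sum>n. a (Suc n)) * (\<Sum>n. g (Suc n))\<bar> \<le> C / sqrt (real N)"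
    show thesis
      by (rule that[OF \<open>C > 0\<close>], unfold A_def zeta_2, rule C)
        (use abs_le_inverse_square_imp_powr abs_moebius_le inverse_square_le_powr in auto)
  qed simp
  have one: "(\<Sum>k\<in>{1..N}. \<Sum>m\<in>{1..N div k}. (moebius k / real k ^ 2) * (1 / real m ^ 2)) = 1" if "N \<ge> 1" for N
  proof -
    have "(\<Sum>k\<in>{1..N}. \<Sum>m\<in>{1..N div k}. (moebius k / real k ^ 2) * (1 / real m ^ 2)) =
       (\<Sum>e\<in>{1..N}. \<Sum>d | d dvd e. moebius d / real d ^ 2 * (1 / real (e div d) ^ 2))"
      by (rule sum_divisors_eq[symmetric])
    also have "\<dots> = (\<Sum>e\<in>{1..N}. (\<Sum>d | d dvd e. moebius d) / real e ^ 2)"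
      unfolding sum_divide_distrib
      by (intro sum.cong refl) (auto simp: real_of_nat_div power_divide)
    also have "\<dots> = (\<Sum>e\<in>{1..N}. if e = 1 then 1 else 0)"
      by (intro sum.cong refl) (auto simp: sum_moebius_divisors)
    also have "\<dots> = 1" using that by simp
    finally show ?thesis .
  qed
  have "1 = A * zeta 2" by (rule limit_const_eqI[of _ _ C]) (use C one in force)
  then show ?thesis using zeta_2_pos by (simp add: A_def field_simps)
qed

text \<open>This is -\<zeta>'(2) by \<open>deriv_zeta_2\<close>, in the form in which Moebius sums
  with logarithms produce it.\<close>

definition zeta_log :: real where
  "zeta_log = (\<Sum>n. ln (real (Suc n)) / real (Suc n) ^ 2)"

text \<open>Since \<open>ln (d * m) = ln d + ln m\<close>, the two convolutions of
  \<open>moebius\<close> with \<open>1\<close> that carry the logarithm on either factor add up, at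
  \<open>e\<close>, to \<open>ln e\<close> times the divisor sum of \<open>moebius\<close>. This is
  \<open>0\<close> for every \<open>e\<close>, at \<open>e = 1\<close> because of the
  logarithm.\<close>

lemma moebius_ln_series: "(\<Sum>n. moebius (Suc n) * ln (real (Suc n)) / real (Suc n) ^ 2) = - zeta_log / zeta 2 ^ 2"
proof -
  define B where "B = (\<Sum>n. moebius (Suc n) * ln (real (Suc n)) / real (Suc n) ^ 2)"
  obtain C where C: "C > 0" "\<And>N. N \<ge> 1 \<Longrightarrow> \<bar>(\<Sum>k\<in>{1..N}. \<Sum>m\<in>{1..N div k}. (moebius k * ln (real k) / real k ^ 2) * (1 / real m ^ 2)) - B * zeta 2\<bar> \<le> C / sqrt (real N)"
  proof (rule hyperbola_product_bound[of 4])
    fix C :: real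
    assume "C > 0" and C: "\<And>a g N. (\<And>k. k \<ge> 1 \<Longrightarrow> \<bar>a k\<bar> \<le> 4 * real k powr (-7/4)) \<Longrightarrow>
      (\<And>m. m \<ge> 1 \<Longrightarrow> \<bar>g m\<bar> \<le> 4 * real m powr (-7/4)) \<Longrightarrow> N \<ge> 1 \<Longrightarrow>
      \<bar>(\<Sum>k\<in>{1..N}. \<Sum>m\<in>{1..N div k}. a k * g m) - (\<Sum>n. a (Suc n)) * (\<Sum>n. g (Suc n))\<bar> \<le> C / sqrt (real N)"
    show thesis
      by (rule that[OF \<open>C > 0\<close>], unfold B_def zeta_2, rule C)
        (use moebius_ln_le_powr inverse_square_le_powr in auto)
  qed simp
  obtain D where D: "D > 0" "\<And>N. N \<ge> 1 \<Longrightarrow> \<bar>(\<Sum>k\<in>{1..N}. \<Sum>m\<in>{1..N div k}. (moebius k / real k ^ 2) * (ln (real m) / real m ^ 2)) - (1 / zeta 2) * zeta_log\<bar> \<le> D / sqrt (real N)"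
  proof (rule hyperbola_product_bound[of 4])
    fix C :: real
    assume "C > 0" and C: "\<And>a g N. (\<And>k. k \<ge> 1 \<Longrightarrow> \<bar>a k\<bar> \<le> 4 * real k powr (-7/4)) \<Longrightarrow>
      (\<And>m. m \<ge> 1 \<Longrightarrow> \<bar>g m\<bar> \<le> 4 * real m powr (-7/4)) \<Longrightarrow> N \<ge> 1 \<Longrightarrow>
      \<bar>(\<Sum>k\<in>{1..N}. \<Sum>m\<in>{1..N div k}. a k * g m) - (\<Sum>n. a (Suc n)) * (\<Sum>n. g (Suc n))\<bar> \<le> C / sqrt (real N)"
    show thesis
      by (rule that[OF \<open>C > 0\<close>], unfold moebius_series[symmetric] zeta_log_def, rule C)
        (use abs_le_inverse_square_imp_powr abs_moebius_le ln_over_square_le_powr in auto)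
  qed simp
  have zero: "(\<Sum>k\<in>{1..N}. \<Sum>m\<in>{1..N div k}. (moebius k * ln (real k) / real k ^ 2) * (1 / real m ^ 2)) +
     (\<Sum>k\<in>{1..N}. \<Sum>m\<in>{1..N div k}. (moebius k / real k ^ 2) * (ln (real m) / real m ^ 2)) = 0" for N
  proof -
    have "(\<Sum>k\<in>{1..N}. \<Sum>m\<in>{1..N div k}. (moebius k * ln (real k) / real k ^ 2) * (1 / real m ^ 2)) +
     (\<Sum>k\<in>{1..N}. \<Sum>m\<in>{1..N div k}. (moebius k / real k ^ 2) * (ln (real m) / real m ^ 2)) =
      (\<Sum>k\<in>{1..N}. \<Sum>m\<in>{1..N div k}. moebius k * ln (real (k * m)) / real (k * m) ^ 2)"
      unfolding sum.distrib[symmetric]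
      by (intro sum.cong refl) (simp add: ln_mult power_mult_distrib field_simps)
    also have "\<dots> = (\<Sum>e\<in>{1..N}. \<Sum>d | d dvd e. moebius d * ln (real (d * (e div d))) / real (d * (e div d)) ^ 2)"
      by (rule sum_divisors_eq[symmetric])
    also have "\<dots> = (\<Sum>e\<in>{1..N}. (\<Sum>d | d dvd e. moebius d) * (ln (real e) / real e ^ 2))"
      unfolding sum_distrib_right by (intro sum.cong refl) auto
    also have "\<dots> = (\<Sum>e\<in>{1..N}. 0)"
      by (intro sum.cong refl) (auto simp: sum_moebius_divisors)
    finally show ?thesis by simp
  qed
  have "B * zeta 2 = - ((1 / zeta 2) * zeta_log)"
  proof (rule limit_const_eqI[of _ _ "C + D"])
    fix N :: nat assume N: "N \<ge> 1"
    show "\<bar>B * zeta 2 - - ((1 / zeta 2) * zeta_log)\<bar> \<le> (C + D) / sqrt (real N)"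
      using C(2)[OF N] D(2)[OF N] zero[of N] unfolding add_divide_distrib by linarith
  qed
  then show ?thesis using zeta_2_pos unfolding B_def[symmetric] by (simp add: field_simps power2_eq_square)
qed

text \<open>Termwise differentiation on \<open>{7/4..9/4}\<close>, where
  \<open>ln n \<le> 4 * n powr (1/4)\<close> bounds the derivatives by a summable series with
  exponent \<open>-3/2\<close>.\<close>

lemma deriv_zeta_2: "deriv zeta (2::real) = - zeta_log"
proof -
  define f f' :: "nat \<Rightarrow> real \<Rightarrow> real"
    where "f = (\<lambda>n x. real (Suc n) powr (- x))" and "f' = (\<lambda>n x. - ln (real (Suc n)) * real (Suc n) powr (- x))"
  have sm: "summable (\<lambda>n. real (Suc n) powr (-3/2))"
    by (rule summable_Suc_powr) simp
  have "((\<lambda>x. \<Sum>n. f n x) has_field_derivative (\<Sum>n. f' n 2)) (at 2)"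
  proof (rule has_field_derivative_series')
    show "convex {7/4..9/4::real}" by (rule convex_real_interval)
    show "(f n has_field_derivative f' n x) (at x within {7/4..9/4})" for n x
      unfolding f_def f'_def powr_def by (auto intro!: derivative_eq_intros simp del: of_nat_Suc)
    show "uniformly_convergent_on {7/4..9/4} (\<lambda>n x. \<Sum>i<n. f' i x)"
    proof (rule Weierstrass_m_test'[where M = "\<lambda>n. 4 * real (Suc n) powr (-3/2)"])
      fix n and x :: real assume x: "x \<in> {7/4..9/4}"
      have "norm (f' n x) = ln (real (Suc n)) * real (Suc n) powr (- x)"
        unfolding f'_def norm_mult real_norm_def abs_minus by (simp del: of_nat_Suc)
      also have "\<dots> \<le> (4 * real (Suc n) powr (1/4)) * real (Suc n) powr (-7/4)"
        using x ln_le_powr_quarter[of "Suc n"] by (intro mult_mono powr_mono) auto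
      also have "\<dots> = 4 * real (Suc n) powr (-3/2)" by (simp flip: powr_add del: of_nat_Suc)
      finally show "norm (f' n x) \<le> 4 * real (Suc n) powr (-3/2)" .
    qed (intro summable_mult sm)
    show "(2::real) \<in> {7/4..9/4}" by simp
    show "summable (\<lambda>n. f n 2)" unfolding f_def by (rule summable_Suc_powr) simp
    show "(2::real) \<in> interior {7/4..9/4}" by simp
  qed
  moreover have "(\<lambda>x. \<Sum>n. f n x) = zeta" by (simp add: zeta_def f_def fun_eq_iff)
  moreover have "(\<Sum>n. f' n 2) = - zeta_log"
  proof -
    have "summable (\<lambda>n. ln (real (Suc n)) / real (Suc n) ^ 2)"
      by (rule series_tail_bound(1)[where g = "\<lambda>m. ln (real m) / real m ^ 2" and c = 4]) (use ln_over_square_le_powr in auto)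
    then have "- zeta_log = (\<Sum>n. - (ln (real (Suc n)) / real (Suc n) ^ 2))" unfolding zeta_log_def by (rule suminf_minus[symmetric])
    also have "\<dots> = (\<Sum>n. f' n 2)"
      by (intro arg_cong[where f = suminf] ext) (simp add: f'_def powr_minus powr_numeral inverse_eq_divide del: of_nat_Suc)
    finally show ?thesis ..
  qed
  ultimately show ?thesis by (simp add: DERIV_imp_deriv)
qed

section \<open>Lattice points in a triangle\<close>

text \<open>The bound \<open>X\<close> is real because Moebius inversion over common divisors
  \<open>k\<close> of \<open>t\<close> and \<open>s\<close> replaces \<open>Q\<close> by
  \<open>Q / k\<close>.\<close>

definition cone_count :: "nat \<Rightarrow> nat \<Rightarrow> real \<Rightarrow> nat" where
  "cone_count d e X = card {(t,s). 1 \<le> t \<and> 1 \<le> s \<and> real (t * d + s * e) \<le> X}"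

lemma cone_count_eq_sum:
  assumes d: "1 \<le> d" and e: "1 \<le> e" and X: "0 \<le> X"
  shows "finite {(t,s). 1 \<le> t \<and> 1 \<le> s \<and> real (t * d + s * e) \<le> X}"
    "real (cone_count d e X) = (\<Sum>t\<in>{1..nat \<lfloor>X / real d\<rfloor>}. real (nat \<lfloor>(X - real t * real d) / real e\<rfloor>))"
proof -
  have iff: "t \<le> nat \<lfloor>x\<rfloor> \<longleftrightarrow> real t \<le> x" if "1 \<le> t" for t and x :: real
  proof -
    have "t \<le> nat \<lfloor>x\<rfloor> \<longleftrightarrow> int t \<le> \<lfloor>x\<rfloor>" using that by linarith
    then show ?thesis by (simp add: le_floor_iff)
  qed
  have eq: "{(t,s). 1 \<le> t \<and> 1 \<le> s \<and> real (t * d + s * e) \<le> X} =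
     (SIGMA t:{1..nat \<lfloor>X / real d\<rfloor>}. {1..nat \<lfloor>(X - real t * real d) / real e\<rfloor>})"
  proof (rule Set.set_eqI, rule prod.induct)
    fix t s
    have "s \<le> nat \<lfloor>(X - real t * real d) / real e\<rfloor> \<longleftrightarrow> real (t * d + s * e) \<le> X" if "1 \<le> s"
      unfolding iff[OF that] using e by (simp add: pos_le_divide_eq algebra_simps)
    moreover have "t \<le> nat \<lfloor>X / real d\<rfloor>" if "1 \<le> t" "real (t * d + s * e) \<le> X"
    proof -
      have "real t * real d + real s * real e \<le> X" "0 \<le> real s * real e" using that by simp_all
      then have "real t * real d \<le> X" by linarith
      then show ?thesis unfolding iff[OF that(1)] using d by (simp add: pos_le_divide_eq)
    qed
    ultimately show "(t,s) \<in> {(t,s). 1 \<le> t \<and> 1 \<le> s \<and> real (t * d + s * e) \<le> X} \<longleftrightarrow>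
       (t,s) \<in> (SIGMA t:{1..nat \<lfloor>X / real d\<rfloor>}. {1..nat \<lfloor>(X - real t * real d) / real e\<rfloor>})"
      by (cases "1 \<le> s"; cases "1 \<le> t") auto
  qed
  show "finite {(t,s). 1 \<le> t \<and> 1 \<le> s \<and> real (t * d + s * e) \<le> X}" unfolding eq by auto
  show "real (cone_count d e X) = (\<Sum>t\<in>{1..nat \<lfloor>X / real d\<rfloor>}. real (nat \<lfloor>(X - real t * real d) / real e\<rfloor>))"
    unfolding cone_count_def eq by (subst card_SigmaI) auto
qed

text \<open>Row \<open>t\<close> contributes the floor of \<open>(X - t d) / e\<close>. Without the
  floors the rows add up to \<open>S / e\<close>, where \<open>X ^ 2 - 2 d S\<close> lies between
  \<open>0\<close> and \<open>d X\<close>; so the upper bound has no error term. For the lower bound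
  the floors cost at most one per row, and there are at most \<open>X / d \<le> X / e\<close>
  rows.\<close>

lemma cone_count_bounds:
  assumes e: "1 \<le> e" and d: "e \<le> d" and X: "0 \<le> X"
  shows "real (cone_count d e X) \<le> X ^ 2 / (2 * real d * real e)"
    "X ^ 2 / (2 * real d * real e) - 2 * X / real e \<le> real (cone_count d e X)"
proof -
  define n where "n = nat \<lfloor>X / real d\<rfloor>"
  define r where "r = X - real d * real n"
  have d1: "1 \<le> d" using d e by simp
  have dn: "real n \<le> X / real d" "X / real d < real n + 1" using X d1 by (auto simp: n_def)
  have r: "0 \<le> r" "r \<le> real d" using dn d1 by (auto simp: r_def field_simps)
  have eq: "real (cone_count d e X) = (\<Sum>t\<in>{1..n}. real (nat \<lfloor>(X - real t * real d) / real e\<rfloor>))"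
    unfolding n_def by (rule cone_count_eq_sum) (use d1 e X in auto)
  define S where "S = (\<Sum>t\<in>{1..n}. (X - real t * real d))"
  have S: "2 * S = 2 * real n * X - real d * real n * (real n + 1)"
  proof -
    have T: "2 * (\<Sum>t\<in>{1..n}. real t) = real n * (real n + 1)" by (induction n) (auto simp: algebra_simps)
    have "S = real n * X - (\<Sum>t\<in>{1..n}. real t) * real d"
      by (simp add: S_def sum_subtractf sum_distrib_right)
    then have "2 * S = 2 * real n * X - (2 * (\<Sum>t\<in>{1..n}. real t)) * real d" by simp
    then show ?thesis unfolding T by (simp only: mult_ac)
  qed
  have key: "X ^ 2 - 2 * real d * S = r ^ 2 + real d ^ 2 * real n"
  proof -
    have "2 * real d * S = real d * (2 * real n * X - real d * real n * (real n + 1))" by (simp flip: S)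
    then show ?thesis by (simp add: r_def power2_eq_square algebra_simps)
  qed
  have nonneg: "0 \<le> (X - real t * real d) / real e" if "t \<in> {1..n}" for t
  proof -
    have "real t * real d \<le> real n * real d" using that by (intro mult_right_mono) auto
    also have "\<dots> \<le> X" using dn d1 by (simp add: pos_le_divide_eq)
    finally show ?thesis by simp
  qed
  have Se: "(\<Sum>t\<in>{1..n}. (X - real t * real d) / real e) = S / real e" by (simp add: S_def sum_divide_distrib)
  have "real (cone_count d e X) \<le> (\<Sum>t\<in>{1..n}. (X - real t * real d) / real e)"
    unfolding eq by (intro sum_mono) (use nonneg in auto)
  also have "\<dots> \<le> (X ^ 2 / (2 * real d)) / real e"
    unfolding Se
  proof (rule divide_right_mono)
    have "2 * real d * S \<le> X ^ 2" using key by (smt (verit) mult_nonneg_nonneg of_nat_0_le_iff zero_le_power2)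
    then show "S \<le> X ^ 2 / (2 * real d)" using d1 by (simp add: pos_le_divide_eq mult_ac)
  qed simp
  finally show "real (cone_count d e X) \<le> X ^ 2 / (2 * real d * real e)" by simp
  have "r ^ 2 \<le> real d * r" unfolding power2_eq_square using r by (intro mult_right_mono) auto
  then have "r ^ 2 + real d ^ 2 * real n \<le> real d * X" by (simp add: r_def power2_eq_square algebra_simps)
  then have "X ^ 2 - real d * X \<le> 2 * real d * S" using key by linarith
  then have "(X ^ 2 - real d * X) / (2 * real d) \<le> S" using d1 by (simp add: pos_divide_le_eq mult_ac)
  then have SL: "X ^ 2 / (2 * real d) - X / 2 \<le> S" using d1 by (simp add: diff_divide_distrib)
  have "(X ^ 2 / (2 * real d) - X / 2) / real e - real n \<le> S / real e - real n"
    using SL by (intro diff_right_mono divide_right_mono) auto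
  also have "\<dots> = (\<Sum>t\<in>{1..n}. (X - real t * real d) / real e - 1)" unfolding Se[symmetric] by (simp add: sum_subtractf)
  also have "\<dots> \<le> real (cone_count d e X)" unfolding eq
  proof (rule sum_mono)
    fix t assume "t \<in> {1..n}"
    then have "0 \<le> \<lfloor>(X - real t * real d) / real e\<rfloor>" using nonneg by (simp only: zero_le_floor)
    then show "(X - real t * real d) / real e - 1 \<le> real (nat \<lfloor>(X - real t * real d) / real e\<rfloor>)"
      by (simp add: le_diff_eq[symmetric] real_of_int_floor_gt_diff_one less_imp_le)
  qed
  finally have low: "(X ^ 2 / (2 * real d) - X / 2) / real e - real n \<le> real (cone_count d e X)" .
  have "real n \<le> X / real e"
    by (rule order_trans[OF dn(1)]) (use d e X in \<open>auto intro!: divide_left_mono\<close>)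
  moreover have "X / real e = 2 * (X / (2 * real e))" "2 * X / real e = 2 * (X / real e)" by simp_all
  moreover have "0 \<le> X / real e" using X by simp
  ultimately have "real n + X / (2 * real e) \<le> 2 * X / real e" by linarith
  then show "X ^ 2 / (2 * real d * real e) - 2 * X / real e \<le> real (cone_count d e X)"
    using low by (simp add: diff_divide_distrib)
qed

text \<open>The geometric mean of the error bounds \<open>2 X / e\<close> and
  \<open>X ^ 2 / (2 d e)\<close>. At \<open>X = Q / k\<close> the former would sum over
  \<open>k\<close> to a logarithm, whereas \<open>k powr (-3/2)\<close> converges; the price is the
  factor \<open>1 / sqrt d\<close>, whose sum over \<open>d\<close> is
  \<open>O(sqrt Q)\<close>.\<close>

lemma cone_count_approx:
  assumes e: "1 \<le> e" and d: "e \<le> d" and X: "0 \<le> X"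
  shows "\<bar>real (cone_count d e X) - X ^ 2 / (2 * real d * real e)\<bar> \<le> X powr (3/2) / (real e * sqrt (real d))"
proof -
  define a where "a = \<bar>real (cone_count d e X) - X ^ 2 / (2 * real d * real e)\<bar>"
  note b = cone_count_bounds[OF e d X]
  have a1: "a \<le> 2 * X / real e" "a \<le> X ^ 2 / (2 * real d * real e)" "0 \<le> a"
    using b X by (auto simp: a_def abs_le_iff)
  have "a * a \<le> (2 * X / real e) * (X ^ 2 / (2 * real d * real e))"
    using a1 X by (intro mult_mono) auto
  also have "\<dots> = X ^ 3 / (real e ^ 2 * real d)" by (simp add: power2_eq_square power3_eq_cube mult_ac)
  also have "\<dots> = (X powr (3/2) / (real e * sqrt (real d))) ^ 2"
  proof -
    have "(X powr (3/2)) ^ 2 = X powr 3" by (simp add: power2_eq_square flip: powr_add)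
    also have "\<dots> = X ^ 3" using X by (cases "X = 0") (simp_all add: powr_numeral)
    finally show ?thesis by (simp add: power_divide power_mult_distrib)
  qed
  finally have "a ^ 2 \<le> (X powr (3/2) / (real e * sqrt (real d))) ^ 2" by (simp add: power2_eq_square)
  then show ?thesis unfolding a_def[symmetric] by (rule power2_le_imp_le) simp
qed

lemma coprime_cone_eq_sum_moebius:
  assumes d: "1 \<le> d" and e: "1 \<le> e"
  shows "real (coprime_cone Q d e) = (\<Sum>k\<in>{1..Q}. moebius k * real (cone_count d e (real Q / real k)))"
proof -
  let ?S = "{(t,s). 1 \<le> t \<and> 1 \<le> s \<and> real (t * d + s * e) \<le> real Q}"
  have fin: "finite ?S" by (rule cone_count_eq_sum(1)) (use d e in auto)
  have "{(t,s). 1 \<le> t \<and> 1 \<le> s \<and> coprime t s \<and> t * d + s * e \<le> Q} = {p\<in>?S. coprime (fst p) (snd p)}"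
    unfolding of_nat_le_iff by auto
  then have "real (coprime_cone Q d e) = (\<Sum>p\<in>{p\<in>?S. coprime (fst p) (snd p)}. 1)"
    by (simp add: coprime_cone_def)
  also have "\<dots> = (\<Sum>p\<in>?S. if coprime (fst p) (snd p) then 1 else 0)" by (rule sum.inter_filter[OF fin])
  also have "\<dots> = (\<Sum>p\<in>?S. \<Sum>k\<in>{1..Q}. if k dvd fst p \<and> k dvd snd p then moebius k else 0)"
  proof (rule sum.cong[OF refl])
    fix p assume "p \<in> ?S"
    then obtain t s where p: "p = (t,s)" "1 \<le> t" "t * d + s * e \<le> Q" unfolding of_nat_le_iff by auto
    have "t * 1 \<le> t * d" using d by (intro mult_le_mono) auto
    then have "t \<le> Q" using p by linarith
    then show "(if coprime (fst p) (snd p) then 1 else 0) = (\<Sum>k\<in>{1..Q}. if k dvd fst p \<and> k dvd snd p then moebius k else 0)"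
      using coprime_indicator_sum_moebius[of t Q s] p by simp
  qed
  also have "\<dots> = (\<Sum>k\<in>{1..Q}. \<Sum>p\<in>?S. if k dvd fst p \<and> k dvd snd p then moebius k else 0)" by (rule sum.swap)
  also have "\<dots> = (\<Sum>k\<in>{1..Q}. moebius k * real (cone_count d e (real Q / real k)))"
  proof (rule sum.cong[OF refl])
    fix k assume k: "k \<in> {1..Q}"
    have "(\<Sum>p\<in>?S. if k dvd fst p \<and> k dvd snd p then moebius k else 0) = (\<Sum>p\<in>{p\<in>?S. k dvd fst p \<and> k dvd snd p}. moebius k)"
      by (rule sum.inter_filter[OF fin, symmetric])
    also have "\<dots> = moebius k * real (card {p\<in>?S. k dvd fst p \<and> k dvd snd p})" by simp
    also have "{p\<in>?S. k dvd fst p \<and> k dvd snd p} =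
       (\<lambda>(t,s). (k * t, k * s)) ` {(t,s). 1 \<le> t \<and> 1 \<le> s \<and> real (t * d + s * e) \<le> real Q / real k}" (is "?L = ?f ` ?R")
    proof (intro equalityI subsetI)
      fix p assume "p \<in> ?L"
      then obtain t s where p: "p = (k * t, k * s)" and h: "1 \<le> k * t" "1 \<le> k * s" "real (k * t * d + k * s * e) \<le> real Q"
        by (auto elim!: dvdE)
      have "real k * real (t * d + s * e) \<le> real Q" using h(3) by (simp add: algebra_simps)
      then have "real (t * d + s * e) \<le> real Q / real k" using k by (simp add: pos_le_divide_eq mult.commute)
      moreover have "1 \<le> t" "1 \<le> s" using h by (auto simp: Suc_le_eq)
      ultimately have "(t,s) \<in> ?R" by simp
      then show "p \<in> ?f ` ?R" unfolding p by force
    next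
      fix p assume "p \<in> ?f ` ?R"
      then obtain t s where p: "p = (k * t, k * s)" and h: "1 \<le> t" "1 \<le> s" "real (t * d + s * e) \<le> real Q / real k" by auto
      have "real k * real (t * d + s * e) \<le> real Q" using h(3) k by (simp add: pos_le_divide_eq mult.commute)
      then have "real (k * t * d + k * s * e) \<le> real Q" by (simp add: algebra_simps)
      then show "p \<in> ?L" using h k by (auto simp: p Suc_le_eq)
    qed
    also have "card (?f ` ?R) = card ?R" by (rule card_image) (use k in \<open>auto simp: inj_on_def\<close>)
    finally show "(\<Sum>p\<in>?S. if k dvd fst p \<and> k dvd snd p then moebius k else 0) = moebius k * real (cone_count d e (real Q / real k))"
      by (simp add: cone_count_def)
  qed
  finally show ?thesis .
qed

lemma moebius_partial_sums:
  obtains C where "C > 0"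
    "\<And>N. N \<ge> 1 \<Longrightarrow> \<bar>(\<Sum>k\<in>{1..N}. moebius k / real k ^ 2) - 1 / zeta 2\<bar> \<le> C / sqrt (real N)"
    "\<And>N. N \<ge> 1 \<Longrightarrow> \<bar>(\<Sum>k\<in>{1..N}. moebius k * ln (real k) / real k ^ 2) + zeta_log / zeta 2 ^ 2\<bar> \<le> C / sqrt (real N)"
proof -
  obtain C where C: "C > 0" "\<And>g M. (\<And>m. m \<ge> 1 \<Longrightarrow> \<bar>g m\<bar> \<le> 4 * real m powr (-7/4)) \<Longrightarrow> M \<ge> 1 \<Longrightarrow>
    \<bar>(\<Sum>m\<in>{1..M}. g m) - (\<Sum>n. g (Suc n))\<bar> \<le> C / sqrt (real M)"
    using series_tail_bound_uniform[of 4] by auto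
  show ?thesis
  proof (rule that[OF C(1)])
    fix N :: nat assume N: "N \<ge> 1"
    show "\<bar>(\<Sum>k\<in>{1..N}. moebius k / real k ^ 2) - 1 / zeta 2\<bar> \<le> C / sqrt (real N)"
      unfolding moebius_series[symmetric]
      by (rule C(2)[OF _ N]) (intro abs_le_inverse_square_imp_powr abs_moebius_le)
    have "\<bar>(\<Sum>k\<in>{1..N}. moebius k * ln (real k) / real k ^ 2) - (\<Sum>n. moebius (Suc n) * ln (real (Suc n)) / real (Suc n) ^ 2)\<bar> \<le> C / sqrt (real N)"
      by (rule C(2)[OF _ N]) (rule moebius_ln_le_powr)
    then show "\<bar>(\<Sum>k\<in>{1..N}. moebius k * ln (real k) / real k ^ 2) + zeta_log / zeta 2 ^ 2\<bar> \<le> C / sqrt (real N)"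
      unfolding moebius_ln_series by simp
  qed
qed

text \<open>Moebius inversion applied to \<open>cone_count_approx\<close>. Truncating the Moebius
  series at \<open>Q\<close> costs a relative error \<open>1 / sqrt Q\<close>, which fits into the
  same bound because \<open>sqrt d \<le> d\<close>.\<close>

lemma coprime_cone_approx:
  obtains C where "C > 0" "\<And>Q d e. 1 \<le> e \<Longrightarrow> e \<le> d \<Longrightarrow> d \<le> Q \<Longrightarrow>
    \<bar>real (coprime_cone Q d e) - real Q ^ 2 / (2 * zeta 2 * real d * real e)\<bar> \<le> C * (real Q / real e * sqrt (real Q / real d))"
proof -
  obtain C1 where C1: "C1 > 0" "\<And>N. N \<ge> 1 \<Longrightarrow> \<bar>(\<Sum>k\<in>{1..N}. moebius k / real k ^ 2) - 1 / zeta 2\<bar> \<le> C1 / sqrt (real N)"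
    using moebius_partial_sums by metis
  obtain C2 where C2: "C2 > 0" "\<And>N. (\<Sum>k\<in>{1..N}. real k powr (-3/2)) \<le> C2"
    using sum_powr_bounded[of "3/2"] by auto
  have "\<bar>real (coprime_cone Q d e) - real Q ^ 2 / (2 * zeta 2 * real d * real e)\<bar> \<le> (C1 + C2) * (real Q / real e * sqrt (real Q / real d))"
    if e: "1 \<le> e" and d: "e \<le> d" and Q: "d \<le> Q" for Q d e
  proof -
    define A where "A = (\<Sum>k\<in>{1..Q}. moebius k / real k ^ 2)"
    define w where "w = real Q ^ 2 / (2 * real d * real e)"
    define u where "u = real Q / real e * sqrt (real Q / real d)"
    have d1: "1 \<le> d" and Q1: "1 \<le> Q" using e d Q by auto
    have "real (coprime_cone Q d e) = (\<Sum>k\<in>{1..Q}. moebius k * (real (cone_count d e (real Q / real k)) - (real Q / real k) ^ 2 / (2 * real d * real e))) + w * A"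
      unfolding coprime_cone_eq_sum_moebius[OF d1 e] A_def w_def sum_distrib_left sum.distrib[symmetric]
      by (intro sum.cong refl) (simp add: right_diff_distrib power_divide mult_ac)
    moreover have "real Q ^ 2 / (2 * zeta 2 * real d * real e) = w * (1 / zeta 2)"
      by (simp add: w_def mult_ac)
    ultimately have "real (coprime_cone Q d e) - real Q ^ 2 / (2 * zeta 2 * real d * real e) =
      (\<Sum>k\<in>{1..Q}. moebius k * (real (cone_count d e (real Q / real k)) - (real Q / real k) ^ 2 / (2 * real d * real e))) + w * (A - 1 / zeta 2)"
      by (simp add: algebra_simps)
    also have "\<bar>\<dots>\<bar> \<le> u * C2 + u * C1"
    proof (rule order_trans[OF abs_triangle_ineq], rule add_mono)
      have "\<bar>\<Sum>k\<in>{1..Q}. moebius k * (real (cone_count d e (real Q / real k)) - (real Q / real k) ^ 2 / (2 * real d * real e))\<bar> \<le> (\<Sum>k\<in>{1..Q}. u * real k powr (-3/2))"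
      proof (rule order_trans[OF sum_abs], rule sum_mono)
        fix k assume k: "k \<in> {1..Q}"
        have "\<bar>moebius k * (real (cone_count d e (real Q / real k)) - (real Q / real k) ^ 2 / (2 * real d * real e))\<bar> \<le>
            1 * ((real Q / real k) powr (3/2) / (real e * sqrt (real d)))"
          unfolding abs_mult by (intro mult_mono abs_moebius_le cone_count_approx e d) auto
        also have "\<dots> = u * real k powr (-3/2)"
        proof -
          have "(real Q / real k) powr (3/2) = real Q powr (3/2) / real k powr (3/2)"
            by (simp add: powr_divide)
          also have "\<dots> = real Q powr (1 + 1/2) * real k powr (-3/2)"
            by (simp add: powr_minus_divide)
          also have "real Q powr (1 + 1/2) = real Q * sqrt (real Q)"
            unfolding powr_add using Q1 by (simp add: powr_half_sqrt)
          finally show ?thesis by (simp add: u_def real_sqrt_divide)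
        qed
        finally show "\<bar>moebius k * (real (cone_count d e (real Q / real k)) - (real Q / real k) ^ 2 / (2 * real d * real e))\<bar> \<le> u * real k powr (-3/2)" .
      qed
      also have "\<dots> \<le> u * C2" unfolding sum_distrib_left[symmetric] by (intro mult_left_mono C2) (simp add: u_def)
      finally show "\<bar>\<Sum>k\<in>{1..Q}. moebius k * (real (cone_count d e (real Q / real k)) - (real Q / real k) ^ 2 / (2 * real d * real e))\<bar> \<le> u * C2" .
      have "\<bar>w * (A - 1 / zeta 2)\<bar> \<le> w * (C1 / sqrt (real Q))"
        unfolding abs_mult A_def using C1(2)[OF Q1] by (intro mult_mono) (auto simp: w_def)
      also have "\<dots> \<le> u * C1"
      proof -
        have "w / sqrt (real Q) \<le> u"
        proof -
          have "w / sqrt (real Q) = real Q / real e * (sqrt (real Q) / (2 * real d))"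
          proof -
            have q: "real Q ^ 2 = real Q * (sqrt (real Q) * sqrt (real Q))" by (simp add: power2_eq_square)
            have "w = (real Q / real e * (sqrt (real Q) / (2 * real d))) * sqrt (real Q)"
              unfolding w_def q by (simp only: divide_inverse inverse_mult_distrib mult_ac)
            then show ?thesis using Q1 by simp
          qed
          also have "\<dots> \<le> real Q / real e * (sqrt (real Q) / sqrt (real d))"
          proof (intro mult_left_mono divide_left_mono)
            have "real d * 1 \<le> real d * real d" using d1 by (intro mult_left_mono) auto
            then have "sqrt (real d) \<le> real d" by (intro real_le_lsqrt) (auto simp: power2_eq_square)
            then show "sqrt (real d) \<le> 2 * real d" by simp
          qed (use d1 in auto)
          finally show ?thesis by (simp add: u_def real_sqrt_divide)
        qed
        then have "C1 * (w / sqrt (real Q)) \<le> C1 * u" using C1 by (intro mult_left_mono) auto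
        then show ?thesis by (simp add: mult_ac)
      qed
      finally show "\<bar>w * (A - 1 / zeta 2)\<bar> \<le> u * C1" .
    qed
    also have "u * C2 + u * C1 = (C1 + C2) * u" by (simp only: algebra_simps)
    finally show ?thesis unfolding u_def .
  qed
  moreover have "C1 + C2 > 0" using C1 C2 by simp
  ultimately show ?thesis using that by blast
qed

section \<open>Sieving by the divisors of a modulus\<close>

lemma coprime_indicator_divisors:
  assumes "e > 0"
  shows "(if coprime u e then 1 else 0 :: real) = (\<Sum>g | g dvd e. if g dvd u then moebius g else 0)"
proof -
  have "(if coprime u e then 1 else 0 :: real) = (\<Sum>k\<in>{1..e}. if k dvd e \<and> k dvd u then moebius k else 0)"
    using coprime_indicator_sum_moebius[of e e u] assms by (simp add: coprime_commute)
  also have "\<dots> = (\<Sum>k\<in>{1..e}. if k dvd e then (if k dvd u then moebius k else 0) else 0)"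
    by (intro sum.cong refl) auto
  also have "\<dots> = (\<Sum>k\<in>{k\<in>{1..e}. k dvd e}. if k dvd u then moebius k else 0)"
    by (rule sum.inter_filter[symmetric]) simp
  also have "{k\<in>{1..e}. k dvd e} = {g. g dvd e}"
    using assms by (auto simp: dvd_imp_le Suc_le_eq intro!: Nat.gr0I)
  finally show ?thesis .
qed

lemma card_coprime_filter:
  assumes "e > 0" "finite S"
  shows "real (card {u\<in>S. coprime u e}) = (\<Sum>g | g dvd e. moebius g * real (card {u\<in>S. g dvd u}))"
proof -
  have "real (card {u\<in>S. coprime u e}) = (\<Sum>u\<in>S. if coprime u e then 1 else 0)"
    by (simp add: sum.inter_filter[OF assms(2), symmetric])
  also have "\<dots> = (\<Sum>u\<in>S. \<Sum>g | g dvd e. if g dvd u then moebius g else 0)"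
    by (intro sum.cong refl coprime_indicator_divisors assms)
  also have "\<dots> = (\<Sum>g | g dvd e. \<Sum>u\<in>S. if g dvd u then moebius g else 0)" by (rule sum.swap)
  also have "\<dots> = (\<Sum>g | g dvd e. moebius g * real (card {u\<in>S. g dvd u}))"
    by (intro sum.cong refl) (simp add: sum.inter_filter[OF assms(2), symmetric])
  finally show ?thesis .
qed

lemma totient_eq_sum_moebius:
  assumes "e > 0"
  shows "real (totient e) = (\<Sum>g | g dvd e. moebius g * real (e div g))"
proof -
  have "{u. u < e \<and> coprime u e} = {u\<in>{..<e}. coprime u e}" by auto
  then have "real (totient e) = real (card {u\<in>{..<e}. coprime u e})"
    using card_coprime_less[OF assms] by simp
  also have "\<dots> = (\<Sum>g | g dvd e. moebius g * real (card {u\<in>{..<e}. g dvd u}))"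
    by (rule card_coprime_filter[OF assms]) simp
  also have "\<dots> = (\<Sum>g | g dvd e. moebius g * real (e div g))"
    by (intro sum.cong refl) (use card_multiples_less[OF _ assms] in simp)
  finally show ?thesis .
qed

lemma totient_over_eq_sum_moebius:
  assumes "e > 0"
  shows "real (totient e) / real e = (\<Sum>g | g dvd e. moebius g / real g)"
  unfolding totient_eq_sum_moebius[OF assms] sum_divide_distrib
  by (intro sum.cong refl) (use assms in \<open>auto simp: real_of_nat_div\<close>)

section \<open>The contribution of a fixed denominator\<close>

text \<open>For \<alpha> \<ge> 0 the ceiling counts the integers \<open>f \<ge> 0\<close> with
  \<open>f < \<alpha> m\<close>, so this is the excess of the count over
  \<open>\<alpha> m\<close>.\<close>

definition ceil_defect :: "rat \<Rightarrow> nat \<Rightarrow> real" where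
  "ceil_defect \<alpha> m = of_int \<lceil>\<alpha> * of_nat m\<rceil> - of_rat \<alpha> * real m"

lemma ceil_defect_bounds: "0 \<le> ceil_defect \<alpha> m" "ceil_defect \<alpha> m \<le> 1" "\<bar>ceil_defect \<alpha> m\<bar> \<le> 1"
proof -
  define z where "z = \<lceil>\<alpha> * of_nat m\<rceil>"
  have h: "\<alpha> * of_nat m \<le> of_int z" "of_int z < \<alpha> * of_nat m + 1"
    unfolding z_def by linarith+
  have eq: "(of_rat (\<alpha> * of_nat m) :: real) = of_rat \<alpha> * real m" "(of_rat (of_int z) :: real) = of_int z" by (simp_all add: of_rat_mult)
  have "(of_rat (\<alpha> * of_nat m) :: real) \<le> of_rat (of_int z)" using h(1) by (simp only: of_rat_less_eq)
  then show 1: "0 \<le> ceil_defect \<alpha> m" unfolding eq ceil_defect_def z_def[symmetric] by simp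
  have "(of_rat (of_int z) :: real) < of_rat (\<alpha> * of_nat m + 1)" using h(2) by (simp only: of_rat_less)
  then show 2: "ceil_defect \<alpha> m \<le> 1" unfolding ceil_defect_def z_def[symmetric] of_rat_add eq by simp
  show "\<bar>ceil_defect \<alpha> m\<bar> \<le> 1" using 1 2 by simp
qed

text \<open>The sieved defect: by \<open>card_coprime_below\<close> it is the excess of the number
  of \<open>f < \<alpha> e\<close> prime to \<open>e\<close> over
  \<open>\<alpha> \<phi>(e)\<close>.\<close>

definition coprime_defect :: "rat \<Rightarrow> nat \<Rightarrow> real" where
  "coprime_defect \<alpha> e = (\<Sum>g | g dvd e. moebius g * ceil_defect \<alpha> (e div g))"

lemma abs_coprime_defect_le: "\<bar>coprime_defect \<alpha> e\<bar> \<le> real (tau e)"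
proof -
  have "\<bar>coprime_defect \<alpha> e\<bar> \<le> (\<Sum>g | g dvd e. \<bar>moebius g\<bar> * \<bar>ceil_defect \<alpha> (e div g)\<bar>)"
    unfolding coprime_defect_def abs_mult[symmetric] by (rule sum_abs)
  also have "\<dots> \<le> (\<Sum>g | g dvd e. 1 * 1)"
    by (intro sum_mono mult_mono abs_moebius_le ceil_defect_bounds) auto
  finally show ?thesis by (simp add: tau_def)
qed

text \<open>The multiples of \<open>g\<close> below \<open>\<alpha> e\<close> are \<open>g\<close>
  times the integers below \<open>\<alpha> (e / g)\<close>, and the main terms of the sieve add up
  to \<alpha> times the totient.\<close>

lemma card_coprime_below:
  assumes e: "e > 0" and a: "0 \<le> \<alpha>"
  shows "real (card {f. f < nat \<lceil>\<alpha> * of_nat e\<rceil> \<and> coprime f e}) = of_rat \<alpha> * real (totient e) + coprime_defect \<alpha> e"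
proof -
  have fl: "f < nat \<lceil>\<alpha> * of_nat m\<rceil> \<longleftrightarrow> (of_nat f :: rat) < \<alpha> * of_nat m" for f m
    by (simp add: zless_nat_eq_int_zless less_ceiling_iff)
  have c0: "0 \<le> \<lceil>\<alpha> * of_nat m\<rceil>" for m
  proof -
    have "0 \<le> \<alpha> * of_nat m" using a by simp
    then show ?thesis by linarith
  qed
  have "{f. f < nat \<lceil>\<alpha> * of_nat e\<rceil> \<and> coprime f e} = {f\<in>{..<nat \<lceil>\<alpha> * of_nat e\<rceil>}. coprime f e}" by auto
  then have "real (card {f. f < nat \<lceil>\<alpha> * of_nat e\<rceil> \<and> coprime f e}) =
      (\<Sum>g | g dvd e. moebius g * real (card {f\<in>{..<nat \<lceil>\<alpha> * of_nat e\<rceil>}. g dvd f}))"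
    by (simp only: card_coprime_filter[OF e finite_lessThan])
  also have "\<dots> = (\<Sum>g | g dvd e. moebius g * (of_rat \<alpha> * real (e div g)) + moebius g * ceil_defect \<alpha> (e div g))"
  proof (intro sum.cong refl)
    fix g assume "g \<in> {g. g dvd e}"
    then obtain m where m: "e = g * m" by blast
    have g: "g > 0" using e m by simp
    have "{f\<in>{..<nat \<lceil>\<alpha> * of_nat e\<rceil>}. g dvd f} = (\<lambda>f. g * f) ` {..<nat \<lceil>\<alpha> * of_nat m\<rceil>}"
    proof -
      have iff: "g * f < nat \<lceil>\<alpha> * of_nat e\<rceil> \<longleftrightarrow> f < nat \<lceil>\<alpha> * of_nat m\<rceil>" for f
      proof -
        have "(of_nat (g * f) :: rat) < \<alpha> * of_nat e \<longleftrightarrow> of_nat g * of_nat f < of_nat g * (\<alpha> * of_nat m)"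
          by (simp add: m mult_ac)
        also have "\<dots> \<longleftrightarrow> of_nat f < \<alpha> * of_nat m" using g by (intro mult_less_cancel_left_pos) simp
        finally show ?thesis unfolding fl .
      qed
      show ?thesis by (auto simp: iff elim!: dvdE)
    qed
    then have "card {f\<in>{..<nat \<lceil>\<alpha> * of_nat e\<rceil>}. g dvd f} = nat \<lceil>\<alpha> * of_nat m\<rceil>"
      using g by (simp add: card_image inj_on_def)
    moreover have "real (nat \<lceil>\<alpha> * of_nat m\<rceil>) = of_rat \<alpha> * real m + ceil_defect \<alpha> m"
      using c0[of m] by (simp add: ceil_defect_def)
    moreover have "e div g = m" using g by (simp add: m)
    ultimately show "moebius g * real (card {f\<in>{..<nat \<lceil>\<alpha> * of_nat e\<rceil>}. g dvd f}) =
        moebius g * (of_rat \<alpha> * real (e div g)) + moebius g * ceil_defect \<alpha> (e div g)"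
      by (simp add: distrib_left)
  qed
  also have "\<dots> = of_rat \<alpha> * real (totient e) + coprime_defect \<alpha> e"
    unfolding totient_eq_sum_moebius[OF e] coprime_defect_def by (simp add: sum.distrib sum_distrib_left mult_ac)
  finally show ?thesis .
qed

lemma harm_le_ln:
  assumes "M \<ge> 1"
  shows "harm M \<le> 1 + ln (real M)"
proof -
  obtain n where n: "M = Suc n" using assms by (cases M) auto
  have "harm (Suc n) - ln (real (Suc n)) \<le> harm (Suc 0) - ln (real (Suc 0))"
    by (rule decseqD[OF decseq_harm_diff_ln]) simp
  moreover have "harm (Suc 0) = (1::real)" by (simp add: harm_def)
  ultimately show ?thesis unfolding n by simp
qed

lemma sum_inverse_sqrt_le: "(\<Sum>d\<in>{1..n}. 1 / sqrt (real d)) \<le> 2 * sqrt (real n)"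
proof (induction n)
  case (Suc n)
  define x y where "x = sqrt (real n)" and "y = sqrt (real (Suc n))"
  have xy: "0 \<le> x" "0 < y" "x \<le> y" "y ^ 2 = x ^ 2 + 1" by (auto simp: x_def y_def)
  have "(y - x) * (2 * y) \<ge> (y - x) * (y + x)" using xy by (intro mult_left_mono) auto
  moreover have "(y - x) * (y + x) = 1" using xy by (simp add: power2_eq_square algebra_simps)
  ultimately have "1 / y \<le> 2 * (y - x)" using xy by (simp add: pos_divide_le_eq mult_ac)
  then show ?case using Suc by (simp add: x_def y_def)
qed simp

text \<open>Sieving by \<open>g dvd e\<close> leads to harmonic numbers at \<open>Q div g\<close>.
  Each is within \<open>1 + ln e\<close> of \<open>ln Q\<close> because
  \<open>g \<le> e \<le> Q\<close>, and there are \<open>tau e\<close> of them.\<close>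

lemma coprime_harmonic_sum:
  assumes e: "1 \<le> e" and Q: "e \<le> Q"
  shows "\<bar>(\<Sum>d\<in>{1..Q}. if coprime d e then 1 / real d else 0) - real (totient e) / real e * ln (real Q)\<bar>
    \<le> real (tau e) * (1 + ln (real e))"
proof -
  have "(\<Sum>d\<in>{1..Q}. if coprime d e then 1 / real d else 0) = (\<Sum>d\<in>{1..Q}. (if coprime d e then 1 else 0) * (1 / real d))"
    by (intro sum.cong refl) auto
  also have "\<dots> = (\<Sum>d\<in>{1..Q}. \<Sum>g | g dvd e. (if g dvd d then moebius g else 0) * (1 / real d))"
    using e by (simp only: coprime_indicator_divisors sum_distrib_right)
  also have "\<dots> = (\<Sum>g | g dvd e. \<Sum>d\<in>{1..Q}. (if g dvd d then moebius g else 0) * (1 / real d))" by (rule sum.swap)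
  also have "\<dots> = (\<Sum>g | g dvd e. moebius g / real g * harm (Q div g))"
  proof (intro sum.cong refl)
    fix g assume "g \<in> {g. g dvd e}"
    then have g: "g > 0" using e by (auto intro!: Nat.gr0I)
    have "(\<Sum>d\<in>{1..Q}. (if g dvd d then moebius g else 0) * (1 / real d)) = (\<Sum>d\<in>{d\<in>{1..Q}. g dvd d}. moebius g / real d)"
      by (subst sum.inter_filter) (auto intro!: sum.cong)
    also have "\<dots> = (\<Sum>j\<in>{1..Q div g}. moebius g / real (g * j))"
      by (rule sum.reindex_bij_witness[of _ "\<lambda>j. g * j" "\<lambda>d. d div g"])
         (use g in \<open>auto simp: less_eq_div_iff_mult_less_eq mult.commute Suc_le_eq div_le_mono\<close>)
    also have "\<dots> = moebius g / real g * harm (Q div g)"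
      by (simp add: harm_def sum_distrib_left inverse_eq_divide)
    finally show "(\<Sum>d\<in>{1..Q}. (if g dvd d then moebius g else 0) * (1 / real d)) = moebius g / real g * harm (Q div g)" .
  qed
  finally have eq: "(\<Sum>d\<in>{1..Q}. if coprime d e then 1 / real d else 0) = (\<Sum>g | g dvd e. moebius g / real g * harm (Q div g))" .
  have "(\<Sum>d\<in>{1..Q}. if coprime d e then 1 / real d else 0) - real (totient e) / real e * ln (real Q) =
     (\<Sum>g | g dvd e. moebius g / real g * (harm (Q div g) - ln (real Q)))"
    unfolding eq using e by (subst totient_over_eq_sum_moebius) (auto simp: right_diff_distrib sum_subtractf sum_distrib_right)
  also have "\<bar>\<dots>\<bar> \<le> (\<Sum>g | g dvd e. 1 * (1 + ln (real e)))"
  proof (rule order_trans[OF sum_abs], rule sum_mono)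
    fix g assume "g \<in> {g. g dvd e}"
    then have g: "g > 0" "g \<le> e" using e by (auto intro!: Nat.gr0I dvd_imp_le)
    define M where "M = Q div g"
    have M: "M \<ge> 1" "M \<le> Q" using g Q by (simp_all add: M_def Suc_le_eq div_greater_zero_iff)
    have up: "harm M \<le> 1 + ln (real Q)"
      using harm_le_ln[OF M(1)] M by (smt (verit) ln_le_cancel_iff of_nat_0_less_iff of_nat_le_iff zero_less_one le_trans Suc_le_eq One_nat_def)
    have "Q < g * (M + 1)"
      using g mult_div_mod_eq[of g Q] mod_less_divisor[of g Q]
      unfolding M_def distrib_left mult_1_right by linarith
    then have "real Q \<le> real e * (real M + 1)"
    proof -
      have "real Q \<le> real (g * (M + 1))" using \<open>Q < g * (M + 1)\<close> by (intro of_nat_mono) simp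
      also have "\<dots> \<le> real (e * (M + 1))" using g by (intro of_nat_mono mult_right_mono) auto
      finally show ?thesis by (simp add: algebra_simps)
    qed
    then have "ln (real Q) \<le> ln (real e * (real M + 1))" using e Q by (subst ln_le_cancel_iff) auto
    also have "\<dots> = ln (real e) + ln (real M + 1)" using e by (simp add: ln_mult)
    also have "ln (real M + 1) \<le> harm M" by (rule harm_ge_ln)
    finally have "ln (real Q) \<le> ln (real e) + harm M" by simp
    moreover have "0 \<le> ln (real e)" using e by simp
    ultimately have "\<bar>harm M - ln (real Q)\<bar> \<le> 1 + ln (real e)" using up by linarith
    moreover have "\<bar>moebius g / real g\<bar> \<le> 1" using abs_moebius_le[of g] g by (simp add: divide_le_eq)
    ultimately show "\<bar>moebius g / real g * (harm (Q div g) - ln (real Q))\<bar> \<le> 1 * (1 + ln (real e))"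
      unfolding abs_mult M_def by (intro mult_mono) auto
  qed
  finally show ?thesis by (simp add: tau_def)
qed

text \<open>The contribution of the denominator \<open>e\<close> in the case \<alpha> = 1, where
  \<open>f\<close> runs through all residues prime to \<open>e\<close>.\<close>

definition row_total :: "nat \<Rightarrow> nat \<Rightarrow> real" where
  "row_total Q e = (\<Sum>d\<in>{e..Q}. if coprime d e then real (coprime_cone Q d e) else 0)"

lemma sum_row_weight:
  assumes "1 \<le> e"
  shows "(\<Sum>u | u < e \<and> coprime u e. real (row_weight Q e u)) = row_total Q e"
proof -
  have fin: "finite {u. u < e \<and> coprime u e}" by simp
  have cop: "coprime (u + j * e) e \<longleftrightarrow> coprime u e" for u j
  proof -
    have "gcd (u + j * e) e = gcd u e" by (metis gcd_add_mult add.commute gcd.commute)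
    then show ?thesis by (simp only: coprime_iff_gcd_eq_1)
  qed
  have "(\<Sum>u | u < e \<and> coprime u e. real (row_weight Q e u)) =
     (\<Sum>(u,j)\<in>{u. u < e \<and> coprime u e} \<times> {1..Q}. real (coprime_cone Q (u + j * e) e))"
    by (simp add: row_weight_def sum.cartesian_product)
  also have "\<dots> = (\<Sum>d\<in>{d. e \<le> d \<and> d div e \<le> Q \<and> coprime d e}. real (coprime_cone Q d e))"
  proof (rule sum.reindex_bij_witness[of _ "\<lambda>d. (d mod e, d div e)" "\<lambda>(u,j). u + j * e"])
    fix p assume p: "p \<in> {u. u < e \<and> coprime u e} \<times> {1..Q}"
    show "(case p of (u, j) \<Rightarrow> u + j * e) \<in> {d. e \<le> d \<and> d div e \<le> Q \<and> coprime d e}"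
      using p assms by (auto simp: cop intro!: trans_le_add2)
  next
    fix d assume d: "d \<in> {d. e \<le> d \<and> d div e \<le> Q \<and> coprime d e}"
    have "coprime (d mod e + (d div e) * e) e" using d by simp
    then show "(d mod e, d div e) \<in> {u. u < e \<and> coprime u e} \<times> {1..Q}"
      using d assms unfolding cop by (simp add: Suc_le_eq div_greater_zero_iff)
  qed (use assms in auto)
  also have "\<dots> = (\<Sum>d\<in>{d\<in>{e..Q}. coprime d e}. real (coprime_cone Q d e))"
  proof (rule sum.mono_neutral_right)
    show "finite {d. e \<le> d \<and> d div e \<le> Q \<and> coprime d e}"
    proof (rule finite_subset[of _ "{..(Q + 1) * e}"])
      show "{d. e \<le> d \<and> d div e \<le> Q \<and> coprime d e} \<subseteq> {..(Q + 1) * e}"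
      proof (rule subsetI)
        fix d assume "d \<in> {d. e \<le> d \<and> d div e \<le> Q \<and> coprime d e}"
        then have "d div e \<le> Q" by simp
        then have "(d div e) * e \<le> Q * e" by (rule mult_right_mono) simp
        moreover have "d mod e \<le> e" using assms by (simp add: less_imp_le)
        moreover have "d = (d div e) * e + d mod e" by simp
        ultimately have "d \<le> Q * e + e" by linarith
        then show "d \<in> {..(Q + 1) * e}" by simp
      qed
    qed simp
    show "{d\<in>{e..Q}. coprime d e} \<subseteq> {d. e \<le> d \<and> d div e \<le> Q \<and> coprime d e}"
      by (auto intro: order_trans[OF div_le_dividend])
    show "\<forall>i\<in>{d. e \<le> d \<and> d div e \<le> Q \<and> coprime d e} - {d\<in>{e..Q}. coprime d e}. real (coprime_cone Q i e) = 0"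
      by (auto intro!: coprime_cone_eq_0)
  qed
  also have "\<dots> = row_total Q e" unfolding row_total_def by (rule sum.inter_filter) simp
  finally show ?thesis .
qed

text \<open>Only the term with \<open>ln Q\<close> is isolated. The error is not summable over
  \<open>e\<close>, but in \<open>sum_outer_approx\<close> it is multiplied by
  \<open>coprime_defect \<alpha> e / totient e\<close>, of order \<open>1 / e\<close> up to divisor
  functions. The sum over all \<open>e\<close> is found by other means in
  \<open>sum_row_total_approx\<close>.\<close>

lemma row_total_approx:
  obtains C where "C > 0" "\<And>Q e. 1 \<le> e \<Longrightarrow> e \<le> Q \<Longrightarrow>
    \<bar>row_total Q e - real Q ^ 2 / (2 * zeta 2) * (real (totient e) / real e ^ 2) * ln (real Q)\<bar>
      \<le> C * (real Q ^ 2 * real (tau e) * (1 + ln (real e)) / real e)"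
proof -
  obtain C0 where C0: "C0 > 0" "\<And>Q d e. 1 \<le> e \<Longrightarrow> e \<le> d \<Longrightarrow> d \<le> Q \<Longrightarrow>
    \<bar>real (coprime_cone Q d e) - real Q ^ 2 / (2 * zeta 2 * real d * real e)\<bar> \<le> C0 * (real Q / real e * sqrt (real Q / real d))"
    using coprime_cone_approx by blast
  have z: "zeta (2::real) > 0" by (rule zeta_2_pos)
  have "\<bar>row_total Q e - real Q ^ 2 / (2 * zeta 2) * (real (totient e) / real e ^ 2) * ln (real Q)\<bar>
      \<le> (2 * C0 + 1 / zeta 2) * (real Q ^ 2 * real (tau e) * (1 + ln (real e)) / real e)"
    if e: "1 \<le> e" and Q: "e \<le> Q" for Q e
  proof -
    define w where "w = real Q ^ 2 / (2 * zeta 2 * real e)"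
    define L where "L = 1 + ln (real e)"
    have L1: "L \<ge> 1" using e by (simp add: L_def)
    have t1: "real (tau e) \<ge> 1" using tau_pos[of e] e by simp
    define H where "H = (\<Sum>d\<in>{e..Q}. if coprime d e then 1 / real d else 0)"
    have "row_total Q e - w * H = (\<Sum>d\<in>{e..Q}. if coprime d e then real (coprime_cone Q d e) - real Q ^ 2 / (2 * zeta 2 * real d * real e) else 0)"
      unfolding row_total_def H_def sum_distrib_left sum_subtractf[symmetric]
      by (intro sum.cong refl) (auto simp: w_def)
    also have "\<bar>\<dots>\<bar> \<le> (\<Sum>d\<in>{e..Q}. C0 * (real Q / real e * sqrt (real Q / real d)))"
    proof (rule order_trans[OF sum_abs], rule sum_mono)
      fix d assume d: "d \<in> {e..Q}"
      then show "\<bar>if coprime d e then real (coprime_cone Q d e) - real Q ^ 2 / (2 * zeta 2 * real d * real e) else 0\<bar> \<le> C0 * (real Q / real e * sqrt (real Q / real d))"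
        using C0(2)[of e d Q] C0(1) e by auto
    qed
    also have "\<dots> \<le> (\<Sum>d\<in>{1..Q}. C0 * (real Q / real e * sqrt (real Q / real d)))"
      by (rule sum_mono2) (use e C0(1) in auto)
    also have "\<dots> = C0 * (real Q / real e * sqrt (real Q)) * (\<Sum>d\<in>{1..Q}. 1 / sqrt (real d))"
      by (simp add: sum_distrib_left real_sqrt_divide)
    also have "\<dots> \<le> C0 * (real Q / real e * sqrt (real Q)) * (2 * sqrt (real Q))"
      using C0(1) by (intro mult_left_mono sum_inverse_sqrt_le) auto
    also have "\<dots> = 2 * C0 * (real Q ^ 2 / real e)"
      using real_sqrt_mult_self[of "real Q"] by (simp add: power2_eq_square del: real_sqrt_mult_self)
    finally have E1: "\<bar>row_total Q e - w * H\<bar> \<le> 2 * C0 * (real Q ^ 2 / real e)" .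
    define K S where "K = real (totient e) / real e * ln (real Q)"
      and "S = (\<Sum>d\<in>{1..<e}. if coprime d e then 1 / real d else 0)"
    have "(\<Sum>d\<in>{1..Q}. if coprime d e then 1 / real d else 0) = S + H"
    proof -
      have "{1..Q} = {1..<e} \<union> {e..Q}" using e Q by auto
      then show ?thesis unfolding H_def S_def by (simp only:) (rule sum.union_disjoint; auto)
    qed
    then have "\<bar>S + H - K\<bar> \<le> real (tau e) * L"
      using coprime_harmonic_sum[OF e Q] unfolding L_def K_def by simp
    moreover have "0 \<le> S" unfolding S_def by (intro sum_nonneg) auto
    moreover have "S \<le> L"
    proof -
      have "(\<Sum>d\<in>{1..<e}. if coprime d e then 1 / real d else 0) \<le> (\<Sum>d\<in>{1..<e}. 1 / real d)" by (intro sum_mono) auto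
      also have "\<dots> \<le> (\<Sum>d\<in>{1..e}. 1 / real d)" by (rule sum_mono2) auto
      also have "\<dots> = harm e" by (rule sum_inverse_eq_harm)
      also have "\<dots> \<le> L" unfolding L_def by (rule harm_le_ln[OF e])
      finally show ?thesis unfolding S_def .
    qed
    moreover have "L \<le> real (tau e) * L" using t1 L1 by simp
    ultimately have "\<bar>H - K\<bar> \<le> 2 * (real (tau e) * L)" by linarith
    then have "\<bar>H - real (totient e) / real e * ln (real Q)\<bar> \<le> 2 * (real (tau e) * L)" unfolding K_def .
    then have "w * \<bar>H - real (totient e) / real e * ln (real Q)\<bar> \<le> w * (2 * (real (tau e) * L))"
      by (intro mult_left_mono) (use z in \<open>auto simp: w_def\<close>)
    moreover have "w \<ge> 0" using z by (simp add: w_def)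
    ultimately have E2: "\<bar>w * H - w * (real (totient e) / real e * ln (real Q))\<bar> \<le> w * (2 * (real (tau e) * L))"
      by (simp only: right_diff_distrib[symmetric] abs_mult abs_of_nonneg)
    have "\<bar>row_total Q e - w * (real (totient e) / real e * ln (real Q))\<bar> \<le> 2 * C0 * (real Q ^ 2 / real e) + w * (2 * (real (tau e) * L))"
      using E1 E2 by linarith
    also have "\<dots> \<le> 2 * C0 * (real Q ^ 2 / real e * (real (tau e) * L)) + w * (2 * (real (tau e) * L))"
    proof -
      have "1 * 1 \<le> real (tau e) * L" using t1 L1 by (intro mult_mono) auto
      then have "real Q ^ 2 / real e * (1 * 1) \<le> real Q ^ 2 / real e * (real (tau e) * L)"
        by (rule mult_left_mono) simp
      then have "2 * C0 * (real Q ^ 2 / real e * (1 * 1)) \<le> 2 * C0 * (real Q ^ 2 / real e * (real (tau e) * L))"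
        by (rule mult_left_mono) (use C0(1) in simp)
      then show ?thesis by (simp only: mult_1_right add_le_cancel_right)
    qed
    also have "\<dots> = (2 * C0 + 1 / zeta 2) * (real Q ^ 2 * real (tau e) * L / real e)"
      unfolding w_def using e z by (simp add: field_simps)
    also have "w * (real (totient e) / real e * ln (real Q)) = real Q ^ 2 / (2 * zeta 2) * (real (totient e) / real e ^ 2) * ln (real Q)"
      unfolding w_def by (simp add: power2_eq_square)
    finally show ?thesis unfolding L_def .
  qed
  moreover have "2 * C0 + 1 / zeta (2::real) > 0" using C0 z by (simp add: add_pos_pos)
  ultimately show ?thesis using that by blast
qed

lemma row_weight_antimono:
  assumes "1 \<le> e" "u \<le> v"
  shows "row_weight Q e v \<le> row_weight Q e u"
  unfolding row_weight_def
proof (rule sum_mono, rule coprime_cone_antimono)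
  fix j assume "j \<in> {1..Q}"
  then have "1 * 1 \<le> j * e" using assms by (intro mult_le_mono) auto
  then show "1 \<le> u + j * e" by linarith
qed (use assms in auto)

text \<open>The denominators of the two rows interleave: \<open>e - 1 + j * e\<close> is less than
  \<open>(j + 1) * e\<close>. By monotonicity the difference telescopes to the single cone with
  \<open>d = e\<close>, free of the logarithm contained in the row weights themselves.\<close>

lemma row_weight_variation:
  assumes e: "1 \<le> e"
  shows "real (row_weight Q e 0) - real (row_weight Q e (e - 1)) \<le> real Q ^ 2 / real e ^ 2"
proof -
  define a where "a = (\<lambda>j. real (coprime_cone Q (j * e) e))"
  have "real (row_weight Q e 0) - real (row_weight Q e (e - 1)) =
     (\<Sum>j\<in>{1..Q}. a j - real (coprime_cone Q (e - 1 + j * e) e))"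
    by (simp add: row_weight_def a_def sum_subtractf)
  also have "\<dots> \<le> (\<Sum>j\<in>{1..Q}. a j - a (Suc j))"
  proof (rule sum_mono, rule diff_left_mono)
    fix j assume "j \<in> {1..Q}"
    then have "1 * 1 \<le> j * e" using e by (intro mult_le_mono) auto
    then have "1 \<le> e - 1 + j * e" by linarith
    then have "coprime_cone Q (Suc j * e) e \<le> coprime_cone Q (e - 1 + j * e) e"
      by (rule coprime_cone_antimono) (use e in auto)
    then show "a (Suc j) \<le> real (coprime_cone Q (e - 1 + j * e) e)" by (simp add: a_def)
  qed
  also have "\<dots> = a 1 - a (Suc Q)" by (induction Q) (auto)
  also have "\<dots> \<le> a 1" by (simp add: a_def)
  also have "\<dots> \<le> real Q ^ 2 / (real e * real e)" unfolding a_def using coprime_cone_le[OF e e, of Q] by simp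
  finally show ?thesis by (simp add: power2_eq_square)
qed

text \<open>Four factors of this size cost \<open>e powr (1/8)\<close>. Together with the
  \<open>3/4\<close> of the Kloosterman sums and the \<open>-2\<close> of
  \<open>row_weight_variation\<close> this gives the summable exponent \<open>-9/8\<close>.\<close>

lemma tau_harm_powr_bound:
  obtains C where "C > 0" "\<And>e. e \<ge> 1 \<Longrightarrow> real (tau e) \<le> C * real e powr (1/32)"
    "\<And>e. e \<ge> 1 \<Longrightarrow> harm e \<le> C * real e powr (1/32)" "\<And>e. e \<ge> 1 \<Longrightarrow> 1 + ln (real e) \<le> C * real e powr (1/32)"
proof -
  obtain C0 where C0: "C0 > 0" "\<And>n. n > 0 \<Longrightarrow> real (tau n) \<le> C0 * real n powr (1/32)"
    using tau_le_powr[of "1/32"] by auto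
  define C where "C = C0 + 33"
  have ln: "1 + ln (real e) \<le> C * real e powr (1/32)" if "e \<ge> 1" for e
  proof -
    have "ln (real e) \<le> 32 * real e powr (1/32)" using ln_powr_bound[of "real e" "1/32"] that by simp
    moreover have p1: "1 \<le> real e powr (1/32)" using that by (simp add: ge_one_powr_ge_zero)
    ultimately have "1 + ln (real e) \<le> 33 * real e powr (1/32)" by linarith
    also have "\<dots> \<le> C * real e powr (1/32)" using C0 by (intro mult_right_mono) (auto simp: C_def)
    finally show ?thesis .
  qed
  show ?thesis
  proof (rule that[of C])
    show "C > 0" using C0 by (simp add: C_def)
    show "1 + ln (real e) \<le> C * real e powr (1/32)" if "e \<ge> 1" for e by (rule ln[OF that])
    show "harm e \<le> C * real e powr (1/32)" if "e \<ge> 1" for e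
      using harm_le_ln[OF that] ln[OF that] by linarith
    show "real (tau e) \<le> C * real e powr (1/32)" if "e \<ge> 1" for e
    proof -
      have "real (tau e) \<le> C0 * real e powr (1/32)" using C0(2)[of e] that by simp
      also have "\<dots> \<le> C * real e powr (1/32)" by (intro mult_right_mono) (auto simp: C_def)
      finally show ?thesis .
    qed
  qed
qed

definition defect_series :: "rat \<Rightarrow> real" where
  "defect_series \<alpha> = (\<Sum>n. ceil_defect \<alpha> (Suc n) / real (Suc n) ^ 2)"

text \<open>As a Dirichlet convolution of \<open>moebius\<close> and
  \<open>ceil_defect \<alpha>\<close>, the sieved defect has a series that is the product of
  \<open>1 / zeta 2\<close> and \<open>defect_series \<alpha>\<close>. Uniformity in \<alpha> rests
  on the bound \<open>1\<close> for all defects.\<close>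

lemma sum_coprime_defect_approx:
  obtains C where "C > 0" "\<And>\<alpha> Q. Q \<ge> 1 \<Longrightarrow>
    \<bar>(\<Sum>e\<in>{1..Q}. coprime_defect \<alpha> e / real e ^ 2) - defect_series \<alpha> / zeta 2\<bar> \<le> C / sqrt (real Q)"
proof (rule hyperbola_product_bound[of 4])
  fix C :: real
  assume "C > 0" and C: "\<And>a g N. (\<And>k. k \<ge> 1 \<Longrightarrow> \<bar>a k\<bar> \<le> 4 * real k powr (-7/4)) \<Longrightarrow>
      (\<And>m. m \<ge> 1 \<Longrightarrow> \<bar>g m\<bar> \<le> 4 * real m powr (-7/4)) \<Longrightarrow> N \<ge> 1 \<Longrightarrow>
      \<bar>(\<Sum>k\<in>{1..N}. \<Sum>m\<in>{1..N div k}. a k * g m) - (\<Sum>n. a (Suc n)) * (\<Sum>n. g (Suc n))\<bar> \<le> C / sqrt (real N)"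
  show thesis
  proof (rule that[OF \<open>C > 0\<close>])
    fix \<alpha> and Q :: nat assume Q: "Q \<ge> 1"
    have "(\<Sum>e\<in>{1..Q}. coprime_defect \<alpha> e / real e ^ 2) =
        (\<Sum>e\<in>{1..Q}. \<Sum>g | g dvd e. (moebius g / real g ^ 2) * (ceil_defect \<alpha> (e div g) / real (e div g) ^ 2))"
      unfolding coprime_defect_def sum_divide_distrib
      by (intro sum.cong refl) (auto simp: real_of_nat_div power_divide)
    also have "\<dots> = (\<Sum>k\<in>{1..Q}. \<Sum>m\<in>{1..Q div k}. (moebius k / real k ^ 2) * (ceil_defect \<alpha> m / real m ^ 2))"
      by (rule sum_divisors_eq)
    finally have eq: "(\<Sum>e\<in>{1..Q}. coprime_defect \<alpha> e / real e ^ 2) = \<dots>" .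
    have "defect_series \<alpha> / zeta 2 = (\<Sum>n. moebius (Suc n) / real (Suc n) ^ 2) * (\<Sum>n. ceil_defect \<alpha> (Suc n) / real (Suc n) ^ 2)"
      unfolding moebius_series defect_series_def by simp
    then show "\<bar>(\<Sum>e\<in>{1..Q}. coprime_defect \<alpha> e / real e ^ 2) - defect_series \<alpha> / zeta 2\<bar> \<le> C / sqrt (real Q)"
      unfolding eq
      by (simp only:) (rule C[OF _ _ Q]; intro abs_le_inverse_square_imp_powr abs_moebius_le ceil_defect_bounds)
  qed
qed simp

text \<open>By equidistribution the row of \<open>e\<close> is the proportion of admissible
  \<open>f\<close> times \<open>row_total Q e\<close>. The proportion is \<alpha> plus
  \<open>coprime_defect \<alpha> e / totient e\<close>. The part with \<alpha> is kept as a sum of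
  row totals; only the part with the defect is expanded further.\<close>

lemma sum_outer_approx:
  obtains C where "C > 0" "\<And>\<alpha> Q. 0 \<le> \<alpha> \<Longrightarrow> \<alpha> \<le> 1 \<Longrightarrow> Q \<ge> 1 \<Longrightarrow>
    \<bar>(\<Sum>e\<in>{1..Q}. \<Sum>(f,u)\<in>inv_pairs e. if f < nat \<lceil>\<alpha> * of_nat e\<rceil> then real (row_weight Q e u) else 0)
     - (of_rat \<alpha> * (\<Sum>e\<in>{1..Q}. row_total Q e) + real Q ^ 2 * ln (real Q) / (2 * zeta 2 ^ 2) * defect_series \<alpha>)\<bar>
     \<le> C * real Q ^ 2"
proof -
  obtain K where K: "K > 0" "\<And>e. e \<ge> 1 \<Longrightarrow> real (tau e) \<le> K * real e powr (1/32)"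
    "\<And>e. e \<ge> 1 \<Longrightarrow> harm e \<le> K * real e powr (1/32)" "\<And>e. e \<ge> 1 \<Longrightarrow> 1 + ln (real e) \<le> K * real e powr (1/32)"
    using tau_harm_powr_bound by blast
  obtain S where S: "S > 0" "\<And>N. (\<Sum>k\<in>{1..N}. real k powr (-9/8)) \<le> S"
    using sum_powr_bounded[of "9/8"] by auto
  obtain R where R: "R > 0" "\<And>Q e. 1 \<le> e \<Longrightarrow> e \<le> Q \<Longrightarrow>
    \<bar>row_total Q e - real Q ^ 2 / (2 * zeta 2) * (real (totient e) / real e ^ 2) * ln (real Q)\<bar>
      \<le> R * (real Q ^ 2 * real (tau e) * (1 + ln (real e)) / real e)"
    using row_total_approx by blast
  obtain D where D: "D > 0" "\<And>\<alpha> Q. Q \<ge> 1 \<Longrightarrow>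
    \<bar>(\<Sum>e\<in>{1..Q}. coprime_defect \<alpha> e / real e ^ 2) - defect_series \<alpha> / zeta 2\<bar> \<le> D / sqrt (real Q)"
    using sum_coprime_defect_approx by blast
  have z: "zeta (2::real) > 0" by (rule zeta_2_pos)
  define C where "C = 80 * K ^ 4 * S + R * K ^ 4 * S + D / zeta 2"
  have main: "\<bar>(\<Sum>e\<in>{1..Q}. \<Sum>(f,u)\<in>inv_pairs e. if f < nat \<lceil>\<alpha> * of_nat e\<rceil> then real (row_weight Q e u) else 0)
     - (of_rat \<alpha> * (\<Sum>e\<in>{1..Q}. row_total Q e) + real Q ^ 2 * ln (real Q) / (2 * zeta 2 ^ 2) * defect_series \<alpha>)\<bar>
     \<le> C * real Q ^ 2"
    if a: "0 \<le> \<alpha>" "\<alpha> \<le> 1" and Q: "Q \<ge> 1" for \<alpha> and Q :: nat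
  proof -
    define X where "X = (\<lambda>e. \<Sum>(f,u)\<in>inv_pairs e. if f < nat \<lceil>\<alpha> * of_nat e\<rceil> then real (row_weight Q e u) else 0)"
    define n0 where "n0 = (\<lambda>e. real (card {f. f < nat \<lceil>\<alpha> * of_nat e\<rceil> \<and> coprime f e}))"
    define Y where "Y = row_total Q"
    define \<rho> where "\<rho> = coprime_defect \<alpha>"
    define v where "v = real Q ^ 2 * ln (real Q) / (2 * zeta 2)"
    have neg2: "real e powr (-2) = 1 / real e ^ 2" if "e \<ge> 1" for e :: nat
      using that by (simp add: powr_minus_divide)
    have E1: "\<bar>X e - n0 e / real (totient e) * Y e\<bar> \<le> real Q ^ 2 * (80 * K ^ 4) * real e powr (-9/8)"
      if e: "e \<in> {1..Q}" for e
    proof -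
      have e1: "1 \<le> e" using e by simp
      have ne: "nat \<lceil>\<alpha> * of_nat e\<rceil> \<le> e"
      proof -
        have "\<alpha> * of_nat e \<le> 1 * of_nat e" using a by (intro mult_right_mono) auto
        then have "\<lceil>\<alpha> * of_nat e\<rceil> \<le> int e" by (simp add: ceiling_le_iff)
        then show ?thesis by simp
      qed
      have "\<bar>X e - n0 e / real (totient e) * Y e\<bar> \<le> (real (row_weight Q e 0) - real (row_weight Q e (e - 1))) *
          (80 * real (tau e) ^ 2 * harm e ^ 2 * real e powr (3/4))"
        unfolding X_def n0_def Y_def sum_row_weight[OF e1, symmetric]
        by (rule inv_pairs_equidistributed) (use e1 ne row_weight_antimono[OF e1] in auto)
      also have "\<dots> \<le> (real Q ^ 2 / real e ^ 2) * (80 * (K * real e powr (1/32)) ^ 2 * (K * real e powr (1/32)) ^ 2 * real e powr (3/4))"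
        by (intro mult_mono row_weight_variation power_mono K e1 mult_nonneg_nonneg) (auto simp: harm_nonneg)
      also have "\<dots> = real Q ^ 2 * (80 * K ^ 4) * ((real e powr (1/32)) ^ 4 * real e powr (3/4) / real e ^ 2)"
        by (simp add: power_mult_distrib eval_nat_numeral)
      also have "(real e powr (1/32)) ^ 4 * real e powr (3/4) / real e ^ 2 = real e powr (-9/8)"
      proof -
        have "(real e powr (1/32)) ^ 4 * real e powr (3/4) * real e powr (-2) = real e powr (-9/8)"
          using e1 by (simp add: powr_power flip: powr_add)
        then show ?thesis unfolding neg2[OF e1] by simp
      qed
      finally show ?thesis .
    qed
    \<comment> \<open>The factors are \<open>tau e\<close> for the defect, \<open>tau e / e\<close>
      for \<open>1 / totient e\<close>, and the error of \<open>row_total_approx\<close> with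
      \<open>tau e * (1 + ln e) / e\<close>.\<close>
    have E2: "\<bar>\<rho> e / real (totient e) * Y e - v * (\<rho> e / real e ^ 2)\<bar> \<le> real Q ^ 2 * (R * K ^ 4) * real e powr (-9/8)"
      if e: "e \<in> {1..Q}" for e
    proof -
      have e1: "1 \<le> e" using e by simp
      have t0: "real (totient e) > 0" using e1 by simp
      have "real e \<le> real (tau e) * real (totient e)" using le_tau_mult_totient[of e] by (simp flip: of_nat_mult)
      then have inv: "1 / real (totient e) \<le> real (tau e) / real e" using t0 e1 by (simp add: field_simps)
      have "\<rho> e / real (totient e) * Y e - v * (\<rho> e / real e ^ 2) =
         \<rho> e * (1 / real (totient e)) * (row_total Q e - real Q ^ 2 / (2 * zeta 2) * (real (totient e) / real e ^ 2) * ln (real Q))"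
        using t0 by (simp add: Y_def v_def field_simps)
      also have "\<bar>\<dots>\<bar> \<le> real (tau e) * (real (tau e) / real e) * (R * (real Q ^ 2 * real (tau e) * (1 + ln (real e)) / real e))"
        unfolding abs_mult \<rho>_def
        by (intro mult_mono abs_coprime_defect_le R(2)) (use e e1 inv in auto)
      also have "\<dots> = (real (tau e) * real (tau e) * real (tau e) * (1 + ln (real e))) * (R * real Q ^ 2 / real e ^ 2)"
        by (simp add: power2_eq_square)
      also have "\<dots> \<le> ((K * real e powr (1/32)) * (K * real e powr (1/32)) * (K * real e powr (1/32)) * (K * real e powr (1/32))) * (R * real Q ^ 2 / real e ^ 2)"
        using R(1) K(1) e1 by (intro mult_right_mono mult_mono K) auto
      also have "\<dots> = real Q ^ 2 * (R * K ^ 4) * ((real e powr (1/32)) ^ 4 / real e ^ 2)"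
        by (simp add: eval_nat_numeral)
      also have "(real e powr (1/32)) ^ 4 / real e ^ 2 \<le> real e powr (-9/8)"
      proof -
        have "(real e powr (1/32)) ^ 4 * real e powr (-2) = real e powr (-15/8)"
          using e1 by (simp add: powr_power flip: powr_add)
        also have "\<dots> \<le> real e powr (-9/8)" using e1 by (intro powr_mono) auto
        finally show ?thesis unfolding neg2[OF e1] by simp
      qed
      finally show ?thesis using R(1) K(1) by (simp add: mult_left_mono)
    qed
    have sumS: "(\<Sum>e\<in>{1..Q}. real Q ^ 2 * c * real e powr (-9/8)) \<le> real Q ^ 2 * c * S" if "c \<ge> 0" for c
      unfolding sum_distrib_left[symmetric] using that by (intro mult_left_mono S) auto
    have n0: "n0 e / real (totient e) * Y e = of_rat \<alpha> * Y e + \<rho> e / real (totient e) * Y e" if "e \<in> {1..Q}" for e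
      using card_coprime_below[of e \<alpha>] that a unfolding n0_def \<rho>_def by (simp add: add_divide_distrib distrib_right)
    have "\<bar>(\<Sum>e\<in>{1..Q}. X e) - (\<Sum>e\<in>{1..Q}. n0 e / real (totient e) * Y e)\<bar> \<le> real Q ^ 2 * (80 * K ^ 4) * S"
      unfolding sum_subtractf[symmetric]
      by (rule order_trans[OF sum_abs], rule order_trans[OF sum_mono[OF E1] sumS]) auto
    moreover have "(\<Sum>e\<in>{1..Q}. n0 e / real (totient e) * Y e) = of_rat \<alpha> * (\<Sum>e\<in>{1..Q}. Y e) + (\<Sum>e\<in>{1..Q}. \<rho> e / real (totient e) * Y e)"
      unfolding sum_distrib_left sum.distrib[symmetric] by (rule sum.cong[OF refl n0])
    moreover have "\<bar>(\<Sum>e\<in>{1..Q}. \<rho> e / real (totient e) * Y e) - v * (\<Sum>e\<in>{1..Q}. \<rho> e / real e ^ 2)\<bar> \<le> real Q ^ 2 * (R * K ^ 4) * S"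
      unfolding sum_distrib_left sum_subtractf[symmetric]
      using R(1) by (intro order_trans[OF sum_abs] order_trans[OF sum_mono[OF E2] sumS]) auto
    \<comment> \<open>The \<open>ln Q\<close> contained in \<open>v\<close> is outweighed by the
      \<open>1 / sqrt Q\<close> from truncating the defect series.\<close>
    moreover have "\<bar>v * (\<Sum>e\<in>{1..Q}. \<rho> e / real e ^ 2) - v * (defect_series \<alpha> / zeta 2)\<bar> \<le> real Q ^ 2 * (D / zeta 2)"
    proof -
      have v0: "v \<ge> 0" using Q z by (simp add: v_def)
      have "\<bar>v * (\<Sum>e\<in>{1..Q}. \<rho> e / real e ^ 2) - v * (defect_series \<alpha> / zeta 2)\<bar> \<le> v * (D / sqrt (real Q))"
        using mult_left_mono[OF D(2)[OF Q, of \<alpha>] v0] v0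
        by (simp only: right_diff_distrib[symmetric] abs_mult abs_of_nonneg \<rho>_def)
      also have "\<dots> = real Q ^ 2 * (D / (2 * zeta 2)) * (ln (real Q) / sqrt (real Q))" by (simp add: v_def)
      also have "\<dots> \<le> real Q ^ 2 * (D / (2 * zeta 2)) * 2"
      proof (rule mult_left_mono)
        show "ln (real Q) / sqrt (real Q) \<le> 2"
          using ln_powr_bound[of "real Q" "1/2"] Q by (simp add: powr_half_sqrt divide_le_eq)
      qed (use D(1) z in simp)
      finally show ?thesis by simp
    qed
    moreover have "v * (defect_series \<alpha> / zeta 2) = real Q ^ 2 * ln (real Q) / (2 * zeta 2 ^ 2) * defect_series \<alpha>"
      by (simp add: v_def power2_eq_square)
    moreover have "C * real Q ^ 2 = real Q ^ 2 * (80 * K ^ 4) * S + real Q ^ 2 * (R * K ^ 4) * S + real Q ^ 2 * (D / zeta 2)"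
      by (simp add: C_def algebra_simps)
    ultimately show ?thesis unfolding X_def[symmetric] Y_def[symmetric] by linarith
  qed
  have "C > 0" unfolding C_def using K(1) S(1) R(1) D(1) z by (intro add_pos_pos mult_pos_pos divide_pos_pos) auto
  then show ?thesis using main by (rule that)
qed

section \<open>The divisor problem and its convolution\<close>

definition divisor_sum :: "nat \<Rightarrow> real" where
  "divisor_sum N = (\<Sum>n\<in>{1..N}. real (tau n))"

lemma finite_mult_le: "finite {(a,b). 1 \<le> a \<and> 1 \<le> b \<and> a * b \<le> (N::nat)}"
proof (rule finite_subset[of _ "{..N} \<times> {..N}"])
  show "{(a,b). 1 \<le> a \<and> 1 \<le> b \<and> a * b \<le> N} \<subseteq> {..N} \<times> {..N}"
  proof (rule subsetI)
    fix p assume "p \<in> {(a,b). 1 \<le> a \<and> 1 \<le> b \<and> a * b \<le> N}"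
    then obtain a b where p: "p = (a,b)" "1 \<le> a" "1 \<le> b" "a * b \<le> N" by auto
    have "a * 1 \<le> a * b" "1 * b \<le> a * b" using p by (intro mult_le_mono; simp)+
    then have "a \<le> N" "b \<le> N" using p by linarith+
    then show "p \<in> {..N} \<times> {..N}" by (simp add: p)
  qed
qed simp

lemma sum_tau_mult:
  fixes F :: "nat \<Rightarrow> real"
  shows "(\<Sum>n\<in>{1..N}. real (tau n) * F n) = (\<Sum>(a,b)\<in>{(a,b). 1 \<le> a \<and> 1 \<le> b \<and> a * b \<le> N}. F (a * b))"
proof -
  have "(\<Sum>n\<in>{1..N}. real (tau n) * F n) = (\<Sum>n\<in>{1..N}. \<Sum>d | d dvd n. F (d * (n div d)))"
    by (intro sum.cong refl) (simp add: tau_def)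
  also have "\<dots> = (\<Sum>(a,b)\<in>{(a,b). 1 \<le> a \<and> 1 \<le> b \<and> a * b \<le> N}. F (a * b))" by (rule sum_divisors_reindex)
  finally show ?thesis .
qed

lemma divisor_sum_eq_card: "divisor_sum N = real (card {(a,b). 1 \<le> a \<and> 1 \<le> b \<and> a * b \<le> N})"
  using sum_tau_mult[of "\<lambda>_. 1" N] by (simp add: divisor_sum_def)

text \<open>A pair with product at most \<open>N\<close> has an entry at most \<open>m\<close>, the
  integer part of \<open>sqrt N\<close>; the \<open>m ^ 2\<close> pairs with both entries at most
  \<open>m\<close> are counted twice.\<close>

lemma divisor_sum_hyperbola:
  assumes "m * m \<le> N" "N < (m + 1) * (m + 1)"
  shows "divisor_sum N = 2 * (\<Sum>a\<in>{1..m}. real (N div a)) - real m ^ 2"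
proof -
  define P where "P = {(a,b). 1 \<le> a \<and> 1 \<le> b \<and> a * b \<le> N}"
  define P1 P2 where "P1 = {p\<in>P. fst p \<le> m}" and "P2 = {p\<in>P. snd p \<le> m}"
  have fin: "finite P" unfolding P_def by (rule finite_mult_le)
  have fin12: "finite P1" "finite P2" using fin by (auto simp: P1_def P2_def)
  have un: "P = P1 \<union> P2"
  proof -
    have ab: "a \<le> m \<or> b \<le> m" if "a * b \<le> N" for a b
    proof (rule ccontr)
      assume "\<not> (a \<le> m \<or> b \<le> m)"
      then have "(m + 1) * (m + 1) \<le> a * b" by (intro mult_le_mono) auto
      then show False using that assms by linarith
    qed
    have "fst p \<le> m \<or> snd p \<le> m" if "p \<in> P" for p
    proof -
      have "fst p * snd p \<le> N" using that by (auto simp: P_def)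
      then show ?thesis by (rule ab)
    qed
    then show ?thesis unfolding P1_def P2_def by blast
  qed
  have int: "P1 \<inter> P2 = {1..m} \<times> {1..m}"
  proof -
    have "a * b \<le> N" if "a \<le> m" "b \<le> m" for a b
      using mult_le_mono[OF that] assms by linarith
    then show ?thesis by (auto simp: P_def P1_def P2_def)
  qed
  have c1: "real (card P1) = (\<Sum>a\<in>{1..m}. real (N div a))"
  proof -
    have "P1 = (SIGMA a:{1..m}. {1..N div a})"
      by (auto simp: P_def P1_def less_eq_div_iff_mult_less_eq mult.commute)
    then show ?thesis by simp
  qed
  have c2: "card P2 = card P1"
  proof -
    have "P2 = prod.swap ` P1" by (force simp: P_def P1_def P2_def mult.commute image_iff)
    then show ?thesis by (simp add: card_image)
  qed
  have "card P + card (P1 \<inter> P2) = card P1 + card P2"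
    unfolding un using card_Un_Int[OF fin12] by simp
  then have "real (card P) + real (m * m) = 2 * real (card P1)"
    unfolding c2 int by (simp flip: of_nat_add of_nat_mult)
  then show ?thesis using c1 unfolding divisor_sum_eq_card P_def[symmetric] by (simp add: power2_eq_square)
qed

text \<open>The constant lies between the increasing sequence \<open>harm n - ln (n + 1)\<close> and
  the decreasing sequence \<open>harm n - ln n\<close>, which are at most \<open>1 / n\<close>
  apart.\<close>

lemma harm_approx:
  assumes "m \<ge> 1"
  shows "\<bar>harm m - ln (real m) - euler_mascheroni\<bar> \<le> 1 / real m"
proof -
  obtain n where n: "m = Suc n" using assms by (cases m) auto
  have lim: "(\<lambda>n. harm (Suc n) - ln (real (Suc n))) \<longlonglongrightarrow> euler_mascheroni"
    using LIMSEQ_Suc[OF euler_mascheroni_LIMSEQ] by simp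
  have "euler_mascheroni \<le> harm (Suc n) - ln (real (Suc n))"
    by (rule decseq_ge[OF decseq_harm_diff_ln lim])
  moreover have "harm (Suc n) - ln (real (Suc (Suc n))) \<le> euler_mascheroni"
  proof -
    have inc: "incseq (\<lambda>n. harm (Suc n) - ln (real (Suc (Suc n))))"
    proof (rule incseq_SucI)
      fix n
      have "ln (real (Suc (Suc (Suc n)))) - ln (real (Suc (Suc n))) \<le> 1 / real (Suc (Suc n))"
        using ln_diff_le[of "real (Suc (Suc (Suc n)))" "real (Suc (Suc n))"] by simp
      then show "harm (Suc n) - ln (real (Suc (Suc n))) \<le> harm (Suc (Suc n)) - ln (real (Suc (Suc (Suc n))))"
        by (simp add: harm_Suc[of "Suc n"] inverse_eq_divide del: of_nat_Suc)
    qed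
    have "(\<lambda>n. (harm (Suc n) - ln (real (Suc n))) - (ln (real (Suc (Suc n))) - ln (real (Suc n)))) \<longlonglongrightarrow> euler_mascheroni - 0"
      by (intro tendsto_diff lim) real_asymp
    then have "(\<lambda>n. harm (Suc n) - ln (real (Suc (Suc n)))) \<longlonglongrightarrow> euler_mascheroni" by simp
    then show ?thesis by (rule incseq_le[OF inc])
  qed
  moreover have "ln (real (Suc (Suc n))) - ln (real (Suc n)) \<le> 1 / real (Suc n)"
    using ln_diff_le[of "real (Suc (Suc n))" "real (Suc n)"] by simp
  ultimately show ?thesis unfolding n by linarith
qed

text \<open>With \<open>r = sqrt N\<close>, the floors in the hyperbola formula, the passage from
  \<open>harm m\<close> to \<open>ln r + \<gamma>\<close> and the one from \<open>m ^ 2\<close> to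
  \<open>N\<close> each cost \<open>O(r)\<close>.\<close>

lemma divisor_sum_approx:
  assumes N: "N \<ge> 1"
  shows "\<bar>divisor_sum N - (real N * ln (real N) + (2 * euler_mascheroni - 1) * real N)\<bar> \<le> 16 * sqrt (real N)"
proof -
  define m where "m = nat \<lfloor>sqrt (real N)\<rfloor>"
  define r where "r = sqrt (real N)"
  define \<gamma> :: real where "\<gamma> = euler_mascheroni"
  have r1: "r \<ge> 1" "r * r = real N" using N by (simp_all add: r_def)
  have m: "real m \<le> r" "r < real m + 1" "m \<ge> 1"
    using r1 unfolding m_def r_def[symmetric] by linarith+
  have mm: "m * m \<le> N" "N < (m + 1) * (m + 1)"
  proof -
    have "real m * real m \<le> r * r" using m by (intro mult_mono) auto
    then have "real (m * m) \<le> real N" using r1 by simp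
    then show "m * m \<le> N" by (simp only: of_nat_le_iff)
    have "r * r < (real m + 1) * (real m + 1)" using m r1 by (intro mult_strict_mono) auto
    then have "real N < real ((m + 1) * (m + 1))" unfolding r1(2) by (simp only: of_nat_mult of_nat_add of_nat_1)
    then show "N < (m + 1) * (m + 1)" by (simp only: of_nat_less_iff)
  qed
  define S where "S = (\<Sum>a\<in>{1..m}. real (N div a))"
  have S: "S \<le> real N * harm m" "real N * harm m - real m \<le> S"
  proof -
    have eq: "real N * harm m = (\<Sum>a\<in>{1..m}. real N / real a)" by (simp add: harm_def sum_distrib_left divide_inverse)
    show "S \<le> real N * harm m" unfolding S_def eq by (intro sum_mono of_nat_div_le_of_nat)
    have "real N * harm m - real m = (\<Sum>a\<in>{1..m}. real N / real a - 1)" unfolding eq by (simp add: sum_subtractf)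
    also have "\<dots> \<le> S" unfolding S_def
    proof (rule sum_mono)
      fix a
      have "\<lfloor>real N / real a\<rfloor> = int (N div a)" by (rule floor_divide_of_nat_eq)
      then show "real N / real a - 1 \<le> real (N div a)" by linarith
    qed
    finally show "real N * harm m - real m \<le> S" .
  qed
  have h: "\<bar>harm m - ln (real m) - \<gamma>\<bar> \<le> 1 / real m" unfolding \<gamma>_def by (rule harm_approx[OF m(3)])
  have lnm: "\<bar>ln (real m) - ln r\<bar> \<le> 1 / real m"
  proof -
    have "ln (real m) \<le> ln r" using m by simp
    moreover have "ln r - ln (real m) \<le> (r - real m) / real m" using m r1 by (intro ln_diff_le) auto
    moreover have "(r - real m) / real m \<le> 1 / real m" using m by (intro divide_right_mono) auto
    ultimately show ?thesis by linarith
  qed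
  have lnN: "ln (real N) = 2 * ln r" using r1(1) by (simp add: r1(2)[symmetric] ln_mult)
  have Nm: "real N / real m \<le> 2 * r"
  proof -
    have "r \<le> 2 * real m" using m by linarith
    then have "r * r \<le> r * (2 * real m)" using r1 by (intro mult_left_mono) auto
    then show ?thesis using m r1 by (simp add: pos_divide_le_eq mult_ac)
  qed
  have "\<bar>harm m - (ln r + \<gamma>)\<bar> \<le> 2 / real m" using h lnm by linarith
  then have "real N * \<bar>harm m - (ln r + \<gamma>)\<bar> \<le> real N * (2 / real m)" by (rule mult_left_mono) simp
  moreover have "real N * (2 / real m) = 2 * (real N / real m)" by simp
  ultimately have "real N * \<bar>harm m - (ln r + \<gamma>)\<bar> \<le> 4 * r" using Nm by linarith
  then have H: "\<bar>real N * harm m - real N * (ln r + \<gamma>)\<bar> \<le> 4 * r"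
    by (simp only: right_diff_distrib[symmetric] abs_mult abs_of_nat)
  have m2: "\<bar>real m ^ 2 - real N\<bar> \<le> 2 * r"
  proof -
    have "(r - real m) * (r + real m) \<le> 1 * (2 * r)" using m r1 by (intro mult_mono) auto
    moreover have "(r - real m) * (r + real m) = real N - real m ^ 2" using r1 by (simp add: power2_eq_square algebra_simps)
    moreover have "real m ^ 2 \<le> real N" using mm by (simp add: power2_eq_square flip: of_nat_mult)
    ultimately show ?thesis by simp
  qed
  have "divisor_sum N = 2 * S - real m ^ 2" unfolding S_def by (rule divisor_sum_hyperbola[OF mm])
  moreover have "real N * ln (real N) + (2 * \<gamma> - 1) * real N = 2 * (real N * (ln r + \<gamma>)) - real N"
    unfolding lnN by (simp add: algebra_simps)
  ultimately show ?thesis using S H m2 m r1 unfolding \<gamma>_def[symmetric] r_def[symmetric] by linarith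
qed

section \<open>Sums of logarithms\<close>

lemma sum_ln_bounds:
  assumes "N \<ge> 1"
  shows "real N * ln (real N) - real N \<le> (\<Sum>i\<in>{1..N}. ln (real i))"
    "(\<Sum>i\<in>{1..N}. ln (real i)) \<le> real N * ln (real N) - real N + 1 + ln (real N)"
proof -
  have "real N * ln (real N) - real N \<le> (\<Sum>i\<in>{1..N}. ln (real i)) \<and>
     (\<Sum>i\<in>{1..N}. ln (real i)) \<le> real N * ln (real N) - real N + 1 + ln (real N)"
    using assms
  proof (induction N rule: dec_induct)
    case (step n)
    define a b where "a = ln (real n)" and "b = ln (real n + 1)"
    have n: "n \<ge> 1" using step by simp
    have "b - a \<le> ((real n + 1) - real n) / real n" unfolding a_def b_def using n by (intro ln_diff_le) auto
    then have 1: "real n * (b - a) \<le> 1" using n by (simp add: field_simps)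
    have "a - b \<le> (real n - (real n + 1)) / (real n + 1)" unfolding a_def b_def using n by (intro ln_diff_le) auto
    then have "(a - b) * (real n + 1) \<le> -1" using n by (simp add: field_simps)
    then have 2: "1 \<le> (real n + 1) * (b - a)" by (simp add: algebra_simps)
    have e: "ln (real (Suc n)) = b" "real (Suc n) = real n + 1" by (simp_all add: b_def add.commute)
    have s: "(\<Sum>i\<in>{1..Suc n}. ln (real i)) = (\<Sum>i\<in>{1..n}. ln (real i)) + b" using e(1) by simp
    have IH: "real n * a - real n \<le> (\<Sum>i\<in>{1..n}. ln (real i))"
      "(\<Sum>i\<in>{1..n}. ln (real i)) \<le> real n * a - real n + 1 + a" using step.IH by (simp_all add: a_def)
    have "real n * b - real n * a \<le> 1" "1 \<le> real n * b + b - real n * a - a" using 1 2 by (simp_all add: algebra_simps)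
    then show ?case using IH unfolding s e(1) unfolding e(2) distrib_right by linarith
  qed simp
  then show "real N * ln (real N) - real N \<le> (\<Sum>i\<in>{1..N}. ln (real i))"
    "(\<Sum>i\<in>{1..N}. ln (real i)) \<le> real N * ln (real N) - real N + 1 + ln (real N)" by auto
qed

lemma sum_reflect: "(\<Sum>i\<in>{1..<N}. f (N - i)) = (\<Sum>i\<in>{1..<N}. f (i::nat) :: real)"
  by (rule sum.reindex_bij_witness[of _ "\<lambda>i. N - i" "\<lambda>i. N - i"]) auto

lemma sum_atLeastLessThan_of_nat: "N \<ge> 1 \<Longrightarrow> (\<Sum>i\<in>{1..<N}. real i) = real N ^ 2 / 2 - real N / 2"
  by (induction N rule: dec_induct) (auto simp: power2_eq_square field_simps)

text \<open>Riemann sums on \<open>(0, 1]\<close>: the integral of \<open>ln t\<close> is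
  \<open>-1\<close>, hence the sum is close to \<open>- N\<close>. The singularity at
  \<open>0\<close> is tamed by \<open>- ln t \<le> 4 * t powr (-1/4)\<close>, whose square has the
  integrable exponent \<open>-1/2\<close>.\<close>

lemma ln_ratio_sums:
  assumes N: "N \<ge> 1"
  defines "l \<equiv> \<lambda>i. ln (real i / real N)"
  shows "\<bar>(\<Sum>i\<in>{1..<N}. l i) + real N\<bar> \<le> 1 + ln (real N)"
    "(\<Sum>i\<in>{1..<N}. \<bar>l i\<bar>) \<le> real N" "(\<Sum>i\<in>{1..<N}. l i ^ 2) \<le> 32 * real N"
proof -
  have "{1..N} = insert N {1..<N}" using N by auto
  then have "(\<Sum>i\<in>{1..N}. l i) = (\<Sum>i\<in>{1..<N}. l i)" using N by (simp add: l_def)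
  moreover have "(\<Sum>i\<in>{1..N}. l i) = (\<Sum>i\<in>{1..N}. ln (real i)) - real N * ln (real N)"
    using N by (simp add: l_def ln_div sum_subtractf)
  ultimately have s: "(\<Sum>i\<in>{1..<N}. l i) = (\<Sum>i\<in>{1..N}. ln (real i)) - real N * ln (real N)" by simp
  have L0: "ln (real N) \<ge> 0" using N by simp
  show 1: "\<bar>(\<Sum>i\<in>{1..<N}. l i) + real N\<bar> \<le> 1 + ln (real N)"
    using sum_ln_bounds[OF N] s L0 by linarith
  have neg: "l i \<le> 0" if "i \<in> {1..<N}" for i using that by (simp add: l_def)
  have "(\<Sum>i\<in>{1..<N}. \<bar>l i\<bar>) = (\<Sum>i\<in>{1..<N}. - l i)" using neg by (intro sum.cong refl) (simp add: abs_of_nonpos)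
  then show "(\<Sum>i\<in>{1..<N}. \<bar>l i\<bar>) \<le> real N" using sum_ln_bounds(1)[OF N] s by (simp add: sum_negf)
  have "(\<Sum>i\<in>{1..<N}. l i ^ 2) \<le> (\<Sum>i\<in>{1..<N}. 16 * sqrt (real N) * (1 / sqrt (real i)))"
  proof (rule sum_mono)
    fix i assume i: "i \<in> {1..<N}"
    have "- l i = ln (real N / real i)" using i by (simp add: l_def ln_div)
    also have "\<dots> \<le> (real N / real i) powr (1/4) / (1/4)" using i by (intro ln_powr_bound) auto
    finally have "- l i \<le> 4 * (real N / real i) powr (1/4)" by simp
    then have "(- l i) ^ 2 \<le> (4 * (real N / real i) powr (1/4)) ^ 2" using neg[OF i] by (intro power_mono) auto
    also have "\<dots> = 16 * (real N / real i) powr (1/2)"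
      by (simp add: power_mult_distrib power2_eq_square flip: powr_add)
    also have "\<dots> = 16 * sqrt (real N) * (1 / sqrt (real i))" by (simp add: powr_half_sqrt real_sqrt_divide)
    finally show "l i ^ 2 \<le> 16 * sqrt (real N) * (1 / sqrt (real i))" by simp
  qed
  also have "\<dots> \<le> (\<Sum>i\<in>{1..N}. 16 * sqrt (real N) * (1 / sqrt (real i)))" by (rule sum_mono2) auto
  also have "\<dots> = 16 * sqrt (real N) * (\<Sum>i\<in>{1..N}. 1 / sqrt (real i))" by (rule sum_distrib_left[symmetric])
  also have "\<dots> \<le> 16 * sqrt (real N) * (2 * sqrt (real N))" by (intro mult_left_mono sum_inverse_sqrt_le) simp
  finally show "(\<Sum>i\<in>{1..<N}. l i ^ 2) \<le> 32 * real N" by simp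
qed

text \<open>A form of partial summation: if \<open>b\<close> consists of the increments of a
  function vanishing at \<open>0\<close>, the inner sums on the left are its values, and on the
  right the summatory function of \<open>a\<close> appears.\<close>

lemma sum_triangle_swap:
  fixes a b :: "nat \<Rightarrow> real"
  shows "(\<Sum>i\<in>{1..N}. a i * (\<Sum>j\<in>{1..N-i}. b j)) = (\<Sum>j\<in>{1..<N}. b j * (\<Sum>i\<in>{1..N-j}. a i))"
proof -
  have "(\<Sum>i\<in>{1..N}. a i * (\<Sum>j\<in>{1..N-i}. b j)) = (\<Sum>(i,j)\<in>(SIGMA i:{1..N}. {1..N-i}). a i * b j)"
    by (simp add: sum_distrib_left sum.Sigma)
  also have "\<dots> = (\<Sum>(j,i)\<in>(SIGMA j:{1..<N}. {1..N-j}). b j * a i)"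
    by (rule sum.reindex_bij_witness[of _ prod.swap prod.swap]) auto
  also have "\<dots> = (\<Sum>j\<in>{1..<N}. b j * (\<Sum>i\<in>{1..N-j}. a i))"
    by (simp add: sum_distrib_left sum.Sigma)
  finally show ?thesis .
qed

lemma ln_le_two_sqrt: "N \<ge> 1 \<Longrightarrow> ln (real N) \<le> 2 * sqrt (real N)"
  using ln_powr_bound[of "real N" "1/2"] by (simp add: powr_half_sqrt)

text \<open>With \<open>G\<close> the smooth approximation of \<open>divisor_sum\<close> and
  \<open>g\<close> its increments, the divisor function is removed twice: in \<open>A1\<close> from
  the second factor, and after \<open>sum_triangle_swap\<close> also from the first. Logarithms and
  square-root errors are both \<open>O(sqrt n)\<close>, so that each replacement costs
  \<open>O(n ^ 2)\<close>. What remains in \<open>A3\<close> is an explicit sum of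
  logarithms.\<close>

lemma divisor_convolution_approx:
  assumes N: "N \<ge> 1"
  defines "L \<equiv> ln (real N)"
  shows "\<bar>(\<Sum>i\<in>{1..N}. real (tau i) * divisor_sum (N - i)) - real N ^ 2 / 2 * (L ^ 2 + (4 * euler_mascheroni - 3) * L)\<bar>
    \<le> 1000 * real N ^ 2"
proof -
  define \<gamma> :: real where "\<gamma> = euler_mascheroni"
  define c where "c = 2 * \<gamma> - 1"
  define n where "n = real N"
  define x where "x = sqrt n"
  have \<gamma>: "0 < \<gamma>" "\<gamma> < 1"
    using euler_mascheroni_pos euler_mascheroni_bounds[of 1] ln2_ge_two_thirds
    unfolding \<gamma>_def by (simp_all add: harm_expand)
  have c: "\<bar>c\<bar> \<le> 1" using \<gamma> by (simp add: c_def)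
  have n1: "n \<ge> 1" and x1: "x \<ge> 1" "x * x = n" using N by (simp_all add: n_def x_def)
  have L: "0 \<le> L" "L \<le> 2 * x" using N ln_le_two_sqrt[OF N] by (simp_all add: L_def x_def n_def)
  define G where "G = (\<lambda>j::nat. real j * ln (real j) + c * real j)"
  have \<Delta>: "\<bar>divisor_sum j - G j\<bar> \<le> 16 * sqrt (real j)" for j
  proof (cases "j = 0")
    case True then show ?thesis by (simp add: divisor_sum_def G_def)
  next
    case False then show ?thesis using divisor_sum_approx[of j] by (simp add: G_def c_def \<gamma>_def)
  qed
  have Dmono: "divisor_sum i \<le> divisor_sum N" if "i \<le> N" for i
    unfolding divisor_sum_def by (rule sum_mono2) (use that in auto)
  have D0: "0 \<le> divisor_sum i" for i unfolding divisor_sum_def by (intro sum_nonneg) auto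
  have DN: "divisor_sum N \<le> n * (19 * x)"
  proof -
    have "divisor_sum N \<le> G N + 16 * x" using \<Delta>[of N] by (simp add: x_def n_def)
    also have "G N = n * L + c * n" by (simp add: G_def n_def L_def)
    also have "c * n \<le> 1 * n" using c n1 by (intro mult_right_mono) auto
    also have "n * L \<le> n * (2 * x)" using L n1 by (intro mult_left_mono) auto
    finally have "divisor_sum N \<le> n * (2 * x) + 1 * n + 16 * x" by simp
    also have "\<dots> \<le> n * (2 * x) + n * x + n * (16 * x)"
      using n1 x1 by (intro add_mono) auto
    finally show ?thesis by (simp add: algebra_simps)
  qed
  define g where "g = (\<lambda>j. G j - G (j - 1))"
  have Gsum: "G k = (\<Sum>j\<in>{1..k}. g j)" for k
    by (induction k) (auto simp: g_def G_def)
  have g: "\<bar>g j - (ln (real j) + 2 * \<gamma>)\<bar> \<le> 1 / real j" if "j \<ge> 1" for j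
  proof (cases "j = 1")
    case True then show ?thesis by (simp add: g_def G_def c_def)
  next
    case False
    define y where "y = real j"
    have y: "y \<ge> 2" "real (j - 1) = y - 1" using that False by (simp_all add: y_def of_nat_diff)
    have e: "g j - (ln y + 2 * \<gamma>) = (y - 1) * (ln y - ln (y - 1)) - 1"
      using y by (simp add: g_def G_def c_def y_def[symmetric] algebra_simps)
    have "ln y - ln (y - 1) \<le> (y - (y - 1)) / (y - 1)" using y by (intro ln_diff_le) auto
    then have 1: "(y - 1) * (ln y - ln (y - 1)) \<le> 1" using y by (simp add: field_simps)
    have "ln (y - 1) - ln y \<le> ((y - 1) - y) / y" using y by (intro ln_diff_le) auto
    then have "1 / y \<le> ln y - ln (y - 1)" by simp
    then have "(y - 1) * (1 / y) \<le> (y - 1) * (ln y - ln (y - 1))" using y by (intro mult_left_mono) auto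
    moreover have "(y - 1) * (1 / y) = 1 - 1 / y" using y by (simp add: field_simps)
    ultimately have "1 - 1 / y \<le> (y - 1) * (ln y - ln (y - 1))" by simp
    then show ?thesis using 1 y unfolding y_def[symmetric] e by simp
  qed
  define T where "T = (\<Sum>i\<in>{1..N}. real (tau i) * divisor_sum (N - i))"
  define A1 where "A1 = (\<Sum>i\<in>{1..N}. real (tau i) * G (N - i))"
  define A2 where "A2 = (\<Sum>j\<in>{1..<N}. (ln (real j) + 2 * \<gamma>) * divisor_sum (N - j))"
  define A3 where "A3 = (\<Sum>j\<in>{1..<N}. (ln (real j) + 2 * \<gamma>) * G (N - j))"
  \<comment> \<open>Here \<open>304 = 19 * 16\<close>, from \<open>DN\<close> and from the error in
    \<Delta>.\<close>
  have E1: "\<bar>T - A1\<bar> \<le> 304 * n ^ 2"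
  proof -
    have "\<bar>T - A1\<bar> \<le> (\<Sum>i\<in>{1..N}. real (tau i) * (16 * x))"
      unfolding T_def A1_def sum_subtractf[symmetric] right_diff_distrib[symmetric]
    proof (rule order_trans[OF sum_abs], rule sum_mono)
      fix i
      have "\<bar>divisor_sum (N - i) - G (N - i)\<bar> \<le> 16 * sqrt (real (N - i))" by (rule \<Delta>)
      also have "\<dots> \<le> 16 * x" by (simp add: x_def n_def)
      finally show "\<bar>real (tau i) * (divisor_sum (N - i) - G (N - i))\<bar> \<le> real (tau i) * (16 * x)"
        unfolding abs_mult abs_of_nat by (intro mult_left_mono) auto
    qed
    also have "\<dots> = divisor_sum N * (16 * x)" by (simp only: divisor_sum_def sum_distrib_right)
    also have "\<dots> \<le> (n * (19 * x)) * (16 * x)" using DN x1 by (intro mult_right_mono) auto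
    also have "\<dots> = 304 * (n * (x * x))" by simp
    also have "\<dots> = 304 * n ^ 2" unfolding x1(2) by (simp add: power2_eq_square)
    finally show ?thesis .
  qed
  have A1: "A1 = (\<Sum>j\<in>{1..<N}. g j * divisor_sum (N - j))"
    unfolding A1_def Gsum divisor_sum_def by (rule sum_triangle_swap)
  have E2: "\<bar>A1 - A2\<bar> \<le> 57 * n ^ 2"
  proof -
    have "\<bar>A1 - A2\<bar> \<le> (\<Sum>j\<in>{1..<N}. 1 / real j * divisor_sum N)"
      unfolding A1 A2_def sum_subtractf[symmetric] left_diff_distrib[symmetric]
    proof (rule order_trans[OF sum_abs], rule sum_mono)
      fix j assume "j \<in> {1..<N}"
      then show "\<bar>(g j - (ln (real j) + 2 * \<gamma>)) * divisor_sum (N - j)\<bar> \<le> 1 / real j * divisor_sum N"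
        unfolding abs_mult abs_of_nonneg[OF D0] by (intro mult_mono g Dmono D0) auto
    qed
    also have "\<dots> \<le> (\<Sum>j\<in>{1..N}. 1 / real j * divisor_sum N)" by (rule sum_mono2) (auto simp: D0)
    also have "\<dots> = harm N * divisor_sum N" by (simp only: sum_distrib_right[symmetric] sum_inverse_eq_harm)
    also have "\<dots> \<le> (3 * x) * (n * (19 * x))"
    proof (intro mult_mono DN D0)
      show "harm N \<le> 3 * x" using harm_le_ln[OF N] L x1 unfolding L_def by linarith
    qed (use x1 in auto)
    also have "\<dots> = 57 * (n * (x * x))" by simp
    also have "\<dots> = 57 * n ^ 2" unfolding x1(2) by (simp add: power2_eq_square)
    finally show ?thesis .
  qed
  have E3: "\<bar>A2 - A3\<bar> \<le> 64 * n ^ 2"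
  proof -
    have "\<bar>A2 - A3\<bar> \<le> (\<Sum>j\<in>{1..<N}. (4 * x) * (16 * x))"
      unfolding A2_def A3_def sum_subtractf[symmetric] right_diff_distrib[symmetric]
    proof (rule order_trans[OF sum_abs], rule sum_mono)
      fix j assume j: "j \<in> {1..<N}"
      have "\<bar>divisor_sum (N - j) - G (N - j)\<bar> \<le> 16 * sqrt (real (N - j))" by (rule \<Delta>)
      also have "\<dots> \<le> 16 * x" by (simp add: x_def n_def)
      finally have 1: "\<bar>divisor_sum (N - j) - G (N - j)\<bar> \<le> 16 * x" .
      have "ln (real j) \<le> L" "0 \<le> ln (real j)" using j by (simp_all add: L_def)
      then have "\<bar>ln (real j) + 2 * \<gamma>\<bar> \<le> 4 * x" using \<gamma> L x1 by simp
      then show "\<bar>(ln (real j) + 2 * \<gamma>) * (divisor_sum (N - j) - G (N - j))\<bar> \<le> (4 * x) * (16 * x)"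
        unfolding abs_mult using 1 x1 by (intro mult_mono) auto
    qed
    also have "\<dots> = real (N - 1) * (64 * (x * x))" by simp
    also have "\<dots> \<le> n * (64 * (x * x))" by (intro mult_right_mono) (auto simp: n_def)
    also have "\<dots> = 64 * n ^ 2" unfolding x1(2) by (simp add: power2_eq_square)
    finally show ?thesis .
  qed
  \<comment> \<open>Scaling by \<open>N\<close> separates the large part \<open>L\<close> of each
    logarithm from \<open>l\<close>, which is bounded on average.\<close>
  define l where "l = (\<lambda>i. ln (real i / real N))"
  have l: "\<bar>(\<Sum>i\<in>{1..<N}. l i) + n\<bar> \<le> 1 + L" "(\<Sum>i\<in>{1..<N}. \<bar>l i\<bar>) \<le> n" "(\<Sum>i\<in>{1..<N}. l i ^ 2) \<le> 32 * n"
    using ln_ratio_sums[OF N] by (simp_all add: l_def n_def L_def)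
  have lnl: "ln (real i) = L + l i" if "i \<in> {1..<N}" for i using that by (simp add: l_def L_def ln_div)
  define s0 s1 where "s0 = (\<Sum>i\<in>{1..<N}. real i)" and "s1 = (\<Sum>i\<in>{1..<N}. l i)"
  define R where "R = (\<Sum>i\<in>{1..<N}. real i * (l i * l (N - i) + 2 * \<gamma> * l i + c * l (N - i) + 2 * \<gamma> * c))"
  have A3: "A3 = L ^ 2 * s0 + L * (4 * \<gamma> - 1) * s0 + L * (n * s1) + R"
  proof -
    have "A3 = (\<Sum>i\<in>{1..<N}. (ln (real (N - i)) + 2 * \<gamma>) * G i)"
      unfolding A3_def by (subst sum_reflect[symmetric]) (intro sum.cong refl, simp)
    also have "\<dots> = (\<Sum>i\<in>{1..<N}. L ^ 2 * real i + L * (4 * \<gamma> - 1) * real i + L * (real i * l i + real i * l (N - i)) +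
       real i * (l i * l (N - i) + 2 * \<gamma> * l i + c * l (N - i) + 2 * \<gamma> * c))"
    proof (rule sum.cong[OF refl])
      fix i assume i: "i \<in> {1..<N}"
      have "ln (real (N - i)) = L + l (N - i)" by (rule lnl) (use i in auto)
      then show "(ln (real (N - i)) + 2 * \<gamma>) * G i = L ^ 2 * real i + L * (4 * \<gamma> - 1) * real i + L * (real i * l i + real i * l (N - i)) +
       real i * (l i * l (N - i) + 2 * \<gamma> * l i + c * l (N - i) + 2 * \<gamma> * c)"
        using lnl[OF i] by (simp add: G_def c_def power2_eq_square algebra_simps)
    qed
    also have "\<dots> = L ^ 2 * s0 + L * (4 * \<gamma> - 1) * s0 + L * ((\<Sum>i\<in>{1..<N}. real i * l i) + (\<Sum>i\<in>{1..<N}. real i * l (N - i))) + R"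
      unfolding R_def[symmetric] sum.distrib[of "\<lambda>i. L ^ 2 * real i + L * (4 * \<gamma> - 1) * real i + L * (real i * l i + real i * l (N - i))"]
      by (simp add: s0_def sum.distrib flip: sum_distrib_left)
    also have "(\<Sum>i\<in>{1..<N}. real i * l (N - i)) = (\<Sum>i\<in>{1..<N}. real (N - i) * l i)"
      by (subst sum_reflect[symmetric]) (intro sum.cong refl, simp)
    also have "(\<Sum>i\<in>{1..<N}. real i * l i) + \<dots> = n * s1"
      unfolding s1_def sum_distrib_left sum.distrib[symmetric]
      by (intro sum.cong refl) (simp add: n_def of_nat_diff algebra_simps)
    finally show ?thesis .
  qed
  have R: "\<bar>R\<bar> \<le> 37 * n ^ 2"
  proof -
    have "\<bar>R\<bar> \<le> (\<Sum>i\<in>{1..<N}. n * ((l i ^ 2 + l (N - i) ^ 2) / 2 + 2 * \<bar>l i\<bar> + \<bar>l (N - i)\<bar> + 2))"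
      unfolding R_def
    proof (rule order_trans[OF sum_abs], rule sum_mono)
      fix i assume i: "i \<in> {1..<N}"
      have "0 \<le> (\<bar>l i\<bar> - \<bar>l (N - i)\<bar>) ^ 2" by simp
      then have "\<bar>l i\<bar> * \<bar>l (N - i)\<bar> \<le> (l i ^ 2 + l (N - i) ^ 2) / 2"
        by (simp add: power2_diff)
      moreover have "\<bar>2 * \<gamma> * l i\<bar> \<le> 2 * \<bar>l i\<bar>" using \<gamma> by (simp add: abs_mult mult_right_mono)
      moreover have "\<bar>c * l (N - i)\<bar> \<le> \<bar>l (N - i)\<bar>" using c mult_right_mono[of "\<bar>c\<bar>" 1 "\<bar>l (N - i)\<bar>"] by (simp add: abs_mult)
      moreover have "\<bar>2 * \<gamma> * c\<bar> \<le> 2"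
      proof -
        have "\<bar>2 * \<gamma>\<bar> * \<bar>c\<bar> \<le> 2 * 1" using \<gamma> c by (intro mult_mono) auto
        then show ?thesis by (simp add: abs_mult)
      qed
      moreover have "\<bar>l i * l (N - i)\<bar> = \<bar>l i\<bar> * \<bar>l (N - i)\<bar>" by (rule abs_mult)
      ultimately have "\<bar>l i * l (N - i) + 2 * \<gamma> * l i + c * l (N - i) + 2 * \<gamma> * c\<bar> \<le>
         (l i ^ 2 + l (N - i) ^ 2) / 2 + 2 * \<bar>l i\<bar> + \<bar>l (N - i)\<bar> + 2" by linarith
      moreover have "\<bar>real i\<bar> \<le> n" using i by (simp add: n_def)
      ultimately show "\<bar>real i * (l i * l (N - i) + 2 * \<gamma> * l i + c * l (N - i) + 2 * \<gamma> * c)\<bar> \<le>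
         n * ((l i ^ 2 + l (N - i) ^ 2) / 2 + 2 * \<bar>l i\<bar> + \<bar>l (N - i)\<bar> + 2)"
        unfolding abs_mult[of "real i"] using n1 by (intro mult_mono) auto
    qed
    also have "\<dots> = n * (((\<Sum>i\<in>{1..<N}. l i ^ 2) + (\<Sum>i\<in>{1..<N}. l (N - i) ^ 2)) / 2 + 2 * (\<Sum>i\<in>{1..<N}. \<bar>l i\<bar>) + (\<Sum>i\<in>{1..<N}. \<bar>l (N - i)\<bar>) + (\<Sum>i\<in>{1..<N}. 2))"
      by (simp only: sum.distrib sum_distrib_left[symmetric] sum_divide_distrib[symmetric])
    also have "\<dots> \<le> n * (((32 * n) + (32 * n)) / 2 + 2 * n + n + 2 * n)"
    proof (intro mult_left_mono add_mono divide_right_mono l)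
      show "(\<Sum>i\<in>{1..<N}. l (N - i) ^ 2) \<le> 32 * n" using sum_reflect[of "\<lambda>i. l i ^ 2" N] l(3) by simp
      show "(\<Sum>i\<in>{1..<N}. \<bar>l (N - i)\<bar>) \<le> n" using sum_reflect[of "\<lambda>i. \<bar>l i\<bar>" N] l(2) by simp
      show "(\<Sum>i\<in>{1..<N}. 2) \<le> 2 * n" by (simp add: n_def)
    qed (use n1 in auto)
    also have "\<dots> = 37 * n ^ 2" by (simp add: power2_eq_square)
    finally show ?thesis .
  qed
  have s0: "s0 = n ^ 2 / 2 - n / 2" unfolding s0_def n_def by (rule sum_atLeastLessThan_of_nat[OF N])
  have nx: "n * x \<le> n ^ 2"
  proof -
    have "x * 1 \<le> x * x" using x1 by (intro mult_left_mono) auto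
    then have "x \<le> n" using x1 by simp
    then show ?thesis using n1 by (simp add: power2_eq_square)
  qed
  have nn: "n * n = n ^ 2" by (simp add: power2_eq_square)
  \<comment> \<open>The coefficient \<open>4 * \<gamma> - 3\<close> combines
    \<open>4 * \<gamma> - 1\<close> with a \<open>-2\<close> that comes from \<open>s1\<close> being
    close to \<open>- n\<close>.\<close>
  have "A3 - n ^ 2 / 2 * (L ^ 2 + (4 * \<gamma> - 3) * L) = - (L ^ 2 * n) / 2 - (L * n) * (4 * \<gamma> - 1) / 2 + (L * n) * (s1 + n) + R"
    unfolding A3 s0 by (simp add: algebra_simps power2_eq_square add_divide_distrib diff_divide_distrib)
  also have "\<bar>\<dots>\<bar> \<le> 2 * n ^ 2 + 3 * n ^ 2 + 6 * n ^ 2 + 37 * n ^ 2"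
  proof -
    have Ln: "0 \<le> L * n" "L * n \<le> 2 * n ^ 2"
    proof -
      show "0 \<le> L * n" using L n1 by simp
      have "L * n \<le> (2 * x) * n" using L n1 by (intro mult_right_mono) auto
      then show "L * n \<le> 2 * n ^ 2" using nx by (simp add: mult_ac)
    qed
    have LL: "L ^ 2 \<le> 4 * n"
    proof -
      have "L * L \<le> (2 * x) * (2 * x)" using L x1 by (intro mult_mono) auto
      then show ?thesis using x1(2) by (simp add: power2_eq_square)
    qed
    have 1: "\<bar>- (L ^ 2 * n) / 2\<bar> \<le> 2 * n ^ 2"
    proof -
      have "L ^ 2 * n \<le> (4 * n) * n" using LL n1 by (intro mult_right_mono) auto
      then show ?thesis using n1 by (simp add: power2_eq_square)
    qed
    have 2: "\<bar>(L * n) * (4 * \<gamma> - 1) / 2\<bar> \<le> 3 * n ^ 2"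
    proof -
      have "\<bar>(L * n) * (4 * \<gamma> - 1)\<bar> = (L * n) * \<bar>4 * \<gamma> - 1\<bar>" unfolding abs_mult[of "L * n"] abs_of_nonneg[OF Ln(1)] ..
      also have "\<dots> \<le> (2 * n ^ 2) * 3" by (rule mult_mono[OF Ln(2)]) (use \<gamma> in auto)
      finally show ?thesis by simp
    qed
    have 3: "\<bar>(L * n) * (s1 + n)\<bar> \<le> 6 * n ^ 2"
    proof -
      have "\<bar>(L * n) * (s1 + n)\<bar> = (L * n) * \<bar>s1 + n\<bar>" unfolding abs_mult[of "L * n"] abs_of_nonneg[OF Ln(1)] ..
      also have "\<dots> \<le> (L * n) * (1 + L)" using Ln l(1) unfolding s1_def by (intro mult_left_mono) auto
      also have "\<dots> = L * n + L ^ 2 * n" by (simp add: algebra_simps power2_eq_square)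
      also have "\<dots> \<le> 2 * n ^ 2 + (4 * n) * n" using Ln LL n1 by (intro add_mono mult_right_mono) auto
      finally show ?thesis by (simp add: power2_eq_square)
    qed
    show ?thesis using 1 2 3 R by linarith
  qed
  finally have E4: "\<bar>A3 - n ^ 2 / 2 * (L ^ 2 + (4 * \<gamma> - 3) * L)\<bar> \<le> 48 * n ^ 2" by simp
  have "\<bar>T - n ^ 2 / 2 * (L ^ 2 + (4 * \<gamma> - 3) * L)\<bar> \<le> 473 * n ^ 2" using E1 E2 E3 E4 by linarith
  also have "\<dots> \<le> 1000 * n ^ 2" by (intro mult_right_mono) auto
  finally show ?thesis unfolding T_def n_def \<gamma>_def .
qed

section \<open>The main term\<close>

text \<open>Sorted by the products \<open>t d\<close> and \<open>s e\<close>, these quadruples are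
  counted by the convolution of \<open>tau\<close> with itself. The bound is real since it will be
  divided by \<open>g k\<close> in Moebius inversion.\<close>

definition quad_set :: "real \<Rightarrow> (nat \<times> nat \<times> nat \<times> nat) set" where
  "quad_set X = {(d,e,t,s). 1 \<le> d \<and> 1 \<le> e \<and> 1 \<le> t \<and> 1 \<le> s \<and> real (t * d + s * e) \<le> X}"

definition half_quad_set :: "real \<Rightarrow> (nat \<times> nat \<times> nat \<times> nat) set" where
  "half_quad_set X = {(d,e,t,s). 1 \<le> e \<and> e \<le> d \<and> 1 \<le> t \<and> 1 \<le> s \<and> real (t * d + s * e) \<le> X}"

lemma finite_quad_set: "finite (quad_set X)"
proof (rule finite_subset)
  let ?N = "nat \<lfloor>X\<rfloor>"
  show "quad_set X \<subseteq> {..?N} \<times> {..?N} \<times> {..?N} \<times> {..?N}"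
  proof (rule subsetI)
    fix p assume "p \<in> quad_set X"
    then obtain d e t s where p: "p = (d,e,t,s)" and h: "1 \<le> d" "1 \<le> e" "1 \<le> t" "1 \<le> s" "real (t * d + s * e) \<le> X"
      by (auto simp: quad_set_def)
    have "1 * d \<le> t * d" "t * 1 \<le> t * d" "1 * e \<le> s * e" "s * 1 \<le> s * e"
      using h by (intro mult_le_mono; simp)+
    moreover have "t * d + s * e \<le> ?N" using h(5) by linarith
    ultimately have "d \<le> ?N" "e \<le> ?N" "t \<le> ?N" "s \<le> ?N" by linarith+
    then show "p \<in> {..?N} \<times> {..?N} \<times> {..?N} \<times> {..?N}" by (simp add: p)
  qed
qed simp

lemma half_quad_set_subset: "half_quad_set X \<subseteq> quad_set X"
  by (auto simp: half_quad_set_def quad_set_def)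

lemma finite_half_quad_set: "finite (half_quad_set X)"
  by (rule finite_subset[OF half_quad_set_subset finite_quad_set])

lemma quad_set_real_nat: "0 \<le> X \<Longrightarrow> quad_set X = quad_set (real (nat \<lfloor>X\<rfloor>))"
  "0 \<le> X \<Longrightarrow> half_quad_set X = half_quad_set (real (nat \<lfloor>X\<rfloor>))"
proof -
  assume X: "0 \<le> X"
  have r: "real m \<le> X \<longleftrightarrow> real m \<le> real (nat \<lfloor>X\<rfloor>)" for m
  proof -
    have "real m \<le> X \<longleftrightarrow> int m \<le> \<lfloor>X\<rfloor>" by (simp add: le_floor_iff)
    then show ?thesis using X by linarith
  qed
  show "quad_set X = quad_set (real (nat \<lfloor>X\<rfloor>))" "half_quad_set X = half_quad_set (real (nat \<lfloor>X\<rfloor>))"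
    unfolding quad_set_def half_quad_set_def by (simp_all only: r)
qed

lemma card_quad_set: "real (card (quad_set (real N))) = (\<Sum>i\<in>{1..N}. real (tau i) * divisor_sum (N - i))"
proof -
  let ?P = "\<lambda>N. {(a,b). 1 \<le> a \<and> 1 \<le> b \<and> a * b \<le> (N::nat)}"
  have bij: "bij_betw (\<lambda>((d,t),(e,s)). (d,e,t,s)) (SIGMA p:?P N. ?P (N - fst p * snd p)) (quad_set (real N))"
  proof (rule bij_betw_byWitness[where f' = "\<lambda>(d,e,t,s). ((d,t),(e,s))"])
    show "(\<lambda>((d,t),(e,s)). (d,e,t,s)) ` (SIGMA p:?P N. ?P (N - fst p * snd p)) \<subseteq> quad_set (real N)"
      unfolding quad_set_def of_nat_le_iff by (auto simp: mult.commute)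
    show "(\<lambda>(d,e,t,s). ((d,t),(e,s))) ` quad_set (real N) \<subseteq> (SIGMA p:?P N. ?P (N - fst p * snd p))"
      unfolding quad_set_def of_nat_le_iff by (auto simp: mult.commute)
  qed auto
  have "real (card (quad_set (real N))) = real (card (SIGMA p:?P N. ?P (N - fst p * snd p)))"
    using bij_betw_same_card[OF bij] by simp
  also have "\<dots> = (\<Sum>p\<in>?P N. real (card (?P (N - fst p * snd p))))"
    by (subst card_SigmaI) (use finite_mult_le in \<open>auto simp del: One_nat_def\<close>)
  also have "\<dots> = (\<Sum>(a,b)\<in>?P N. divisor_sum (N - a * b))"
    by (intro sum.cong refl) (auto simp: divisor_sum_eq_card)
  also have "\<dots> = (\<Sum>i\<in>{1..N}. real (tau i) * divisor_sum (N - i))" by (rule sum_tau_mult[symmetric])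
  finally show ?thesis .
qed

lemma sum_inverse_square_le_2: "(\<Sum>e\<in>{1..N}. 1 / real e ^ 2) \<le> 2"
proof -
  have "(\<Sum>e\<in>{1..N}. 1 / real e ^ 2) \<le> 2 - 1 / real N" if "N \<ge> 1"
    using that
  proof (induction N rule: dec_induct)
    case (step n)
    have "1 / real (Suc n) ^ 2 \<le> 1 / real n - 1 / real (Suc n)"
    proof -
      have "1 / real n - 1 / real (Suc n) = 1 / (real n * real (Suc n))" using step by (simp add: field_simps)
      moreover have "1 / real (Suc n) ^ 2 \<le> 1 / (real n * real (Suc n))"
        unfolding power2_eq_square using step by (intro divide_left_mono mult_right_mono) auto
      ultimately show ?thesis by simp
    qed
    then show ?case using step.IH by simp
  qed simp
  then show ?thesis by (cases "N = 0") (auto intro: order_trans)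
qed

text \<open>Exchanging \<open>(d, t)\<close> with \<open>(e, s)\<close> maps one half onto the
  other. They overlap where \<open>d = e\<close>, with at most \<open>(N / e) ^ 2\<close> elements
  for each \<open>e\<close>.\<close>

lemma card_half_quad_set_nat:
  "\<bar>2 * real (card (half_quad_set (real N))) - real (card (quad_set (real N)))\<bar> \<le> 2 * real N ^ 2"
proof -
  define H D where "H = half_quad_set (real N)" and "D = {p\<in>quad_set (real N). fst p = fst (snd p)}"
  define H' where "H' = {p\<in>quad_set (real N). fst p \<le> fst (snd p)}"
  have fin: "finite H" "finite D" "finite H'"
    using finite_quad_set finite_half_quad_set by (auto simp: H_def D_def H'_def)
  have sw: "H' = (\<lambda>(d,e,t,s). (e,d,s,t)) ` H"
  proof (intro equalityI subsetI)
    fix p assume "p \<in> H'"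
    then obtain d e t s where p: "p = (d,e,t,s)" and "(e,d,s,t) \<in> H"
      by (auto simp: H'_def H_def quad_set_def half_quad_set_def add.commute)
    then have "(\<lambda>(d,e,t,s). (e,d,s,t)) (e,d,s,t) \<in> (\<lambda>(d,e,t,s). (e,d,s,t)) ` H" by (rule_tac imageI)
    then show "p \<in> (\<lambda>(d,e,t,s). (e,d,s,t)) ` H" by (simp add: p)
  qed (auto simp: H'_def H_def quad_set_def half_quad_set_def add.commute)
  have cH: "card H' = card H" unfolding sw by (rule card_image) (auto simp: inj_on_def)
  have un: "quad_set (real N) = H \<union> H'"
    by (auto simp: H'_def H_def quad_set_def half_quad_set_def)
  have int: "H \<inter> H' = D"
    by (auto simp: H'_def H_def D_def quad_set_def half_quad_set_def)
  have "card (quad_set (real N)) + card D = card H + card H'"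
    unfolding un int[symmetric] using card_Un_Int[OF fin(1,3)] by simp
  then have eq: "2 * real (card H) - real (card (quad_set (real N))) = real (card D)"
    unfolding cH by (simp flip: of_nat_add)
  have "D \<subseteq> (\<lambda>(e,t,s). (e,e,t,s)) ` (SIGMA e:{1..N}. {1..N div e} \<times> {1..N div e})"
  proof (rule subsetI)
    fix p assume "p \<in> D"
    then obtain e t s where p: "p = (e,e,t,s)" and h: "1 \<le> e" "1 \<le> t" "1 \<le> s" "t * e + s * e \<le> N"
      unfolding D_def quad_set_def of_nat_le_iff by auto
    have "t * e \<le> N" "s * e \<le> N" "1 * e \<le> t * e" using h by (auto intro: mult_le_mono)
    then have "e \<le> N" by linarith
    have "t \<le> N div e" "s \<le> N div e" using h \<open>t * e \<le> N\<close> \<open>s * e \<le> N\<close> by (simp_all add: less_eq_div_iff_mult_less_eq)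
    then show "p \<in> (\<lambda>(e,t,s). (e,e,t,s)) ` (SIGMA e:{1..N}. {1..N div e} \<times> {1..N div e})"
      using h \<open>e \<le> N\<close> by (intro image_eqI[of _ _ "(e,t,s)"]) (auto simp: p)
  qed
  then have "card D \<le> card ((\<lambda>(e,t,s). (e,e,t,s)) ` (SIGMA e:{1..N}. {1..N div e} \<times> {1..N div e}))"
    by (rule card_mono[rotated]) auto
  also have "\<dots> \<le> card (SIGMA e:{1..N}. {1..N div e} \<times> {1..N div e})" by (rule card_image_le) auto
  also have "\<dots> = (\<Sum>e\<in>{1..N}. (N div e) * (N div e))" by simp
  finally have "real (card D) \<le> (\<Sum>e\<in>{1..N}. real (N div e) * real (N div e))"
    by (simp flip: of_nat_mult of_nat_sum)
  also have "\<dots> \<le> (\<Sum>e\<in>{1..N}. (real N / real e) * (real N / real e))"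
    by (intro sum_mono mult_mono of_nat_div_le_of_nat) auto
  also have "\<dots> = real N ^ 2 * (\<Sum>e\<in>{1..N}. 1 / real e ^ 2)"
    by (simp add: sum_distrib_left power2_eq_square)
  also have "\<dots> \<le> real N ^ 2 * 2" by (intro mult_left_mono sum_inverse_square_le_2) simp
  finally show ?thesis unfolding H_def[symmetric] eq by simp
qed

lemma half_quad_set_approx:
  obtains C where "C > 0" "\<And>X. X > 0 \<Longrightarrow>
    \<bar>real (card (half_quad_set X)) - X ^ 2 / 4 * (ln X ^ 2 + (4 * euler_mascheroni - 3) * ln X)\<bar> \<le> C * (X ^ 2 + X powr (3/2))"
proof -
  define c :: real where "c = 4 * euler_mascheroni - 3"
  have \<gamma>: "0 < (euler_mascheroni :: real)" "(euler_mascheroni :: real) < 1"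
    using euler_mascheroni_pos euler_mascheroni_bounds[of 1] ln2_ge_two_thirds by (simp_all add: harm_expand)
  have c: "\<bar>c\<bar> \<le> 3" using \<gamma> by (simp add: c_def)
  have small: "\<bar>real (card (half_quad_set X)) - X ^ 2 / 4 * (ln X ^ 2 + c * ln X)\<bar> \<le> 1000 * (X ^ 2 + X powr (3/2))"
    if X: "0 < X" "X < 1" for X
  proof -
    have "nat \<lfloor>X\<rfloor> = 0" using X by simp
    then have "half_quad_set X = half_quad_set 0" using quad_set_real_nat(2)[of X] X by simp
    also have "\<dots> = {}" by (auto simp: half_quad_set_def simp del: of_nat_add of_nat_mult)
    finally have emp: "half_quad_set X = {}" .
    define y where "y = 1 / X"
    have y: "y > 1" "ln X = - ln y" using X by (simp_all add: y_def ln_div)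
    \<comment> \<open>The square of \<open>p\<close> dominates both logarithmic terms, and
      \<open>X ^ 2 * p ^ 2 = X powr (3/2)\<close>.\<close>
    define p where "p = X powr (-1/4)"
    have p: "p \<ge> 1" "ln y \<le> 4 * p" "ln y \<ge> 0"
    proof -
      have "ln y \<le> y powr (1/4) / (1/4)" using y by (intro ln_powr_bound) auto
      moreover have "y powr (1/4) = p" using X by (simp add: y_def p_def powr_divide powr_minus_divide)
      ultimately show "ln y \<le> 4 * p" by simp
      have "1 \<le> y powr (1/4)" using y by (intro ge_one_powr_ge_zero) auto
      then show "p \<ge> 1" using \<open>y powr (1/4) = p\<close> by simp
      show "ln y \<ge> 0" using y by simp
    qed
    have "\<bar>ln X ^ 2 + c * ln X\<bar> \<le> (ln y) ^ 2 + 3 * ln y"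
    proof -
      have "\<bar>c * ln X\<bar> \<le> 3 * ln y" unfolding abs_mult y(2) using c p by (intro mult_mono) auto
      moreover have "ln X ^ 2 = (ln y) ^ 2" by (simp add: y(2))
      ultimately show ?thesis by (smt (verit) zero_le_power2)
    qed
    also have "\<dots> \<le> (4 * p) ^ 2 + 3 * (4 * p * p)"
    proof (intro add_mono power_mono mult_left_mono p)
      have "4 * p * 1 \<le> 4 * p * p" using p(1) by (intro mult_left_mono) auto
      then show "ln y \<le> 4 * p * p" using p(2) by linarith
    qed auto
    also have "\<dots> = 28 * p ^ 2" by (simp add: power2_eq_square)
    finally have b: "\<bar>ln X ^ 2 + c * ln X\<bar> \<le> 28 * p ^ 2" .
    have "\<bar>X ^ 2 / 4 * (ln X ^ 2 + c * ln X)\<bar> = X ^ 2 / 4 * \<bar>ln X ^ 2 + c * ln X\<bar>" by (simp add: abs_mult)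
    also have "\<dots> \<le> X ^ 2 / 4 * (28 * p ^ 2)" using b by (intro mult_left_mono) auto
    also have "\<dots> = 7 * (X ^ 2 * p ^ 2)" by simp
    also have "X ^ 2 * p ^ 2 = X powr (3/2)"
    proof -
      have "X ^ 2 = X powr 2" using X by (simp add: powr_numeral)
      moreover have "p ^ 2 = X powr (-1/2)" by (simp add: p_def power2_eq_square flip: powr_add)
      ultimately show ?thesis by (simp flip: powr_add)
    qed
    also have "7 * X powr (3/2) \<le> 1000 * (X ^ 2 + X powr (3/2))" by simp
    finally show ?thesis using emp by simp
  qed
  have large: "\<bar>real (card (half_quad_set X)) - X ^ 2 / 4 * (ln X ^ 2 + c * ln X)\<bar> \<le> 1000 * (X ^ 2 + X powr (3/2))"
    if X: "1 \<le> X" for X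
  proof -
    define N where "N = nat \<lfloor>X\<rfloor>"
    define n where "n = real N"
    have N: "N \<ge> 1" using X by (simp add: N_def le_nat_floor)
    have "real N = of_int \<lfloor>X\<rfloor>" using X by (simp add: N_def)
    then have n: "1 \<le> n" "n \<le> X" "X < n + 1" using N unfolding n_def by linarith+
    define L M where "L = ln n" and "M = ln X"
    have LM: "0 \<le> L" "L \<le> M" using n by (simp_all add: L_def M_def)
    have dLM: "M - L \<le> 1 / n"
    proof -
      have "ln X - ln n \<le> (X - n) / n" using n by (intro ln_diff_le) auto
      also have "\<dots> \<le> 1 / n" using n by (intro divide_right_mono) auto
      finally show ?thesis by (simp add: L_def M_def)
    qed
    have M2: "M ^ 2 \<le> 16 * X" "M \<le> 4 * X"
    proof -
      have "M \<le> X powr (1/2) / (1/2)" unfolding M_def using X by (intro ln_powr_bound) auto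
      then have a: "M \<le> 2 * sqrt X" using X by (simp add: powr_half_sqrt)
      then have "M * M \<le> (2 * sqrt X) * (2 * sqrt X)" using LM X by (intro mult_mono) auto
      then show "M ^ 2 \<le> 16 * X" using X by (simp add: power2_eq_square)
      have "M \<le> X - 1" unfolding M_def using X by (intro ln_le_minus_one) auto
      then show "M \<le> 4 * X" using X by simp
    qed
    have A: "\<bar>2 * real (card (half_quad_set X)) - n ^ 2 / 2 * (L ^ 2 + c * L)\<bar> \<le> 1002 * n ^ 2"
    proof -
      have hq: "half_quad_set X = half_quad_set (real N)" using quad_set_real_nat(2)[of X] X by (simp add: N_def)
      have "\<bar>real (card (quad_set (real N))) - n ^ 2 / 2 * (L ^ 2 + c * L)\<bar> \<le> 1000 * n ^ 2"
        unfolding card_quad_set L_def n_def c_def by (rule divisor_convolution_approx[OF N])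
      then show ?thesis using card_half_quad_set_nat[of N] unfolding hq n_def[symmetric] by linarith
    qed
    \<comment> \<open>Passing from the integer part \<open>n\<close> to \<open>X\<close> changes the
      square by \<open>O(X)\<close> and the logarithm by \<open>O(1 / n)\<close>.\<close>
    have B: "\<bar>X ^ 2 / 2 * (M ^ 2 + c * M) - n ^ 2 / 2 * (L ^ 2 + c * L)\<bar> \<le> 100 * X ^ 2"
    proof -
      have "X ^ 2 * (M ^ 2 + c * M) - n ^ 2 * (L ^ 2 + c * L) =
         (X ^ 2 - n ^ 2) * (M ^ 2 + c * M) + n ^ 2 * ((M - L) * (M + L + c))"
        by (simp add: power2_eq_square algebra_simps)
      also have "\<bar>\<dots>\<bar> \<le> (2 * X) * (28 * X) + (n * 1) * (11 * X)"
      proof (rule order_trans[OF abs_triangle_ineq], rule add_mono)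
        have "\<bar>X ^ 2 - n ^ 2\<bar> \<le> 2 * X"
        proof -
          have "(X - n) * (X + n) \<le> 1 * (2 * X)" using n by (intro mult_mono) auto
          moreover have "0 \<le> (X - n) * (X + n)" using n by (intro mult_nonneg_nonneg) auto
          moreover have "(X - n) * (X + n) = X ^ 2 - n ^ 2" by (simp add: power2_eq_square algebra_simps)
          ultimately show ?thesis by simp
        qed
        moreover have "\<bar>M ^ 2 + c * M\<bar> \<le> 28 * X"
        proof -
          have "\<bar>c * M\<bar> \<le> 3 * (4 * X)" unfolding abs_mult using c LM M2 by (intro mult_mono) auto
          moreover have "0 \<le> M ^ 2" by simp
          ultimately show ?thesis using M2(1) by linarith
        qed
        ultimately show "\<bar>(X ^ 2 - n ^ 2) * (M ^ 2 + c * M)\<bar> \<le> (2 * X) * (28 * X)"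
          unfolding abs_mult using X by (intro mult_mono) auto
        have "\<bar>n ^ 2 * ((M - L) * (M + L + c))\<bar> = (n * (n * (M - L))) * \<bar>M + L + c\<bar>"
          using n LM by (simp add: abs_mult power2_eq_square)
        also have "\<dots> \<le> (n * 1) * (11 * X)"
        proof (rule mult_mono)
          have "n * (M - L) \<le> 1" using dLM n by (simp add: field_simps)
          then show "n * (n * (M - L)) \<le> n * 1" using n by (intro mult_left_mono) auto
          show "\<bar>M + L + c\<bar> \<le> 11 * X" using c LM M2 X by linarith
        qed (use n in auto)
        finally show "\<bar>n ^ 2 * ((M - L) * (M + L + c))\<bar> \<le> (n * 1) * (11 * X)" .
      qed
      also have "\<dots> \<le> (2 * X) * (28 * X) + (X * 1) * (11 * X)" using n X by (intro add_left_mono mult_right_mono) auto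
      also have "\<dots> = 67 * X ^ 2" by (simp add: power2_eq_square)
      finally have "\<bar>X ^ 2 * (M ^ 2 + c * M) - n ^ 2 * (L ^ 2 + c * L)\<bar> \<le> 67 * X ^ 2" .
      moreover have "0 \<le> X ^ 2" by simp
      ultimately show ?thesis unfolding times_divide_eq_left by linarith
    qed
    have "n ^ 2 \<le> X ^ 2" using n by (intro power_mono) auto
    then have "\<bar>2 * real (card (half_quad_set X)) - X ^ 2 / 2 * (M ^ 2 + c * M)\<bar> \<le> 1102 * X ^ 2" using A B by linarith
    moreover have "0 \<le> X powr (3/2)" "0 \<le> X ^ 2" by simp_all
    moreover have "X ^ 2 / 2 * (M ^ 2 + c * M) = 2 * (X ^ 2 / 4 * (M ^ 2 + c * M))" by simp
    ultimately show ?thesis unfolding M_def[symmetric] distrib_left[of 1000] by linarith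
  qed
  show ?thesis
    by (rule that[of 1000]) (use small large in \<open>auto simp: c_def not_less\<close>, metis not_less)
qed

lemma sum_row_total_eq_card:
  "(\<Sum>e\<in>{1..Q}. row_total Q e) =
    real (card {(d,e,t,s)\<in>half_quad_set (real Q). coprime d e \<and> coprime t s})"
proof -
  let ?C = "\<lambda>d e. {(t,s). 1 \<le> t \<and> 1 \<le> s \<and> coprime t s \<and> t * d + s * e \<le> Q}"
  let ?D = "\<lambda>e. {d\<in>{e..Q}. coprime d e}"
  have bij: "bij_betw (\<lambda>(e,d,t,s). (d,e,t,s)) (SIGMA e:{1..Q}. SIGMA d:?D e. ?C d e)
     {(d,e,t,s)\<in>half_quad_set (real Q). coprime d e \<and> coprime t s}"
  proof (rule bij_betw_byWitness[where f' = "\<lambda>(d,e,t,s). (e,d,t,s)"])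
    show "(\<lambda>(e,d,t,s). (d,e,t,s)) ` (SIGMA e:{1..Q}. SIGMA d:?D e. ?C d e) \<subseteq>
       {(d,e,t,s)\<in>half_quad_set (real Q). coprime d e \<and> coprime t s}"
      unfolding half_quad_set_def of_nat_le_iff by auto
    show "(\<lambda>(d,e,t,s). (e,d,t,s)) ` {(d,e,t,s)\<in>half_quad_set (real Q). coprime d e \<and> coprime t s} \<subseteq>
       (SIGMA e:{1..Q}. SIGMA d:?D e. ?C d e)"
    proof (rule image_subsetI)
      fix p assume "p \<in> {(d,e,t,s)\<in>half_quad_set (real Q). coprime d e \<and> coprime t s}"
      then obtain d e t s where p: "p = (d,e,t,s)" and h: "1 \<le> e" "e \<le> d" "1 \<le> t" "1 \<le> s" "t * d + s * e \<le> Q"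
        "coprime d e" "coprime t s"
        unfolding half_quad_set_def of_nat_le_iff by auto
      have "1 * d \<le> t * d" using h by (intro mult_le_mono) auto
      then have "d \<le> Q" using h by linarith
      then show "(\<lambda>(d,e,t,s). (e,d,t,s)) p \<in> (SIGMA e:{1..Q}. SIGMA d:?D e. ?C d e)"
        using h by (simp add: p)
    qed
  qed auto
  have finC: "finite (?C d e)" if "e \<in> {1..Q}" "d \<in> ?D e" for d e
    by (rule finite_cone) (use that in auto)
  have "(\<Sum>e\<in>{1..Q}. row_total Q e) = (\<Sum>e\<in>{1..Q}. \<Sum>d\<in>?D e. real (card (?C d e)))"
    unfolding row_total_def coprime_cone_def
    by (intro sum.cong refl sum.inter_filter[symmetric]) simp
  also have "\<dots> = real (\<Sum>e\<in>{1..Q}. card (SIGMA d:?D e. ?C d e))"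
    unfolding of_nat_sum
  proof (intro sum.cong refl)
    fix e assume e: "e \<in> {1..Q}"
    have "card (SIGMA d:?D e. ?C d e) = (\<Sum>d\<in>?D e. card (?C d e))"
      by (rule card_SigmaI) (use finC[OF e] in \<open>auto simp del: One_nat_def\<close>)
    then show "(\<Sum>d\<in>?D e. real (card (?C d e))) = real (card (SIGMA d:?D e. ?C d e))" by simp
  qed
  also have "(\<Sum>e\<in>{1..Q}. card (SIGMA d:?D e. ?C d e)) = card (SIGMA e:{1..Q}. SIGMA d:?D e. ?C d e)"
  proof (rule card_SigmaI[symmetric])
    show "\<forall>e\<in>{1..Q}. finite (SIGMA d:?D e. ?C d e)"
      using finC by (intro ballI finite_SigmaI) (auto simp del: One_nat_def)
  qed simp
  also have "\<dots> = card {(d,e,t,s)\<in>half_quad_set (real Q). coprime d e \<and> coprime t s}"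
    by (rule bij_betw_same_card[OF bij])
  finally show ?thesis .
qed

section \<open>Moebius inversion in both coprime pairs\<close>

lemma card_half_quad_multiples:
  assumes "g \<ge> 1" "k \<ge> 1"
  shows "card {(d,e,t,s)\<in>half_quad_set X. (g dvd d \<and> g dvd e) \<and> (k dvd t \<and> k dvd s)} =
     card (half_quad_set (X / (real g * real k)))"
proof -
  have gk: "real g * real k > 0" using assms by simp
  have iff: "real (k * t * (g * d) + k * s * (g * e)) \<le> X \<longleftrightarrow> real (t * d + s * e) \<le> X / (real g * real k)" for d e t s
  proof -
    have "real (k * t * (g * d) + k * s * (g * e)) = real (t * d + s * e) * (real g * real k)"
      by (simp add: algebra_simps)
    then show ?thesis using gk by (simp only: pos_le_divide_eq)
  qed
  have "bij_betw (\<lambda>(d,e,t,s). (g * d, g * e, k * t, k * s)) (half_quad_set (X / (real g * real k)))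
     {(d,e,t,s)\<in>half_quad_set X. (g dvd d \<and> g dvd e) \<and> (k dvd t \<and> k dvd s)}"
  proof (rule bij_betw_imageI)
    show "inj_on (\<lambda>(d,e,t,s). (g * d, g * e, k * t, k * s)) (half_quad_set (X / (real g * real k)))"
      using assms by (auto simp: inj_on_def)
    show "(\<lambda>(d,e,t,s). (g * d, g * e, k * t, k * s)) ` half_quad_set (X / (real g * real k)) =
       {(d,e,t,s)\<in>half_quad_set X. (g dvd d \<and> g dvd e) \<and> (k dvd t \<and> k dvd s)}" (is "?f ` ?A = ?B")
    proof (intro equalityI subsetI)
      fix p assume "p \<in> ?f ` ?A"
      then obtain x where x: "x \<in> ?A" "p = ?f x" by blast
      obtain d e t s where xx: "x = (d,e,t,s)" by (metis surj_pair)
      have p: "p = (g * d, g * e, k * t, k * s)" using x(2) by (simp add: xx)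
      have h: "1 \<le> e" "e \<le> d" "1 \<le> t" "1 \<le> s" "real (t * d + s * e) \<le> X / (real g * real k)"
        using x(1) unfolding xx half_quad_set_def by blast+
      have "real (k * t * (g * d) + k * s * (g * e)) \<le> X" using h(5) by (simp only: iff)
      moreover have "1 \<le> g * e" "1 \<le> k * t" "1 \<le> k * s" using h assms by (simp_all add: Suc_le_eq)
      moreover have "g * e \<le> g * d" using h by simp
      ultimately show "p \<in> ?B" unfolding p half_quad_set_def mem_Collect_eq prod.case
        by (intro conjI) (assumption | rule dvd_triv_left)+
    next
      fix p assume "p \<in> ?B"
      then obtain D E T S where P: "p = (D,E,T,S)" and H: "1 \<le> E" "E \<le> D" "1 \<le> T" "1 \<le> S" "real (T * D + S * E) \<le> X"
        "g dvd D" "g dvd E" "k dvd T" "k dvd S"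
        unfolding half_quad_set_def by blast
      obtain d e t s where q: "D = g * d" "E = g * e" "T = k * t" "S = k * s" using H(6-9) by (elim dvdE)
      have "real (t * d + s * e) \<le> X / (real g * real k)" using H(5) unfolding q by (simp only: iff)
      moreover have "1 \<le> e" "1 \<le> t" "1 \<le> s" using H(1,3,4) unfolding q by (auto simp: Suc_le_eq)
      moreover have "e \<le> d" using H(2) assms unfolding q by simp
      ultimately have "(d,e,t,s) \<in> ?A" unfolding half_quad_set_def by blast
      then have "?f (d,e,t,s) \<in> ?f ` ?A" by (rule imageI)
      then show "p \<in> ?f ` ?A" by (simp add: P q)
    qed
  qed
  then show ?thesis by (rule bij_betw_same_card[symmetric])
qed

lemma sum_row_total_moebius:
  "(\<Sum>e\<in>{1..Q}. row_total Q e) =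
    (\<Sum>g\<in>{1..Q}. \<Sum>k\<in>{1..Q}. moebius g * moebius k * real (card (half_quad_set (real Q / (real g * real k)))))"
proof -
  let ?S = "half_quad_set (real Q)"
  let ?P = "\<lambda>g k p. case p of (d,e,t,s) \<Rightarrow> (g dvd d \<and> g dvd e) \<and> (k dvd t \<and> k dvd s)"
  have fin: "finite ?S" by (rule finite_half_quad_set)
  have "{(d,e,t,s)\<in>?S. coprime d e \<and> coprime t s} = {p\<in>?S. case p of (d,e,t,s) \<Rightarrow> coprime d e \<and> coprime t s}" by auto
  then have "(\<Sum>e\<in>{1..Q}. row_total Q e) = (\<Sum>p\<in>{p\<in>?S. case p of (d,e,t,s) \<Rightarrow> coprime d e \<and> coprime t s}. 1)"
    unfolding sum_row_total_eq_card by simp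
  also have "\<dots> = (\<Sum>p\<in>?S. if (case p of (d,e,t,s) \<Rightarrow> coprime d e \<and> coprime t s) then 1 else 0)"
    by (rule sum.inter_filter[OF fin])
  also have "\<dots> = (\<Sum>p\<in>?S. \<Sum>g\<in>{1..Q}. \<Sum>k\<in>{1..Q}. if ?P g k p then moebius g * moebius k else 0)"
  proof (rule sum.cong[OF refl])
    fix p assume "p \<in> ?S"
    then obtain d e t s where p: "p = (d,e,t,s)" and h: "1 \<le> e" "e \<le> d" "1 \<le> t" "1 \<le> s" "t * d + s * e \<le> Q"
      unfolding half_quad_set_def of_nat_le_iff by auto
    have "1 * d \<le> t * d" "t * 1 \<le> t * d" using h by (auto intro!: mult_le_mono)
    then have dt: "0 < d" "d \<le> Q" "0 < t" "t \<le> Q" using h by linarith+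
    have "(if coprime d e \<and> coprime t s then 1 else 0 :: real) = (if coprime d e then 1 else 0) * (if coprime t s then 1 else 0)" by simp
    also have "\<dots> = (\<Sum>g\<in>{1..Q}. \<Sum>k\<in>{1..Q}. (if g dvd d \<and> g dvd e then moebius g else 0) * (if k dvd t \<and> k dvd s then moebius k else 0))"
      unfolding coprime_indicator_sum_moebius[OF dt(1,2)] coprime_indicator_sum_moebius[OF dt(3,4)] by (rule sum_product)
    also have "\<dots> = (\<Sum>g\<in>{1..Q}. \<Sum>k\<in>{1..Q}. if ?P g k p then moebius g * moebius k else 0)"
      by (intro sum.cong refl) (auto simp: p)
    finally show "(if (case p of (d,e,t,s) \<Rightarrow> coprime d e \<and> coprime t s) then 1 else 0) =
       (\<Sum>g\<in>{1..Q}. \<Sum>k\<in>{1..Q}. if ?P g k p then moebius g * moebius k else 0)" by (simp add: p)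
  qed
  also have "\<dots> = (\<Sum>g\<in>{1..Q}. \<Sum>p\<in>?S. \<Sum>k\<in>{1..Q}. if ?P g k p then moebius g * moebius k else 0)" by (rule sum.swap)
  also have "\<dots> = (\<Sum>g\<in>{1..Q}. \<Sum>k\<in>{1..Q}. \<Sum>p\<in>?S. if ?P g k p then moebius g * moebius k else 0)"
    by (rule sum.cong[OF refl], rule sum.swap)
  also have "\<dots> = (\<Sum>g\<in>{1..Q}. \<Sum>k\<in>{1..Q}. moebius g * moebius k * real (card (half_quad_set (real Q / (real g * real k)))))"
  proof (intro sum.cong refl)
    fix g k assume gk: "g \<in> {1..Q}" "k \<in> {1..Q}"
    have "(\<Sum>p\<in>?S. if ?P g k p then moebius g * moebius k else 0) = (\<Sum>p\<in>{p\<in>?S. ?P g k p}. moebius g * moebius k)"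
      by (rule sum.inter_filter[OF fin, symmetric])
    also have "{p\<in>?S. ?P g k p} = {(d,e,t,s)\<in>?S. (g dvd d \<and> g dvd e) \<and> (k dvd t \<and> k dvd s)}" by auto
    finally show "(\<Sum>p\<in>?S. if ?P g k p then moebius g * moebius k else 0) =
        moebius g * moebius k * real (card (half_quad_set (real Q / (real g * real k))))"
      using gk card_half_quad_multiples[of g k "real Q"] by simp
  qed
  finally show ?thesis .
qed

lemma ln_squared_over_square_le_powr: "m \<ge> 1 \<Longrightarrow> ln (real m) ^ 2 / real m ^ 2 \<le> 256 * real m powr (-7/4)"
proof -
  assume m: "m \<ge> 1"
  have "ln (real m) \<le> 8 * real m powr (1/8)" using ln_powr_bound[of "real m" "1/8"] m by simp
  then have "ln (real m) ^ 2 \<le> (8 * real m powr (1/8)) ^ 2" using m by (intro power_mono) auto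
  also have "\<dots> = 64 * real m powr (1/4)" by (simp add: power_mult_distrib power2_eq_square flip: powr_add)
  finally have "ln (real m) ^ 2 / real m ^ 2 \<le> 64 * real m powr (1/4) / real m ^ 2" by (rule divide_right_mono) simp
  also have "\<dots> = 64 * (real m powr (1/4) * real m powr (-2))" using m by (simp add: powr_minus powr_numeral inverse_eq_divide)
  also have "real m powr (1/4) * real m powr (-2) = real m powr (-7/4)" by (simp flip: powr_add)
  also have "64 * real m powr (-7/4) \<le> 256 * real m powr (-7/4)" by simp
  finally show ?thesis .
qed

text \<open>Inserting \<open>ln X = L - ln g - ln k\<close> for \<open>X = Q / (g k)\<close>
  expresses the double sum by \<open>A\<close>, \<open>B\<close> and \<open>B2\<close>, the Moebius
  sums with zero, one and two logarithms. Only \<open>A * A\<close> and \<open>A * B\<close> occur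
  with powers of \<open>L\<close>, and they reach their limits at the rate
  \<open>1 / sqrt Q\<close>. The limit of \<open>B\<close> is the source of the term
  \<open>4 * zeta_log / zeta 2\<close>.\<close>

lemma sum_row_total_approx:
  obtains C where "C > 0" "\<And>Q. Q \<ge> 1 \<Longrightarrow>
    \<bar>(\<Sum>e\<in>{1..Q}. row_total Q e) - real Q ^ 2 / (4 * zeta 2 ^ 2) *
       (ln (real Q) ^ 2 + (4 * euler_mascheroni - 3 + 4 * zeta_log / zeta 2) * ln (real Q))\<bar> \<le> C * real Q ^ 2"
proof -
  obtain H where H: "H > 0" "\<And>X. X > 0 \<Longrightarrow>
    \<bar>real (card (half_quad_set X)) - X ^ 2 / 4 * (ln X ^ 2 + (4 * euler_mascheroni - 3) * ln X)\<bar> \<le> H * (X ^ 2 + X powr (3/2))"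
    using half_quad_set_approx by blast
  obtain P where P: "P > 0" "\<And>N. (\<Sum>k\<in>{1..N}. real k powr (-3/2)) \<le> P"
    using sum_powr_bounded[of "3/2"] by auto
  obtain P2 where P2: "P2 > 0" "\<And>N. (\<Sum>k\<in>{1..N}. real k powr (-7/4)) \<le> P2"
    using sum_powr_bounded[of "7/4"] by auto
  obtain K where K: "K > 0"
    "\<And>N. N \<ge> 1 \<Longrightarrow> \<bar>(\<Sum>k\<in>{1..N}. moebius k / real k ^ 2) - 1 / zeta 2\<bar> \<le> K / sqrt (real N)"
    "\<And>N. N \<ge> 1 \<Longrightarrow> \<bar>(\<Sum>k\<in>{1..N}. moebius k * ln (real k) / real k ^ 2) + zeta_log / zeta 2 ^ 2\<bar> \<le> K / sqrt (real N)"
    using moebius_partial_sums by blast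
  define c :: real where "c = 4 * euler_mascheroni - 3"
  have \<gamma>: "0 < (euler_mascheroni :: real)" "(euler_mascheroni :: real) < 1"
    using euler_mascheroni_pos euler_mascheroni_bounds[of 1] ln2_ge_two_thirds by (simp_all add: harm_expand)
  have c: "\<bar>c\<bar> \<le> 3" using \<gamma> by (simp add: c_def)
  \<comment> \<open>A common bound for \<open>A\<close>, \<open>B\<close> and \<open>B2\<close>: the
    \<open>256\<close> is that of \<open>ln_squared_over_square_le_powr\<close>, the
    \<open>2\<close> that of \<open>sum_inverse_square_le_2\<close>.\<close>
  define W where "W = 256 * P2 + 2"
  define z :: real where "z = zeta 2"
  have z: "z > 0" unfolding z_def by (rule zeta_2_pos)
  define a0 b0 where "a0 = 1 / z" and "b0 = - zeta_log / z ^ 2"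
  \<comment> \<open>The \<open>16\<close>, \<open>6\<close> and \<open>8\<close> belong to
    \<open>t1\<close>, \<open>t2\<close> and \<open>t3\<close>; the \<open>10\<close> is
    \<open>6 + 2 + 2\<close>, from the three products that carry no \<open>L\<close>.\<close>
  define E where "E = 16 * K * (W + \<bar>a0\<bar>) + 6 * K * (W + \<bar>a0\<bar>) + 8 * K * (W + \<bar>a0\<bar>) + 10 * W * W"
  define C where "C = H * (4 + P * P) + E / 4 + 1"
  have main: "\<bar>(\<Sum>e\<in>{1..Q}. row_total Q e) - real Q ^ 2 / (4 * zeta 2 ^ 2) *
       (ln (real Q) ^ 2 + (4 * euler_mascheroni - 3 + 4 * zeta_log / zeta 2) * ln (real Q))\<bar> \<le> C * real Q ^ 2"
    if Q: "Q \<ge> 1" for Q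
  proof -
    define q where "q = real Q"
    define L where "L = ln q"
    have q1: "q \<ge> 1" using Q by (simp add: q_def)
    define a l where "a = (\<lambda>k. moebius k / real k ^ 2)" and "l = (\<lambda>k::nat. ln (real k))"
    define A B B2 where "A = (\<Sum>k\<in>{1..Q}. a k)" and "B = (\<Sum>k\<in>{1..Q}. a k * l k)" and "B2 = (\<Sum>k\<in>{1..Q}. a k * l k ^ 2)"
    have absa: "\<bar>a k\<bar> \<le> 1 / real k ^ 2" for k
      unfolding a_def abs_divide using abs_moebius_le[of k] by (simp add: divide_right_mono)
    have AW: "\<bar>A\<bar> \<le> W"
    proof -
      have "\<bar>A\<bar> \<le> (\<Sum>k\<in>{1..Q}. 1 / real k ^ 2)" unfolding A_def by (rule order_trans[OF sum_abs sum_mono]) (rule absa)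
      also have "\<dots> \<le> 2" by (rule sum_inverse_square_le_2)
      finally show ?thesis using P2 by (simp add: W_def)
    qed
    have BW: "\<bar>B\<bar> \<le> W"
    proof -
      have "\<bar>B\<bar> \<le> (\<Sum>k\<in>{1..Q}. 4 * real k powr (-7/4))" unfolding B_def
      proof (rule order_trans[OF sum_abs sum_mono])
        fix k assume "k \<in> {1..Q}"
        then show "\<bar>a k * l k\<bar> \<le> 4 * real k powr (-7/4)"
          using moebius_ln_le_powr[of k] by (simp add: a_def l_def)
      qed
      also have "\<dots> \<le> 4 * P2" unfolding sum_distrib_left[symmetric] by (intro mult_left_mono P2) simp
      finally show ?thesis using P2 by (simp add: W_def)
    qed
    have B2W: "\<bar>B2\<bar> \<le> W"
    proof -
      have "\<bar>B2\<bar> \<le> (\<Sum>k\<in>{1..Q}. 256 * real k powr (-7/4))" unfolding B2_def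
      proof (rule order_trans[OF sum_abs sum_mono])
        fix k assume k: "k \<in> {1..Q}"
        have "\<bar>a k * l k ^ 2\<bar> \<le> 1 / real k ^ 2 * l k ^ 2" unfolding abs_mult using absa[of k] by (intro mult_mono) auto
        then show "\<bar>a k * l k ^ 2\<bar> \<le> 256 * real k powr (-7/4)"
          using ln_squared_over_square_le_powr[of k] k by (simp add: l_def)
      qed
      also have "\<dots> \<le> 256 * P2" unfolding sum_distrib_left[symmetric] by (intro mult_left_mono P2) simp
      finally show ?thesis by (simp add: W_def)
    qed
    have W0: "W \<ge> 0" using AW by linarith
    have A: "\<bar>A - a0\<bar> \<le> K / sqrt q" and B: "\<bar>B - b0\<bar> \<le> K / sqrt q"
      using K(2,3)[OF Q] by (simp_all add: A_def B_def a_def l_def a0_def b0_def z_def q_def)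
    define M where "M = (\<lambda>g k. (q / (real g * real k)) ^ 2 / 4 * ((L - l g - l k) ^ 2 + c * (L - l g - l k)))"
    have M: "(\<Sum>g\<in>{1..Q}. \<Sum>k\<in>{1..Q}. moebius g * moebius k * M g k) =
       q ^ 2 / 4 * (A * A * (L ^ 2 + c * L) - 4 * L * (A * B) - 2 * c * (A * B) + 2 * (A * B2) + 2 * (B * B))"
    proof -
      have "(\<Sum>g\<in>{1..Q}. \<Sum>k\<in>{1..Q}. moebius g * moebius k * M g k) =
        (\<Sum>g\<in>{1..Q}. \<Sum>k\<in>{1..Q}. q ^ 2 / 4 * ((L ^ 2 + c * L) * (a g * a k) - (2 * L + c) * ((a g * l g) * a k) - (2 * L + c) * (a g * (a k * l k))
           + (a g * l g ^ 2) * a k + a g * (a k * l k ^ 2) + 2 * ((a g * l g) * (a k * l k))))"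
        by (intro sum.cong refl) (simp add: M_def a_def power_divide power_mult_distrib power2_eq_square field_simps)
      also have "\<dots> = q ^ 2 / 4 * ((L ^ 2 + c * L) * (A * A) - (2 * L + c) * (B * A) - (2 * L + c) * (A * B) + B2 * A + A * B2 + 2 * (B * B))"
        unfolding A_def B_def B2_def sum_product
        by (simp only: sum_distrib_left[symmetric] sum.distrib sum_subtractf)
      also have "\<dots> = q ^ 2 / 4 * (A * A * (L ^ 2 + c * L) - 4 * L * (A * B) - 2 * c * (A * B) + 2 * (A * B2) + 2 * (B * B))"
        by (simp add: algebra_simps)
      finally show ?thesis .
    qed
    have err: "\<bar>(\<Sum>e\<in>{1..Q}. row_total Q e) - (\<Sum>g\<in>{1..Q}. \<Sum>k\<in>{1..Q}. moebius g * moebius k * M g k)\<bar> \<le> H * (4 + P * P) * q ^ 2"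
    proof -
      have "\<bar>(\<Sum>e\<in>{1..Q}. row_total Q e) - (\<Sum>g\<in>{1..Q}. \<Sum>k\<in>{1..Q}. moebius g * moebius k * M g k)\<bar> \<le>
        (\<Sum>g\<in>{1..Q}. \<Sum>k\<in>{1..Q}. H * (q ^ 2 * ((1 / real g ^ 2) * (1 / real k ^ 2)) + q powr (3/2) * (real g powr (-3/2) * real k powr (-3/2))))"
        unfolding sum_row_total_moebius sum_subtractf[symmetric] right_diff_distrib[symmetric]
      proof (rule order_trans[OF sum_abs], rule sum_mono, rule order_trans[OF sum_abs], rule sum_mono)
        fix g k assume gk: "g \<in> {1..Q}" "k \<in> {1..Q}"
        define X where "X = q / (real g * real k)"
        have X: "X > 0" using gk q1 by (simp add: X_def)
        have lX: "ln X = L - l g - l k" using gk q1 by (simp add: X_def L_def l_def ln_div ln_mult)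
        have "\<bar>real (card (half_quad_set X)) - M g k\<bar> \<le> H * (X ^ 2 + X powr (3/2))"
          using H(2)[OF X] unfolding lX M_def X_def[symmetric] c_def .
        also have "X ^ 2 = q ^ 2 * ((1 / real g ^ 2) * (1 / real k ^ 2))" by (simp add: X_def power_divide power_mult_distrib)
        also have "X powr (3/2) = q powr (3/2) * (real g powr (-3/2) * real k powr (-3/2))"
          using gk q1 by (simp add: X_def powr_divide powr_mult powr_minus_divide)
        finally have b: "\<bar>real (card (half_quad_set X)) - M g k\<bar> \<le> H * (q ^ 2 * ((1 / real g ^ 2) * (1 / real k ^ 2)) + q powr (3/2) * (real g powr (-3/2) * real k powr (-3/2)))" .
        have "\<bar>moebius g * moebius k\<bar> \<le> 1 * 1" unfolding abs_mult by (intro mult_mono abs_moebius_le) auto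
        then have m: "\<bar>moebius g * moebius k\<bar> * \<bar>real (card (half_quad_set X)) - M g k\<bar> \<le> \<bar>real (card (half_quad_set X)) - M g k\<bar>"
          by (intro mult_left_le_one_le) auto
        show "\<bar>moebius g * moebius k * (real (card (half_quad_set (real Q / (real g * real k)))) - M g k)\<bar> \<le>
            H * (q ^ 2 * ((1 / real g ^ 2) * (1 / real k ^ 2)) + q powr (3/2) * (real g powr (-3/2) * real k powr (-3/2)))"
          unfolding abs_mult[of "moebius g * moebius k"] q_def[symmetric] X_def[symmetric] by (rule order_trans[OF m b])
      qed
      also have "\<dots> = H * (q ^ 2 * ((\<Sum>g\<in>{1..Q}. 1 / real g ^ 2) * (\<Sum>k\<in>{1..Q}. 1 / real k ^ 2)) +
          q powr (3/2) * ((\<Sum>g\<in>{1..Q}. real g powr (-3/2)) * (\<Sum>k\<in>{1..Q}. real k powr (-3/2))))"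
        unfolding sum_product by (simp only: sum_distrib_left[symmetric] sum.distrib)
      also have "\<dots> \<le> H * (q ^ 2 * (2 * 2) + q ^ 2 * (P * P))"
      proof (intro mult_left_mono add_mono)
        show "(\<Sum>g\<in>{1..Q}. 1 / real g ^ 2) * (\<Sum>k\<in>{1..Q}. 1 / real k ^ 2) \<le> 2 * 2"
          by (intro mult_mono sum_inverse_square_le_2 sum_nonneg) auto
        have "q powr (3/2) \<le> q powr 2" using q1 by (intro powr_mono) auto
        then have "q powr (3/2) \<le> q ^ 2" using q1 by (simp add: powr_numeral)
        moreover have "(\<Sum>g\<in>{1..Q}. real g powr (-3/2)) * (\<Sum>k\<in>{1..Q}. real k powr (-3/2)) \<le> P * P"
          using P(1) by (intro mult_mono P sum_nonneg) auto
        ultimately show "q powr (3/2) * ((\<Sum>g\<in>{1..Q}. real g powr (-3/2)) * (\<Sum>k\<in>{1..Q}. real k powr (-3/2))) \<le> q ^ 2 * (P * P)"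
          by (rule mult_mono) (auto intro!: mult_nonneg_nonneg sum_nonneg)
      qed (use H in auto)
      also have "\<dots> = H * (4 + P * P) * q ^ 2" by (simp add: algebra_simps)
      finally show ?thesis .
    qed
    have L: "0 \<le> L" "L / sqrt q \<le> 2" "L ^ 2 / sqrt q \<le> 16"
    proof -
      show "0 \<le> L" using q1 by (simp add: L_def)
      have "L \<le> q powr (1/2) / (1/2)" unfolding L_def using q1 by (intro ln_powr_bound) auto
      then show "L / sqrt q \<le> 2" using q1 by (simp add: powr_half_sqrt divide_le_eq)
      have "L \<le> q powr (1/4) / (1/4)" unfolding L_def using q1 by (intro ln_powr_bound) auto
      then have "L ^ 2 \<le> (4 * q powr (1/4)) ^ 2" using \<open>0 \<le> L\<close> by (intro power_mono) auto
      also have "\<dots> = 16 * sqrt q" using q1 by (simp add: power_mult_distrib power2_eq_square flip: powr_add powr_half_sqrt)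
      finally show "L ^ 2 / sqrt q \<le> 16" using q1 by (simp add: divide_le_eq)
    qed
    have AA: "\<bar>A * A - a0 * a0\<bar> \<le> K * (W + \<bar>a0\<bar>) / sqrt q"
    proof -
      have "A * A - a0 * a0 = (A - a0) * (A + a0)" by (simp add: algebra_simps)
      also have "\<bar>\<dots>\<bar> \<le> (K / sqrt q) * (W + \<bar>a0\<bar>)" unfolding abs_mult
        using A AW K(1) q1 by (intro mult_mono) auto
      finally show ?thesis by simp
    qed
    have AB: "\<bar>A * B - a0 * b0\<bar> \<le> K * (W + \<bar>a0\<bar>) / sqrt q"
    proof -
      have "A * B - a0 * b0 = (A - a0) * B + a0 * (B - b0)" by (simp add: algebra_simps)
      also have "\<bar>\<dots>\<bar> \<le> (K / sqrt q) * W + \<bar>a0\<bar> * (K / sqrt q)"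
        using A B BW K(1) q1 unfolding abs_mult[symmetric]
        by (intro order_trans[OF abs_triangle_ineq] add_mono; unfold abs_mult; intro mult_mono) auto
      finally show ?thesis by (simp add: algebra_simps add_divide_distrib)
    qed
    define V where "V = K * (W + \<bar>a0\<bar>)"
    have V0: "V \<ge> 0" using K(1) W0 by (simp add: V_def)
    have t1: "\<bar>(A * A - a0 * a0) * (L ^ 2)\<bar> \<le> 16 * V"
    proof -
      have "\<bar>(A * A - a0 * a0) * (L ^ 2)\<bar> \<le> (V / sqrt q) * L ^ 2" unfolding abs_mult using AA by (intro mult_mono) (auto simp: V_def)
      also have "\<dots> = V * (L ^ 2 / sqrt q)" by simp
      also have "\<dots> \<le> V * 16" using L V0 by (intro mult_left_mono) auto
      finally show ?thesis by simp
    qed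
    have VL: "(V / sqrt q) * L \<le> V * 2"
      using mult_left_mono[OF L(2) V0] by simp
    have t2: "\<bar>(A * A - a0 * a0) * (c * L)\<bar> \<le> 6 * V"
    proof -
      have "\<bar>(A * A - a0 * a0) * (c * L)\<bar> = \<bar>A * A - a0 * a0\<bar> * L * \<bar>c\<bar>" using L(1) by (simp add: abs_mult)
      also have "\<dots> \<le> ((V / sqrt q) * L) * 3"
      proof (rule mult_mono)
        show "\<bar>A * A - a0 * a0\<bar> * L \<le> (V / sqrt q) * L" using AA L(1) by (intro mult_right_mono) (auto simp: V_def)
        show "0 \<le> (V / sqrt q) * L" using V0 L(1) q1 by simp
      qed (use c in auto)
      also have "\<dots> \<le> (V * 2) * 3" by (rule mult_right_mono[OF VL]) simp
      finally show ?thesis by simp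
    qed
    have t3: "\<bar>4 * L * (A * B - a0 * b0)\<bar> \<le> 8 * V"
    proof -
      have "\<bar>4 * L * (A * B - a0 * b0)\<bar> = 4 * (\<bar>A * B - a0 * b0\<bar> * L)" using L(1) by (simp add: abs_mult)
      also have "\<dots> \<le> 4 * ((V / sqrt q) * L)" using AB L(1) by (intro mult_left_mono mult_right_mono) (auto simp: V_def)
      also have "\<dots> \<le> 4 * (V * 2)" by (rule mult_left_mono[OF VL]) simp
      finally show ?thesis by simp
    qed
    have prods: "\<bar>A * B\<bar> \<le> W * W" "\<bar>A * B2\<bar> \<le> W * W" "\<bar>B * B\<bar> \<le> W * W"
      unfolding abs_mult
      by (rule mult_mono[OF AW BW W0 abs_ge_zero] mult_mono[OF AW B2W W0 abs_ge_zero] mult_mono[OF BW BW W0 abs_ge_zero])+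
    have t4: "\<bar>2 * c * (A * B)\<bar> \<le> 6 * (W * W)"
    proof -
      have "\<bar>2 * c * (A * B)\<bar> = (2 * \<bar>c\<bar>) * \<bar>A * B\<bar>" by (simp add: abs_mult)
      also have "\<dots> \<le> 6 * (W * W)" using c prods by (intro mult_mono) auto
      finally show ?thesis .
    qed
    define Y where "Y = A * A * (L ^ 2 + c * L) - 4 * L * (A * B) - 2 * c * (A * B) + 2 * (A * B2) + 2 * (B * B)"
    define Y0 where "Y0 = a0 * a0 * (L ^ 2 + c * L) - 4 * L * (a0 * b0)"
    have "Y - Y0 = (A * A - a0 * a0) * (L ^ 2) + (A * A - a0 * a0) * (c * L) - 4 * L * (A * B - a0 * b0) - 2 * c * (A * B) + 2 * (A * B2) + 2 * (B * B)"
      by (simp add: Y_def Y0_def algebra_simps)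
    then have "\<bar>Y - Y0\<bar> \<le> 16 * V + 6 * V + 8 * V + 10 * (W * W)"
      using t1 t2 t3 t4 prods by linarith
    then have YE: "\<bar>Y - Y0\<bar> \<le> E" by (simp add: E_def V_def)
    have "q ^ 2 / 4 * \<bar>Y - Y0\<bar> \<le> q ^ 2 / 4 * E" using YE by (rule mult_left_mono) simp
    moreover have "\<bar>q ^ 2 / 4 * Y - q ^ 2 / 4 * Y0\<bar> = q ^ 2 / 4 * \<bar>Y - Y0\<bar>"
      unfolding right_diff_distrib[symmetric] abs_mult by simp
    moreover have "q ^ 2 / 4 * E = E / 4 * q ^ 2" by simp
    ultimately have "\<bar>q ^ 2 / 4 * Y - q ^ 2 / 4 * Y0\<bar> \<le> E / 4 * q ^ 2" by linarith
    moreover have "q ^ 2 / 4 * Y0 = q ^ 2 / (4 * z ^ 2) * (L ^ 2 + (c + 4 * zeta_log / z) * L)"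
      using z by (simp add: Y0_def a0_def b0_def power2_eq_square field_simps)
    moreover have "\<bar>(\<Sum>e\<in>{1..Q}. row_total Q e) - q ^ 2 / 4 * Y\<bar> \<le> H * (4 + P * P) * q ^ 2"
      using err unfolding M Y_def .
    ultimately have "\<bar>(\<Sum>e\<in>{1..Q}. row_total Q e) - q ^ 2 / (4 * z ^ 2) * (L ^ 2 + (c + 4 * zeta_log / z) * L)\<bar> \<le> H * (4 + P * P) * q ^ 2 + E / 4 * q ^ 2"
      by linarith
    also have "\<dots> \<le> C * q ^ 2" by (simp add: C_def algebra_simps)
    finally show ?thesis unfolding q_def L_def z_def c_def .
  qed
  have W0: "W \<ge> 0" using P2 by (simp add: W_def)
  have "E \<ge> 0" unfolding E_def using K(1) W0 by (intro add_nonneg_nonneg mult_nonneg_nonneg) auto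
  then have "C > 0" unfolding C_def using H(1) P(1) by (intro add_nonneg_pos add_nonneg_nonneg mult_nonneg_nonneg) auto
  then show ?thesis using main by (rule that)
qed

section \<open>The defect series and the coefficient F\<close>

lemma denom_pos: "0 \<le> \<alpha> \<Longrightarrow> denom \<alpha> \<ge> 1"
  using of_rat_denom[of \<alpha>] by (metis One_nat_def Suc_leI)

lemma denom_dvd_iff:
  assumes "0 \<le> \<alpha>"
  shows "\<alpha> * of_nat m \<in> \<int> \<longleftrightarrow> denom \<alpha> dvd m"
proof -
  obtain v where v: "\<alpha> = of_nat v / of_nat (denom \<alpha>)" "coprime v (denom \<alpha>)" "denom \<alpha> > 0"
    using of_rat_denom[OF assms] .
  define w where "w = denom \<alpha>"
  have w: "(of_nat w :: rat) \<noteq> 0" using v(3) by (simp add: w_def)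
  have am: "\<alpha> * of_nat m = of_nat (v * m) / of_nat w" using v(1) by (metis of_nat_mult times_divide_eq_left w_def)
  show ?thesis
  proof
    assume "\<alpha> * of_nat m \<in> \<int>"
    then obtain z where "\<alpha> * of_nat m = of_int z" by (elim Ints_cases)
    then have "(of_int (int (v * m)) :: rat) = of_int (z * int w)"
      using w unfolding am by (simp add: divide_eq_eq)
    then have "int (v * m) = z * int w" by (simp only: of_int_eq_iff)
    then have "int w dvd int (v * m)" by simp
    then have "w dvd v * m" by (simp only: of_nat_dvd_iff)
    then show "denom \<alpha> dvd m" using v(2) unfolding w_def by (simp add: coprime_dvd_mult_right_iff coprime_commute)
  next
    assume "denom \<alpha> dvd m"
    then obtain k where "m = w * k" by (auto simp: w_def)
    then have "\<alpha> * of_nat m = of_int (int (v * k))" unfolding am using w by simp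
    then show "\<alpha> * of_nat m \<in> \<int>" by (metis Ints_of_int)
  qed
qed

lemma ceil_defect_eq_0:
  assumes "0 \<le> \<alpha>" "denom \<alpha> dvd m"
  shows "ceil_defect \<alpha> m = 0"
proof -
  have "\<alpha> * of_nat m \<in> \<int>" using denom_dvd_iff[OF assms(1), of m] assms(2) by simp
  then obtain z where z: "\<alpha> * of_nat m = of_int z" by (elim Ints_cases)
  have "of_rat \<alpha> * real m = of_rat (\<alpha> * of_nat m)" by (simp add: of_rat_mult)
  then show ?thesis by (simp add: ceil_defect_def z)
qed

lemma ceil_defect_eq_frac:
  assumes "0 \<le> \<alpha>" "\<not> denom \<alpha> dvd m"
  shows "ceil_defect \<alpha> m = 1 - of_rat (frac (\<alpha> * of_nat m))"
proof -
  have ni: "\<alpha> * of_nat m \<notin> \<int>" using denom_dvd_iff[OF assms(1), of m] assms(2) by simp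
  have "\<lceil>\<alpha> * of_nat m\<rceil> = \<lfloor>\<alpha> * of_nat m\<rfloor> + 1" using ni by (simp add: ceiling_altdef frac_def) (metis Ints_of_int)
  moreover have "of_rat (frac (\<alpha> * of_nat m)) = of_rat \<alpha> * real m - of_int \<lfloor>\<alpha> * of_nat m\<rfloor>"
    by (simp add: frac_def of_rat_diff of_rat_mult)
  ultimately show ?thesis by (simp add: ceil_defect_def)
qed

lemma ceil_defect_periodic:
  assumes "0 \<le> \<alpha>"
  shows "ceil_defect \<alpha> (n * denom \<alpha> + r) = ceil_defect \<alpha> r"
proof -
  have "\<alpha> * of_nat (n * denom \<alpha>) \<in> \<int>"
    using denom_dvd_iff[OF assms, of "n * denom \<alpha>"] by (simp del: of_nat_mult)
  then obtain z where z: "\<alpha> * of_nat (n * denom \<alpha>) = of_int z" by (elim Ints_cases)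
  have "\<alpha> * of_nat (n * denom \<alpha> + r) = of_int z + \<alpha> * of_nat r"
    using z by (simp add: distrib_left)
  then have "\<lceil>\<alpha> * of_nat (n * denom \<alpha> + r)\<rceil> = z + \<lceil>\<alpha> * of_nat r\<rceil>"
    by (metis ceiling_add_of_int add.commute)
  moreover have "of_rat \<alpha> * real (n * denom \<alpha>) = of_int z"
  proof -
    have "of_rat \<alpha> * real (n * denom \<alpha>) = of_rat (\<alpha> * of_nat (n * denom \<alpha>))" by (simp add: of_rat_mult)
    then show ?thesis unfolding z by simp
  qed
  ultimately show ?thesis by (simp add: ceil_defect_def distrib_left)
qed

lemma summable_defect: "summable (\<lambda>n. ceil_defect \<alpha> (Suc n) / real (Suc n) ^ 2)"
  by (rule series_tail_bound(1)[where g = "\<lambda>m. ceil_defect \<alpha> m / real m ^ 2" and c = 4])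
     (intro abs_le_inverse_square_imp_powr ceil_defect_bounds)

text \<open>The series starts at \<open>m = 0\<close>, with the term \<open>0\<close>, so that it
  can be grouped into the blocks \<open>{n * w..<n * w + w}\<close>.\<close>

lemma defect_sums: "(\<lambda>m. ceil_defect \<alpha> m / real m ^ 2) sums defect_series \<alpha>"
proof -
  have "(\<lambda>n. ceil_defect \<alpha> (Suc n) / real (Suc n) ^ 2) sums defect_series \<alpha>"
    unfolding defect_series_def by (rule summable_sums[OF summable_defect])
  then show ?thesis by (subst (asm) sums_Suc_iff) simp
qed

text \<open>Pulling \<open>1 / w\<close> out of \<open>n + r / w\<close> turns the Hurwitz series
  into the sum over a residue class modulo \<open>w\<close>.\<close>

lemma hurwitz_zeta_sums:
  assumes "0 < r" "0 < w"
  shows "(\<lambda>n. 1 / real (n * w + r) ^ 2) sums (hurwitz_zeta 2 (real r / real w) / real w ^ 2)"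
proof -
  have eq: "(of_nat n + of_real (real r / real w)) powr - 2 = real w ^ 2 * (1 / real (n * w + r) ^ 2)" for n
  proof -
    define A where "A = real (n * w + r)"
    have A: "A > 0" using assms by (simp add: A_def add_nonneg_pos)
    have "real n + real r / real w = A / real w" using assms by (simp add: A_def field_simps)
    then have "(of_nat n + of_real (real r / real w)) powr - 2 = (A / real w) powr - 2" by simp
    also have "\<dots> = real w ^ 2 * (1 / A ^ 2)"
      using A assms by (simp add: powr_minus powr_numeral power_divide inverse_eq_divide)
    finally show ?thesis by (simp only: A_def)
  qed
  have sm: "summable (\<lambda>n. 1 / real (n * w + r) ^ 2)"
  proof (rule summable_comparison_test')
    show "summable (\<lambda>n. (if n = 0 then 1 else 0) + 1 / real n ^ 2)"
    proof (rule summable_add)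
      show "summable (\<lambda>n::nat. if n = 0 then 1 else 0 :: real)" using summable_finite[of "{0::nat}"] by simp
      show "summable (\<lambda>n. 1 / real n ^ 2)" using inverse_power_summable[of 2, where 'a = real] by (simp add: inverse_eq_divide)
    qed
    fix n :: nat
    show "norm (1 / real (n * w + r) ^ 2) \<le> (if n = 0 then 1 else 0) + 1 / real n ^ 2"
    proof (cases "n = 0")
      case True then show ?thesis using assms by (simp add: divide_le_eq)
    next
      case False
      have "n * 1 \<le> n * w" using assms by (intro mult_le_mono) auto
      then have "real n \<le> real (n * w + r)" by (intro of_nat_mono) linarith
      then have "real n ^ 2 \<le> real (n * w + r) ^ 2" by (intro power_mono) auto
      then show ?thesis using False by (simp add: divide_left_mono)
    qed
  qed
  have "hurwitz_zeta 2 (real r / real w) = real w ^ 2 * (\<Sum>n. 1 / real (n * w + r) ^ 2)"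
    unfolding hurwitz_zeta_def eq by (rule suminf_mult[OF sm])
  then have "hurwitz_zeta 2 (real r / real w) / real w ^ 2 = (\<Sum>n. 1 / real (n * w + r) ^ 2)" using assms by simp
  then show ?thesis using summable_sums[OF sm] by simp
qed

text \<open>The defects have period \<open>w\<close>, vanish at multiples of \<open>w\<close> and
  equal \<open>1 - frac (\<alpha> r)\<close> at the other residues \<open>r\<close>. Grouping the
  series into blocks of length \<open>w\<close> therefore produces the Hurwitz values at
  \<open>r / w\<close>.\<close>

lemma of_rat_mult_F_coeff:
  assumes "0 < \<alpha>"
  shows "of_rat \<alpha> * F_coeff \<alpha> = defect_series \<alpha>"
proof -
  define w where "w = denom \<alpha>"
  have a0: "0 \<le> \<alpha>" using assms by simp
  have w: "w \<ge> 1" unfolding w_def by (rule denom_pos[OF a0])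
  define c where "c = (\<lambda>r. 1 - real_of_rat (frac (\<alpha> * of_nat r)))"
  have block: "(\<Sum>m\<in>{n * w..<n * w + w}. ceil_defect \<alpha> m / real m ^ 2) = (\<Sum>r\<in>{1..<w}. c r * (1 / real (n * w + r) ^ 2))" for n
  proof -
    have "(\<Sum>m\<in>{n * w..<n * w + w}. ceil_defect \<alpha> m / real m ^ 2) = (\<Sum>r\<in>{0..<w}. ceil_defect \<alpha> (n * w + r) / real (n * w + r) ^ 2)"
      by (rule sum.reindex_bij_witness[of _ "\<lambda>r. n * w + r" "\<lambda>m. m - n * w"]) auto
    also have "\<dots> = (\<Sum>r\<in>{0..<w}. ceil_defect \<alpha> r / real (n * w + r) ^ 2)"
      unfolding w_def by (simp add: ceil_defect_periodic[OF a0])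
    also have "{0..<w} = insert 0 {1..<w}" using w by auto
    also have "(\<Sum>r\<in>insert 0 {1..<w}. ceil_defect \<alpha> r / real (n * w + r) ^ 2) = (\<Sum>r\<in>{1..<w}. ceil_defect \<alpha> r / real (n * w + r) ^ 2)"
      by (simp add: ceil_defect_def)
    also have "\<dots> = (\<Sum>r\<in>{1..<w}. c r * (1 / real (n * w + r) ^ 2))"
    proof (intro sum.cong refl)
      fix r assume r: "r \<in> {1..<w}"
      then have "\<not> denom \<alpha> dvd r" by (auto simp: w_def dest: dvd_imp_le)
      then show "ceil_defect \<alpha> r / real (n * w + r) ^ 2 = c r * (1 / real (n * w + r) ^ 2)"
        by (simp add: ceil_defect_eq_frac[OF a0] c_def)
    qed
    finally show ?thesis .
  qed
  have "(\<lambda>n. \<Sum>m\<in>{n * w..<n * w + w}. ceil_defect \<alpha> m / real m ^ 2) sums defect_series \<alpha>"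
    by (rule sums_group[OF defect_sums]) (use w in simp)
  then have 1: "(\<lambda>n. \<Sum>r\<in>{1..<w}. c r * (1 / real (n * w + r) ^ 2)) sums defect_series \<alpha>"
    unfolding block .
  have 2: "(\<lambda>n. \<Sum>r\<in>{1..<w}. c r * (1 / real (n * w + r) ^ 2)) sums (\<Sum>r\<in>{1..<w}. c r * (hurwitz_zeta 2 (real r / real w) / real w ^ 2))"
    by (intro sums_sum sums_mult hurwitz_zeta_sums) (use w in auto)
  define T where "T = (\<Sum>r\<in>{1..<w}. c r * hurwitz_zeta 2 (real r / real w))"
  have "defect_series \<alpha> = (\<Sum>r\<in>{1..<w}. c r * (hurwitz_zeta 2 (real r / real w) / real w ^ 2))"
    by (rule sums_unique2[OF 1 2])
  then have "defect_series \<alpha> = T / real w ^ 2" by (simp add: T_def sum_divide_distrib)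
  moreover have "F_coeff \<alpha> = 1 / (of_rat \<alpha> * real w ^ 2) * T"
    by (simp only: F_coeff_def T_def c_def w_def)
  ultimately show ?thesis using assms by simp
qed

text \<open>Complementation exchanges ceiling and floor, \<open>\<lceil>(1 - \<alpha>) m\<rceil> = m
  - \<lfloor>\<alpha> m\<rfloor>\<close>, and these two roundings of \<open>\<alpha> m\<close>
  differ by \<open>1\<close> unless it is an integer.\<close>

lemma ceil_defect_add_complement:
  assumes "0 \<le> \<alpha>" "\<alpha> \<le> 1"
  shows "ceil_defect \<alpha> m + ceil_defect (1 - \<alpha>) m = (if denom \<alpha> dvd m then 0 else 1)"
proof -
  have "(1 - \<alpha>) * of_nat m = - (\<alpha> * of_nat m) + of_int (int m)" by (simp add: algebra_simps)
  then have "\<lceil>(1 - \<alpha>) * of_nat m\<rceil> = \<lceil>- (\<alpha> * of_nat m)\<rceil> + int m" by (simp only: ceiling_add_of_int)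
  then have c: "\<lceil>(1 - \<alpha>) * of_nat m\<rceil> = int m - \<lfloor>\<alpha> * of_nat m\<rfloor>" by (simp add: ceiling_minus)
  have "ceil_defect \<alpha> m + ceil_defect (1 - \<alpha>) m = of_int (\<lceil>\<alpha> * of_nat m\<rceil> - \<lfloor>\<alpha> * of_nat m\<rfloor>)"
    unfolding ceil_defect_def c by (simp add: of_rat_diff algebra_simps)
  also have "\<lceil>\<alpha> * of_nat m\<rceil> - \<lfloor>\<alpha> * of_nat m\<rfloor> = (if \<alpha> * of_nat m \<in> \<int> then 0 else 1)"
    by (auto simp: ceiling_altdef elim: Ints_cases) (metis Ints_of_int)
  finally show ?thesis using denom_dvd_iff[OF assms(1)] by simp
qed

text \<open>The denominator is determined by its multiples \<open>m\<close>, those with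
  \<open>\<alpha> m\<close> integral, and \<open>\<alpha> m\<close> is integral together with
  \<open>(1 - \<alpha>) m\<close>.\<close>

lemma denom_complement:
  assumes "0 \<le> \<alpha>" "\<alpha> \<le> 1"
  shows "denom (1 - \<alpha>) = denom \<alpha>"
proof -
  have "denom (1 - \<alpha>) dvd m \<longleftrightarrow> denom \<alpha> dvd m" for m
  proof -
    have "(1 - \<alpha>) * of_nat m = of_nat m - \<alpha> * of_nat m" "\<alpha> * of_nat m = of_nat m - (1 - \<alpha>) * of_nat m"
      by (simp_all add: algebra_simps)
    then have "(1 - \<alpha>) * of_nat m \<in> \<int> \<longleftrightarrow> \<alpha> * of_nat m \<in> \<int>" by (metis Ints_diff Ints_of_nat)
    then show ?thesis using denom_dvd_iff[of \<alpha> m] denom_dvd_iff[of "1 - \<alpha>" m] assms by simp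
  qed
  then show ?thesis by (metis dvd_antisym dvd_refl)
qed

lemma zeta_2_sums: "(\<lambda>m. 1 / real m ^ 2) sums zeta 2"
proof -
  have "summable (\<lambda>n. 1 / real (Suc n) ^ 2)"
    by (rule series_tail_bound(1)[where g = "\<lambda>m. 1 / real m ^ 2" and c = 4]) (use inverse_square_le_powr in auto)
  then have "(\<lambda>n. 1 / real (Suc n) ^ 2) sums zeta 2" unfolding zeta_2 by (rule summable_sums)
  then show ?thesis by (subst (asm) sums_Suc_iff) simp
qed

text \<open>Subtracting both defect series from the one for \<open>zeta 2\<close> leaves the terms
  at multiples of \<open>w\<close>, whose sum is \<open>zeta 2 / w ^ 2\<close>.\<close>

lemma defect_series_add_complement:
  assumes "0 \<le> \<alpha>" "\<alpha> \<le> 1"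
  shows "defect_series \<alpha> + defect_series (1 - \<alpha>) = zeta 2 * (1 - 1 / real (denom \<alpha>) ^ 2)"
proof -
  define w where "w = denom \<alpha>"
  have w: "w \<ge> 1" unfolding w_def by (rule denom_pos[OF assms(1)])
  define f where "f = (\<lambda>m. if w dvd m then 1 / real m ^ 2 else 0)"
  have "(\<lambda>m. ceil_defect \<alpha> m / real m ^ 2 + ceil_defect (1 - \<alpha>) m / real m ^ 2) sums (defect_series \<alpha> + defect_series (1 - \<alpha>))"
    by (intro sums_add defect_sums)
  then have "(\<lambda>m. 1 / real m ^ 2 - (ceil_defect \<alpha> m / real m ^ 2 + ceil_defect (1 - \<alpha>) m / real m ^ 2)) sums (zeta 2 - (defect_series \<alpha> + defect_series (1 - \<alpha>)))"
    by (intro sums_diff zeta_2_sums)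
  also have "(\<lambda>m. 1 / real m ^ 2 - (ceil_defect \<alpha> m / real m ^ 2 + ceil_defect (1 - \<alpha>) m / real m ^ 2)) = f"
    using ceil_defect_add_complement[OF assms] by (auto simp: f_def w_def fun_eq_iff simp flip: add_divide_distrib)
  finally have "(\<lambda>n. sum f {n * w..<n * w + w}) sums (zeta 2 - (defect_series \<alpha> + defect_series (1 - \<alpha>)))"
    by (rule sums_group) (use w in simp)
  moreover have "sum f {n * w..<n * w + w} = 1 / real w ^ 2 * (1 / real n ^ 2)" for n
  proof -
    have "sum f {n * w..<n * w + w} = (\<Sum>r\<in>{0..<w}. f (n * w + r))"
      by (rule sum.reindex_bij_witness[of _ "\<lambda>r. n * w + r" "\<lambda>m. m - n * w"]) auto
    also have "{0..<w} = insert 0 {1..<w}" using w by auto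
    also have "(\<Sum>r\<in>insert 0 {1..<w}. f (n * w + r)) = f (n * w) + (\<Sum>r\<in>{1..<w}. f (n * w + r))" by simp
    also have "(\<Sum>r\<in>{1..<w}. f (n * w + r)) = 0"
      by (rule sum.neutral) (auto simp: f_def dvd_add_right_iff dest: dvd_imp_le)
    also have "f (n * w) = 1 / real w ^ 2 * (1 / real n ^ 2)" by (simp add: f_def power_mult_distrib)
    finally show ?thesis by simp
  qed
  ultimately have "(\<lambda>n. 1 / real w ^ 2 * (1 / real n ^ 2)) sums (zeta 2 - (defect_series \<alpha> + defect_series (1 - \<alpha>)))" by simp
  moreover have "(\<lambda>n. 1 / real w ^ 2 * (1 / real n ^ 2)) sums (1 / real w ^ 2 * zeta 2)" by (intro sums_mult zeta_2_sums)
  ultimately have "zeta 2 - (defect_series \<alpha> + defect_series (1 - \<alpha>)) = 1 / real w ^ 2 * zeta 2" by (rule sums_unique2)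
  then show ?thesis by (simp add: w_def algebra_simps)
qed

lemma defect_series_bounds: "0 \<le> defect_series \<alpha>" "defect_series \<alpha> \<le> zeta 2"
proof -
  show "0 \<le> defect_series \<alpha>"
    by (rule sums_le[OF _ sums_zero defect_sums]) (simp add: ceil_defect_bounds)
  show "defect_series \<alpha> \<le> zeta 2"
    by (rule sums_le[OF _ defect_sums zeta_2_sums]) (simp add: divide_right_mono ceil_defect_bounds)
qed

lemma denom_1: "denom 1 = 1"
  by (simp add: denom_def)

lemma defect_series_1: "defect_series 1 = 0"
  by (simp add: defect_series_def ceil_defect_eq_0 denom_1 del: of_nat_Suc)

section \<open>Averages over Farey fractions\<close>

lemma finite_farey: "finite (farey Q)"
proof -
  have "farey Q \<subseteq> (\<lambda>(a,b). of_nat a / of_nat b) ` ({..Q} \<times> {..Q})"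
  proof
    fix x assume "x \<in> farey Q"
    then obtain a b where x: "x = of_nat a / of_nat b" "1 \<le> b" "b \<le> Q" "x \<le> 1" by (auto simp: farey_def)
    then have "(of_nat a :: rat) \<le> of_nat b" by (simp add: divide_le_eq)
    then have "a \<le> b" by simp
    then show "x \<in> (\<lambda>(a,b). of_nat a / of_nat b) ` ({..Q} \<times> {..Q})" using x by force
  qed
  then show ?thesis by (rule finite_subset) simp
qed

text \<open>The totients count the fractions in \<open>[0, 1)\<close>, with \<open>0\<close>
  occurring at \<open>q = 1\<close>; the extra summand is the fraction \<open>1\<close>.\<close>

lemma card_farey:
  assumes "Q \<ge> 1"
  shows "card (farey Q) = 1 + (\<Sum>q\<in>{1..Q}. totient q)"
proof -
  have "\<exists>a b. (1::rat) = of_nat a / of_nat b \<and> 1 \<le> b \<and> b \<le> Q"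
    using assms by (intro exI[of _ 1]) simp
  then have one: "1 \<in> farey Q" unfolding farey_def by simp
  have "farey Q \<subseteq> {0..1}" by (auto simp: farey_def)
  then have "farey Q = insert 1 (farey_low 1 Q)" using one by (auto simp: farey_low_def)
  moreover have "1 \<notin> farey_low 1 Q" by (simp add: farey_low_def)
  moreover have "finite (farey_low 1 Q)" using finite_farey by (simp add: farey_low_def)
  ultimately have "card (farey Q) = 1 + card (farey_low 1 Q)" by simp
  also have "card (farey_low 1 Q) = card (low_pairs 1 Q)"
    using bij_betw_same_card[OF bij_betw_low_pairs[of 1 Q]] by simp
  also have "low_pairs 1 Q = prod.swap ` (SIGMA q:{1..Q}. {a. a < q \<and> coprime a q})"
    by (force simp: low_pairs_def image_iff)
  also have "card \<dots> = card (SIGMA q:{1..Q}. {a. a < q \<and> coprime a q})" by (rule card_image) (simp add: inj_on_def)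
  also have "\<dots> = (\<Sum>q\<in>{1..Q}. card {a. a < q \<and> coprime a q})" by (rule card_SigmaI) auto
  also have "\<dots> = (\<Sum>q\<in>{1..Q}. totient q)" by (intro sum.cong refl card_coprime_less) auto
  finally show ?thesis .
qed

text \<open>The error \<open>Q powr (3/2)\<close> will be multiplied by \<open>main_term\<close>,
  which is \<open>O(sqrt Q)\<close>, so that it leads to the admissible
  \<open>O(Q ^ 2)\<close>.\<close>

lemma card_farey_approx:
  obtains C where "C > 0" "\<And>Q. Q \<ge> 1 \<Longrightarrow>
    \<bar>real (card (farey Q)) - real Q ^ 2 / (2 * zeta 2)\<bar> \<le> C * (real Q * sqrt (real Q))"
proof -
  obtain K where K: "K > 0" "\<And>N. N \<ge> 1 \<Longrightarrow> \<bar>(\<Sum>k\<in>{1..N}. moebius k / real k ^ 2) - 1 / zeta 2\<bar> \<le> K / sqrt (real N)"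
    using moebius_partial_sums by metis
  have "\<bar>real (card (farey Q)) - real Q ^ 2 / (2 * zeta 2)\<bar> \<le> (4 + K) * (real Q * sqrt (real Q))" if Q: "Q \<ge> 1" for Q
  proof -
    define x where "x = sqrt (real Q)"
    have x: "x \<ge> 1" "x * x = real Q" using Q by (simp_all add: x_def)
    define A where "A = (\<Sum>k\<in>{1..Q}. moebius k / real k ^ 2)"
    have "(\<Sum>q\<in>{1..Q}. real (totient q)) = (\<Sum>q\<in>{1..Q}. \<Sum>g | g dvd q. moebius g * real (q div g))"
      by (intro sum.cong refl totient_eq_sum_moebius) auto
    also have "\<dots> = (\<Sum>k\<in>{1..Q}. \<Sum>m\<in>{1..Q div k}. moebius k * real m)" by (rule sum_divisors_eq)
    also have "\<dots> = (\<Sum>k\<in>{1..Q}. moebius k * (\<Sum>m\<in>{1..Q div k}. real m))" by (simp add: sum_distrib_left)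
    finally have T: "(\<Sum>q\<in>{1..Q}. real (totient q)) = (\<Sum>k\<in>{1..Q}. moebius k * (\<Sum>m\<in>{1..Q div k}. real m))" .
    have E: "\<bar>(\<Sum>k\<in>{1..Q}. moebius k * (\<Sum>m\<in>{1..Q div k}. real m)) - real Q ^ 2 / 2 * A\<bar> \<le> real Q * harm Q"
    proof -
      have "real Q ^ 2 / 2 * A = (\<Sum>k\<in>{1..Q}. moebius k * ((real Q / real k) ^ 2 / 2))"
        unfolding A_def sum_distrib_left by (intro sum.cong refl) (simp add: power_divide mult_ac)
      then have "\<bar>(\<Sum>k\<in>{1..Q}. moebius k * (\<Sum>m\<in>{1..Q div k}. real m)) - real Q ^ 2 / 2 * A\<bar> \<le>
         (\<Sum>k\<in>{1..Q}. \<bar>moebius k * ((\<Sum>m\<in>{1..Q div k}. real m) - (real Q / real k) ^ 2 / 2)\<bar>)"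
        by (simp only: sum_subtractf[symmetric] right_diff_distrib[symmetric]) (rule sum_abs)
      also have "\<dots> \<le> (\<Sum>k\<in>{1..Q}. real Q / real k)"
      proof (rule sum_mono)
        fix k assume k: "k \<in> {1..Q}"
        define N y where "N = real (Q div k)" and "y = real Q / real k"
        have y1: "y \<ge> 1" using k by (simp add: y_def)
        have Ny: "N \<le> y" "y < N + 1"
        proof -
          have "\<lfloor>real Q / real k\<rfloor> = int (Q div k)" by (rule floor_divide_of_nat_eq)
          then show "N \<le> y" "y < N + 1" unfolding N_def y_def by linarith+
        qed
        have "2 * (\<Sum>m\<in>{1..n}. real m) = real n * (real n + 1)" for n by (induction n) (auto simp: algebra_simps)
        from this[of "Q div k"] have s: "(\<Sum>m\<in>{1..Q div k}. real m) = N * (N + 1) / 2" by (simp add: N_def)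
        define p where "p = N * (N + 1)"
        have "p \<le> y * (y + 1)" unfolding p_def using Ny y1 by (intro mult_mono) (auto simp: N_def)
        also have "\<dots> = y ^ 2 + y" by (simp add: power2_eq_square algebra_simps)
        finally have p1: "p \<le> y ^ 2 + y" .
        have "y ^ 2 - y = (y - 1) * y" by (simp add: power2_eq_square algebra_simps)
        also have "\<dots> \<le> p" unfolding p_def using Ny y1 by (intro mult_mono) (auto simp: N_def)
        finally have "\<bar>p / 2 - y ^ 2 / 2\<bar> \<le> y" using p1 y1 by linarith
        then have "\<bar>N * (N + 1) / 2 - y ^ 2 / 2\<bar> \<le> y" by (simp only: p_def)
        then have b: "\<bar>(\<Sum>m\<in>{1..Q div k}. real m) - (real Q / real k) ^ 2 / 2\<bar> \<le> y" unfolding s y_def .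
        have "\<bar>moebius k * ((\<Sum>m\<in>{1..Q div k}. real m) - (real Q / real k) ^ 2 / 2)\<bar> \<le> 1 * y"
          unfolding abs_mult using b by (intro mult_mono abs_moebius_le) auto
        then show "\<bar>moebius k * ((\<Sum>m\<in>{1..Q div k}. real m) - (real Q / real k) ^ 2 / 2)\<bar> \<le> real Q / real k" by (simp add: y_def)
      qed
      also have "\<dots> = real Q * harm Q" by (simp add: harm_def sum_distrib_left divide_inverse)
      finally show ?thesis .
    qed
    have H: "real Q * harm Q \<le> 3 * (real Q * x)"
    proof -
      have "harm Q \<le> 3 * x" using harm_le_ln[OF Q] ln_le_two_sqrt[OF Q] x unfolding x_def by linarith
      then have "real Q * harm Q \<le> real Q * (3 * x)" by (rule mult_left_mono) simp
      then show ?thesis by simp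
    qed
    have KE: "\<bar>real Q ^ 2 / 2 * A - real Q ^ 2 / (2 * zeta 2)\<bar> \<le> K * (real Q * x)"
    proof -
      have "real Q ^ 2 / 2 * A - real Q ^ 2 / (2 * zeta 2) = real Q ^ 2 / 2 * (A - 1 / zeta 2)" by (simp add: algebra_simps)
      also have "\<bar>\<dots>\<bar> \<le> real Q ^ 2 / 2 * (K / x)"
        unfolding abs_mult using K(2)[OF Q] by (intro mult_mono) (auto simp: A_def x_def)
      also have "\<dots> = (K / 2) * (real Q * x)" using x(1) unfolding x(2)[symmetric] by (simp add: power2_eq_square)
      also have "\<dots> \<le> K * (real Q * x)" using K(1) x(1) by (intro mult_right_mono) auto
      finally show ?thesis .
    qed
    have "1 * 1 \<le> real Q * x" using Q x by (intro mult_mono) auto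
    moreover have "real (card (farey Q)) = 1 + (\<Sum>q\<in>{1..Q}. real (totient q))" unfolding card_farey[OF Q] by simp
    moreover have "(4 + K) * (real Q * x) = 4 * (real Q * x) + K * (real Q * x)" by (simp add: algebra_simps)
    ultimately show ?thesis using E H KE unfolding T[symmetric] x_def[symmetric] by linarith
  qed
  moreover have "4 + K > 0" using K by simp
  ultimately show ?thesis using that by blast
qed

text \<open>For large \<open>Q\<close> the error takes at most half of the main term. In the
  remaining range \<open>Q\<close> is bounded and the trivial bound \<open>1\<close> for the
  cardinality suffices, at the price of a fourth power in \<open>B\<close>.\<close>

lemma card_farey_ge:
  obtains B where "B > 0" "\<And>Q. Q \<ge> 1 \<Longrightarrow> real Q ^ 2 \<le> B * real (card (farey Q))"
proof -
  obtain C where C: "C > 0" "\<And>Q. Q \<ge> 1 \<Longrightarrow> \<bar>real (card (farey Q)) - real Q ^ 2 / (2 * zeta 2)\<bar> \<le> C * (real Q * sqrt (real Q))"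
    using card_farey_approx by blast
  define \<kappa> :: real where "\<kappa> = 1 / (2 * zeta 2)"
  have \<kappa>: "\<kappa> > 0" using zeta_2_pos by (simp add: \<kappa>_def)
  define B where "B = 2 / \<kappa> + (2 * C / \<kappa>) ^ 4"
  have "real Q ^ 2 \<le> B * real (card (farey Q))" if Q: "Q \<ge> 1" for Q
  proof -
    define x where "x = sqrt (real Q)"
    define n where "n = real (card (farey Q))"
    have x: "x \<ge> 1" "real Q = x * x" using Q by (simp_all add: x_def)
    have n1: "n \<ge> 1" unfolding n_def card_farey[OF Q] by (simp add: sum_nonneg)
    have lo: "\<kappa> * real Q ^ 2 - C * (real Q * x) \<le> n"
      using C(2)[OF Q] unfolding x_def[symmetric] n_def[symmetric] \<kappa>_def by (simp add: abs_le_iff)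
    show ?thesis
    proof (cases "2 * C \<le> \<kappa> * x")
      case True
      have "2 * C * (real Q * x) \<le> \<kappa> * x * (real Q * x)" using True x by (intro mult_right_mono) auto
      also have "\<dots> = \<kappa> * real Q ^ 2" unfolding x(2) by (simp add: power2_eq_square)
      finally have "\<kappa> * real Q ^ 2 \<le> 2 * n" using lo by linarith
      then have "real Q ^ 2 \<le> 2 / \<kappa> * n" using \<kappa> by (simp add: field_simps)
      also have "\<dots> \<le> B * n" using n1 by (intro mult_right_mono) (auto simp: B_def)
      finally show ?thesis by (simp add: n_def)
    next
      case False
      then have "x \<le> 2 * C / \<kappa>" using \<kappa> by (simp add: field_simps)
      then have "x ^ 4 \<le> (2 * C / \<kappa>) ^ 4" using x by (intro power_mono) auto
      then have "real Q ^ 2 \<le> (2 * C / \<kappa>) ^ 4" unfolding x(2) by (simp add: eval_nat_numeral)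
      also have "\<dots> \<le> B" using \<kappa> by (simp add: B_def)
      also have "B * 1 \<le> B * n" using n1 C \<kappa> by (intro mult_left_mono) (auto simp: B_def)
      finally show ?thesis by (simp add: n_def)
    qed
  qed
  moreover have "B > 0" using C \<kappa> by (simp add: B_def add_pos_pos)
  ultimately show ?thesis using that by blast
qed

text \<open>Here \<open>\<alpha> F(\<alpha>)\<close> is written as
  \<open>defect_series \<alpha>\<close>; apart from it the expression is linear in \<alpha>, which
  makes the values at \<open>1\<close>, \<alpha> and \<open>1 - \<alpha>\<close> easy to
  combine.\<close>

definition main_term :: "rat \<Rightarrow> nat \<Rightarrow> real" where
  "main_term \<alpha> Q = of_rat \<alpha> * ln (real Q) ^ 2 / (2 * zeta 2)
     + of_rat \<alpha> * ln (real Q) / zeta 2 * (2 * euler_mascheroni - 3 / 2 + 2 * zeta_log / zeta 2)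
     + ln (real Q) / zeta 2 * defect_series \<alpha>"

lemma sum_minus_cf_length_main:
  obtains C where "C > 0" "\<And>\<alpha> Q. 0 \<le> \<alpha> \<Longrightarrow> \<alpha> \<le> 1 \<Longrightarrow> Q \<ge> 1 \<Longrightarrow>
    \<bar>(\<Sum>x\<in>farey_low \<alpha> Q. real (minus_cf_length x)) - real Q ^ 2 / (2 * zeta 2) * main_term \<alpha> Q\<bar>
      \<le> C * (real Q ^ 2 * (1 + ln (real (denom \<alpha>))))"
proof -
  obtain C1 where C1: "C1 > 0" "\<And>\<alpha> Q. 0 \<le> \<alpha> \<Longrightarrow> \<alpha> \<le> 1 \<Longrightarrow> Q \<ge> 1 \<Longrightarrow>
    \<bar>(\<Sum>e\<in>{1..Q}. \<Sum>(f,u)\<in>inv_pairs e. if f < nat \<lceil>\<alpha> * of_nat e\<rceil> then real (row_weight Q e u) else 0)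
     - (of_rat \<alpha> * (\<Sum>e\<in>{1..Q}. row_total Q e) + real Q ^ 2 * ln (real Q) / (2 * zeta 2 ^ 2) * defect_series \<alpha>)\<bar>
     \<le> C1 * real Q ^ 2"
    using sum_outer_approx by blast
  obtain C2 where C2: "C2 > 0" "\<And>Q. Q \<ge> 1 \<Longrightarrow>
    \<bar>(\<Sum>e\<in>{1..Q}. row_total Q e) - real Q ^ 2 / (4 * zeta 2 ^ 2) *
       (ln (real Q) ^ 2 + (4 * euler_mascheroni - 3 + 4 * zeta_log / zeta 2) * ln (real Q))\<bar> \<le> C2 * real Q ^ 2"
    using sum_row_total_approx by blast
  have z: "zeta (2::real) > 0" by (rule zeta_2_pos)
  have "\<bar>(\<Sum>x\<in>farey_low \<alpha> Q. real (minus_cf_length x)) - real Q ^ 2 / (2 * zeta 2) * main_term \<alpha> Q\<bar>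
      \<le> (C1 + C2 + 1) * (real Q ^ 2 * (1 + ln (real (denom \<alpha>))))"
    if a: "0 \<le> \<alpha>" "\<alpha> \<le> 1" and Q: "Q \<ge> 1" for \<alpha> Q
  proof -
    define q where "q = real Q ^ 2"
    define w where "w = 1 + ln (real (denom \<alpha>))"
    define L where "L = ln (real Q)"
    define A where "A = (\<Sum>x\<in>farey_low \<alpha> Q. real (minus_cf_length x))"
    define X where "X = (\<Sum>e\<in>{1..Q}. \<Sum>(f,u)\<in>inv_pairs e. if f < nat \<lceil>\<alpha> * of_nat e\<rceil> then real (row_weight Q e u) else 0)"
    define T where "T = (\<Sum>e\<in>{1..Q}. row_total Q e)"
    define T0 where "T0 = real Q ^ 2 / (4 * zeta 2 ^ 2) * (ln (real Q) ^ 2 + (4 * euler_mascheroni - 3 + 4 * zeta_log / zeta 2) * ln (real Q))"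
    define S where "S = real Q ^ 2 * ln (real Q) / (2 * zeta 2 ^ 2) * defect_series \<alpha>"
    define r :: real where "r = of_rat \<alpha>"
    have r: "0 \<le> r" "r \<le> 1" using a by (simp_all add: r_def)
    have q0: "q \<ge> 0" by (simp add: q_def)
    have w1: "w \<ge> 1" using denom_pos[OF a(1)] by (simp add: w_def)
    have "\<bar>A - X\<bar> \<le> q * harm (denom \<alpha>)"
      unfolding A_def X_def q_def by (rule sum_minus_cf_length_approx[OF a])
    also have "\<dots> \<le> q * w" using harm_le_ln[OF denom_pos[OF a(1)]] q0 by (intro mult_left_mono) (auto simp: w_def)
    finally have 1: "\<bar>A - X\<bar> \<le> q * w" .
    have 2: "\<bar>X - (r * T + S)\<bar> \<le> C1 * q"
      unfolding X_def r_def T_def S_def q_def by (rule C1(2)[OF a Q])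
    have "\<bar>r * T - r * T0\<bar> = r * \<bar>T - T0\<bar>" using r(1) by (simp add: abs_mult flip: right_diff_distrib)
    also have "\<dots> \<le> 1 * (C2 * q)" using C2(2)[OF Q] r unfolding T_def T0_def q_def by (intro mult_mono) auto
    finally have 3: "\<bar>r * T - r * T0\<bar> \<le> C2 * q" by simp
    have 4: "r * T0 + S = real Q ^ 2 / (2 * zeta 2) * main_term \<alpha> Q"
    proof -
      define i where "i = 1 / zeta (2::real)"
      have d: "x / zeta 2 = x * i" "x / (2 * zeta 2) = x * i / 2" "x / (4 * zeta 2 ^ 2) = x * i * i / 4" "x / (2 * zeta 2 ^ 2) = x * i * i / 2" for x :: real
        by (simp_all add: i_def power2_eq_square)
      show ?thesis unfolding T0_def S_def main_term_def r_def[symmetric] L_def[symmetric] d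
        by (simp add: algebra_simps)
    qed
    have "C1 * q * 1 \<le> C1 * q * w" "C2 * q * 1 \<le> C2 * q * w"
      using w1 q0 C1(1) C2(1) by (intro mult_left_mono; simp)+
    moreover have "(C1 + C2 + 1) * (q * w) = C1 * q * w + C2 * q * w + q * w" by (simp add: algebra_simps)
    ultimately have "\<bar>A - (r * T0 + S)\<bar> \<le> (C1 + C2 + 1) * (q * w)" using 1 2 3 by linarith
    then show ?thesis unfolding 4 A_def q_def w_def .
  qed
  moreover have "C1 + C2 + 1 > 0" using C1 C2 by simp
  ultimately show ?thesis using that by blast
qed

lemma avg_low_approx:
  obtains C where "C > 0" "\<And>\<alpha> Q. 0 \<le> \<alpha> \<Longrightarrow> \<alpha> \<le> 1 \<Longrightarrow> Q \<ge> 1 \<Longrightarrow>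
    \<bar>avg_low \<alpha> Q - main_term \<alpha> Q\<bar> \<le> C * (1 + ln (real (denom \<alpha>)))"
proof -
  obtain C1 where C1: "C1 > 0" "\<And>\<alpha> Q. 0 \<le> \<alpha> \<Longrightarrow> \<alpha> \<le> 1 \<Longrightarrow> Q \<ge> 1 \<Longrightarrow>
    \<bar>(\<Sum>x\<in>farey_low \<alpha> Q. real (minus_cf_length x)) - real Q ^ 2 / (2 * zeta 2) * main_term \<alpha> Q\<bar>
      \<le> C1 * (real Q ^ 2 * (1 + ln (real (denom \<alpha>))))"
    using sum_minus_cf_length_main by blast
  obtain C2 where C2: "C2 > 0" "\<And>Q. Q \<ge> 1 \<Longrightarrow>
    \<bar>real (card (farey Q)) - real Q ^ 2 / (2 * zeta 2)\<bar> \<le> C2 * (real Q * sqrt (real Q))"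
    using card_farey_approx by blast
  obtain B where B: "B > 0" "\<And>Q. Q \<ge> 1 \<Longrightarrow> real Q ^ 2 \<le> B * real (card (farey Q))"
    using card_farey_ge by blast
  have z: "zeta (2::real) > 0" by (rule zeta_2_pos)
  define d :: real where "d = \<bar>2 * euler_mascheroni - 3 / 2 + 2 * zeta_log / zeta 2\<bar>"
  \<comment> \<open>Bounds the three parts of \<open>main_term\<close> against
    \<open>sqrt Q\<close>, by \<open>L ^ 2 \<le> 16 * sqrt Q\<close>,
    \<open>L \<le> 2 * sqrt Q\<close> and
    \<open>defect_series \<alpha> \<le> zeta 2\<close>.\<close>
  define D where "D = 8 / zeta 2 + 2 * d / zeta 2 + 2"
  have d0: "d \<ge> 0" by (simp add: d_def)
  have "\<bar>avg_low \<alpha> Q - main_term \<alpha> Q\<bar> \<le> (B * C1 + B * C2 * D) * (1 + ln (real (denom \<alpha>)))"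
    if a: "0 \<le> \<alpha>" "\<alpha> \<le> 1" and Q: "Q \<ge> 1" for \<alpha> Q
  proof -
    define q where "q = real Q"
    define x where "x = sqrt q"
    define w where "w = 1 + ln (real (denom \<alpha>))"
    define L where "L = ln q"
    define A where "A = (\<Sum>x\<in>farey_low \<alpha> Q. real (minus_cf_length x))"
    define n where "n = real (card (farey Q))"
    define m where "m = main_term \<alpha> Q"
    define \<kappa> :: real where "\<kappa> = 1 / (2 * zeta 2)"
    have q1: "q \<ge> 1" and x: "x \<ge> 1" "x * x = q" using Q by (simp_all add: q_def x_def)
    have w1: "w \<ge> 1" using denom_pos[OF a(1)] by (simp add: w_def)
    have n1: "n \<ge> 1" unfolding n_def card_farey[OF Q] by (simp add: sum_nonneg)
    have Bn: "q ^ 2 \<le> B * n" using B(2)[OF Q] by (simp add: q_def n_def)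
    have r: "0 \<le> (of_rat \<alpha> :: real)" "(of_rat \<alpha> :: real) \<le> 1" using a by simp_all
    have L: "0 \<le> L" "L \<le> 2 * x" "L ^ 2 \<le> 16 * x"
    proof -
      show "0 \<le> L" using q1 by (simp add: L_def)
      show "L \<le> 2 * x" using ln_le_two_sqrt[OF Q] by (simp add: L_def x_def q_def)
      have "L \<le> q powr (1/4) / (1/4)" unfolding L_def using q1 by (intro ln_powr_bound) auto
      then have "L ^ 2 \<le> (4 * q powr (1/4)) ^ 2" using \<open>0 \<le> L\<close> by (intro power_mono) auto
      also have "\<dots> = 16 * x" using q1 by (simp add: x_def power_mult_distrib power2_eq_square flip: powr_add powr_half_sqrt)
      finally show "L ^ 2 \<le> 16 * x" .
    qed
    have mD: "\<bar>m\<bar> \<le> D * x"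
    proof -
      define m1 m2 m3 where "m1 = of_rat \<alpha> * L ^ 2 / (2 * zeta 2)"
        and "m2 = of_rat \<alpha> * L / zeta 2 * (2 * euler_mascheroni - 3 / 2 + 2 * zeta_log / zeta 2)"
        and "m3 = L / zeta 2 * defect_series \<alpha>"
      have b1: "\<bar>m1\<bar> \<le> 8 / zeta 2 * x"
      proof -
        have "of_rat \<alpha> * L ^ 2 \<le> 1 * (16 * x)" using r L by (intro mult_mono) auto
        then have "of_rat \<alpha> * L ^ 2 / (2 * zeta 2) \<le> 1 * (16 * x) / (2 * zeta 2)" using z by (intro divide_right_mono) auto
        then show ?thesis using r z by (simp add: m1_def)
      qed
      have b2: "\<bar>m2\<bar> \<le> 2 * d / zeta 2 * x"
      proof -
        have "of_rat \<alpha> * L \<le> 1 * (2 * x)" using r L by (intro mult_mono) auto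
        then have "of_rat \<alpha> * L / zeta 2 \<le> 1 * (2 * x) / zeta 2" using z by (intro divide_right_mono) auto
        then have "of_rat \<alpha> * L / zeta 2 * d \<le> 1 * (2 * x) / zeta 2 * d" using d0 by (rule mult_right_mono)
        moreover have "\<bar>of_rat \<alpha> * L / zeta 2 * (2 * euler_mascheroni - 3 / 2 + 2 * zeta_log / zeta 2)\<bar> = of_rat \<alpha> * L / zeta 2 * d"
          unfolding d_def abs_mult using r L z by simp
        ultimately show ?thesis unfolding m2_def by (simp add: mult_ac)
      qed
      have b3: "\<bar>m3\<bar> \<le> 2 * x"
      proof -
        have "L / zeta 2 * defect_series \<alpha> \<le> L / zeta 2 * zeta 2" using L z by (intro mult_left_mono defect_series_bounds) auto
        moreover have "0 \<le> L / zeta 2 * defect_series \<alpha>" using L z defect_series_bounds(1)[of \<alpha>] by simp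
        ultimately show ?thesis using L z by (simp add: m3_def)
      qed
      have D: "D * x = 8 / zeta 2 * x + 2 * d / zeta 2 * x + 2 * x" by (simp add: D_def algebra_simps)
      have "m = m1 + m2 + m3" unfolding m_def main_term_def L_def q_def m1_def m2_def m3_def ..
      then show ?thesis using b1 b2 b3 unfolding D by linarith
    qed
    have E1: "\<bar>A - q ^ 2 * \<kappa> * m\<bar> \<le> C1 * (q ^ 2 * w)"
      using C1(2)[OF a Q] unfolding A_def q_def m_def w_def \<kappa>_def by simp
    have E2: "\<bar>q ^ 2 * \<kappa> - n\<bar> \<le> C2 * (q * x)"
      using C2(2)[OF Q] unfolding q_def n_def x_def \<kappa>_def by (simp add: abs_minus_commute)
    have E3: "\<bar>(q ^ 2 * \<kappa> - n) * m\<bar> \<le> C2 * D * q ^ 2"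
    proof -
      have "\<bar>(q ^ 2 * \<kappa> - n) * m\<bar> \<le> (C2 * (q * x)) * (D * x)"
        unfolding abs_mult using E2 mD C2(1) q1 x by (intro mult_mono) auto
      also have "\<dots> = C2 * D * (q * (x * x))" by (simp add: mult_ac)
      finally show ?thesis unfolding x(2) by (simp add: power2_eq_square)
    qed
    have "A - n * m = (A - q ^ 2 * \<kappa> * m) + (q ^ 2 * \<kappa> - n) * m" by (simp add: algebra_simps)
    then have "\<bar>A - n * m\<bar> \<le> C1 * (q ^ 2 * w) + C2 * D * q ^ 2" using E1 E3 by linarith
    also have "\<dots> \<le> C1 * (B * n * w) + C2 * D * (B * n)"
    proof -
      have "D \<ge> 0" using d0 z by (simp add: D_def)
      then show ?thesis using Bn C1(1) C2(1) w1 by (intro add_mono mult_left_mono mult_right_mono) auto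
    qed
    also have "\<dots> \<le> C1 * (B * n * w) + C2 * D * (B * n) * w"
    proof -
      have "D \<ge> 0" using d0 z by (simp add: D_def)
      then have "C2 * D * (B * n) * 1 \<le> C2 * D * (B * n) * w" using C2(1) B(1) n1 w1 by (intro mult_left_mono) auto
      then show ?thesis by simp
    qed
    also have "\<dots> = ((B * C1 + B * C2 * D) * w) * n" by (simp add: algebra_simps)
    finally have fin: "\<bar>A - n * m\<bar> \<le> ((B * C1 + B * C2 * D) * w) * n" .
    have "avg_low \<alpha> Q - m = (A - n * m) / n"
      using n1 unfolding avg_low_def A_def[symmetric] n_def[symmetric] by (simp add: field_simps)
    also have "\<bar>\<dots>\<bar> = \<bar>A - n * m\<bar> / n" using n1 by simp
    also have "\<dots> \<le> (B * C1 + B * C2 * D) * w" using fin n1 by (simp add: divide_le_eq)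
    finally show ?thesis unfolding m_def w_def .
  qed
  moreover have "B * C1 + B * C2 * D > 0"
  proof -
    have "D \<ge> 0" using d0 z by (simp add: D_def)
    then show ?thesis using B C1 C2 by (intro add_pos_nonneg mult_pos_pos mult_nonneg_nonneg) auto
  qed
  ultimately show ?thesis using that by blast
qed

lemma main_term_eq:
  assumes "0 < \<alpha>"
  shows "main_term \<alpha> Q = real_of_rat \<alpha> * (ln (real Q))\<^sup>2 / (2 * zeta 2)
     + real_of_rat \<alpha> * ln (real Q) / zeta 2 *
         (2 * euler_mascheroni - 2 * (deriv zeta 2 / zeta 2) + F_coeff \<alpha> - 3 / 2)"
  unfolding main_term_def of_rat_mult_F_coeff[OF assms, symmetric] deriv_zeta_2
  using zeta_2_pos by (simp add: field_simps)

section \<open>Error terms and the complementary range\<close>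

text \<open>The interval \<open>(0, 1)\<close> is a bracket of every \<open>x\<close> strictly
  between, and at \<open>1\<close> the convention applies. It makes \<open>err\<close> at least
  \<open>1\<close>, so that it absorbs constants.\<close>

lemma minus_cf_length_ge_1:
  assumes "0 < x" "x \<le> 1"
  shows "minus_cf_length x \<ge> 1"
proof (cases "x = 1")
  case False
  then have x1: "x < 1" using assms by simp
  obtain a where a: "x = of_nat a / of_nat (denom x)" "denom x > 0"
    using of_rat_denom[of x] assms by (metis less_imp_le)
  define q where "q = denom x"
  have xq: "x = of_int (int a) / of_int (int q)" "int q > 0" using a by (simp_all add: q_def)
  have "0 < a" using assms a by (auto intro!: Nat.gr0I)
  moreover have "a < q"
  proof -
    have "(of_nat a / of_nat q :: rat) < 1" using a(1) x1 unfolding q_def by metis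
    then show ?thesis using a(2) by (simp add: q_def divide_less_eq)
  qed
  ultimately have "(1,1,1,0) \<in> brackets (int a) (int q)" by (simp add: brackets_def)
  moreover have "finite (brackets (int a) (int q))" "minus_cf_length x = card (brackets (int a) (int q))"
    using minus_cf_length_eq_card_brackets[OF _ x1 xq] assms by auto
  ultimately show ?thesis by (auto simp: Suc_le_eq card_gt_0_iff)
qed (simp add: minus_cf_length_def)

text \<open>The square of the logarithm in \<open>err\<close> dominates the logarithm through
  \<open>2 * L \<le> L ^ 2 + 1\<close>; the constant is supplied by the length.\<close>

lemma err_ge:
  assumes "0 < \<alpha>" "\<alpha> \<le> 1"
  shows "1 + ln (real (denom \<alpha>)) \<le> 2 * err \<alpha>" "real (minus_cf_length \<alpha>) + 1 \<le> 2 * err \<alpha>"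
proof -
  define L where "L = ln (real (denom \<alpha>))"
  define n s where "n = real (minus_cf_length \<alpha>)" and "s = L ^ 2"
  have n: "n \<ge> 1" using minus_cf_length_ge_1[OF assms] by (simp add: n_def)
  have e: "err \<alpha> = n + s" by (simp add: err_def L_def n_def s_def)
  have s: "0 \<le> s" "2 * L \<le> s + 1"
    using sum_squares_bound[of L 1] by (simp_all add: s_def)
  show "1 + ln (real (denom \<alpha>)) \<le> 2 * err \<alpha>"
    unfolding e L_def[symmetric] using s n by argo
  show "real (minus_cf_length \<alpha>) + 1 \<le> 2 * err \<alpha>"
    unfolding e n_def[symmetric] using s n by argo
qed

text \<open>The range above \<open>1 - \<alpha>\<close> is what remains of \<open>farey Q\<close>
  without \<open>farey_low (1 - \<alpha>) Q\<close> and the point \<open>1 - \<alpha>\<close>. It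
  contains the point \<open>1\<close>, which is missing from \<open>farey_low 1 Q\<close>. These two
  points account for the difference.\<close>

lemma avg_high_eq:
  assumes a: "0 < \<alpha>" "\<alpha> < 1" and Q: "Q \<ge> 1"
  shows "\<bar>avg_high \<alpha> Q - (avg_low 1 Q - avg_low (1 - \<alpha>) Q)\<bar> \<le> real (minus_cf_length (1 - \<alpha>)) + 1"
proof -
  define f where "f = (\<lambda>x. real (minus_cf_length x))"
  define n where "n = real (card (farey Q))"
  define E where "E = (if 1 - \<alpha> \<in> farey Q then f (1 - \<alpha>) else 0)"
  have n1: "n \<ge> 1" unfolding n_def card_farey[OF Q] by (simp add: sum_nonneg)
  have fin: "finite (farey Q)" by (rule finite_farey)
  have "\<exists>a b. (1::rat) = of_nat a / of_nat b \<and> 1 \<le> b \<and> b \<le> Q"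
    using Q by (intro exI[of _ 1]) simp
  then have one: "1 \<in> farey Q" unfolding farey_def by simp
  have sub: "farey Q \<subseteq> {0..1}" by (auto simp: farey_def)
  have "farey Q = insert 1 (farey_low 1 Q)" "1 \<notin> farey_low 1 Q" "finite (farey_low 1 Q)"
    using one sub fin by (auto simp: farey_low_def)
  then have 1: "sum f (farey Q) = 1 + sum f (farey_low 1 Q)" by (simp add: f_def minus_cf_length_def)
  have "farey Q = (farey_low (1 - \<alpha>) Q \<union> (farey Q \<inter> {1 - \<alpha>})) \<union> farey_high \<alpha> Q"
    using sub by (auto simp: farey_low_def farey_high_def)
  then have "sum f (farey Q) = sum f ((farey_low (1 - \<alpha>) Q \<union> (farey Q \<inter> {1 - \<alpha>})) \<union> farey_high \<alpha> Q)" by simp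
  also have "\<dots> = sum f (farey_low (1 - \<alpha>) Q \<union> (farey Q \<inter> {1 - \<alpha>})) + sum f (farey_high \<alpha> Q)"
    by (rule sum.union_disjoint) (use fin in \<open>auto simp: farey_low_def farey_high_def\<close>)
  also have "sum f (farey_low (1 - \<alpha>) Q \<union> (farey Q \<inter> {1 - \<alpha>})) = sum f (farey_low (1 - \<alpha>) Q) + sum f (farey Q \<inter> {1 - \<alpha>})"
    by (rule sum.union_disjoint) (use fin in \<open>auto simp: farey_low_def\<close>)
  also have "sum f (farey Q \<inter> {1 - \<alpha>}) = E" by (auto simp: E_def)
  finally have "sum f (farey_high \<alpha> Q) - (sum f (farey_low 1 Q) - sum f (farey_low (1 - \<alpha>) Q)) = 1 - E" using 1 by linarith
  moreover have "avg_high \<alpha> Q - (avg_low 1 Q - avg_low (1 - \<alpha>) Q) =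
      (sum f (farey_high \<alpha> Q) - (sum f (farey_low 1 Q) - sum f (farey_low (1 - \<alpha>) Q))) / n"
    unfolding avg_high_def avg_low_def n_def f_def by (simp add: diff_divide_distrib)
  ultimately have "avg_high \<alpha> Q - (avg_low 1 Q - avg_low (1 - \<alpha>) Q) = (1 - E) / n" by simp
  also have "\<bar>\<dots>\<bar> \<le> \<bar>1 - E\<bar> / 1" unfolding abs_divide using n1 by (intro divide_left_mono) auto
  also have "\<dots> \<le> f (1 - \<alpha>) + 1" by (auto simp: E_def f_def)
  finally show ?thesis by (simp add: f_def)
qed

theorem theorem1p3:
  shows "(\<exists>C::real. \<forall>(Q::nat) (\<alpha>::rat).
           Q \<ge> 1 \<and> 0 < \<alpha> \<and> \<alpha> \<le> 1 \<and> real (denom \<alpha>) < sqrt (real Q) \<longrightarrow>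
           \<bar>avg_low \<alpha> Q
              - (real_of_rat \<alpha> * (ln (real Q))\<^sup>2 / (2 * zeta 2)
                 + real_of_rat \<alpha> * ln (real Q) / zeta 2 *
                     (2 * euler_mascheroni - 2 * (deriv zeta 2 / zeta 2) + F_coeff \<alpha> - 3 / 2))\<bar>
             \<le> C * err \<alpha>)
     \<and> (\<exists>C::real. \<forall>(Q::nat) (\<alpha>::rat).
           Q \<ge> 1 \<and> 0 < \<alpha> \<and> \<alpha> < 1 \<and> real (denom \<alpha>) < sqrt (real Q) \<longrightarrow>
           \<bar>avg_high \<alpha> Q
              - (avg_low \<alpha> Q - (1 - 1 / (real (denom \<alpha>))\<^sup>2) * ln (real Q))\<bar>
             \<le> C * err (1 - \<alpha>))"
proof -
  obtain C where C: "C > 0" "\<And>\<alpha> Q. 0 \<le> \<alpha> \<Longrightarrow> \<alpha> \<le> 1 \<Longrightarrow> Q \<ge> 1 \<Longrightarrow>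
    \<bar>avg_low \<alpha> Q - main_term \<alpha> Q\<bar> \<le> C * (1 + ln (real (denom \<alpha>)))"
    using avg_low_approx by blast
  show ?thesis
  proof (intro conjI exI allI impI; elim conjE)
    fix Q :: nat and \<alpha> :: rat
    assume h: "Q \<ge> 1" "0 < \<alpha>" "\<alpha> \<le> 1"
    have "\<bar>avg_low \<alpha> Q - main_term \<alpha> Q\<bar> \<le> C * (1 + ln (real (denom \<alpha>)))"
      using C(2)[of \<alpha> Q] h by simp
    also have "\<dots> \<le> C * (2 * err \<alpha>)" using err_ge(1)[of \<alpha>] h C(1) by (intro mult_left_mono) auto
    also have "\<dots> = (2 * C) * err \<alpha>" by simp
    finally show "\<bar>avg_low \<alpha> Q
              - (real_of_rat \<alpha> * (ln (real Q))\<^sup>2 / (2 * zeta 2)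
                 + real_of_rat \<alpha> * ln (real Q) / zeta 2 *
                     (2 * euler_mascheroni - 2 * (deriv zeta 2 / zeta 2) + F_coeff \<alpha> - 3 / 2))\<bar>
             \<le> (2 * C) * err \<alpha>"
      unfolding main_term_eq[OF h(2)] .
  next
    fix Q :: nat and \<alpha> :: rat
    assume h: "Q \<ge> 1" "0 < \<alpha>" "\<alpha> < 1"
    define w where "w = denom \<alpha>"
    define l where "l = 1 + ln (real w)"
    define L where "L = ln (real Q)"
    have w1: "w \<ge> 1" unfolding w_def using h by (intro denom_pos) simp
    have dw: "denom (1 - \<alpha>) = w" unfolding w_def using h by (intro denom_complement) auto
    have l1: "l \<ge> 1" using w1 by (simp add: l_def)
    have b1: "\<bar>avg_low \<alpha> Q - main_term \<alpha> Q\<bar> \<le> C * l" using C(2)[of \<alpha> Q] h by (simp add: l_def w_def)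
    have b2: "\<bar>avg_low (1 - \<alpha>) Q - main_term (1 - \<alpha>) Q\<bar> \<le> C * l" using C(2)[of "1 - \<alpha>" Q] h dw by (simp add: l_def)
    have "\<bar>avg_low 1 Q - main_term 1 Q\<bar> \<le> C * 1" using C(2)[of 1 Q] h by (simp add: denom_1)
    also have "\<dots> \<le> C * l" using C(1) l1 by (intro mult_left_mono) auto
    finally have b3: "\<bar>avg_low 1 Q - main_term 1 Q\<bar> \<le> C * l" .
    \<comment> \<open>The terms linear in \<alpha> cancel and \<open>defect_series 1\<close> is
      \<open>0\<close>, so only the two complementary defect series survive.\<close>
    have mt: "main_term 1 Q - main_term (1 - \<alpha>) Q - main_term \<alpha> Q = - ((1 - 1 / (real w)\<^sup>2) * L)"
    proof -
      have "main_term 1 Q - main_term (1 - \<alpha>) Q - main_term \<alpha> Q = - (L / zeta 2 * (defect_series \<alpha> + defect_series (1 - \<alpha>)))"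
      proof -
        define a where "a = real_of_rat \<alpha>"
        define K where "K = 2 * euler_mascheroni - 3 / 2 + 2 * zeta_log / zeta (2::real)"
        define i where "i = 1 / zeta (2::real)"
        have d: "x / zeta 2 = x * i" "x / (2 * zeta 2) = x * (i * (1 / 2))" for x :: real
          by (simp_all add: i_def)
        have ca: "real_of_rat (1 - \<alpha>) = 1 - a" by (simp add: a_def of_rat_diff)
        show ?thesis
          unfolding main_term_def defect_series_1 K_def[symmetric] L_def[symmetric] ca a_def[symmetric] d
          by (simp add: algebra_simps)
      qed
      also have "defect_series \<alpha> + defect_series (1 - \<alpha>) = zeta 2 * (1 - 1 / (real w)\<^sup>2)"
        unfolding w_def using h by (intro defect_series_add_complement) auto
      finally show ?thesis using zeta_2_pos by simp
    qed
    have hi: "\<bar>avg_high \<alpha> Q - (avg_low 1 Q - avg_low (1 - \<alpha>) Q)\<bar> \<le> real (minus_cf_length (1 - \<alpha>)) + 1"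
      by (rule avg_high_eq) (use h in auto)
    have e: "l \<le> 2 * err (1 - \<alpha>)" "real (minus_cf_length (1 - \<alpha>)) + 1 \<le> 2 * err (1 - \<alpha>)"
      using err_ge[of "1 - \<alpha>"] h dw by (simp_all add: l_def)
    have "C * l \<le> C * (2 * err (1 - \<alpha>))" using e(1) C(1) by (intro mult_left_mono) auto
    then have "3 * (C * l) + (real (minus_cf_length (1 - \<alpha>)) + 1) \<le> 6 * (C * err (1 - \<alpha>)) + 2 * err (1 - \<alpha>)"
      using e(2) by simp
    also have "\<dots> = (6 * C + 2) * err (1 - \<alpha>)" by (simp add: algebra_simps)
    finally have fin: "3 * (C * l) + (real (minus_cf_length (1 - \<alpha>)) + 1) \<le> (6 * C + 2) * err (1 - \<alpha>)" .
    \<comment> \<open>The approximations at \<alpha>, \<open>1 - \<alpha>\<close> and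
      \<open>1\<close> cost \<open>C * l\<close> each, and the two boundary points cost the
      rest.\<close>
    have "\<bar>avg_high \<alpha> Q - (avg_low \<alpha> Q - (1 - 1 / (real w)\<^sup>2) * L)\<bar> \<le> 3 * (C * l) + (real (minus_cf_length (1 - \<alpha>)) + 1)"
      using b1 b2 b3 mt hi by linarith
    then show "\<bar>avg_high \<alpha> Q
              - (avg_low \<alpha> Q - (1 - 1 / (real (denom \<alpha>))\<^sup>2) * ln (real Q))\<bar>
             \<le> (6 * C + 2) * err (1 - \<alpha>)"
      using fin unfolding w_def L_def by linarith
  qed
qed

end
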